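(* Let $k$ be a field and let $(G,\alpha)$ be an Artin representation on $F_n$. For every $\lambda\in k^\times$ the Katz-Long-Moody functor $\mathcal{KLM}_\lambda$ maps the full subcategory $\mathbf{Mod}^{\mathrm{NT}}_{k[F_n\rtimes_\alpha G]}$ of the category of left $k[F_n\rtimes_\alpha G]$-modules to itself, and, as an endofunctor of this subcategory, it satisfies the following. (1) Suppose $G=\{e\}$ and identify $F_n\rtimes_\alpha\{e\}$ with $F_n$. Then $\mathcal{KLM}_\lambda$ is isomorphic to the Katz middle convolution functor of Dettweiler-Reiter. (2) (Multiplicativity) For $\lambda,\tau\in k^\times$ there is an isomorphism $\mathcal{KLM}_\lambda\circ\mathcal{KLM}_\tau\cong\mathcal{KLM}_{\lambda\tau}$ of endofunctors of $\mathbf{Mod}^{\mathrm{NT}}_{k[F_n\rtimes_\alpha G]}$. (3) (Auto-equivalence) For $\lambda\in k^\times$, $\mathcal{KLM}_\lambda$ is an auto-equivalence of the category $\mathbf{Mod}^{\mathrm{NT}}_{k[F_n\rtimes_\alpha G]}$, and $\mathcal{KLM}_{\lambda^{-1}}$ is an inverse functor.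
   Context: Let $k$ be a field, $n\ge 2$ an integer, $F_n$ the free group on $x_1,\dots,x_n$, and $B_n$ the Artin braid group with standard generators $\sigma_1,\dots,\sigma_{n-1}$. The map $\theta\colon B_n\to\mathrm{Aut}(F_n)$ is the injective homomorphism with $\theta(\sigma_i)(x_i)=x_{i+1}$, $\theta(\sigma_i)(x_{i+1})=x_{i+1}^{-1}x_ix_{i+1}$, $\theta(\sigma_i)(x_j)=x_j$ for $j\neq i,i+1$. An Artin representation $(G,\alpha)$ on $F_n$ is a group $G$ with a homomorphism $\alpha\colon G\to\mathrm{Aut}(F_n)$ that factors as $\alpha=\theta\circ\alpha_{B_n}$ for some homomorphism $\alpha_{B_n}\colon G\to B_n$. In $F_n\rtimes_\alpha G$ one has $gxg^{-1}=\alpha(g)(x)$. $I_{F_n}\subset k[F_n]$ is the augmentation ideal; it is a free right $k[F_n]$-module with basis $x_1-1,\dots,x_n-1$. For $0\le i\le n$ and $1\le j\le n$ put $\lambda_{\ge i}(j)=\lambda$ if $j\le i$ and $\lambda_{\ge i}(j)=1$ if $j>i$. Let $\circ_\lambda$ be the left action of $F_n$ on $I_{F_n}$ by right $k[F_n]$-module automorphisms determined by $$x_i\circ_\lambda(x_j-1)=\lambda_{\ge i}(j)\,x_i(x_j-1)-(\lambda_{\ge (i-1)}(j)-1)(x_j-1).$$ $I_{F_n,\lambda}$ denotes $I_{F_n}$ with the left action $\circ_\lambda$ of $F_n$ and the left action of $g\in G$ by $\alpha(g)$; this makes it a left $k[F_n\rtimes_\alpha G]$-module. The twisted Long-Moody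 functor is the endofunctor $\mathcal{LM}_\lambda(V)=I_{F_n,\lambda}\otimes_{k[F_n]}V$, $\mathcal{LM}_\lambda(\phi)=\mathrm{id}\otimes\phi$, of left $k[F_n\rtimes_\alpha G]$-modules, with action $x\cdot(f\otimes v)=(x\circ_\lambda f)\otimes v$ for $x\in F_n$ and $g\cdot(f\otimes v)=\alpha(g)(f)\otimes gv$ for $g\in G$. For a left $k[F_n\rtimes_\alpha G]$-module $V$ let $\mathcal{LM}_\lambda(V)^{F_n}$ be the $F_n$-invariants and, for $1\le i\le n$, let $\mathcal{LM}_\lambda(V)^{[i]}=\{w\in\mathcal{LM}_\lambda(V)\mid x_iw=\lambda w,\ x_jw=w\text{ for }j\ne i\}$. The sum $\sum_i\mathcal{LM}_\lambda(V)^{[i]}+\mathcal{LM}_\lambda(V)^{F_n}$ is a submodule, and $$\mathcal{KLM}_\lambda(V):=\mathcal{LM}_\lambda(V)\Big/\Big(\sum_{i=1}^n\mathcal{LM}_\lambda(V)^{[i]}+\mathcal{LM}_\lambda(V)^{F_n}\Big),$$ with the induced maps on morphisms, is the Katz-Long-Moody functor. A left $k[F_n]$-module $T$ is almost trivial if $\dim_kT=1$ and there is an index $i$ such that $x_j$ acts trivially on $T$ for all $j\neq i$. A left $k[F_n]$-module $V$ has property (P1) if $\mathrm{Hom}_{k[F_n]}(T,V)=0$ for all almost trivial $T$, and (P2) if $\mathrm{Hom}_{k[F_n]}(V,T)=0$ for all almost trivial $T$. $\mathbf{Mod}^{\mathrm{NT}}_{k[F_n\rtimes_\alpha G]}$ is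 the full subcategory of left $k[F_n\rtimes_\alpha G]$-modules whose underlying $k[F_n]$-module has both (P1) and (P2). Dettweiler-Reiter middle convolution (on left $k[F_n]$-modules): if $x_i$ acts on $V$ by $A_i$, let $C_\lambda(V)=V^{\oplus n}$, on which $x_i$ acts by the block matrix $N_i$ that is the identity outside the $i$-th block row and whose $i$-th block row is $(\lambda(A_1-1),\dots,\lambda(A_{i-1}-1),\lambda A_i,A_{i+1}-1,\dots,A_n-1)$. Let $K=\bigoplus_{i=1}^n\mathrm{Ker}(A_i-1)\subset V^{\oplus n}$ (with $\mathrm{Ker}(A_i-1)$ in the $i$-th position) and $L=\bigcap_{i=1}^n\mathrm{Ker}(N_i-1)$. The middle convolution functor sends $V$ to $C_\lambda(V)/(K+L)$, with the maps induced by $\phi^{\oplus n}$ on morphisms. *)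

theory Defs
  imports "HOL-Algebra.Module" "HOL-Algebra.AbelCoset" "HOL-Algebra.Bij"
    "HOL-Algebra.Generated_Groups" "HOL-Algebra.Free_Abelian_Groups"
begin

section \<open>Groups given by generators and relations\<close>

text \<open>A word is a list of letters; \<open>(s, True)\<close> is the generator \<open>s\<close> and \<open>(s, False)\<close> its inverse.\<close>

type_synonym 'a word = "('a \<times> bool) list"

definition words :: "'a set \<Rightarrow> 'a word set" where
  "words S = lists (S \<times> UNIV)"

inductive pres_eq :: "'a set \<Rightarrow> ('a word \<times> 'a word) set \<Rightarrow> 'a word \<Rightarrow> 'a word \<Rightarrow> bool"
  for S R where
  refl: "u \<in> words S \<Longrightarrow> pres_eq S R u u"
| sym: "pres_eq S R u v \<Longrightarrow> pres_eq S R v u"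
| trans: "pres_eq S R u v \<Longrightarrow> pres_eq S R v w \<Longrightarrow> pres_eq S R u w"
| cancel: "u \<in> words S \<Longrightarrow> v \<in> words S \<Longrightarrow> s \<in> S \<Longrightarrow>
    pres_eq S R (u @ [(s, b), (s, \<not> b)] @ v) (u @ v)"
| rel: "u \<in> words S \<Longrightarrow> v \<in> words S \<Longrightarrow> (r, r') \<in> R \<Longrightarrow> r \<in> words S \<Longrightarrow> r' \<in> words S \<Longrightarrow>
    pres_eq S R (u @ r @ v) (u @ r' @ v)"

definition pres_class :: "'a set \<Rightarrow> ('a word \<times> 'a word) set \<Rightarrow> 'a word \<Rightarrow> 'a word set" where
  "pres_class S R u = {v. pres_eq S R u v}"

definition pres_group :: "'a set \<Rightarrow> ('a word \<times> 'a word) set \<Rightarrow> 'a word set monoid" where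
  "pres_group S R =
    \<lparr>carrier = pres_class S R ` words S,
     monoid.mult = (\<lambda>X Y. \<Union>u\<in>X. \<Union>v\<in>Y. pres_class S R (u @ v)),
     one = pres_class S R []\<rparr>"

type_synonym fgrp = "nat word set"

definition free_grp :: "nat \<Rightarrow> fgrp monoid" where
  "free_grp n = pres_group {1..n} {}"

definition fgen :: "nat \<Rightarrow> nat \<Rightarrow> fgrp" where
  "fgen n i = pres_class {1..n} {} [(i, True)]"

definition braid_rels :: "nat \<Rightarrow> (nat word \<times> nat word) set" where
  "braid_rels n =
    {([(i, True), (i + 1, True), (i, True)], [(i + 1, True), (i, True), (i + 1, True)]) | i.
       1 \<le> i \<and> i + 1 < n} \<union>
    {([(i, True), (j, True)], [(j, True), (i, True)]) | i j. 1 \<le> i \<and> i + 2 \<le> j \<and> j < n}"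

definition braid_group :: "nat \<Rightarrow> nat word set monoid" where
  "braid_group n = pres_group {1..<n} (braid_rels n)"

definition bgen :: "nat \<Rightarrow> nat \<Rightarrow> nat word set" where
  "bgen n i = pres_class {1..<n} (braid_rels n) [(i, True)]"

section \<open>Artin representations\<close>

text \<open>The group \<open>AutoGroup\<close> multiplies by composition, \<open>(\<phi> \<otimes> \<psi>) x = \<phi> (\<psi> x)\<close>.  As the
  \<open>bgen n i\<close> generate the braid group, exactly one map satisfies \<open>artin_hom n\<close>
  (up to its values outside the carrier).\<close>

definition artin_hom :: "nat \<Rightarrow> (nat word set \<Rightarrow> fgrp \<Rightarrow> fgrp) \<Rightarrow> bool" where
  "artin_hom n \<theta> \<longleftrightarrow>
    \<theta> \<in> hom (braid_group n) (AutoGroup (free_grp n)) \<and>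
    (\<forall>i\<in>{1..<n}.
       \<theta> (bgen n i) (fgen n i) = fgen n (i + 1) \<and>
       \<theta> (bgen n i) (fgen n (i + 1)) =
         inv\<^bsub>free_grp n\<^esub> (fgen n (i + 1)) \<otimes>\<^bsub>free_grp n\<^esub> fgen n i \<otimes>\<^bsub>free_grp n\<^esub> fgen n (i + 1) \<and>
       (\<forall>j\<in>{1..n} - {i, i + 1}. \<theta> (bgen n i) (fgen n j) = fgen n j))"

definition artin_rep :: "nat \<Rightarrow> ('g, 'z) monoid_scheme \<Rightarrow> ('g \<Rightarrow> fgrp \<Rightarrow> fgrp) \<Rightarrow> bool" where
  "artin_rep n G \<alpha> \<longleftrightarrow>
    group G \<and> \<alpha> \<in> hom G (AutoGroup (free_grp n)) \<and>
    (\<exists>\<theta> \<beta>. artin_hom n \<theta> \<and> \<beta> \<in> hom G (braid_group n) \<and> (\<forall>g\<in>carrier G. \<alpha> g = \<theta> (\<beta> g)))"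

definition semidirect ::
  "('x, 'y) monoid_scheme \<Rightarrow> ('g, 'z) monoid_scheme \<Rightarrow> ('g \<Rightarrow> 'x \<Rightarrow> 'x) \<Rightarrow> ('x \<times> 'g) monoid" where
  "semidirect F G \<alpha> =
    \<lparr>carrier = carrier F \<times> carrier G,
     monoid.mult = (\<lambda>(x, g) (y, h). (x \<otimes>\<^bsub>F\<^esub> \<alpha> g y, g \<otimes>\<^bsub>G\<^esub> h)),
     one = (\<one>\<^bsub>F\<^esub>, \<one>\<^bsub>G\<^esub>)\<rparr>"

section \<open>Group algebras and left modules\<close>

definition group_algebra :: "('h, 'z) monoid_scheme \<Rightarrow> ('h \<Rightarrow> 'k::field) ring" where
  "group_algebra H =
    \<lparr>carrier = {a. finite {x. a x \<noteq> 0} \<and> {x. a x \<noteq> 0} \<subseteq> carrier H},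
     monoid.mult = (\<lambda>a b z. \<Sum>(x, y)\<in>{(x, y). a x \<noteq> 0 \<and> b y \<noteq> 0 \<and> x \<otimes>\<^bsub>H\<^esub> y = z}. a x * b y),
     one = (\<lambda>x. if x = \<one>\<^bsub>H\<^esub> then 1 else 0),
     ring.zero = (\<lambda>x. 0),
     ring.add = (\<lambda>a b x. a x + b x)\<rparr>"

text \<open>\<open>gsingle c x\<close> is the element \<open>c x\<close> of the group algebra.\<close>

definition gsingle :: "'k::field \<Rightarrow> 'h \<Rightarrow> 'h \<Rightarrow> 'k" where
  "gsingle c x = (\<lambda>y. if y = x then c else 0)"

text \<open>\<open>galg_map f\<close> is the \<open>k\<close>-linear extension of \<open>f\<close> to the group algebra.\<close>

definition galg_map :: "('h \<Rightarrow> 'l) \<Rightarrow> ('h \<Rightarrow> 'k::field) \<Rightarrow> 'l \<Rightarrow> 'k" where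
  "galg_map f a = (\<lambda>y. \<Sum>x\<in>{x. a x \<noteq> 0 \<and> f x = y}. a x)"

text \<open>The library's locale \<open>module\<close> requires a commutative ring.  As there, the fields
  \<open>mult\<close> and \<open>one\<close> of the module record play no role.\<close>

locale left_module = R?: ring R + M?: abelian_group M for R (structure) and M (structure) +
  assumes smult_closed:
      "\<lbrakk>a \<in> carrier R; x \<in> carrier M\<rbrakk> \<Longrightarrow> a \<odot>\<^bsub>M\<^esub> x \<in> carrier M"
    and smult_l_distr:
      "\<lbrakk>a \<in> carrier R; b \<in> carrier R; x \<in> carrier M\<rbrakk> \<Longrightarrow>
        (a \<oplus> b) \<odot>\<^bsub>M\<^esub> x = a \<odot>\<^bsub>M\<^esub> x \<oplus>\<^bsub>M\<^esub> b \<odot>\<^bsub>M\<^esub> x"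
    and smult_r_distr:
      "\<lbrakk>a \<in> carrier R; x \<in> carrier M; y \<in> carrier M\<rbrakk> \<Longrightarrow>
        a \<odot>\<^bsub>M\<^esub> (x \<oplus>\<^bsub>M\<^esub> y) = a \<odot>\<^bsub>M\<^esub> x \<oplus>\<^bsub>M\<^esub> a \<odot>\<^bsub>M\<^esub> y"
    and smult_assoc1:
      "\<lbrakk>a \<in> carrier R; b \<in> carrier R; x \<in> carrier M\<rbrakk> \<Longrightarrow>
        (a \<otimes> b) \<odot>\<^bsub>M\<^esub> x = a \<odot>\<^bsub>M\<^esub> (b \<odot>\<^bsub>M\<^esub> x)"
    and smult_one:
      "x \<in> carrier M \<Longrightarrow> \<one> \<odot>\<^bsub>M\<^esub> x = x"

definition lmod_hom ::
  "('r, 'x) ring_scheme \<Rightarrow> ('r, 'a) module \<Rightarrow> ('r, 'b) module \<Rightarrow> ('a \<Rightarrow> 'b) set" where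
  "lmod_hom R M N =
    {\<phi> \<in> carrier M \<rightarrow>\<^sub>E carrier N.
       (\<forall>x\<in>carrier M. \<forall>y\<in>carrier M. \<phi> (x \<oplus>\<^bsub>M\<^esub> y) = \<phi> x \<oplus>\<^bsub>N\<^esub> \<phi> y) \<and>
       (\<forall>a\<in>carrier R. \<forall>x\<in>carrier M. \<phi> (a \<odot>\<^bsub>M\<^esub> x) = a \<odot>\<^bsub>N\<^esub> \<phi> x)}"

definition restrict_scalars :: "('s \<Rightarrow> 'r) \<Rightarrow> ('r, 'a) module \<Rightarrow> ('s, 'a) module" where
  "restrict_scalars p M =
    \<lparr>carrier = carrier M, monoid.mult = monoid.mult M, one = \<one>\<^bsub>M\<^esub>,
     ring.zero = \<zero>\<^bsub>M\<^esub>, ring.add = ring.add M,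
     smult = (\<lambda>a x. p a \<odot>\<^bsub>M\<^esub> x)\<rparr>"

definition quot_module :: "('r, 'a) module \<Rightarrow> 'a set \<Rightarrow> ('r, 'a set) module" where
  "quot_module M S =
    \<lparr>carrier = a_rcosets\<^bsub>M\<^esub> S, monoid.mult = undefined, one = undefined,
     ring.zero = S, ring.add = set_add M,
     smult = (\<lambda>a X. \<Union>x\<in>X. S +>\<^bsub>M\<^esub> (a \<odot>\<^bsub>M\<^esub> x))\<rparr>"

definition quot_map ::
  "('r, 'a) module \<Rightarrow> 'a set \<Rightarrow> ('r, 'b) module \<Rightarrow> 'b set \<Rightarrow> ('a \<Rightarrow> 'b) \<Rightarrow> 'a set \<Rightarrow> 'b set" where
  "quot_map M S N S' f = (\<lambda>X\<in>carrier (quot_module M S). \<Union>x\<in>X. S' +>\<^bsub>N\<^esub> f x)"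

section \<open>Categories and functors\<close>

text \<open>Hom-sets need not be disjoint, so composition takes the three objects involved, and the action
  of a functor on morphisms takes source and target.\<close>

record ('o, 'm) cat =
  Obj :: "'o set"
  Hom :: "'o \<Rightarrow> 'o \<Rightarrow> 'm set"
  Ident :: "'o \<Rightarrow> 'm"
  Comp :: "'o \<Rightarrow> 'o \<Rightarrow> 'o \<Rightarrow> 'm \<Rightarrow> 'm \<Rightarrow> 'm"

record ('o, 'm, 'p, 'n) funct =
  fobj :: "'o \<Rightarrow> 'p"
  fmap :: "'o \<Rightarrow> 'o \<Rightarrow> 'm \<Rightarrow> 'n"

definition is_functor :: "('o, 'm) cat \<Rightarrow> ('p, 'n) cat \<Rightarrow> ('o, 'm, 'p, 'n) funct \<Rightarrow> bool" where
  "is_functor C D F \<longleftrightarrow>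
    (\<forall>A\<in>Obj C. fobj F A \<in> Obj D) \<and>
    (\<forall>A\<in>Obj C. \<forall>B\<in>Obj C. \<forall>f\<in>Hom C A B. fmap F A B f \<in> Hom D (fobj F A) (fobj F B)) \<and>
    (\<forall>A\<in>Obj C. fmap F A A (Ident C A) = Ident D (fobj F A)) \<and>
    (\<forall>A1\<in>Obj C. \<forall>A2\<in>Obj C. \<forall>A3\<in>Obj C. \<forall>f\<in>Hom C A1 A2. \<forall>g\<in>Hom C A2 A3.
       fmap F A1 A3 (Comp C A1 A2 A3 g f) =
         Comp D (fobj F A1) (fobj F A2) (fobj F A3) (fmap F A2 A3 g) (fmap F A1 A2 f))"

definition id_functor :: "('o, 'm, 'o, 'm) funct" where
  "id_functor = \<lparr>fobj = (\<lambda>A. A), fmap = (\<lambda>A B f. f)\<rparr>"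

definition comp_functor ::
  "('p, 'n, 'q, 'l) funct \<Rightarrow> ('o, 'm, 'p, 'n) funct \<Rightarrow> ('o, 'm, 'q, 'l) funct" (infixl "\<circ>\<^sub>F" 55) where
  "G \<circ>\<^sub>F F =
    \<lparr>fobj = (\<lambda>A. fobj G (fobj F A)),
     fmap = (\<lambda>A B f. fmap G (fobj F A) (fobj F B) (fmap F A B f))\<rparr>"

definition isos :: "('o, 'm) cat \<Rightarrow> 'o \<Rightarrow> 'o \<Rightarrow> 'm set" where
  "isos C A B =
    {f \<in> Hom C A B. \<exists>g\<in>Hom C B A. Comp C A B A g f = Ident C A \<and> Comp C B A B f g = Ident C B}"

definition naturally_isomorphic ::
  "('o, 'm) cat \<Rightarrow> ('p, 'n) cat \<Rightarrow> ('o, 'm, 'p, 'n) funct \<Rightarrow> ('o, 'm, 'p, 'n) funct \<Rightarrow> bool" where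
  "naturally_isomorphic C D F G \<longleftrightarrow>
    is_functor C D F \<and> is_functor C D G \<and>
    (\<exists>\<eta>. (\<forall>A\<in>Obj C. \<eta> A \<in> isos D (fobj F A) (fobj G A)) \<and>
         (\<forall>A\<in>Obj C. \<forall>B\<in>Obj C. \<forall>f\<in>Hom C A B.
            Comp D (fobj F A) (fobj F B) (fobj G B) (\<eta> B) (fmap F A B f) =
            Comp D (fobj F A) (fobj G A) (fobj G B) (fmap G A B f) (\<eta> A)))"

definition equivalence_with_inverse ::
  "('o, 'm) cat \<Rightarrow> ('p, 'n) cat \<Rightarrow> ('o, 'm, 'p, 'n) funct \<Rightarrow> ('p, 'n, 'o, 'm) funct \<Rightarrow> bool" where
  "equivalence_with_inverse C D F G \<longleftrightarrow>
    is_functor C D F \<and> is_functor D C G \<and>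
    naturally_isomorphic C C (G \<circ>\<^sub>F F) id_functor \<and>
    naturally_isomorphic D D (F \<circ>\<^sub>F G) id_functor"

definition full_subcat :: "('o, 'm) cat \<Rightarrow> ('o \<Rightarrow> bool) \<Rightarrow> ('o, 'm) cat" where
  "full_subcat C P = C\<lparr>Obj := {A \<in> Obj C. P A}\<rparr>"

text \<open>The type \<open>'u\<close> is the universe: the objects are all left \<open>R\<close>-modules whose underlying set is a
  subset of \<open>'u\<close>.\<close>

definition left_mod_cat :: "('r, 'x) ring_scheme \<Rightarrow> (('r, 'u) module, 'u \<Rightarrow> 'u) cat" where
  "left_mod_cat R =
    \<lparr>Obj = {M. left_module R M}, Hom = lmod_hom R, Ident = (\<lambda>M. \<lambda>x\<in>carrier M. x),
     Comp = (\<lambda>L M N \<psi> \<phi>. compose (carrier L) \<psi> \<phi>)\<rparr>"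

text \<open>Tensor products and quotients are first built in larger types, and are brought back into the
  universe \<open>'u\<close> by transport of structure along some injection of the underlying set into \<open>'u\<close>.
  For infinite \<open>'u\<close> such injections exist for all modules to which this is applied below,
  as these are quotients of \<open>V\<^sup>n\<close> as sets, with \<open>V \<subseteq> 'u\<close>.\<close>

definition small_enc :: "('r, 'a) module \<Rightarrow> 'a \<Rightarrow> 'u" where
  "small_enc M = (SOME e. inj_on e (carrier M))"

definition small_dec :: "('r, 'a) module \<Rightarrow> 'u \<Rightarrow> 'a" where
  "small_dec M = inv_into (carrier M) (small_enc M)"

definition small_copy :: "('r, 'a) module \<Rightarrow> ('r, 'u) module" where
  "small_copy M =
    \<lparr>carrier = small_enc M ` carrier M, monoid.mult = undefined, one = undefined,
     ring.zero = small_enc M \<zero>\<^bsub>M\<^esub>,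
     ring.add = (\<lambda>x y. small_enc M (small_dec M x \<oplus>\<^bsub>M\<^esub> small_dec M y)),
     smult = (\<lambda>a x. small_enc M (a \<odot>\<^bsub>M\<^esub> small_dec M x))\<rparr>"

definition small_map :: "('r, 'a) module \<Rightarrow> ('r, 'b) module \<Rightarrow> ('a \<Rightarrow> 'b) \<Rightarrow> 'u \<Rightarrow> 'u" where
  "small_map M N f = (\<lambda>x\<in>small_enc M ` carrier M. small_enc N (f (small_dec M x)))"

section \<open>The twisted augmentation ideal\<close>

definition aug_ideal :: "nat \<Rightarrow> (fgrp \<Rightarrow> 'k::field) set" where
  "aug_ideal n = {a \<in> carrier (group_algebra (free_grp n)). (\<Sum>x\<in>{x. a x \<noteq> 0}. a x) = 0}"

definition aug_gen :: "nat \<Rightarrow> nat \<Rightarrow> fgrp \<Rightarrow> 'k::field" where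
  "aug_gen n j = gsingle 1 (fgen n j) \<ominus>\<^bsub>group_algebra (free_grp n)\<^esub> \<one>\<^bsub>group_algebra (free_grp n)\<^esub>"

definition lam_ge :: "'k::field \<Rightarrow> nat \<Rightarrow> nat \<Rightarrow> 'k" where
  "lam_ge lam i j = (if j \<le> i then lam else 1)"

definition is_twisted_action ::
  "nat \<Rightarrow> 'k::field \<Rightarrow> (fgrp \<Rightarrow> (fgrp \<Rightarrow> 'k) \<Rightarrow> (fgrp \<Rightarrow> 'k)) \<Rightarrow> bool" where
  "is_twisted_action n lam t \<longleftrightarrow>
    (let A = group_algebra (free_grp n) :: (fgrp \<Rightarrow> 'k) ring;
         I = aug_ideal n in
     t \<in> hom (free_grp n) (BijGroup I) \<and>
     (\<forall>x\<in>carrier (free_grp n). \<forall>f\<in>I. \<forall>f'\<in>I. t x (f \<oplus>\<^bsub>A\<^esub> f') = t x f \<oplus>\<^bsub>A\<^esub> t x f') \<and>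
     (\<forall>x\<in>carrier (free_grp n). \<forall>f\<in>I. \<forall>a\<in>carrier A. t x (f \<otimes>\<^bsub>A\<^esub> a) = t x f \<otimes>\<^bsub>A\<^esub> a) \<and>
     (\<forall>i\<in>{1..n}. \<forall>j\<in>{1..n}.
        t (fgen n i) (aug_gen n j) =
          gsingle (lam_ge lam i j) (fgen n i) \<otimes>\<^bsub>A\<^esub> aug_gen n j \<ominus>\<^bsub>A\<^esub>
          gsingle (lam_ge lam (i - 1) j - 1) \<one>\<^bsub>free_grp n\<^esub> \<otimes>\<^bsub>A\<^esub> aug_gen n j))"

text \<open>With \<open>\<lambda> = lam \<noteq> 0\<close>, this is the action \<open>x \<circ>\<^sub>\<lambda> f\<close>; it is unique for \<open>x\<close> in the free group and
  \<open>f\<close> in the augmentation ideal.\<close>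

definition twisted_action :: "nat \<Rightarrow> 'k::field \<Rightarrow> fgrp \<Rightarrow> (fgrp \<Rightarrow> 'k) \<Rightarrow> (fgrp \<Rightarrow> 'k)" where
  "twisted_action n lam = (SOME t. is_twisted_action n lam t)"

section \<open>Tensor products\<close>

text \<open>\<open>I \<otimes>\<^sub>R V\<close> for a right ideal \<open>I\<close> of \<open>R\<close> and a left \<open>R\<close>-module \<open>V\<close>.\<close>

definition tensor_rels ::
  "('r, 'x) ring_scheme \<Rightarrow> 'r set \<Rightarrow> ('r, 'a) module \<Rightarrow> ('r \<times> 'a \<Rightarrow>\<^sub>0 int) set" where
  "tensor_rels R I V =
    {frag_of (f \<oplus>\<^bsub>R\<^esub> f', v) - frag_of (f, v) - frag_of (f', v) | f f' v.
       f \<in> I \<and> f' \<in> I \<and> v \<in> carrier V} \<union>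
    {frag_of (f, v \<oplus>\<^bsub>V\<^esub> v') - frag_of (f, v) - frag_of (f, v') | f v v'.
       f \<in> I \<and> v \<in> carrier V \<and> v' \<in> carrier V} \<union>
    {frag_of (f \<otimes>\<^bsub>R\<^esub> a, v) - frag_of (f, a \<odot>\<^bsub>V\<^esub> v) | f a v.
       f \<in> I \<and> a \<in> carrier R \<and> v \<in> carrier V}"

definition tensor_null ::
  "('r, 'x) ring_scheme \<Rightarrow> 'r set \<Rightarrow> ('r, 'a) module \<Rightarrow> ('r \<times> 'a \<Rightarrow>\<^sub>0 int) set" where
  "tensor_null R I V = generate (free_Abelian_group (I \<times> carrier V)) (tensor_rels R I V)"

definition tensor_prod ::
  "('r, 'x) ring_scheme \<Rightarrow> 'r set \<Rightarrow> ('r, 'a) module \<Rightarrow> ('r \<times> 'a \<Rightarrow>\<^sub>0 int) set monoid" where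
  "tensor_prod R I V = free_Abelian_group (I \<times> carrier V) Mod tensor_null R I V"

definition tensor_class ::
  "('r, 'x) ring_scheme \<Rightarrow> 'r set \<Rightarrow> ('r, 'a) module \<Rightarrow> ('r \<times> 'a \<Rightarrow>\<^sub>0 int) \<Rightarrow> ('r \<times> 'a \<Rightarrow>\<^sub>0 int) set" where
  "tensor_class R I V c = tensor_null R I V #>\<^bsub>free_Abelian_group (I \<times> carrier V)\<^esub> c"

section \<open>The twisted Long-Moody and the Katz-Long-Moody functor\<close>

text \<open>Restriction of modules and of module maps along \<open>k[F\<^sub>n] \<subseteq> k[F\<^sub>n \<rtimes> G]\<close>.\<close>

definition res_free ::
  "('g, 'z) monoid_scheme \<Rightarrow> (fgrp \<times> 'g \<Rightarrow> 'k::field, 'a) module \<Rightarrow> (fgrp \<Rightarrow> 'k, 'a) module" where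
  "res_free G V = restrict_scalars (galg_map (\<lambda>x. (x, \<one>\<^bsub>G\<^esub>))) V"

definition res_functor ::
  "('g, 'z) monoid_scheme \<Rightarrow>
   ((fgrp \<times> 'g \<Rightarrow> 'k::field, 'u) module, 'u \<Rightarrow> 'u, (fgrp \<Rightarrow> 'k, 'u) module, 'u \<Rightarrow> 'u) funct" where
  "res_functor G = \<lparr>fobj = res_free G, fmap = (\<lambda>V W \<phi>. \<phi>)\<rparr>"

type_synonym ('k, 'u) lm_elem = "((fgrp \<Rightarrow> 'k) \<times> 'u \<Rightarrow>\<^sub>0 int) set"

text \<open>On simple tensors, \<open>c \<cdot> (x, g) \<in> k[F\<^sub>n \<rtimes> G]\<close> acts by
  \<open>f \<otimes> v \<mapsto> c (x \<circ>\<^sub>\<lambda> \<alpha>(g)(f)) \<otimes> g v\<close>.\<close>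

definition lm_obj ::
  "nat \<Rightarrow> ('g, 'z) monoid_scheme \<Rightarrow> ('g \<Rightarrow> fgrp \<Rightarrow> fgrp) \<Rightarrow> 'k::field \<Rightarrow>
   (fgrp \<times> 'g \<Rightarrow> 'k, 'u) module \<Rightarrow> (fgrp \<times> 'g \<Rightarrow> 'k, ('k, 'u) lm_elem) module" where
  "lm_obj n G \<alpha> lam V =
    (let A = group_algebra (free_grp n);
         T = tensor_prod A (aug_ideal n) (res_free G V) in
     \<lparr>carrier = carrier T, monoid.mult = undefined, one = undefined,
      ring.zero = \<one>\<^bsub>T\<^esub>, ring.add = monoid.mult T,
      smult = (\<lambda>a X. \<Union>c\<in>X. tensor_class A (aug_ideal n) (res_free G V)
        (frag_extend (\<lambda>(f, v). \<Sum>(x, g)\<in>{p. a p \<noteq> 0}.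
           frag_of (gsingle (a (x, g)) \<one>\<^bsub>free_grp n\<^esub> \<otimes>\<^bsub>A\<^esub> twisted_action n lam x (galg_map (\<alpha> g) f),
                    gsingle 1 (\<one>\<^bsub>free_grp n\<^esub>, g) \<odot>\<^bsub>V\<^esub> v)) c))\<rparr>)"

definition lm_map ::
  "nat \<Rightarrow> ('g, 'z) monoid_scheme \<Rightarrow> (fgrp \<times> 'g \<Rightarrow> 'k::field, 'u) module \<Rightarrow>
   (fgrp \<times> 'g \<Rightarrow> 'k, 'u) module \<Rightarrow> ('u \<Rightarrow> 'u) \<Rightarrow> ('k, 'u) lm_elem \<Rightarrow> ('k, 'u) lm_elem" where
  "lm_map n G V W \<phi> =
    (let A = group_algebra (free_grp n) in
     (\<lambda>X\<in>carrier (tensor_prod A (aug_ideal n) (res_free G V)).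
        \<Union>c\<in>X. tensor_class A (aug_ideal n) (res_free G W)
          (frag_extend (\<lambda>(f, v). frag_of (f, \<phi> v)) c)))"

definition free_invariants ::
  "nat \<Rightarrow> ('g, 'z) monoid_scheme \<Rightarrow> (fgrp \<times> 'g \<Rightarrow> 'k::field, 'a) module \<Rightarrow> 'a set" where
  "free_invariants n G W =
    {w \<in> carrier W. \<forall>x\<in>carrier (free_grp n). gsingle 1 (x, \<one>\<^bsub>G\<^esub>) \<odot>\<^bsub>W\<^esub> w = w}"

definition eigen_part ::
  "nat \<Rightarrow> ('g, 'z) monoid_scheme \<Rightarrow> 'k::field \<Rightarrow> (fgrp \<times> 'g \<Rightarrow> 'k, 'a) module \<Rightarrow> nat \<Rightarrow> 'a set" where
  "eigen_part n G lam W i =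
    {w \<in> carrier W.
       gsingle 1 (fgen n i, \<one>\<^bsub>G\<^esub>) \<odot>\<^bsub>W\<^esub> w = gsingle lam (\<one>\<^bsub>free_grp n\<^esub>, \<one>\<^bsub>G\<^esub>) \<odot>\<^bsub>W\<^esub> w \<and>
       (\<forall>j\<in>{1..n} - {i}. gsingle 1 (fgen n j, \<one>\<^bsub>G\<^esub>) \<odot>\<^bsub>W\<^esub> w = w)}"

definition klm_sub ::
  "nat \<Rightarrow> ('g, 'z) monoid_scheme \<Rightarrow> 'k::field \<Rightarrow> (fgrp \<times> 'g \<Rightarrow> 'k, 'a) module \<Rightarrow> 'a set" where
  "klm_sub n G lam W =
    {finsum W t {1..n} | t. \<forall>i\<in>{1..n}. t i \<in> eigen_part n G lam W i} <+>\<^bsub>W\<^esub> free_invariants n G W"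

definition klm_quot ::
  "nat \<Rightarrow> ('g, 'z) monoid_scheme \<Rightarrow> ('g \<Rightarrow> fgrp \<Rightarrow> fgrp) \<Rightarrow> 'k::field \<Rightarrow>
   (fgrp \<times> 'g \<Rightarrow> 'k, 'u) module \<Rightarrow> (fgrp \<times> 'g \<Rightarrow> 'k, ('k, 'u) lm_elem set) module" where
  "klm_quot n G \<alpha> lam V = quot_module (lm_obj n G \<alpha> lam V) (klm_sub n G lam (lm_obj n G \<alpha> lam V))"

definition KLM ::
  "nat \<Rightarrow> ('g, 'z) monoid_scheme \<Rightarrow> ('g \<Rightarrow> fgrp \<Rightarrow> fgrp) \<Rightarrow> 'k::field \<Rightarrow>
   ((fgrp \<times> 'g \<Rightarrow> 'k, 'u) module, 'u \<Rightarrow> 'u, (fgrp \<times> 'g \<Rightarrow> 'k, 'u) module, 'u \<Rightarrow> 'u) funct" where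
  "KLM n G \<alpha> lam =
    \<lparr>fobj = (\<lambda>V. small_copy (klm_quot n G \<alpha> lam V)),
     fmap = (\<lambda>V W \<phi>. small_map (klm_quot n G \<alpha> lam V) (klm_quot n G \<alpha> lam W)
       (quot_map (lm_obj n G \<alpha> lam V) (klm_sub n G lam (lm_obj n G \<alpha> lam V))
                 (lm_obj n G \<alpha> lam W) (klm_sub n G lam (lm_obj n G \<alpha> lam W))
                 (lm_map n G V W \<phi>)))\<rparr>"

section \<open>Modules without almost trivial sub- or quotient modules\<close>

text \<open>A one-dimensional module is isomorphic to one with underlying set \<open>UNIV :: 'k set\<close>.  So the
  element type \<open>'k\<close> suffices for almost trivial modules, whatever the type of the
  module \<open>V\<close> they are compared with.\<close>

definition almost_trivial :: "nat \<Rightarrow> (fgrp \<Rightarrow> 'k::field, 'k) module \<Rightarrow> bool" where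
  "almost_trivial n T \<longleftrightarrow>
    left_module (group_algebra (free_grp n)) T \<and>
    (\<exists>t\<in>carrier T. t \<noteq> \<zero>\<^bsub>T\<^esub> \<and> (\<forall>w\<in>carrier T. \<exists>c. w = gsingle c \<one>\<^bsub>free_grp n\<^esub> \<odot>\<^bsub>T\<^esub> t)) \<and>
    (\<exists>i\<in>{1..n}. \<forall>j\<in>{1..n} - {i}. \<forall>t\<in>carrier T. gsingle 1 (fgen n j) \<odot>\<^bsub>T\<^esub> t = t)"

definition P1 :: "nat \<Rightarrow> (fgrp \<Rightarrow> 'k::field, 'a) module \<Rightarrow> bool" where
  "P1 n V \<longleftrightarrow> (\<forall>T. almost_trivial n T \<longrightarrow>
     lmod_hom (group_algebra (free_grp n)) T V = {\<lambda>t\<in>carrier T. \<zero>\<^bsub>V\<^esub>})"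

definition P2 :: "nat \<Rightarrow> (fgrp \<Rightarrow> 'k::field, 'a) module \<Rightarrow> bool" where
  "P2 n V \<longleftrightarrow> (\<forall>T. almost_trivial n T \<longrightarrow>
     lmod_hom (group_algebra (free_grp n)) V T = {\<lambda>v\<in>carrier V. \<zero>\<^bsub>T\<^esub>})"

definition Mod_NT ::
  "'k::field itself \<Rightarrow> 'u itself \<Rightarrow> nat \<Rightarrow> ('g, 'z) monoid_scheme \<Rightarrow> ('g \<Rightarrow> fgrp \<Rightarrow> fgrp) \<Rightarrow>
   ((fgrp \<times> 'g \<Rightarrow> 'k, 'u) module, 'u \<Rightarrow> 'u) cat" where
  "Mod_NT _ _ n G \<alpha> =
    full_subcat (left_mod_cat (group_algebra (semidirect (free_grp n) G \<alpha>)))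
      (\<lambda>V. P1 n (res_free G V) \<and> P2 n (res_free G V))"

definition Mod_NT_free ::
  "'k::field itself \<Rightarrow> 'u itself \<Rightarrow> nat \<Rightarrow> ((fgrp \<Rightarrow> 'k, 'u) module, 'u \<Rightarrow> 'u) cat" where
  "Mod_NT_free _ _ n =
    full_subcat (left_mod_cat (group_algebra (free_grp n))) (\<lambda>V. P1 n V \<and> P2 n V)"

section \<open>The middle convolution of Dettweiler and Reiter\<close>

definition power_module :: "nat \<Rightarrow> ('r, 'u) module \<Rightarrow> ('r, nat \<Rightarrow> 'u) module" where
  "power_module n V =
    \<lparr>carrier = {1..n} \<rightarrow>\<^sub>E carrier V, monoid.mult = undefined, one = undefined,
     ring.zero = (\<lambda>i\<in>{1..n}. \<zero>\<^bsub>V\<^esub>),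
     ring.add = (\<lambda>v w. \<lambda>i\<in>{1..n}. v i \<oplus>\<^bsub>V\<^esub> w i),
     smult = (\<lambda>a v. \<lambda>i\<in>{1..n}. a \<odot>\<^bsub>V\<^esub> v i)\<rparr>"

text \<open>The operator \<open>N\<^sub>i\<close>; \<open>dr_entry\<close> gives the elements of \<open>k[F\<^sub>n]\<close> that act as the entries of its
  \<open>i\<close>-th block row.\<close>

definition dr_entry :: "nat \<Rightarrow> 'k::field \<Rightarrow> nat \<Rightarrow> nat \<Rightarrow> fgrp \<Rightarrow> 'k" where
  "dr_entry n lam i j =
    (let A = group_algebra (free_grp n) in
     if j < i then gsingle lam (fgen n j) \<ominus>\<^bsub>A\<^esub> gsingle lam \<one>\<^bsub>free_grp n\<^esub>
     else if j = i then gsingle lam (fgen n i)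
     else gsingle 1 (fgen n j) \<ominus>\<^bsub>A\<^esub> \<one>\<^bsub>A\<^esub>)"

definition dr_op ::
  "nat \<Rightarrow> 'k::field \<Rightarrow> (fgrp \<Rightarrow> 'k, 'u) module \<Rightarrow> nat \<Rightarrow> (nat \<Rightarrow> 'u) \<Rightarrow> (nat \<Rightarrow> 'u)" where
  "dr_op n lam V i v = v(i := (\<Oplus>\<^bsub>V\<^esub> j\<in>{1..n}. dr_entry n lam i j \<odot>\<^bsub>V\<^esub> v j))"

definition is_dr_smult ::
  "nat \<Rightarrow> 'k::field \<Rightarrow> (fgrp \<Rightarrow> 'k, 'u) module \<Rightarrow> ((fgrp \<Rightarrow> 'k) \<Rightarrow> (nat \<Rightarrow> 'u) \<Rightarrow> (nat \<Rightarrow> 'u)) \<Rightarrow> bool" where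
  "is_dr_smult n lam V s \<longleftrightarrow>
    left_module (group_algebra (free_grp n)) ((power_module n V)\<lparr>smult := s\<rparr>) \<and>
    (\<forall>c. \<forall>v\<in>carrier (power_module n V).
       s (gsingle c \<one>\<^bsub>free_grp n\<^esub>) v = gsingle c \<one>\<^bsub>free_grp n\<^esub> \<odot>\<^bsub>power_module n V\<^esub> v) \<and>
    (\<forall>i\<in>{1..n}. \<forall>v\<in>carrier (power_module n V). s (gsingle 1 (fgen n i)) v = dr_op n lam V i v)"

text \<open>\<open>C\<^sub>\<lambda>(V)\<close>: the only \<open>k[F\<^sub>n]\<close>-module structure on the vector space \<open>V\<^sup>n\<close> in which the generators
  act by the operators \<open>N\<^sub>i\<close>.\<close>

definition dr_conv :: "nat \<Rightarrow> 'k::field \<Rightarrow> (fgrp \<Rightarrow> 'k, 'u) module \<Rightarrow> (fgrp \<Rightarrow> 'k, nat \<Rightarrow> 'u) module" where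
  "dr_conv n lam V = (power_module n V)\<lparr>smult := (SOME s. is_dr_smult n lam V s)\<rparr>"

definition dr_K :: "nat \<Rightarrow> (fgrp \<Rightarrow> 'k::field, 'u) module \<Rightarrow> (nat \<Rightarrow> 'u) set" where
  "dr_K n V = {v \<in> {1..n} \<rightarrow>\<^sub>E carrier V. \<forall>i\<in>{1..n}. gsingle 1 (fgen n i) \<odot>\<^bsub>V\<^esub> v i = v i}"

definition dr_L :: "nat \<Rightarrow> 'k::field \<Rightarrow> (fgrp \<Rightarrow> 'k, 'u) module \<Rightarrow> (nat \<Rightarrow> 'u) set" where
  "dr_L n lam V = {v \<in> {1..n} \<rightarrow>\<^sub>E carrier V. \<forall>i\<in>{1..n}. dr_op n lam V i v = v}"

definition dr_sub :: "nat \<Rightarrow> 'k::field \<Rightarrow> (fgrp \<Rightarrow> 'k, 'u) module \<Rightarrow> (nat \<Rightarrow> 'u) set" where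
  "dr_sub n lam V = dr_K n V <+>\<^bsub>dr_conv n lam V\<^esub> dr_L n lam V"

definition MC ::
  "nat \<Rightarrow> 'k::field \<Rightarrow>
   ((fgrp \<Rightarrow> 'k, 'u) module, 'u \<Rightarrow> 'u, (fgrp \<Rightarrow> 'k, 'u) module, 'u \<Rightarrow> 'u) funct" where
  "MC n lam =
    \<lparr>fobj = (\<lambda>V. small_copy (quot_module (dr_conv n lam V) (dr_sub n lam V))),
     fmap = (\<lambda>V W \<phi>.
       small_map (quot_module (dr_conv n lam V) (dr_sub n lam V))
                 (quot_module (dr_conv n lam W) (dr_sub n lam W))
         (quot_map (dr_conv n lam V) (dr_sub n lam V) (dr_conv n lam W) (dr_sub n lam W)
           (\<lambda>v\<in>carrier (dr_conv n lam V). \<lambda>i\<in>{1..n}. \<phi> (v i))))\<rparr>"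

end

theory Submission
  imports Defs "HOL-Library.Function_Algebras" "HOL.Vector_Spaces"
begin

text \<open>
  The augmentation ideal \<open>I\<close> is a free right ideal with basis \<open>x\<^sub>1 - 1, \<dots>, x\<^sub>n - 1\<close>, so \<open>I \<otimes> V\<close> is
  \<open>V\<^sup>n\<close>: the vector \<open>v\<close> stands for \<open>\<Sum>\<^sub>j (x\<^sub>j - 1) \<otimes> v\<^sub>j\<close>.  In these coordinates the twisted action of
  \<open>x\<^sub>i\<close> changes only the \<open>i\<close>-th component, to which it adds
  \<open>R\<^sub>i v = (\<lambda> - 1) v\<^sub>i + \<Sum>\<^sub>j \<lambda>\<^bsub>\<ge>i\<^esub>(j) (x\<^sub>j - 1) v\<^sub>j\<close> (the constant \<open>row\<close>).  This is the operator \<open>N\<^sub>i\<close> of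
  Dettweiler and Reiter.  So the Long-Moody module, restricted to the free group, is the convolution
  \<open>C\<^sub>\<lambda>(V)\<close>, and the eigenspaces and invariants that the Katz-Long-Moody functor divides out sum up to
  \<open>K + L\<close> (\<open>klm_sub_eq\<close>).  This gives the comparison with the middle convolution.

  The key to the other parts is that under (P1) the submodule \<open>K + L\<close> is the kernel of the single map
  \<open>v \<mapsto> ((x\<^sub>i - 1) R\<^sub>i v)\<^sub>i\<close> (\<open>klm_ker_eq\<close>).  With this description (P1) and (P2) pass to the quotient
  (\<open>no_sub_conv\<close>, \<open>no_quot_conv\<close>).  Let \<open>m(w) = \<Sum>\<^sub>j (x\<^sub>j - 1) w\<^sub>j\<close> be the multiplication
  \<open>I \<otimes> (I \<otimes> V) \<rightarrow> I \<otimes> V\<close> (the constant \<open>aug_sum\<close>).  It carries the action that is twisted by \<open>\<lambda>\<close> over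
  the action twisted by \<open>\<tau>\<close> to the action twisted by \<open>\<lambda>\<tau>\<close> (\<open>aug_sum_conv\<close>), and
  \<open>R\<^sup>\<tau>\<^sub>i (R\<^sup>\<lambda>\<^sub>i w) = R\<^bsup>\<lambda>\<tau>\<^esup>\<^sub>i (m w)\<close> (\<open>row_row\<close>).  Hence \<open>w\<close> lies in the kernel for the composite of the two
  functors iff \<open>m w\<close> lies in the kernel for \<open>\<lambda>\<tau>\<close> (\<open>klm_ker_klm_ker\<close>), and by (P2) \<open>m\<close> is surjective
  modulo that kernel; this is multiplicativity.  For \<open>\<lambda>\<tau> = 1\<close> the kernel is that of the multiplication
  \<open>I \<otimes> V \<rightarrow> V\<close>, which is surjective by (P2), so the functor for \<open>1\<close> is isomorphic to the identity and the functors
  for \<open>\<lambda>\<close> and \<open>\<lambda>\<^sup>-\<^sup>1\<close> are inverse to each other.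

  An element of \<open>G\<close> acts on the coordinates through the Jacobian matrix of Fox derivatives of the
  automorphism of the free group (\<open>fox_change\<close>).  That this is compatible with the twisted action is a
  property of braids; by the chain rule it suffices to verify it for the generators of the braid group
  (\<open>generator_equivariant\<close>).  That it respects \<open>K\<close> is due to the fact that braids map each \<open>x\<^sub>j\<close> to a conjugate
  of some \<open>x\<^sub>l\<close> (\<open>theta_conj\<close>).

  No computation takes place in the modules themselves, whose elements are cosets in tensor products,
  encoded in the universe.  Every module is presented as a quotient of a vector space \<open>E\<close> with an action of
  the group (locale \<open>presentation\<close>): at first \<open>E\<close> is spanned by a permuted basis, and each
  application of a functor replaces \<open>E\<close> by \<open>nat \<Rightarrow> E\<close>, the action by a convolution, and the kernel by the
  \<open>K + L\<close> above.  Module maps lift to equivariant linear maps of these spaces (\<open>lifts_exists\<close>), which act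
  componentwise after the functor has been applied.  Two functors whose values are presented by
  the same space with the same action and the same kernel are therefore isomorphic
  (\<open>naturally_isomorphic_if_same_presentation\<close>), and all isomorphisms of functors below arise in this way.
\<close>

section \<open>Words and free groups\<close>

lemma words_Nil [simp]: "[] \<in> words S"
  by (simp add: words_def)

lemma words_Cons [simp]: "(s, b) # w \<in> words S \<longleftrightarrow> s \<in> S \<and> w \<in> words S"
  by (auto simp: words_def)

lemma words_append [simp]: "u @ v \<in> words S \<longleftrightarrow> u \<in> words S \<and> v \<in> words S"
  by (auto simp: words_def)

lemma pres_eq_words: "pres_eq S R u v \<Longrightarrow> u \<in> words S \<and> v \<in> words S"
  by (induction rule: pres_eq.induct) auto

lemma pres_eq_context:
  assumes "pres_eq S R u v" "a \<in> words S" "b \<in> words S"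
  shows "pres_eq S R (a @ u @ b) (a @ v @ b)"
  using assms(1)
proof (induction rule: pres_eq.induct)
  case (refl u)
  then show ?case using assms by (intro pres_eq.refl) auto
next
  case (sym u v)
  then show ?case by (blast intro: pres_eq.sym)
next
  case (trans u v w)
  then show ?case by (blast intro: pres_eq.trans)
next
  case (cancel u v s c)
  then show ?case using assms pres_eq.cancel[of "a @ u" S "v @ b" s R c] by simp
next
  case (rel u v r r')
  then show ?case using assms pres_eq.rel[of "a @ u" S "v @ b" r r' R] by simp
qed

lemma pres_eq_append:
  assumes "pres_eq S R u u'" "pres_eq S R v v'"
  shows "pres_eq S R (u @ v) (u' @ v')"
  using pres_eq_context[OF assms(1), of "[]" v] pres_eq_context[OF assms(2), of u' "[]"]
    pres_eq_words[OF assms(1)] pres_eq_words[OF assms(2)] by (auto intro: pres_eq.trans)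

lemma pres_class_eqI: "pres_eq S R u v \<Longrightarrow> pres_class S R u = pres_class S R v"
  unfolding pres_class_def by (auto intro: pres_eq.trans pres_eq.sym)

lemma pres_class_eqD: "pres_class S R u = pres_class S R v \<Longrightarrow> v \<in> words S \<Longrightarrow> pres_eq S R u v"
  unfolding pres_class_def by (auto intro: pres_eq.refl)

lemma pres_class_mult:
  assumes "u \<in> words S" "v \<in> words S"
  shows "pres_class S R u \<otimes>\<^bsub>pres_group S R\<^esub> pres_class S R v = pres_class S R (u @ v)"
proof -
  have *: "pres_class S R (u' @ v') = pres_class S R (u @ v)"
    if "u' \<in> pres_class S R u" "v' \<in> pres_class S R v" for u' v'
    using that pres_eq_append[of S R u u' v v'] unfolding pres_class_def[of S R u] pres_class_def[of S R v]
    by (auto intro!: pres_class_eqI[symmetric])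
  have "u \<in> pres_class S R u" "v \<in> pres_class S R v"
    using assms by (auto simp: pres_class_def intro: pres_eq.refl)
  moreover have "(\<Union>u'\<in>pres_class S R u. \<Union>v'\<in>pres_class S R v. pres_class S R (u' @ v'))
      = (\<Union>u'\<in>pres_class S R u. \<Union>v'\<in>pres_class S R v. pres_class S R (u @ v))"
    using * by (intro SUP_cong refl) blast+
  ultimately show ?thesis by (auto simp: pres_group_def)
qed

definition word_inv :: "'a word \<Rightarrow> 'a word" where
  "word_inv w = rev (map (\<lambda>(s, b). (s, \<not> b)) w)"

lemma word_inv_words [simp]: "word_inv w \<in> words S \<longleftrightarrow> w \<in> words S"
  by (auto simp: words_def word_inv_def lists_eq_set)

lemma word_inv_cancel: "w \<in> words S \<Longrightarrow> pres_eq S R (word_inv w @ w) []"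
proof (induction w)
  case Nil
  then show ?case by (simp add: word_inv_def pres_eq.refl)
next
  case (Cons l w)
  obtain s b where l: "l = (s, b)" by force
  have "pres_eq S R (word_inv w @ [(s, \<not> b), (s, \<not> \<not> b)] @ w) (word_inv w @ w)"
    using Cons.prems by (intro pres_eq.cancel) (auto simp: l)
  with Cons show ?case by (auto simp: l word_inv_def intro: pres_eq.trans)
qed

lemma carrier_pres_group: "carrier (pres_group S R) = pres_class S R ` words S"
  by (simp add: pres_group_def)

lemma one_pres_group: "\<one>\<^bsub>pres_group S R\<^esub> = pres_class S R []"
  by (simp add: pres_group_def)

lemma group_pres_group: "group (pres_group S R)"
proof (rule groupI)
  fix X assume "X \<in> carrier (pres_group S R)"
  then obtain w where w: "w \<in> words S" "X = pres_class S R w" by (auto simp: carrier_pres_group)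
  have "pres_class S R (word_inv w) \<otimes>\<^bsub>pres_group S R\<^esub> X = \<one>\<^bsub>pres_group S R\<^esub>"
    using w word_inv_cancel[of w S R] by (simp add: pres_class_mult one_pres_group pres_class_eqI)
  moreover have "pres_class S R (word_inv w) \<in> carrier (pres_group S R)"
    using w by (auto simp: carrier_pres_group)
  ultimately show "\<exists>Y\<in>carrier (pres_group S R). Y \<otimes>\<^bsub>pres_group S R\<^esub> X = \<one>\<^bsub>pres_group S R\<^esub>"
    by blast
qed (auto simp: carrier_pres_group one_pres_group pres_class_mult)

lemma pres_class_inv_letter:
  assumes "s \<in> S"
  shows "pres_class S R [(s, False)] = inv\<^bsub>pres_group S R\<^esub> (pres_class S R [(s, True)])"
proof -
  interpret group "pres_group S R" by (rule group_pres_group)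
  have "pres_eq S R ([] @ [(s, False), (s, \<not> False)] @ []) ([] @ [])"
    using assms by (intro pres_eq.cancel) auto
  then have "pres_class S R [(s, False)] \<otimes>\<^bsub>pres_group S R\<^esub> pres_class S R [(s, True)] = \<one>\<^bsub>pres_group S R\<^esub>"
    using assms by (simp add: pres_class_mult one_pres_group pres_class_eqI)
  then show ?thesis
    using assms by (intro inv_equality[symmetric]) (auto simp: carrier_pres_group)
qed

lemma pres_group_induct [consumes 1, case_names one gen inv mult]:
  assumes x: "x \<in> carrier (pres_group S R)"
    and one: "P \<one>\<^bsub>pres_group S R\<^esub>"
    and gen: "\<And>s. s \<in> S \<Longrightarrow> P (pres_class S R [(s, True)])"
    and inv: "\<And>x. x \<in> carrier (pres_group S R) \<Longrightarrow> P x \<Longrightarrow> P (inv\<^bsub>pres_group S R\<^esub> x)"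
    and mult: "\<And>x y. x \<in> carrier (pres_group S R) \<Longrightarrow> y \<in> carrier (pres_group S R) \<Longrightarrow>
      P x \<Longrightarrow> P y \<Longrightarrow> P (x \<otimes>\<^bsub>pres_group S R\<^esub> y)"
  shows "P x"
proof -
  interpret group "pres_group S R" by (rule group_pres_group)
  have "P (pres_class S R w)" if "w \<in> words S" for w
    using that
  proof (induction w)
    case Nil
    then show ?case using one by (simp add: one_pres_group)
  next
    case (Cons l w)
    obtain s b where l: "l = (s, b)" by force
    have s: "s \<in> S" "w \<in> words S" using Cons.prems by (auto simp: l)
    have c: "pres_class S R [(s, b)] \<in> carrier (pres_group S R)" for b
      using s by (auto simp: carrier_pres_group)
    have "P (pres_class S R [(s, b)])"
      using gen[OF s(1)] inv[OF c gen[OF s(1)]] pres_class_inv_letter[OF s(1)] by (cases b) auto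
    then have "P (pres_class S R [(s, b)] \<otimes>\<^bsub>pres_group S R\<^esub> pres_class S R w)"
      using s Cons.IH by (intro mult) (auto simp: carrier_pres_group)
    then show ?case using s by (simp add: pres_class_mult l)
  qed
  with x show ?thesis by (auto simp: carrier_pres_group)
qed

lemma group_free_grp: "group (free_grp n)"
  by (simp add: free_grp_def group_pres_group)

lemma fgen_carrier [simp]: "i \<in> {1..n} \<Longrightarrow> fgen n i \<in> carrier (free_grp n)"
  by (auto simp: fgen_def free_grp_def carrier_pres_group)

lemmas free_grp_induct [consumes 1, case_names one gen inv mult] =
  pres_group_induct[where S = "{1..n}" and R = "{}" for n :: nat, folded free_grp_def fgen_def]

text \<open>The free group has the empty set of relations, so this is well defined on its elements and gives its
  universal property.\<close>

definition word_eval :: "('h, 'z) monoid_scheme \<Rightarrow> ('a \<Rightarrow> 'h) \<Rightarrow> 'a word \<Rightarrow> 'h" where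
  "word_eval H h w = foldr (\<lambda>(s, b) y. (if b then h s else inv\<^bsub>H\<^esub> h s) \<otimes>\<^bsub>H\<^esub> y) w \<one>\<^bsub>H\<^esub>"

context
  fixes H :: "('h, 'z) monoid_scheme" (structure) and h :: "'a \<Rightarrow> 'h" and S
  assumes H: "group H" and h: "\<And>s. s \<in> S \<Longrightarrow> h s \<in> carrier H"
begin

interpretation group H by (rule H)

lemma word_eval_closed: "w \<in> words S \<Longrightarrow> word_eval H h w \<in> carrier H"
proof (induction w)
  case (Cons l w)
  then show ?case using h by (cases l) (auto simp: word_eval_def)
qed (simp add: word_eval_def)

lemma word_eval_append:
  "u \<in> words S \<Longrightarrow> v \<in> words S \<Longrightarrow> word_eval H h (u @ v) = word_eval H h u \<otimes> word_eval H h v"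
proof (induction u)
  case Nil
  then show ?case using word_eval_closed[of v] by (simp add: word_eval_def)
next
  case (Cons l u)
  then show ?case using h word_eval_closed[of u] word_eval_closed[of v]
    by (cases l) (auto simp: word_eval_def m_assoc)
qed

lemma word_eval_free: "pres_eq S {} u v \<Longrightarrow> word_eval H h u = word_eval H h v"
proof (induction rule: pres_eq.induct)
  case (cancel u v s b)
  have "word_eval H h [(s, b), (s, \<not> b)] = \<one>"
    using h[OF cancel(3)] by (cases b) (simp_all add: word_eval_def)
  then have "word_eval H h ([(s, b), (s, \<not> b)] @ v) = word_eval H h v"
    using cancel word_eval_closed[of v] by (subst word_eval_append) simp_all
  moreover have "word_eval H h (u @ [(s, b), (s, \<not> b)] @ v)
      = word_eval H h u \<otimes> word_eval H h ([(s, b), (s, \<not> b)] @ v)"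
    using cancel by (intro word_eval_append) simp_all
  ultimately show ?case using cancel by (simp add: word_eval_append)
qed auto

lemma free_group_universal:
  "\<exists>\<phi>\<in>hom (pres_group S {}) H. \<forall>s\<in>S. \<phi> (pres_class S {} [(s, True)]) = h s"
proof
  define rp where "rp X = (SOME w. w \<in> words S \<and> X = pres_class S {} w)" for X
  define \<phi> where "\<phi> X = word_eval H h (rp X)" for X
  have \<phi>: "\<phi> (pres_class S {} w) = word_eval H h w" if "w \<in> words S" for w
  proof -
    have "rp (pres_class S {} w) \<in> words S \<and> pres_class S {} w = pres_class S {} (rp (pres_class S {} w))"
      unfolding rp_def by (rule someI_ex) (use that in blast)
    then show ?thesis
      unfolding \<phi>_def by (metis word_eval_free pres_class_eqD)
  qed
  show "\<phi> \<in> hom (pres_group S {}) H"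
    by (auto simp: hom_def carrier_pres_group \<phi> word_eval_closed pres_class_mult word_eval_append)
  show "\<forall>s\<in>S. \<phi> (pres_class S {} [(s, True)]) = h s"
    using h by (auto simp: \<phi> word_eval_def)
qed

end

text \<open>The action in which the generators act by prescribed bijections; it exists by the universal property of the free
  group.\<close>

definition free_action :: "nat \<Rightarrow> (nat \<Rightarrow> 'x \<Rightarrow> 'x) \<Rightarrow> fgrp \<Rightarrow> 'x \<Rightarrow> 'x" where
  "free_action n T = (SOME \<phi>. \<phi> \<in> hom (free_grp n) (BijGroup UNIV) \<and> (\<forall>i\<in>{1..n}. \<phi> (fgen n i) = T i))"

lemma free_action:
  assumes "\<forall>i\<in>{1..n}. bij (T i)"
  shows free_action_hom: "free_action n T \<in> hom (free_grp n) (BijGroup UNIV)"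
    and free_action_gen: "i \<in> {1..n} \<Longrightarrow> free_action n T (fgen n i) = T i"
proof -
  have "\<exists>\<phi>. \<phi> \<in> hom (free_grp n) (BijGroup UNIV) \<and> (\<forall>i\<in>{1..n}. \<phi> (fgen n i) = T i)"
    using free_group_universal[OF group_BijGroup, of "{1..n}" T UNIV] assms
    by (auto simp: BijGroup_def Bij_def free_grp_def fgen_def)
  from someI_ex[OF this]
  show "free_action n T \<in> hom (free_grp n) (BijGroup UNIV)"
    "i \<in> {1..n} \<Longrightarrow> free_action n T (fgen n i) = T i"
    unfolding free_action_def by auto
qed

lemma free_action_mult:
  assumes "\<forall>i\<in>{1..n}. bij (T i)" "x \<in> carrier (free_grp n)" "y \<in> carrier (free_grp n)"
  shows "free_action n T (x \<otimes>\<^bsub>free_grp n\<^esub> y) e = free_action n T x (free_action n T y e)"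
proof -
  have "free_action n T z \<in> Bij UNIV" if "z \<in> carrier (free_grp n)" for z
    using hom_in_carrier[OF free_action_hom[OF assms(1)] that] by (simp add: BijGroup_def)
  then show ?thesis
    using hom_mult[OF free_action_hom[OF assms(1)] assms(2,3)] assms(2,3)
    by (simp add: BijGroup_def compose_def)
qed

lemma free_action_one:
  assumes "\<forall>i\<in>{1..n}. bij (T i)"
  shows "free_action n T \<one>\<^bsub>free_grp n\<^esub> e = e"
proof -
  have "free_action n T \<one>\<^bsub>free_grp n\<^esub> = \<one>\<^bsub>BijGroup (UNIV :: 'a set)\<^esub>"
    by (rule hom_one[OF free_action_hom[OF assms] group_free_grp group_BijGroup])
  then show ?thesis by (simp add: BijGroup_def)
qed

section \<open>Linear representations and the group algebra\<close>

(* Families are treated as vectors and are only evaluated on demand, by fun_simps. *)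
declare plus_fun_apply [simp del] zero_fun_apply [simp del] minus_apply [simp del] uminus_apply [simp del]

lemma sum_fun_apply: "(\<Sum>i\<in>A. f i) x = (\<Sum>i\<in>A. f i x)"
  by (induction A rule: infinite_finite_induct) (auto simp: plus_fun_apply zero_fun_apply)

definition fscale :: "('k \<Rightarrow> 'e \<Rightarrow> 'e) \<Rightarrow> 'k \<Rightarrow> ('i \<Rightarrow> 'e) \<Rightarrow> 'i \<Rightarrow> 'e" where
  "fscale sc c v = (\<lambda>i. sc c (v i))"

lemma fscale_apply: "fscale sc c v i = sc c (v i)"
  by (simp add: fscale_def)

lemmas fun_simps = plus_fun_apply zero_fun_apply minus_apply uminus_apply sum_fun_apply fscale_apply

locale group_rep = vector_space sc
  for sc :: "'k::field \<Rightarrow> 'e::ab_group_add \<Rightarrow> 'e" +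
  fixes H :: "('h, 'z) monoid_scheme" and \<rho> :: "'h \<Rightarrow> 'e \<Rightarrow> 'e"
  assumes rep_group: "group H"
    and rep_add: "h \<in> carrier H \<Longrightarrow> \<rho> h (u + v) = \<rho> h u + \<rho> h v"
    and rep_scale: "h \<in> carrier H \<Longrightarrow> \<rho> h (sc c u) = sc c (\<rho> h u)"
    and rep_one: "\<rho> \<one>\<^bsub>H\<^esub> u = u"
    and rep_mult: "g \<in> carrier H \<Longrightarrow> h \<in> carrier H \<Longrightarrow> \<rho> (g \<otimes>\<^bsub>H\<^esub> h) u = \<rho> g (\<rho> h u)"

text \<open>The \<open>k\<close>-linear extension of an action of a group to its group algebra.\<close>

definition galg_act :: "('k::field \<Rightarrow> 'e::ab_group_add \<Rightarrow> 'e) \<Rightarrow> ('h \<Rightarrow> 'e \<Rightarrow> 'e) \<Rightarrow> ('h \<Rightarrow> 'k) \<Rightarrow> 'e \<Rightarrow> 'e"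
  where "galg_act sc \<rho> a u = (\<Sum>h | a h \<noteq> 0. sc (a h) (\<rho> h u))"

lemma galg_add [simp]: "a \<oplus>\<^bsub>group_algebra H\<^esub> b = a + b"
  by (simp add: group_algebra_def plus_fun_def)

lemma galg_zero [simp]: "\<zero>\<^bsub>group_algebra H\<^esub> = 0"
  by (simp add: group_algebra_def zero_fun_def)

lemma galg_one: "\<one>\<^bsub>group_algebra H\<^esub> = gsingle 1 \<one>\<^bsub>H\<^esub>"
  by (auto simp: group_algebra_def gsingle_def)

lemma galg_carrier: "a \<in> carrier (group_algebra H) \<longleftrightarrow> finite {x. a x \<noteq> 0} \<and> {x. a x \<noteq> 0} \<subseteq> carrier H"
  by (simp add: group_algebra_def)

lemma gsingle_zero [simp]: "gsingle 0 x = 0"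
  by (auto simp: gsingle_def fun_simps)

lemma gsingle_closed [simp]: "x \<in> carrier H \<Longrightarrow> gsingle c x \<in> carrier (group_algebra H)"
  by (auto simp: galg_carrier gsingle_def)

lemma galg_zero_closed [simp]: "0 \<in> carrier (group_algebra H)"
  by (auto simp: galg_carrier fun_simps)

lemma galg_add_closed [simp]:
  "a \<in> carrier (group_algebra H) \<Longrightarrow> b \<in> carrier (group_algebra H) \<Longrightarrow> a + b \<in> carrier (group_algebra H)"
proof -
  assume ab: "a \<in> carrier (group_algebra H)" "b \<in> carrier (group_algebra H)"
  have "{x. (a + b) x \<noteq> 0} \<subseteq> {x. a x \<noteq> 0} \<union> {x. b x \<noteq> 0}" by (auto simp: fun_simps)
  with ab show ?thesis unfolding galg_carrier by (blast intro: finite_subset finite_UnI)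
qed

lemma galg_uminus_closed [simp]: "a \<in> carrier (group_algebra H) \<Longrightarrow> - a \<in> carrier (group_algebra H)"
  by (auto simp: galg_carrier fun_simps)

lemma galg_diff_closed [simp]:
  "a \<in> carrier (group_algebra H) \<Longrightarrow> b \<in> carrier (group_algebra H) \<Longrightarrow> a - b \<in> carrier (group_algebra H)"
  using galg_add_closed[of a H "- b"] by simp

lemma galg_induct [consumes 1, case_names zero single add]:
  assumes a: "a \<in> carrier (group_algebra H)" and P0: "P 0"
    and Ps: "\<And>c h. h \<in> carrier H \<Longrightarrow> P (gsingle c h)"
    and Pa: "\<And>a b. a \<in> carrier (group_algebra H) \<Longrightarrow> b \<in> carrier (group_algebra H) \<Longrightarrow>
      P a \<Longrightarrow> P b \<Longrightarrow> P (a + b)"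
  shows "P a"
proof -
  have "P (\<Sum>h\<in>A. gsingle (a h) h) \<and> (\<Sum>h\<in>A. gsingle (a h) h) \<in> carrier (group_algebra H)"
    if "finite A" "A \<subseteq> carrier H" for A
    using that by induction (auto intro: P0 Ps Pa)
  moreover have "a = (\<Sum>h | a h \<noteq> 0. gsingle (a h) h)"
  proof
    fix x
    have "(\<Sum>h | a h \<noteq> 0. gsingle (a h) h x) = (\<Sum>h | a h \<noteq> 0. if h = x then a h else 0)"
      by (intro sum.cong) (auto simp: gsingle_def)
    then show "a x = (\<Sum>h | a h \<noteq> 0. gsingle (a h) h) x"
      using a by (simp add: sum_fun_apply galg_carrier)
  qed
  ultimately show ?thesis using a by (metis galg_carrier)
qed

context group_rep
begin

lemma rep_zero: "h \<in> carrier H \<Longrightarrow> \<rho> h 0 = 0"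
  using rep_add[of h 0 0] by simp

lemma rep_minus: "h \<in> carrier H \<Longrightarrow> \<rho> h (- u) = - \<rho> h u"
  using rep_add[of h u "- u"] rep_zero[of h] by (simp add: minus_unique)

lemma rep_diff: "h \<in> carrier H \<Longrightarrow> \<rho> h (u - v) = \<rho> h u - \<rho> h v"
  using rep_add[of h u "- v"] by (simp add: rep_minus)

lemma rep_sum: "h \<in> carrier H \<Longrightarrow> \<rho> h (\<Sum>i\<in>A. f i) = (\<Sum>i\<in>A. \<rho> h (f i))"
  by (induction A rule: infinite_finite_induct) (auto simp: rep_zero rep_add)

lemma rep_inv: "h \<in> carrier H \<Longrightarrow> \<rho> (inv\<^bsub>H\<^esub> h) (\<rho> h u) = u" "h \<in> carrier H \<Longrightarrow> \<rho> h (\<rho> (inv\<^bsub>H\<^esub> h) u) = u"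
  using rep_mult[of "inv\<^bsub>H\<^esub> h" h u] rep_mult[of h "inv\<^bsub>H\<^esub> h" u] rep_group
  by (simp_all add: rep_one group.l_inv group.r_inv)

lemma galg_act_superset:
  assumes "finite A" "{h. a h \<noteq> 0} \<subseteq> A"
  shows "galg_act sc \<rho> a u = (\<Sum>h\<in>A. sc (a h) (\<rho> h u))"
  unfolding galg_act_def using assms by (intro sum.mono_neutral_left) auto

lemma galg_act_add:
  assumes "a \<in> carrier (group_algebra H)" "b \<in> carrier (group_algebra H)"
  shows "galg_act sc \<rho> (a + b) u = galg_act sc \<rho> a u + galg_act sc \<rho> b u"
proof -
  have "finite ({h. a h \<noteq> 0} \<union> {h. b h \<noteq> 0})" (is "finite ?A") using assms by (auto simp: galg_carrier)
  then have "galg_act sc \<rho> (a + b) u = (\<Sum>h\<in>?A. sc ((a + b) h) (\<rho> h u))"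
    "galg_act sc \<rho> a u = (\<Sum>h\<in>?A. sc (a h) (\<rho> h u))"
    "galg_act sc \<rho> b u = (\<Sum>h\<in>?A. sc (b h) (\<rho> h u))"
    by (rule galg_act_superset; auto simp: fun_simps)+
  then show ?thesis by (simp add: fun_simps scale_left_distrib sum.distrib)
qed

lemma galg_act_zero [simp]: "galg_act sc \<rho> 0 u = 0"
  by (simp add: galg_act_def fun_simps)

lemma galg_act_single [simp]: "galg_act sc \<rho> (gsingle c h) u = sc c (\<rho> h u)"
proof -
  have "galg_act sc \<rho> (gsingle c h) u = (\<Sum>g\<in>{h}. sc (gsingle c h g) (\<rho> g u))"
    by (rule galg_act_superset) (auto simp: gsingle_def)
  then show ?thesis by (simp add: gsingle_def)
qed

lemma galg_act_right:
  assumes "a \<in> carrier (group_algebra H)"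
  shows galg_act_add_right: "galg_act sc \<rho> a (u + v) = galg_act sc \<rho> a u + galg_act sc \<rho> a v"
    and galg_act_zero_right: "galg_act sc \<rho> a 0 = 0"
    and galg_act_scale_right: "galg_act sc \<rho> a (sc c u) = sc c (galg_act sc \<rho> a u)"
  using assms
  by (auto simp: galg_act_def galg_carrier rep_add rep_zero rep_scale scale_right_distrib sum.distrib
      scale_sum_right scale_left_commute subset_iff mult.commute intro!: sum.neutral sum.cong)

end

text \<open>Left translations on the space of all functions on a group.  Restricted to the group algebra
  this is the regular representation, so multiplication there is an instance of
  \<open>galg_act\<close>.\<close>

definition ltrans :: "('h, 'z) monoid_scheme \<Rightarrow> 'h \<Rightarrow> ('h \<Rightarrow> 'k) \<Rightarrow> 'h \<Rightarrow> 'k" where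
  "ltrans H x b = (\<lambda>z. if z \<in> carrier H then b (inv\<^bsub>H\<^esub> x \<otimes>\<^bsub>H\<^esub> z) else b z)"

lemma vector_space_fscale: "vector_space sc \<Longrightarrow> vector_space (fscale sc)"
  unfolding vector_space_def by (auto simp: fun_eq_iff fun_simps)

lemma vector_space_mult: "vector_space ((*) :: 'k::field \<Rightarrow> 'k \<Rightarrow> 'k)"
  by standard (auto simp: algebra_simps)

lemma regular_rep:
  assumes "group H"
  shows "group_rep (fscale (*) :: 'k::field \<Rightarrow> _) H (ltrans H)"
proof (intro group_rep.intro vector_space_fscale vector_space_mult group_rep_axioms.intro assms)
  interpret group H by fact
  fix g h and u :: "'a \<Rightarrow> 'k"
  show "ltrans H \<one>\<^bsub>H\<^esub> u = u" by (simp add: ltrans_def fun_eq_iff)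
  assume "g \<in> carrier H" "h \<in> carrier H"
  then show "ltrans H (g \<otimes>\<^bsub>H\<^esub> h) u = ltrans H g (ltrans H h u)"
    by (simp add: ltrans_def fun_eq_iff inv_mult_group m_assoc)
qed (auto simp: ltrans_def fun_eq_iff fun_simps)

lemma ltrans_single:
  assumes "group H" "x \<in> carrier H" "y \<in> carrier H"
  shows "ltrans H x (gsingle c y) = gsingle c (x \<otimes>\<^bsub>H\<^esub> y)"
proof
  interpret group H by fact
  fix z
  show "ltrans H x (gsingle c y) z = gsingle c (x \<otimes>\<^bsub>H\<^esub> y) z"
    using assms(2,3) inv_solve_left[of y x z] by (auto simp: ltrans_def gsingle_def)
qed

text \<open>Multiplication in the group algebra is the linearly extended left translation.  This reduces
  the laws of the ring to properties of \<open>galg_act\<close>.\<close>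

lemma galg_mult_eq_act:
  assumes H: "group H" and a: "a \<in> carrier (group_algebra H)" and b: "b \<in> carrier (group_algebra H)"
  shows "a \<otimes>\<^bsub>group_algebra H\<^esub> b = galg_act (fscale (*)) (ltrans H) a b"
proof
  interpret group H by fact
  fix z
  let ?S = "{(x, y). a x \<noteq> 0 \<and> b y \<noteq> 0 \<and> x \<otimes>\<^bsub>H\<^esub> y = z}"
  have ac: "x \<in> carrier H" if "a x \<noteq> 0" for x using a that by (auto simp: galg_carrier)
  have bc: "x \<in> carrier H" if "b x \<noteq> 0" for x using b that by (auto simp: galg_carrier)
  have rhs: "galg_act (fscale (*)) (ltrans H) a b z = (\<Sum>x | a x \<noteq> 0. a x * ltrans H x b z)"
    by (simp add: galg_act_def fun_simps)
  have lhs: "(a \<otimes>\<^bsub>group_algebra H\<^esub> b) z = (\<Sum>(x, y)\<in>?S. a x * b y)"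
    by (simp add: group_algebra_def)
  have "(\<Sum>(x, y)\<in>?S. a x * b y) = (\<Sum>x | a x \<noteq> 0 \<and> ltrans H x b z \<noteq> 0. a x * ltrans H x b z)"
  proof (rule sum.reindex_bij_witness[where i = "\<lambda>x. (x, inv\<^bsub>H\<^esub> x \<otimes>\<^bsub>H\<^esub> z)" and j = fst], goal_cases)
    case (1 p)
    then show ?case using ac bc by (auto simp: m_assoc[symmetric])
  next
    case (2 p)
    then show ?case using ac bc by (auto simp: ltrans_def m_assoc[symmetric])
  next
    case (3 x)
    then show ?case by simp
  next
    case (4 x)
    then have "z \<in> carrier H" using bc by (auto simp: ltrans_def split: if_splits)
    with 4 ac show ?case by (auto simp: ltrans_def m_assoc[symmetric])
  next
    case (5 p)
    then show ?case using ac bc by (auto simp: ltrans_def m_assoc[symmetric])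
  qed
  also have "\<dots> = (\<Sum>x | a x \<noteq> 0. a x * ltrans H x b z)"
    using a by (intro sum.mono_neutral_left) (auto simp: galg_carrier)
  finally show "(a \<otimes>\<^bsub>group_algebra H\<^esub> b) z = galg_act (fscale (*)) (ltrans H) a b z"
    using lhs rhs by simp
qed

context group_rep
begin

interpretation reg: group_rep "fscale (*) :: 'k \<Rightarrow> _" H "ltrans H"
  by (rule regular_rep[OF rep_group])

abbreviation "A \<equiv> group_algebra H :: ('h \<Rightarrow> 'k) ring"

lemma galg_mult_single:
  assumes "x \<in> carrier H" "y \<in> carrier H"
  shows "gsingle c x \<otimes>\<^bsub>A\<^esub> gsingle d y = gsingle (c * d) (x \<otimes>\<^bsub>H\<^esub> y)"
  using assms by (simp add: galg_mult_eq_act[OF rep_group] ltrans_single[OF rep_group])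
    (auto simp: fscale_def gsingle_def)

lemma galg_mult_closed:
  assumes "a \<in> carrier A" "b \<in> carrier A"
  shows "a \<otimes>\<^bsub>A\<^esub> b \<in> carrier A"
  using assms(1)
proof (induction a rule: galg_induct)
  case (single c h)
  have "fscale (*) c (ltrans H h b) \<in> carrier A" using assms(2)
  proof (induction b rule: galg_induct)
    case zero
    then show ?case using single by (simp only: reg.rep_zero reg.scale_zero_right galg_zero_closed)
  next
    case (single d g)
    have "fscale (*) c (gsingle d (h \<otimes>\<^bsub>H\<^esub> g)) = gsingle (c * d) (h \<otimes>\<^bsub>H\<^esub> g)"
      by (auto simp: fscale_def gsingle_def)
    then show ?case using single \<open>h \<in> carrier H\<close> rep_group
      by (simp add: ltrans_single group.is_monoid monoid.m_closed)
  next
    case (add a b)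
    have "fscale (*) c (ltrans H h (a + b)) \<in> carrier A"
      using add \<open>h \<in> carrier H\<close> by (simp add: reg.rep_add reg.scale_right_distrib)
    then show ?case .
  qed
  then show ?case using single assms(2) by (simp add: galg_mult_eq_act[OF rep_group])
qed (use assms(2) in \<open>simp_all add: galg_mult_eq_act[OF rep_group] reg.galg_act_add\<close>)

lemma galg_act_mult:
  assumes "a \<in> carrier A" "b \<in> carrier A"
  shows "galg_act sc \<rho> (a \<otimes>\<^bsub>A\<^esub> b) u = galg_act sc \<rho> a (galg_act sc \<rho> b u)"
  using assms(1)
proof (induction a rule: galg_induct)
  case zero
  then show ?case using assms(2) by (simp only: galg_mult_eq_act[OF rep_group galg_zero_closed] reg.galg_act_zero galg_act_zero)
next
  case (add a a')
  then have "(a + a') \<otimes>\<^bsub>A\<^esub> b = a \<otimes>\<^bsub>A\<^esub> b + a' \<otimes>\<^bsub>A\<^esub> b"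
    using assms(2) by (simp add: galg_mult_eq_act[OF rep_group] reg.galg_act_add)
  then have "galg_act sc \<rho> ((a + a') \<otimes>\<^bsub>A\<^esub> b) u = galg_act sc \<rho> (a + a') (galg_act sc \<rho> b u)"
    using add assms(2) by (simp add: galg_act_add galg_mult_closed)
  then show ?case .
next
  case (single c h)
  show ?case using assms(2)
  proof (induction b rule: galg_induct)
    case zero
    then show ?case using single
      by (simp add: galg_mult_eq_act[OF rep_group] reg.rep_zero rep_zero)
  next
    case (single d g)
    then show ?case using \<open>h \<in> carrier H\<close> by (simp add: galg_mult_single rep_mult rep_scale)
  next
    case (add b b')
    then have "gsingle c h \<otimes>\<^bsub>A\<^esub> (b + b') = gsingle c h \<otimes>\<^bsub>A\<^esub> b + gsingle c h \<otimes>\<^bsub>A\<^esub> b'"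
      using \<open>h \<in> carrier H\<close>
      by (simp add: galg_mult_eq_act[OF rep_group] reg.rep_add reg.scale_right_distrib)
    then show ?case using add \<open>h \<in> carrier H\<close>
      by (simp add: galg_act_add galg_mult_closed rep_add scale_right_distrib)
  qed
qed

end

lemma ring_group_algebra:
  assumes "group H"
  shows "ring (group_algebra H :: ('h \<Rightarrow> 'k::field) ring)" (is "ring ?A")
proof -
  interpret reg: group_rep "fscale (*) :: 'k \<Rightarrow> _" H "ltrans H"
    by (rule regular_rep[OF assms])
  note act = galg_mult_eq_act[OF assms]
  have one: "\<one>\<^bsub>?A\<^esub> \<in> carrier ?A"
    using assms by (simp add: galg_one group.is_monoid)
  have "abelian_group ?A"
  proof (rule abelian_groupI)
    fix a assume "a \<in> carrier ?A"
    then show "\<exists>b\<in>carrier ?A. b \<oplus>\<^bsub>?A\<^esub> a = \<zero>\<^bsub>?A\<^esub>"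
      by (intro bexI[of _ "- a"]) simp_all
  qed (simp_all add: algebra_simps)
  moreover have "monoid ?A"
  proof (rule monoidI)
    fix a b c assume abc: "a \<in> carrier ?A" "b \<in> carrier ?A" "c \<in> carrier ?A"
    have "(a \<otimes>\<^bsub>?A\<^esub> b) \<otimes>\<^bsub>?A\<^esub> c = galg_act (fscale (*)) (ltrans H) (a \<otimes>\<^bsub>?A\<^esub> b) c"
      using abc reg.galg_mult_closed by (simp add: act)
    also have "\<dots> = a \<otimes>\<^bsub>?A\<^esub> (b \<otimes>\<^bsub>?A\<^esub> c)"
      using abc reg.galg_mult_closed[of b c] reg.galg_act_mult[of a b c] by (simp only: act)
    finally show "(a \<otimes>\<^bsub>?A\<^esub> b) \<otimes>\<^bsub>?A\<^esub> c = a \<otimes>\<^bsub>?A\<^esub> (b \<otimes>\<^bsub>?A\<^esub> c)" .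
  next
    fix a assume a: "a \<in> carrier ?A"
    show "\<one>\<^bsub>?A\<^esub> \<otimes>\<^bsub>?A\<^esub> a = a"
      using a one by (simp add: act galg_one reg.rep_one)
    show "a \<otimes>\<^bsub>?A\<^esub> \<one>\<^bsub>?A\<^esub> = a" using a
    proof (induction a rule: galg_induct)
      case zero
      have "0 \<otimes>\<^bsub>?A\<^esub> \<one>\<^bsub>?A\<^esub> = 0" using one by (simp add: act)
      then show ?case .
    next
      case (single c h)
      then show ?case using assms
        by (simp add: galg_one reg.galg_mult_single group.is_monoid)
    next
      case (add a b)
      then show ?case using one by (simp add: act reg.galg_act_add)
    qed
  qed (use one reg.galg_mult_closed in auto)
  ultimately show ?thesis
    using reg.galg_mult_closed
    by (intro ringI) (auto simp: abelian_group_def abelian_monoid_def act reg.galg_act_add reg.galg_act_add_right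
        intro: monoid.m_assoc)
qed

lemma galg_uminus:
  assumes "group H" "a \<in> carrier (group_algebra H)"
  shows "\<ominus>\<^bsub>group_algebra H\<^esub> a = - a"
proof -
  interpret ring "group_algebra H" by (rule ring_group_algebra[OF assms(1)])
  show ?thesis using assms(2) by (intro minus_equality) simp_all
qed

lemma galg_minus:
  assumes "group H" "a \<in> carrier (group_algebra H)" "b \<in> carrier (group_algebra H)"
  shows "a \<ominus>\<^bsub>group_algebra H\<^esub> b = a - b"
  using assms by (simp add: a_minus_def galg_uminus)

section \<open>Presentations of modules by representations\<close>

text \<open>\<open>M\<close> is the quotient of the representation \<open>\<rho>\<close> on \<open>E\<close> by the kernel of \<open>q\<close>.  Working in \<open>E\<close> gives access to
  the type class operations for vector spaces, while \<open>M\<close> is a module record on a subset of a type.\<close>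

locale presentation = group_rep sc H \<rho>
  for sc :: "'k::field \<Rightarrow> 'e::ab_group_add \<Rightarrow> 'e" and H :: "('h, 'z) monoid_scheme"
    and \<rho> :: "'h \<Rightarrow> 'e \<Rightarrow> 'e" +
  fixes q :: "'e \<Rightarrow> 'm" and M :: "('h \<Rightarrow> 'k, 'm) module"
  assumes q_range: "range q = carrier M"
    and q_add: "q (u + v) = q u \<oplus>\<^bsub>M\<^esub> q v"
    and q_zero: "q 0 = \<zero>\<^bsub>M\<^esub>"
    and q_act: "a \<in> carrier (group_algebra H) \<Longrightarrow> a \<odot>\<^bsub>M\<^esub> q u = q (galg_act sc \<rho> a u)"
begin

lemma q_closed [simp]: "q u \<in> carrier M"
  using q_range by blast

lemma q_surj: "x \<in> carrier M \<Longrightarrow> \<exists>u. x = q u"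
  using q_range by blast

lemma left_module: "left_module (group_algebra H) M"
proof (intro left_module.intro left_module_axioms.intro ring_group_algebra rep_group)
  show "abelian_group M"
  proof (rule abelian_groupI)
    fix x y z assume "x \<in> carrier M" "y \<in> carrier M" "z \<in> carrier M"
    then obtain u v w where "x = q u" "y = q v" "z = q w" by (metis q_surj)
    then show "x \<oplus>\<^bsub>M\<^esub> y \<in> carrier M" "x \<oplus>\<^bsub>M\<^esub> y \<oplus>\<^bsub>M\<^esub> z = x \<oplus>\<^bsub>M\<^esub> (y \<oplus>\<^bsub>M\<^esub> z)"
      "x \<oplus>\<^bsub>M\<^esub> y = y \<oplus>\<^bsub>M\<^esub> x"
      by (simp_all add: q_add[symmetric] algebra_simps)
  next
    show "\<zero>\<^bsub>M\<^esub> \<in> carrier M" by (simp add: q_zero[symmetric])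
  next
    fix x assume "x \<in> carrier M"
    then obtain u where u: "x = q u" by (metis q_surj)
    then show "\<zero>\<^bsub>M\<^esub> \<oplus>\<^bsub>M\<^esub> x = x" by (simp add: q_add[symmetric] q_zero[symmetric])
    show "\<exists>y\<in>carrier M. y \<oplus>\<^bsub>M\<^esub> x = \<zero>\<^bsub>M\<^esub>"
      using u by (intro bexI[of _ "q (- u)"]) (simp_all add: q_add[symmetric] q_zero[symmetric])
  qed
next
  fix a b :: "'h \<Rightarrow> 'k" and x y assume ab: "a \<in> carrier (group_algebra H)" "b \<in> carrier (group_algebra H)"
    and "x \<in> carrier M" "y \<in> carrier M"
  then obtain u v where uv: "x = q u" "y = q v" by (metis q_surj)
  show "a \<odot>\<^bsub>M\<^esub> x \<in> carrier M"
    using ab uv by (simp add: q_act)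
  show "(a \<oplus>\<^bsub>group_algebra H\<^esub> b) \<odot>\<^bsub>M\<^esub> x = a \<odot>\<^bsub>M\<^esub> x \<oplus>\<^bsub>M\<^esub> b \<odot>\<^bsub>M\<^esub> x"
    using ab uv by (simp add: q_act q_add[symmetric] galg_act_add)
  show "a \<odot>\<^bsub>M\<^esub> (x \<oplus>\<^bsub>M\<^esub> y) = a \<odot>\<^bsub>M\<^esub> x \<oplus>\<^bsub>M\<^esub> a \<odot>\<^bsub>M\<^esub> y"
    using ab uv by (simp add: q_act q_add[symmetric] galg_act_add_right)
  show "(a \<otimes>\<^bsub>group_algebra H\<^esub> b) \<odot>\<^bsub>M\<^esub> x = a \<odot>\<^bsub>M\<^esub> (b \<odot>\<^bsub>M\<^esub> x)"
    using ab uv by (simp add: q_act galg_mult_closed galg_act_mult)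
next
  fix x assume "x \<in> carrier M"
  then obtain u where "x = q u" by (metis q_surj)
  then show "\<one>\<^bsub>group_algebra H\<^esub> \<odot>\<^bsub>M\<^esub> x = x"
    using rep_group by (simp add: galg_one q_act group.is_monoid rep_one)
qed

sublocale M: left_module "group_algebra H" M
  by (rule left_module)

lemma q_uminus: "q (- u) = \<ominus>\<^bsub>M\<^esub> q u"
  by (rule M.minus_equality[symmetric]) (simp_all add: q_add[symmetric] q_zero)

lemma q_eq_iff: "q u = q v \<longleftrightarrow> q (u - v) = \<zero>\<^bsub>M\<^esub>"
proof -
  have "q u = q v \<oplus>\<^bsub>M\<^esub> q (u - v)" by (simp add: q_add[symmetric])
  then show ?thesis using M.add.r_cancel_one[of "q v" "q (u - v)"] by simp
qed

lemma q_sum: "finite I \<Longrightarrow> q (\<Sum>i\<in>I. f i) = finsum M (\<lambda>i. q (f i)) I"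
  by (induction I rule: finite_induct) (simp_all add: q_zero q_add)

lemma q_single: "h \<in> carrier H \<Longrightarrow> gsingle c h \<odot>\<^bsub>M\<^esub> q u = q (sc c (\<rho> h u))"
  by (simp add: q_act)

lemma q_scale: "gsingle c \<one>\<^bsub>H\<^esub> \<odot>\<^bsub>M\<^esub> q u = q (sc c u)"
  using rep_group by (simp add: q_single group.is_monoid rep_one)

lemma q_rep: "h \<in> carrier H \<Longrightarrow> gsingle 1 h \<odot>\<^bsub>M\<^esub> q u = q (\<rho> h u)"
  by (simp add: q_single)

end

lemma gsingle_add: "gsingle (c + d) h = gsingle c h + gsingle d h"
  by (auto simp: gsingle_def fun_simps)

lemma lmod_smult_zero:
  assumes "left_module R M" "x \<in> carrier M"
  shows "\<zero>\<^bsub>R\<^esub> \<odot>\<^bsub>M\<^esub> x = \<zero>\<^bsub>M\<^esub>"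
proof -
  interpret left_module R M by fact
  have "\<zero>\<^bsub>R\<^esub> \<odot>\<^bsub>M\<^esub> x = \<zero>\<^bsub>R\<^esub> \<odot>\<^bsub>M\<^esub> x \<oplus>\<^bsub>M\<^esub> \<zero>\<^bsub>R\<^esub> \<odot>\<^bsub>M\<^esub> x"
    using smult_l_distr[of "\<zero>\<^bsub>R\<^esub>" "\<zero>\<^bsub>R\<^esub>" x] assms(2) by simp
  then show ?thesis
    using assms(2) by (metis smult_closed R.zero_closed M.add.l_cancel_one')
qed

lemma lmod_zero_right:
  assumes "left_module R M" "a \<in> carrier R"
  shows "a \<odot>\<^bsub>M\<^esub> \<zero>\<^bsub>M\<^esub> = \<zero>\<^bsub>M\<^esub>"
proof -
  interpret left_module R M by fact
  have "a \<odot>\<^bsub>M\<^esub> \<zero>\<^bsub>M\<^esub> = a \<odot>\<^bsub>M\<^esub> \<zero>\<^bsub>M\<^esub> \<oplus>\<^bsub>M\<^esub> a \<odot>\<^bsub>M\<^esub> \<zero>\<^bsub>M\<^esub>"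
    using smult_r_distr[of a "\<zero>\<^bsub>M\<^esub>" "\<zero>\<^bsub>M\<^esub>"] assms(2) by simp
  then show ?thesis
    using assms(2) by (metis smult_closed M.zero_closed M.add.l_cancel_one')
qed

text \<open>As the group algebra is spanned by group elements, a map that respects addition, scalars and the action of
  group elements is linear over the group algebra.\<close>

lemma presentationI:
  fixes sc :: "'k::field \<Rightarrow> 'e::ab_group_add \<Rightarrow> 'e"
  assumes rep: "group_rep sc H \<rho>" and M: "left_module (group_algebra H) M"
    and range: "range q = carrier M"
    and add: "\<And>u v. q (u + v) = q u \<oplus>\<^bsub>M\<^esub> q v"
    and scale: "\<And>c u. gsingle c \<one>\<^bsub>H\<^esub> \<odot>\<^bsub>M\<^esub> q u = q (sc c u)"
    and elt: "\<And>h u. h \<in> carrier H \<Longrightarrow> gsingle 1 h \<odot>\<^bsub>M\<^esub> q u = q (\<rho> h u)"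
  shows "presentation sc H \<rho> q M"
proof -
  interpret group_rep sc H \<rho> by fact
  interpret M: left_module "group_algebra H" M by fact
  have closed: "q u \<in> carrier M" for u using range by blast
  have one: "\<one>\<^bsub>H\<^esub> \<in> carrier H" using rep_group by (simp add: group.is_monoid)
  have zero: "q 0 = \<zero>\<^bsub>M\<^esub>"
    using add[of 0 0] closed[of 0] by simp
  show ?thesis
  proof (unfold_locales, goal_cases)
    case (4 a u)
    then show ?case
    proof (induction a rule: galg_induct)
      case zero
      show ?case using lmod_smult_zero[OF M closed[of u]] by (simp add: \<open>q 0 = \<zero>\<^bsub>M\<^esub>\<close>)
    next
      case (single c h)
      have "gsingle c h = gsingle c \<one>\<^bsub>H\<^esub> \<otimes>\<^bsub>group_algebra H\<^esub> gsingle 1 h"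
        using single one rep_group by (simp add: galg_mult_single group.is_monoid)
      then have "gsingle c h \<odot>\<^bsub>M\<^esub> q u = gsingle c \<one>\<^bsub>H\<^esub> \<odot>\<^bsub>M\<^esub> (gsingle 1 h \<odot>\<^bsub>M\<^esub> q u)"
        using single one closed by (simp add: M.smult_assoc1)
      then show ?case using single by (simp add: elt scale)
    next
      case (add a b)
      have "(a + b) \<odot>\<^bsub>M\<^esub> q u = q (galg_act sc \<rho> (a + b) u)"
        using add M.smult_l_distr[of a b "q u"] closed by (simp add: galg_act_add assms(4))
      then show ?case .
    qed
  qed (use assms zero in auto)
qed

lemma poly_mapping_additive_induct [case_names single add]:
  assumes single: "\<And>v c. P (Poly_Mapping.single v c)"
    and add: "\<And>p r. P p \<Longrightarrow> P r \<Longrightarrow> P (p + r)"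
  shows "P (p :: 'u \<Rightarrow>\<^sub>0 'k::comm_monoid_add)"
proof -
  have "P (\<Sum>v\<in>A. Poly_Mapping.single v (Poly_Mapping.lookup p v))" if "finite A" for A
    using that single[of _ 0] by induction (auto intro: assms)
  moreover have "p = (\<Sum>v\<in>Poly_Mapping.keys p. Poly_Mapping.single v (Poly_Mapping.lookup p v))"
  proof (rule poly_mapping_eqI)
    fix w
    show "Poly_Mapping.lookup p w =
        Poly_Mapping.lookup (\<Sum>v\<in>Poly_Mapping.keys p. Poly_Mapping.single v (Poly_Mapping.lookup p v)) w"
      by (auto simp: lookup_sum lookup_single when_def in_keys_iff)
  qed
  ultimately show ?thesis by (metis finite_keys)
qed

text \<open>Every module is presented by the vector space with basis the whole type of its elements.  The
  group permutes the basis elements in the module and fixes the others, and evaluation sends the latter to zero.\<close>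

definition pscale :: "'k::field \<Rightarrow> ('u \<Rightarrow>\<^sub>0 'k) \<Rightarrow> ('u \<Rightarrow>\<^sub>0 'k)" where
  "pscale c p = Poly_Mapping.map ((*) c) p"

definition elt_perm :: "('h, 'z) monoid_scheme \<Rightarrow> ('h \<Rightarrow> 'k::field, 'u) module \<Rightarrow> 'h \<Rightarrow> 'u \<Rightarrow> 'u" where
  "elt_perm H V h v = (if v \<in> carrier V then gsingle 1 h \<odot>\<^bsub>V\<^esub> v else v)"

definition perm_act ::
  "('h, 'z) monoid_scheme \<Rightarrow> ('h \<Rightarrow> 'k::field, 'u) module \<Rightarrow> 'h \<Rightarrow> ('u \<Rightarrow>\<^sub>0 'k) \<Rightarrow> ('u \<Rightarrow>\<^sub>0 'k)" where
  "perm_act H V h p = Poly_Mapping.map_key (elt_perm H V (inv\<^bsub>H\<^esub> h)) p"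

definition evaluation ::
  "('h, 'z) monoid_scheme \<Rightarrow> ('h \<Rightarrow> 'k::field, 'u) module \<Rightarrow> ('u \<Rightarrow>\<^sub>0 'k) \<Rightarrow> 'u" where
  "evaluation H V p = finsum V (\<lambda>v. gsingle (Poly_Mapping.lookup p v) \<one>\<^bsub>H\<^esub> \<odot>\<^bsub>V\<^esub> v) (Poly_Mapping.keys p \<inter> carrier V)"

lemma lookup_pscale [simp]: "Poly_Mapping.lookup (pscale c p) v = c * Poly_Mapping.lookup p v"
  by (simp add: pscale_def Poly_Mapping.map.rep_eq when_def)

lemma vector_space_pscale: "vector_space (pscale :: 'k::field \<Rightarrow> _)"
  by standard (auto intro!: poly_mapping_eqI simp: lookup_add algebra_simps)

lemma pscale_single [simp]: "pscale c (Poly_Mapping.single v d) = Poly_Mapping.single v (c * d)"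
  by (auto intro!: poly_mapping_eqI simp: lookup_single when_def)

context
  fixes H :: "('h, 'z) monoid_scheme" and V :: "('h \<Rightarrow> 'k::field, 'u) module"
  assumes H: "group H" and V: "left_module (group_algebra H) V"
begin

interpretation H: group H by (rule H)
interpretation V: left_module "group_algebra H" V by (rule V)
interpretation reg: group_rep "fscale (*) :: 'k \<Rightarrow> _" H "ltrans H"
  by (rule regular_rep[OF H])

lemma elt_perm_one: "elt_perm H V \<one>\<^bsub>H\<^esub> v = v"
  using V.smult_one by (simp add: elt_perm_def galg_one)

lemma elt_perm_mult:
  assumes "g \<in> carrier H" "h \<in> carrier H"
  shows "elt_perm H V (g \<otimes>\<^bsub>H\<^esub> h) v = elt_perm H V g (elt_perm H V h v)"
proof (cases "v \<in> carrier V")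
  case True
  have "gsingle 1 (g \<otimes>\<^bsub>H\<^esub> h) = gsingle (1 :: 'k) g \<otimes>\<^bsub>group_algebra H\<^esub> gsingle 1 h"
    using assms by (simp add: reg.galg_mult_single)
  then show ?thesis
    using True assms V.smult_closed[of "gsingle 1 h" v] by (simp add: elt_perm_def V.smult_assoc1)
qed (simp add: elt_perm_def)

lemma elt_perm_inj: "h \<in> carrier H \<Longrightarrow> inj (elt_perm H V h)"
  by (rule inj_on_inverseI[where g = "elt_perm H V (inv\<^bsub>H\<^esub> h)"])
    (simp add: elt_perm_mult[symmetric] elt_perm_one)

lemma lookup_perm_act:
  "h \<in> carrier H \<Longrightarrow> Poly_Mapping.lookup (perm_act H V h p) v = Poly_Mapping.lookup p (elt_perm H V (inv\<^bsub>H\<^esub> h) v)"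
  by (simp add: perm_act_def Poly_Mapping.map_key.rep_eq elt_perm_inj)

lemma perm_rep: "group_rep pscale H (perm_act H V)"
proof (intro group_rep.intro vector_space_pscale group_rep_axioms.intro H)
  fix g h p assume gh: "g \<in> carrier H" "h \<in> carrier H"
  show "perm_act H V (g \<otimes>\<^bsub>H\<^esub> h) p = perm_act H V g (perm_act H V h p)"
    using gh by (intro poly_mapping_eqI) (simp add: lookup_perm_act H.inv_mult_group elt_perm_mult)
next
  fix p show "perm_act H V \<one>\<^bsub>H\<^esub> p = p"
    by (intro poly_mapping_eqI) (simp add: lookup_perm_act elt_perm_one)
qed (auto intro!: poly_mapping_eqI simp: lookup_perm_act lookup_add)

lemma perm_act_single:
  assumes "h \<in> carrier H"
  shows "perm_act H V h (Poly_Mapping.single v c) = Poly_Mapping.single (elt_perm H V h v) c"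
proof (rule poly_mapping_eqI)
  fix w
  have "elt_perm H V (inv\<^bsub>H\<^esub> h) w = v \<longleftrightarrow> w = elt_perm H V h v"
    using assms by (metis H.inv_closed H.l_inv H.r_inv elt_perm_mult elt_perm_one)
  then show "Poly_Mapping.lookup (perm_act H V h (Poly_Mapping.single v c)) w =
      Poly_Mapping.lookup (Poly_Mapping.single (elt_perm H V h v) c) w"
    using assms by (auto simp: lookup_perm_act lookup_single when_def)
qed

lemma evaluation_superset:
  assumes "finite A" "Poly_Mapping.keys p \<inter> carrier V \<subseteq> A" "A \<subseteq> carrier V"
  shows "evaluation H V p = finsum V (\<lambda>v. gsingle (Poly_Mapping.lookup p v) \<one>\<^bsub>H\<^esub> \<odot>\<^bsub>V\<^esub> v) A"
  unfolding evaluation_def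
proof (rule V.add.finprod_mono_neutral_cong_left)
  fix v assume "v \<in> A - Poly_Mapping.keys p \<inter> carrier V"
  then show "gsingle (Poly_Mapping.lookup p v) \<one>\<^bsub>H\<^esub> \<odot>\<^bsub>V\<^esub> v = \<zero>\<^bsub>V\<^esub>"
    using assms lmod_smult_zero[OF V, of v] by (auto simp: in_keys_iff)
qed (use assms in \<open>auto intro!: V.smult_closed\<close>)

lemma evaluation_add: "evaluation H V (p + r) = evaluation H V p \<oplus>\<^bsub>V\<^esub> evaluation H V r"
proof -
  let ?A = "(Poly_Mapping.keys p \<union> Poly_Mapping.keys r) \<inter> carrier V"
  have fin: "finite ?A" by simp
  have "evaluation H V (p + r) = finsum V (\<lambda>v. gsingle (Poly_Mapping.lookup (p + r) v) \<one>\<^bsub>H\<^esub> \<odot>\<^bsub>V\<^esub> v) ?A"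
    using Poly_Mapping.keys_add[of p r] by (intro evaluation_superset) auto
  also have "\<dots> = finsum V (\<lambda>v. gsingle (Poly_Mapping.lookup p v) \<one>\<^bsub>H\<^esub> \<odot>\<^bsub>V\<^esub> v \<oplus>\<^bsub>V\<^esub>
      gsingle (Poly_Mapping.lookup r v) \<one>\<^bsub>H\<^esub> \<odot>\<^bsub>V\<^esub> v) ?A"
    using V.smult_l_distr[of "gsingle _ \<one>\<^bsub>H\<^esub>" "gsingle _ \<one>\<^bsub>H\<^esub>"]
    by (intro V.add.finprod_cong') (auto simp: lookup_add gsingle_add intro!: V.smult_closed V.a_closed)
  also have "\<dots> = finsum V (\<lambda>v. gsingle (Poly_Mapping.lookup p v) \<one>\<^bsub>H\<^esub> \<odot>\<^bsub>V\<^esub> v) ?A \<oplus>\<^bsub>V\<^esub>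
      finsum V (\<lambda>v. gsingle (Poly_Mapping.lookup r v) \<one>\<^bsub>H\<^esub> \<odot>\<^bsub>V\<^esub> v) ?A"
    by (intro V.finsum_addf) (auto intro!: V.smult_closed)
  also have "finsum V (\<lambda>v. gsingle (Poly_Mapping.lookup p v) \<one>\<^bsub>H\<^esub> \<odot>\<^bsub>V\<^esub> v) ?A = evaluation H V p"
    by (rule evaluation_superset[symmetric]) auto
  also have "finsum V (\<lambda>v. gsingle (Poly_Mapping.lookup r v) \<one>\<^bsub>H\<^esub> \<odot>\<^bsub>V\<^esub> v) ?A = evaluation H V r"
    by (rule evaluation_superset[symmetric]) auto
  finally show ?thesis .
qed

lemma evaluation_single:
  "evaluation H V (Poly_Mapping.single v c) = (if v \<in> carrier V then gsingle c \<one>\<^bsub>H\<^esub> \<odot>\<^bsub>V\<^esub> v else \<zero>\<^bsub>V\<^esub>)"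
proof (cases "v \<in> carrier V")
  case True
  then have "evaluation H V (Poly_Mapping.single v c) =
      finsum V (\<lambda>v'. gsingle (Poly_Mapping.lookup (Poly_Mapping.single v c) v') \<one>\<^bsub>H\<^esub> \<odot>\<^bsub>V\<^esub> v') {v}"
    by (intro evaluation_superset) (auto split: if_splits)
  then show ?thesis using True V.smult_closed[of "gsingle c \<one>\<^bsub>H\<^esub>" v] by simp
next
  case False
  then have "Poly_Mapping.keys (Poly_Mapping.single v c) \<inter> carrier V = {}" by auto
  then show ?thesis using False by (simp add: evaluation_def)
qed

lemma evaluation_closed: "evaluation H V p \<in> carrier V"
  unfolding evaluation_def by (rule V.finsum_closed) (auto intro!: V.smult_closed)

lemma evaluation_presentation: "presentation pscale H (perm_act H V) (evaluation H V) V"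
proof (rule presentationI[OF perm_rep V])
  have "v \<in> range (evaluation H V)" if "v \<in> carrier V" for v
    using evaluation_single[of v 1] that V.smult_one by (metis galg_one rangeI)
  then show "range (evaluation H V) = carrier V"
    using evaluation_closed by blast
next
  interpret group_rep pscale H "perm_act H V" by (rule perm_rep)
  fix c p
  show "gsingle c \<one>\<^bsub>H\<^esub> \<odot>\<^bsub>V\<^esub> evaluation H V p = evaluation H V (pscale c p)"
  proof (induction p rule: poly_mapping_additive_induct)
    case (single v d)
    have "gsingle c \<one>\<^bsub>H\<^esub> \<odot>\<^bsub>V\<^esub> (gsingle d \<one>\<^bsub>H\<^esub> \<odot>\<^bsub>V\<^esub> v) = gsingle (c * d) \<one>\<^bsub>H\<^esub> \<odot>\<^bsub>V\<^esub> v" if "v \<in> carrier V"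
      using that V.smult_assoc1[of "gsingle c \<one>\<^bsub>H\<^esub>" "gsingle d \<one>\<^bsub>H\<^esub>" v] by (simp add: reg.galg_mult_single)
    then show ?case using lmod_zero_right[OF V] by (simp add: evaluation_single)
  next
    case (add p r)
    then show ?case
      by (simp add: evaluation_add V.smult_r_distr evaluation_closed scale_right_distrib)
  qed
  fix h assume h: "h \<in> carrier H"
  show "gsingle 1 h \<odot>\<^bsub>V\<^esub> evaluation H V p = evaluation H V (perm_act H V h p)"
  proof (induction p rule: poly_mapping_additive_induct)
    case (single v d)
    have "gsingle 1 h \<odot>\<^bsub>V\<^esub> (gsingle d \<one>\<^bsub>H\<^esub> \<odot>\<^bsub>V\<^esub> v) = gsingle d \<one>\<^bsub>H\<^esub> \<odot>\<^bsub>V\<^esub> (gsingle 1 h \<odot>\<^bsub>V\<^esub> v)"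
      if "v \<in> carrier V"
      using that h V.smult_assoc1[of "gsingle d \<one>\<^bsub>H\<^esub>" "gsingle 1 h" v]
        V.smult_assoc1[of "gsingle 1 h" "gsingle d \<one>\<^bsub>H\<^esub>" v] by (simp add: reg.galg_mult_single)
    then show ?case using lmod_zero_right[OF V] h V.smult_closed[of "gsingle 1 h" v]
      by (auto simp: evaluation_single perm_act_single elt_perm_def)
  next
    case (add p r)
    then show ?case using h
      by (simp add: evaluation_add V.smult_r_distr evaluation_closed rep_add)
  qed
qed (rule evaluation_add)

end

text \<open>The submodule is given as the image of a stable subspace, so the quotient is again presented by \<open>E\<close>, with
  a larger kernel.\<close>

lemma presentation_quot:
  fixes sc :: "'k::field \<Rightarrow> 'e::ab_group_add \<Rightarrow> 'e" and H :: "('h, 'z) monoid_scheme"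
  assumes "presentation sc H \<rho> q M"
    and S: "S = q ` Z"
    and Z: "0 \<in> Z" "\<And>u v. u \<in> Z \<Longrightarrow> v \<in> Z \<Longrightarrow> u + v \<in> Z" "\<And>c u. u \<in> Z \<Longrightarrow> sc c u \<in> Z"
      "\<And>h u. h \<in> carrier H \<Longrightarrow> u \<in> Z \<Longrightarrow> \<rho> h u \<in> Z"
  shows "presentation sc H \<rho> (\<lambda>u. S +>\<^bsub>M\<^esub> q u) (quot_module M S)"
    and "S +>\<^bsub>M\<^esub> q u = \<zero>\<^bsub>quot_module M S\<^esub> \<longleftrightarrow> q u \<in> S"
proof -
  interpret presentation sc H \<rho> q M by fact
  have neg: "- u \<in> Z" if "u \<in> Z" for u
    using Z(3)[OF that, of "- 1"] by (simp add: scale_minus_left)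
  have "additive_subgroup S M"
  proof (intro additive_subgroupI subgroup.intro)
    show "S \<subseteq> carrier (add_monoid M)" using S by auto
    show "\<one>\<^bsub>add_monoid M\<^esub> \<in> S" using S imageI[OF Z(1), of q] by (simp add: q_zero)
    fix x y assume "x \<in> S" "y \<in> S"
    then obtain u v where "u \<in> Z" "v \<in> Z" "x = q u" "y = q v" using S by auto
    then show "x \<otimes>\<^bsub>add_monoid M\<^esub> y \<in> S" "inv\<^bsub>add_monoid M\<^esub> x \<in> S"
      using S Z(2) neg by (auto simp: q_add[symmetric] a_inv_def[symmetric] q_uminus[symmetric])
  qed
  then interpret S: abelian_subgroup S M
    by (rule abelian_subgroupI3) (rule M.abelian_group_axioms)
  have eqI: "S +>\<^bsub>M\<^esub> q u = S +>\<^bsub>M\<^esub> q v" if "u - v \<in> Z" for u v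
  proof -
    have "q u = q (u - v) \<oplus>\<^bsub>M\<^esub> q v" by (simp add: q_add[symmetric])
    then have "q u \<in> S +>\<^bsub>M\<^esub> q v" using S that by (auto simp: a_r_coset_def')
    then show ?thesis using M.a_repr_independence[of "q u" S "q v"] S.a_subgroup by simp
  qed
  have act_Z: "galg_act sc \<rho> a u \<in> Z" if "a \<in> carrier (group_algebra H)" "u \<in> Z" for a u
    using that(1)
  proof (induction a rule: galg_induct)
    case zero
    show ?case using Z(1) by simp
  next
    case (single c h)
    then show ?case using that(2) Z by simp
  next
    case (add a b)
    have "galg_act sc \<rho> (a + b) u \<in> Z" using add Z(2) by (simp add: galg_act_add)
    then show ?case .
  qed
  show "presentation sc H \<rho> (\<lambda>u. S +>\<^bsub>M\<^esub> q u) (quot_module M S)"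
  proof unfold_locales
    show "range (\<lambda>u. S +>\<^bsub>M\<^esub> q u) = carrier (quot_module M S)"
      by (auto simp: quot_module_def A_RCOSETS_def' q_range[symmetric])
    show "S +>\<^bsub>M\<^esub> q 0 = \<zero>\<^bsub>quot_module M S\<^esub>"
      using M.a_coset_add_zero[of S] S.a_subset by (simp add: quot_module_def q_zero)
    show "S +>\<^bsub>M\<^esub> q (u + v) = (S +>\<^bsub>M\<^esub> q u) \<oplus>\<^bsub>quot_module M S\<^esub> (S +>\<^bsub>M\<^esub> q v)" for u v
      using S.a_rcos_sum[of "q u" "q v"] by (simp add: quot_module_def q_add)
    fix a :: "'h \<Rightarrow> 'k" and u assume a: "a \<in> carrier (group_algebra H)"
    have "S +>\<^bsub>M\<^esub> (a \<odot>\<^bsub>M\<^esub> x) = S +>\<^bsub>M\<^esub> q (galg_act sc \<rho> a u)" if x: "x \<in> S +>\<^bsub>M\<^esub> q u" for x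
    proof -
      obtain z where z: "z \<in> Z" "x = q (z + u)" using x S by (auto simp: a_r_coset_def' q_add)
      then show ?thesis
        using eqI[of "galg_act sc \<rho> a (z + u)" "galg_act sc \<rho> a u"] act_Z[OF a z(1)] a
        by (simp add: q_act galg_act_add_right)
    qed
    moreover have "q u \<in> S +>\<^bsub>M\<^esub> q u" by (rule S.a_rcos_self) simp
    ultimately have "(\<Union>x\<in>S +>\<^bsub>M\<^esub> q u. S +>\<^bsub>M\<^esub> (a \<odot>\<^bsub>M\<^esub> x)) = S +>\<^bsub>M\<^esub> q (galg_act sc \<rho> a u)"
      by blast
    then show "a \<odot>\<^bsub>quot_module M S\<^esub> (S +>\<^bsub>M\<^esub> q u) = S +>\<^bsub>M\<^esub> q (galg_act sc \<rho> a u)"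
      by (simp add: quot_module_def)
  qed
  have "q u \<in> S" if "S +>\<^bsub>M\<^esub> q u = S" using that S.a_rcos_self[of "q u"] by simp
  then show "S +>\<^bsub>M\<^esub> q u = \<zero>\<^bsub>quot_module M S\<^esub> \<longleftrightarrow> q u \<in> S"
    using M.a_coset_join2[of "q u" S] S.a_subgroup by (auto simp: quot_module_def)
qed

lemma presentation_small:
  fixes sc :: "'k::field \<Rightarrow> 'e::ab_group_add \<Rightarrow> 'e" and e0 :: "'m \<Rightarrow> 'u"
  assumes "presentation sc H \<rho> q M" and e0: "inj_on e0 (carrier M)"
  shows "presentation sc H \<rho> (\<lambda>u. small_enc M (q u)) (small_copy M :: (_, 'u) module)"
    and "(small_enc M (q u) :: 'u) = \<zero>\<^bsub>small_copy M\<^esub> \<longleftrightarrow> q u = \<zero>\<^bsub>M\<^esub>"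
    and "small_dec M (small_enc M (q u) :: 'u) = q u"
proof -
  interpret presentation sc H \<rho> q M by fact
  have inj: "inj_on (small_enc M :: 'm \<Rightarrow> 'u) (carrier M)"
    unfolding small_enc_def by (rule someI[of _ e0]) fact
  have dec: "small_dec M (small_enc M (q u) :: 'u) = q u" for u
    using inj by (simp add: small_dec_def)
  then show "small_dec M (small_enc M (q u) :: 'u) = q u" .
  show "presentation sc H \<rho> (\<lambda>u. small_enc M (q u)) (small_copy M :: (_, 'u) module)"
  proof unfold_locales
    show "range (\<lambda>u. small_enc M (q u) :: 'u) = carrier (small_copy M)"
      by (simp add: small_copy_def q_range[symmetric] image_image)
  qed (simp_all add: small_copy_def dec q_add q_zero q_act)
  show "(small_enc M (q u) :: 'u) = \<zero>\<^bsub>small_copy M\<^esub> \<longleftrightarrow> q u = \<zero>\<^bsub>M\<^esub>"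
    using inj_on_eq_iff[OF inj, of "q u" "\<zero>\<^bsub>M\<^esub>"] by (simp add: small_copy_def)
qed

lemma galg_map_single: "galg_map f (gsingle c x) = gsingle c (f x)"
proof
  fix y
  have "{x'. gsingle c x x' \<noteq> 0 \<and> f x' = y} = (if c \<noteq> 0 \<and> f x = y then {x} else {})"
    by (auto simp: gsingle_def)
  then show "galg_map f (gsingle c x) y = gsingle c (f x) y"
    by (auto simp: galg_map_def gsingle_def)
qed

lemma galg_map_superset:
  assumes "finite A" "{x. a x \<noteq> 0} \<subseteq> A"
  shows "galg_map f a y = (\<Sum>x\<in>A. if f x = y then a x else 0)"
proof -
  have "galg_map f a y = (\<Sum>x\<in>{x\<in>A. f x = y}. a x)"
    unfolding galg_map_def using assms by (intro sum.mono_neutral_left) auto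
  also have "\<dots> = (\<Sum>x\<in>A. if f x = y then a x else 0)"
    using assms(1) by (intro sum.mono_neutral_cong_left) auto
  finally show ?thesis .
qed

lemma galg_map_add:
  assumes "a \<in> carrier (group_algebra H)" "b \<in> carrier (group_algebra H)"
  shows "galg_map f (a + b) = galg_map f a + galg_map f b"
proof
  fix y
  have fin: "finite ({h. a h \<noteq> 0} \<union> {h. b h \<noteq> 0})" (is "finite ?A") using assms by (auto simp: galg_carrier)
  have "galg_map f (a + b) y = (\<Sum>x\<in>?A. if f x = y then (a + b) x else 0)"
    using fin by (intro galg_map_superset) (auto simp: fun_simps)
  also have "\<dots> = (\<Sum>x\<in>?A. (if f x = y then a x else 0) + (if f x = y then b x else 0))"
    by (intro sum.cong) (auto simp: fun_simps)
  also have "\<dots> = galg_map f a y + galg_map f b y"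
    using fin by (subst (1 2) galg_map_superset[of ?A]) (auto simp: sum.distrib)
  finally show "galg_map f (a + b) y = (galg_map f a + galg_map f b) y" by (simp add: fun_simps)
qed

lemma galg_map_zero: "galg_map f 0 = 0"
  by (auto simp: galg_map_def fun_simps)

lemma galg_map_closed:
  assumes "a \<in> carrier (group_algebra H)" "\<And>h. h \<in> carrier H \<Longrightarrow> f h \<in> carrier K"
  shows "galg_map f a \<in> carrier (group_algebra K)"
  using assms(1)
proof (induction a rule: galg_induct)
  case zero
  have "galg_map f 0 \<in> carrier (group_algebra K)" by (simp only: galg_map_zero galg_zero_closed)
  then show ?case .
next
  case (add a b)
  have "galg_map f (a + b) \<in> carrier (group_algebra K)" using add by (simp add: galg_map_add[where H = H])
  then show ?case .
qed (simp add: galg_map_single assms(2))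

text \<open>Restriction of scalars along the map of group algebras that a homomorphism of groups induces.\<close>

lemma presentation_restrict:
  fixes sc :: "'k::field \<Rightarrow> 'e::ab_group_add \<Rightarrow> 'e" and K :: "('l, 'y) monoid_scheme"
  assumes "presentation sc H \<rho> q M" and K: "group K" and f: "f \<in> hom K H"
  shows "presentation sc K (\<lambda>x. \<rho> (f x)) q (restrict_scalars (galg_map f) M)"
proof -
  interpret presentation sc H \<rho> q M by fact
  have fc: "x \<in> carrier K \<Longrightarrow> f x \<in> carrier H" for x by (rule hom_in_carrier[OF f])
  interpret K: group_rep sc K "\<lambda>x. \<rho> (f x)"
    by (intro group_rep.intro vector_space_axioms group_rep_axioms.intro K)
      (use fc in \<open>simp_all add: rep_add rep_scale hom_mult[OF f] rep_mult rep_one hom_one[OF f K rep_group]\<close>)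
  show ?thesis
  proof unfold_locales
    fix a :: "'l \<Rightarrow> 'k" and u assume "a \<in> carrier (group_algebra K)"
    then have "galg_act sc \<rho> (galg_map f a) u = galg_act sc (\<lambda>x. \<rho> (f x)) a u"
    proof (induction a rule: galg_induct)
      case zero
      show ?case by (simp only: galg_map_zero galg_act_zero K.galg_act_zero)
    next
      case (single c h)
      show ?case by (simp add: galg_map_single)
    next
      case (add a b)
      have "galg_act sc \<rho> (galg_map f (a + b)) u = galg_act sc (\<lambda>x. \<rho> (f x)) (a + b) u"
        using add galg_map_closed[OF add(1), of f H] galg_map_closed[OF add(2), of f H] fc
        by (simp add: galg_map_add[where H = K] galg_act_add K.galg_act_add)
      then show ?case .
    qed
    then show "a \<odot>\<^bsub>restrict_scalars (galg_map f) M\<^esub> q u = q (galg_act sc (\<lambda>x. \<rho> (f x)) a u)"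
      using galg_map_closed[OF \<open>a \<in> _\<close>, of f H] fc by (simp add: restrict_scalars_def q_act)
  qed (simp_all add: restrict_scalars_def q_range q_add q_zero)
qed

lemma restrict_scalars_sel [simp]:
  "carrier (restrict_scalars p M) = carrier M" "\<zero>\<^bsub>restrict_scalars p M\<^esub> = \<zero>\<^bsub>M\<^esub>"
  "x \<oplus>\<^bsub>restrict_scalars p M\<^esub> y = x \<oplus>\<^bsub>M\<^esub> y" "a \<odot>\<^bsub>restrict_scalars p M\<^esub> x = p a \<odot>\<^bsub>M\<^esub> x"
  by (simp_all add: restrict_scalars_def)

section \<open>Maps out of a presented module\<close>

text \<open>The map that \<open>q'\<close> induces on the quotient presented by \<open>q\<close>; choice of representatives is harmless when \<open>q'\<close>
  is constant on the fibres of \<open>q\<close>.\<close>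

definition induced_map :: "('e \<Rightarrow> 'm) \<Rightarrow> ('e \<Rightarrow> 'p) \<Rightarrow> 'm set \<Rightarrow> 'm \<Rightarrow> 'p" where
  "induced_map q q' X = (\<lambda>x\<in>X. q' (SOME u. q u = x))"

lemma induced_map_apply:
  assumes "\<And>u v. q u = q v \<Longrightarrow> q' u = q' v" "q u \<in> X"
  shows "induced_map q q' X (q u) = q' u"
  using assms(1)[of "SOME v. q v = q u" u] someI[of "\<lambda>v. q v = q u" u] assms(2)
  by (simp add: induced_map_def)

lemma induced_map_iso:
  assumes "presentation sc H \<rho> q M" "presentation sc H \<rho> q' N"
    and ker: "\<And>u. q u = \<zero>\<^bsub>M\<^esub> \<longleftrightarrow> q' u = \<zero>\<^bsub>N\<^esub>"
  shows "induced_map q q' (carrier M) \<in> isos (left_mod_cat (group_algebra H)) M N"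
    and "induced_map q q' (carrier M) (q u) = q' u"
proof -
  interpret q: presentation sc H \<rho> q M by fact
  interpret q': presentation sc H \<rho> q' N by fact
  have eq: "q u = q v \<longleftrightarrow> q' u = q' v" for u v
    using ker by (simp add: q.q_eq_iff q'.q_eq_iff)
  let ?f = "induced_map q q' (carrier M)" and ?g = "induced_map q' q (carrier N)"
  have f: "?f (q u) = q' u" for u using eq by (intro induced_map_apply) auto
  have g: "?g (q' u) = q u" for u using eq by (intro induced_map_apply) auto
  show "?f (q u) = q' u" by (rule f)
  have fh: "?f \<in> lmod_hom (group_algebra H) M N"
  proof -
    have "?f x \<in> carrier N" if "x \<in> carrier M" for x using q.q_surj[OF that] f by auto
    moreover have "?f (x \<oplus>\<^bsub>M\<^esub> y) = ?f x \<oplus>\<^bsub>N\<^esub> ?f y" if "x \<in> carrier M" "y \<in> carrier M" for x y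
      using q.q_surj[OF that(1)] q.q_surj[OF that(2)] f
      by (auto simp: q.q_add[symmetric] q'.q_add[symmetric])
    moreover have "?f (a \<odot>\<^bsub>M\<^esub> x) = a \<odot>\<^bsub>N\<^esub> ?f x" if "a \<in> carrier (group_algebra H)" "x \<in> carrier M" for a x
      using q.q_surj[OF that(2)] that(1) f by (auto simp: q.q_act q'.q_act)
    ultimately show ?thesis unfolding lmod_hom_def by (auto simp: induced_map_def)
  qed
  have gh: "?g \<in> lmod_hom (group_algebra H) N M"
  proof -
    have "?g x \<in> carrier M" if "x \<in> carrier N" for x using q'.q_surj[OF that] g by auto
    moreover have "?g (x \<oplus>\<^bsub>N\<^esub> y) = ?g x \<oplus>\<^bsub>M\<^esub> ?g y" if "x \<in> carrier N" "y \<in> carrier N" for x y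
      using q'.q_surj[OF that(1)] q'.q_surj[OF that(2)] g
      by (auto simp: q.q_add[symmetric] q'.q_add[symmetric])
    moreover have "?g (a \<odot>\<^bsub>N\<^esub> x) = a \<odot>\<^bsub>M\<^esub> ?g x" if "a \<in> carrier (group_algebra H)" "x \<in> carrier N" for a x
      using q'.q_surj[OF that(2)] that(1) g by (auto simp: q.q_act q'.q_act)
    ultimately show ?thesis unfolding lmod_hom_def by (auto simp: induced_map_def)
  qed
  have gf: "compose (carrier M) ?g ?f = (\<lambda>x\<in>carrier M. x)"
    using q.q_surj f g by (fastforce simp: compose_def fun_eq_iff restrict_def)
  have fg: "compose (carrier N) ?f ?g = (\<lambda>x\<in>carrier N. x)"
    using q'.q_surj f g by (fastforce simp: compose_def fun_eq_iff restrict_def)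
  show "?f \<in> isos (left_mod_cat (group_algebra H)) M N"
    using fh gh fg gf by (auto simp: isos_def left_mod_cat_def)
qed

lemma full_subcat_sel [simp]:
  "Obj (full_subcat C P) = {A \<in> Obj C. P A}" "Hom (full_subcat C P) = Hom C"
  "Ident (full_subcat C P) = Ident C" "Comp (full_subcat C P) = Comp C"
  by (simp_all add: full_subcat_def)

lemma left_mod_cat_sel [simp]:
  "Obj (left_mod_cat R) = {M. left_module R M}" "Hom (left_mod_cat R) = lmod_hom R"
  "Ident (left_mod_cat R) M = (\<lambda>x\<in>carrier M. x)"
  "Comp (left_mod_cat R) L M N \<psi> \<phi> = compose (carrier L) \<psi> \<phi>"
  by (simp_all add: left_mod_cat_def)

text \<open>Both values are quotients of the same representation by the same kernel, so the identity of that
  representation induces an isomorphism.  It is natural as soon as both functors send a map to maps that have a common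
  lift to the representations, and this needs to be known only elementwise.\<close>

lemma naturally_isomorphic_if_same_presentation:
  fixes sc :: "'k::field \<Rightarrow> 'e::ab_group_add \<Rightarrow> 'e"
  assumes D: "D = full_subcat (left_mod_cat (group_algebra H)) P"
    and F: "is_functor C D F" "is_functor C D F'"
    and p: "\<And>V. V \<in> Obj C \<Longrightarrow> presentation sc H (\<rho> V) (q V) (fobj F V)"
    and p': "\<And>V. V \<in> Obj C \<Longrightarrow> presentation sc H (\<rho> V) (q' V) (fobj F' V)"
    and ker: "\<And>V u. V \<in> Obj C \<Longrightarrow> q V u = \<zero>\<^bsub>fobj F V\<^esub> \<longleftrightarrow> q' V u = \<zero>\<^bsub>fobj F' V\<^esub>"
    and nat: "\<And>V W f u. V \<in> Obj C \<Longrightarrow> W \<in> Obj C \<Longrightarrow> f \<in> Hom C V W \<Longrightarrow>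
      \<exists>u'. fmap F V W f (q V u) = q W u' \<and> fmap F' V W f (q' V u) = q' W u'"
  shows "naturally_isomorphic C D F F'"
proof -
  define \<eta> where "\<eta> V = induced_map (q V) (q' V) (carrier (fobj F V))" for V
  have iso: "\<eta> V \<in> isos D (fobj F V) (fobj F' V)" and \<eta>: "\<eta> V (q V u) = q' V u" if "V \<in> Obj C" for V u
    using induced_map_iso[OF p[OF that] p'[OF that] ker[OF that]] by (auto simp: \<eta>_def D isos_def)
  have "Comp D (fobj F V) (fobj F W) (fobj F' W) (\<eta> W) (fmap F V W f) =
      Comp D (fobj F V) (fobj F' V) (fobj F' W) (fmap F' V W f) (\<eta> V)"
    if VW: "V \<in> Obj C" "W \<in> Obj C" "f \<in> Hom C V W" for V W f
  proof -
    interpret V: presentation sc H "\<rho> V" "q V" "fobj F V" by (rule p) fact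
    have "\<eta> W (fmap F V W f x) = fmap F' V W f (\<eta> V x)" if x: "x \<in> carrier (fobj F V)" for x
    proof -
      obtain u where u: "x = q V u" using V.q_surj[OF x] by auto
      show ?thesis using nat[OF VW, of u] \<eta> VW u by auto
    qed
    then show ?thesis by (auto simp: D compose_def)
  qed
  then show ?thesis
    using F iso unfolding naturally_isomorphic_def by blast
qed

section \<open>Fox derivatives and the convolution action\<close>

definition gdiff :: "nat \<Rightarrow> (fgrp \<Rightarrow> 'e \<Rightarrow> 'e) \<Rightarrow> nat \<Rightarrow> 'e \<Rightarrow> 'e::ab_group_add" where
  "gdiff n \<rho> j e = \<rho> (fgen n j) e - e"

definition delta :: "nat \<Rightarrow> 'e \<Rightarrow> nat \<Rightarrow> 'e::zero" where
  "delta j e = (\<lambda>i. if i = j then e else 0)"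

text \<open>The multiplication map from \<open>I \<otimes> V\<close> to \<open>V\<close> in the basis \<open>x\<^sub>j - 1\<close> of \<open>I\<close>.\<close>

definition aug_sum :: "nat \<Rightarrow> (fgrp \<Rightarrow> 'e \<Rightarrow> 'e) \<Rightarrow> (nat \<Rightarrow> 'e) \<Rightarrow> 'e::ab_group_add" where
  "aug_sum n \<rho> v = (\<Sum>j\<in>{1..n}. gdiff n \<rho> j (v j))"

text \<open>The twisted action of \<open>x\<^sub>i\<close> on \<open>I \<otimes> V\<close>, in coordinates, is the identity plus this operator in the \<open>i\<close>-th
  component: the coordinate form of the formula that defines \<open>\<circ>\<^sub>\<lambda>\<close>.\<close>

definition row ::
  "('k::field \<Rightarrow> 'e \<Rightarrow> 'e) \<Rightarrow> nat \<Rightarrow> (fgrp \<Rightarrow> 'e \<Rightarrow> 'e) \<Rightarrow> 'k \<Rightarrow> nat \<Rightarrow> (nat \<Rightarrow> 'e) \<Rightarrow> 'e::ab_group_add" where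
  "row sc n \<rho> lam i v = sc (lam - 1) (v i) + (\<Sum>j\<in>{1..n}. sc (lam_ge lam i j) (gdiff n \<rho> j (v j)))"

definition conv_gen ::
  "('k::field \<Rightarrow> 'e \<Rightarrow> 'e) \<Rightarrow> nat \<Rightarrow> (fgrp \<Rightarrow> 'e \<Rightarrow> 'e) \<Rightarrow> 'k \<Rightarrow> nat \<Rightarrow> (nat \<Rightarrow> 'e) \<Rightarrow> (nat \<Rightarrow> 'e::ab_group_add)" where
  "conv_gen sc n \<rho> lam i v = v(i := v i + row sc n \<rho> lam i v)"

definition conv_act ::
  "('k::field \<Rightarrow> 'e \<Rightarrow> 'e) \<Rightarrow> nat \<Rightarrow> (fgrp \<Rightarrow> 'e \<Rightarrow> 'e) \<Rightarrow> 'k \<Rightarrow> fgrp \<Rightarrow> (nat \<Rightarrow> 'e) \<Rightarrow> (nat \<Rightarrow> 'e::ab_group_add)" where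
  "conv_act sc n \<rho> lam = free_action n (conv_gen sc n \<rho> lam)"

text \<open>The action of \<open>x\<^sub>i\<close> on pairs \<open>(e, v)\<close> that encodes the product rule: letting a word act on \<open>(e, 0)\<close> accumulates
  its Fox derivatives, applied to \<open>e\<close>, in the second component.\<close>

definition fox_gen :: "nat \<Rightarrow> (fgrp \<Rightarrow> 'e \<Rightarrow> 'e) \<Rightarrow> nat \<Rightarrow> 'e \<times> (nat \<Rightarrow> 'e) \<Rightarrow> 'e \<times> (nat \<Rightarrow> 'e::ab_group_add)" where
  "fox_gen n \<rho> i = (\<lambda>(e, v). (\<rho> (fgen n i) e, v + delta i e))"

text \<open>The \<open>j\<close>-th component is the Fox derivative of \<open>x\<close> by \<open>x\<^sub>j\<close>, applied to \<open>e\<close>.\<close>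

definition fox :: "nat \<Rightarrow> (fgrp \<Rightarrow> 'e \<Rightarrow> 'e) \<Rightarrow> fgrp \<Rightarrow> 'e \<Rightarrow> nat \<Rightarrow> 'e::ab_group_add" where
  "fox n \<rho> x e = snd (free_action n (fox_gen n \<rho>) x (e, 0))"

text \<open>The Jacobian matrix of an endomorphism \<open>a\<close> of the free group, applied to \<open>v\<close>.  It is the coordinate form of
  \<open>f \<otimes> v \<mapsto> a(f) \<otimes> v\<close>.\<close>

definition fox_change ::
  "nat \<Rightarrow> (fgrp \<Rightarrow> 'e \<Rightarrow> 'e) \<Rightarrow> (fgrp \<Rightarrow> fgrp) \<Rightarrow> (nat \<Rightarrow> 'e) \<Rightarrow> nat \<Rightarrow> 'e::ab_group_add" where
  "fox_change n \<rho> a v =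
    (\<lambda>l. if l \<in> {1..n} then (\<Sum>j\<in>{1..n}. fox n \<rho> (a (fgen n j)) (v j) l) else v l)"

lemma delta_apply: "delta j e i = (if i = j then e else 0)"
  by (simp add: delta_def)

lemma delta_same [simp]: "delta j e j = e"
  by (simp add: delta_def)

lemma delta_add: "delta j (e + e' :: 'e::monoid_add) = delta j e + delta j e'"
  by (auto simp: delta_def fun_simps)

lemma free_action_inv:
  assumes "\<forall>i\<in>{1..n}. bij (T i)" "x \<in> carrier (free_grp n)"
  shows "free_action n T x (free_action n T (inv\<^bsub>free_grp n\<^esub> x) u) = u"
    and "free_action n T (inv\<^bsub>free_grp n\<^esub> x) (free_action n T x u) = u"
proof -
  interpret F: group "free_grp n" by (rule group_free_grp)
  show "free_action n T x (free_action n T (inv\<^bsub>free_grp n\<^esub> x) u) = u"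
    "free_action n T (inv\<^bsub>free_grp n\<^esub> x) (free_action n T x u) = u"
    using assms(2) free_action_mult[of n T x "inv\<^bsub>free_grp n\<^esub> x" u, OF assms(1)]
      free_action_mult[of n T "inv\<^bsub>free_grp n\<^esub> x" x u, OF assms(1)] free_action_one[of n T u, OF assms(1)]
    by simp_all
qed

lemma free_action_linear:
  fixes sc :: "'k::field \<Rightarrow> 'e::ab_group_add \<Rightarrow> 'e"
  assumes "vector_space sc" and bij: "\<forall>i\<in>{1..n}. bij (T i)"
    and add: "\<And>i u v. i \<in> {1..n} \<Longrightarrow> T i (u + v) = T i u + T i v"
    and scale: "\<And>i c u. i \<in> {1..n} \<Longrightarrow> T i (sc c u) = sc c (T i u)"
  shows "group_rep sc (free_grp n) (free_action n T)"
proof (intro group_rep.intro assms(1) group_rep_axioms.intro group_free_grp)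
  fix x assume "x \<in> carrier (free_grp n)"
  then have "(\<forall>u v. free_action n T x (u + v) = free_action n T x u + free_action n T x v) \<and>
      (\<forall>c u. free_action n T x (sc c u) = sc c (free_action n T x u))"
  proof (induction rule: free_grp_induct)
    case (gen i)
    then show ?case by (simp add: free_action_gen[OF bij] add scale)
  next
    case (inv x)
    then have f: "free_action n T x (u + v) = free_action n T x u + free_action n T x v"
      "free_action n T x (sc c u) = sc c (free_action n T x u)" for u v c by auto
    note fg = free_action_inv[OF bij inv(1)]
    have "free_action n T (inv\<^bsub>free_grp n\<^esub> x) (u + v) =
        free_action n T (inv\<^bsub>free_grp n\<^esub> x) u + free_action n T (inv\<^bsub>free_grp n\<^esub> x) v" for u v
      using fg(2)[of "free_action n T (inv\<^bsub>free_grp n\<^esub> x) u + free_action n T (inv\<^bsub>free_grp n\<^esub> x) v"]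
      by (simp add: f fg(1))
    moreover have "free_action n T (inv\<^bsub>free_grp n\<^esub> x) (sc c u) = sc c (free_action n T (inv\<^bsub>free_grp n\<^esub> x) u)" for c u
      using fg(2)[of "sc c (free_action n T (inv\<^bsub>free_grp n\<^esub> x) u)"] by (simp add: f fg(1))
    ultimately show ?case by blast
  qed (simp_all add: free_action_one[OF bij] free_action_mult[OF bij])
  then show "free_action n T x (u + v) = free_action n T x u + free_action n T x v"
    "free_action n T x (sc c u) = sc c (free_action n T x u)" for u v c
    by auto
qed (use free_action_one[OF bij] free_action_mult[OF bij] in auto)

text \<open>By uniqueness: it suffices to compare generators.\<close>

lemma free_action_intertwine:
  assumes T: "\<forall>i\<in>{1..n}. bij (T i)" and T': "\<forall>i\<in>{1..n}. bij (T' i)"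
    and L: "\<And>i u. i \<in> {1..n} \<Longrightarrow> L (T i u) = T' i (L u)"
    and x: "x \<in> carrier (free_grp n)"
  shows "L (free_action n T x u) = free_action n T' x (L u)"
proof -
  have "\<forall>u. L (free_action n T x u) = free_action n T' x (L u)" using x
  proof (induction rule: free_grp_induct)
    case (inv x)
    then have f: "L (free_action n T x u) = free_action n T' x (L u)" for u by auto
    have "L (free_action n T (inv\<^bsub>free_grp n\<^esub> x) u) = free_action n T' (inv\<^bsub>free_grp n\<^esub> x) (L u)" for u
      using free_action_inv(2)[OF T' inv(1), of "L (free_action n T (inv\<^bsub>free_grp n\<^esub> x) u)"]
      by (simp add: f[symmetric] free_action_inv(1)[OF T inv(1)])
    then show ?case by blast
  qed (simp_all add: T T' L free_action_one free_action_gen free_action_mult)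
  then show ?thesis by simp
qed

lemma free_action_stable:
  assumes T: "\<forall>i\<in>{1..n}. bij (T i)"
    and L: "\<And>i u. i \<in> {1..n} \<Longrightarrow> T i u \<in> Z \<longleftrightarrow> u \<in> Z"
    and x: "x \<in> carrier (free_grp n)"
  shows "free_action n T x u \<in> Z \<longleftrightarrow> u \<in> Z"
proof -
  have "\<forall>u. free_action n T x u \<in> Z \<longleftrightarrow> u \<in> Z" using x
  proof (induction rule: free_grp_induct)
    case (inv x)
    then show ?case using free_action_inv(1)[OF T inv(1)] by (metis (no_types))
  qed (simp_all add: T L free_action_one free_action_gen free_action_mult)
  then show ?thesis by simp
qed

locale free_rep = group_rep sc "free_grp n" \<rho>
  for sc :: "'k::field \<Rightarrow> 'e::ab_group_add \<Rightarrow> 'e" and n and \<rho>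
begin

abbreviation "F \<equiv> free_grp n"
abbreviation "D \<equiv> gdiff n \<rho>"

sublocale F: group F by (rule group_free_grp)

lemma gdiff_add: "j \<in> {1..n} \<Longrightarrow> D j (u + v) = D j u + D j v"
  by (simp add: gdiff_def rep_add)

lemma gdiff_zero [simp]: "j \<in> {1..n} \<Longrightarrow> D j 0 = 0"
  by (simp add: gdiff_def rep_zero)

lemma gdiff_scale: "j \<in> {1..n} \<Longrightarrow> D j (sc c u) = sc c (D j u)"
  by (simp add: gdiff_def rep_scale scale_right_diff_distrib)

lemma row_add: "i \<in> {1..n} \<Longrightarrow> row sc n \<rho> lam i (u + v) = row sc n \<rho> lam i u + row sc n \<rho> lam i v"
  by (simp add: row_def fun_simps gdiff_add scale_right_distrib sum.distrib)

lemma row_scale: "i \<in> {1..n} \<Longrightarrow> row sc n \<rho> lam i (fscale sc c u) = sc c (row sc n \<rho> lam i u)"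
  by (simp add: row_def fun_simps gdiff_scale scale_right_distrib scale_sum_right mult.commute)

lemma row_delta: "j \<in> {1..n} \<Longrightarrow> row sc n \<rho> lam i (delta j e) =
    (if i = j then sc (lam - 1) e else 0) + sc (lam_ge lam i j) (D j e)"
proof -
  assume j: "j \<in> {1..n}"
  have "(\<Sum>l\<in>{1..n}. sc (lam_ge lam i l) (D l (delta j e l))) =
      (\<Sum>l\<in>{1..n}. if l = j then sc (lam_ge lam i j) (D j e) else 0)"
    by (intro sum.cong) (auto simp: delta_def)
  then show ?thesis using j by (simp add: row_def delta_apply)
qed

text \<open>Only the diagonal entry of the \<open>i\<close>-th row involves the \<open>i\<close>-th component with an invertible
  coefficient; this is what makes the generators act bijectively.\<close>

definition row_rest :: "'k \<Rightarrow> nat \<Rightarrow> (nat \<Rightarrow> 'e) \<Rightarrow> 'e" where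
  "row_rest lam i v = (\<Sum>j\<in>{1..n} - {i}. sc (lam_ge lam i j) (D j (v j)))"

lemma row_split:
  assumes "i \<in> {1..n}"
  shows "v i + row sc n \<rho> lam i v = sc lam (\<rho> (fgen n i) (v i)) + row_rest lam i v"
proof -
  have "(\<Sum>j\<in>{1..n}. sc (lam_ge lam i j) (D j (v j))) = sc lam (D i (v i)) + row_rest lam i v"
    using assms by (subst sum.remove[of _ i]) (auto simp: row_rest_def lam_ge_def)
  then show ?thesis
    by (simp add: row_def gdiff_def scale_right_diff_distrib scale_left_diff_distrib algebra_simps)
qed

lemma row_rest_upd [simp]: "row_rest lam i (v(i := e)) = row_rest lam i v"
  unfolding row_rest_def by (intro sum.cong) auto

lemma conv_gen_eq:
  "i \<in> {1..n} \<Longrightarrow> conv_gen sc n \<rho> lam i v = v(i := sc lam (\<rho> (fgen n i) (v i)) + row_rest lam i v)"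
  by (simp only: conv_gen_def row_split)

lemma conv_gen_bij:
  assumes "lam \<noteq> 0"
  shows "\<forall>i\<in>{1..n}. bij (conv_gen sc n \<rho> lam i)"
proof (intro ballI o_bij)
  fix i assume i: "i \<in> {1..n}"
  define g where "g v = v(i := \<rho> (inv\<^bsub>F\<^esub> (fgen n i)) (sc (inverse lam) (v i - row_rest lam i v)))" for v
  show "g \<circ> conv_gen sc n \<rho> lam i = id" "conv_gen sc n \<rho> lam i \<circ> g = id"
    using assms i by (auto simp: fun_eq_iff conv_gen_eq g_def rep_inv)
qed

lemma conv_gen_add:
  "i \<in> {1..n} \<Longrightarrow> conv_gen sc n \<rho> lam i (u + v) = conv_gen sc n \<rho> lam i u + conv_gen sc n \<rho> lam i v"
  by (auto simp: conv_gen_def row_add fun_eq_iff fun_simps algebra_simps)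

lemma conv_gen_scale:
  "i \<in> {1..n} \<Longrightarrow> conv_gen sc n \<rho> lam i (fscale sc c u) = fscale sc c (conv_gen sc n \<rho> lam i u)"
  by (auto simp: conv_gen_def row_scale fun_eq_iff fscale_apply scale_right_distrib)

lemma conv_rep: "lam \<noteq> 0 \<Longrightarrow> free_rep (fscale sc) n (conv_act sc n \<rho> lam)"
  unfolding conv_act_def free_rep_def
  by (intro free_action_linear vector_space_fscale vector_space_axioms conv_gen_bij conv_gen_add conv_gen_scale)

lemma conv_act_gen:
  "lam \<noteq> 0 \<Longrightarrow> i \<in> {1..n} \<Longrightarrow> conv_act sc n \<rho> lam (fgen n i) v = v(i := v i + row sc n \<rho> lam i v)"
  by (simp add: conv_act_def free_action_gen conv_gen_bij) (simp add: conv_gen_def)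

lemma conv_gdiff:
  "lam \<noteq> 0 \<Longrightarrow> i \<in> {1..n} \<Longrightarrow> gdiff n (conv_act sc n \<rho> lam) i v = delta i (row sc n \<rho> lam i v)"
  by (auto simp: gdiff_def conv_act_gen delta_def fun_eq_iff fun_simps)

text \<open>Families are indexed by all of \<open>nat\<close>; entries outside \<open>{1..n}\<close> carry no information and are left alone.\<close>

lemma conv_act_outside:
  assumes "lam \<noteq> 0" "x \<in> carrier F" "j \<notin> {1..n}"
  shows "conv_act sc n \<rho> lam x v j = v j"
proof -
  have "conv_act sc n \<rho> lam x v j = free_action n (\<lambda>_ e. e) x (v j)"
    unfolding conv_act_def using assms
    by (intro free_action_intertwine[where L = "\<lambda>v. v j"] conv_gen_bij)
      (auto simp: conv_gen_def bij_def inj_def surj_def)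
  also have "free_action n (\<lambda>_ e. e) x (v j) = v j"
  proof -
    have "free_action n (\<lambda>_ e. e) x (v j) \<in> {v j} \<longleftrightarrow> v j \<in> {v j}"
      using assms(2) by (intro free_action_stable) (auto simp: bij_def inj_def surj_def)
    then show ?thesis by simp
  qed
  finally show ?thesis .
qed

lemma fox_gen_bij: "\<forall>i\<in>{1..n}. bij (fox_gen n \<rho> i)"
proof (intro ballI o_bij)
  fix i assume i: "i \<in> {1..n}"
  define g where "g = (\<lambda>(e, v). (\<rho> (inv\<^bsub>F\<^esub> (fgen n i)) e, v - delta i (\<rho> (inv\<^bsub>F\<^esub> (fgen n i)) e)))"
  show "g \<circ> fox_gen n \<rho> i = id" "fox_gen n \<rho> i \<circ> g = id"
    using i by (auto simp: fun_eq_iff fox_gen_def g_def rep_inv)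
qed

text \<open>The pair action is a crossed homomorphism in disguise: its second component defines a cocycle, the Fox
  derivative, whose product rule is the composition of two such affine maps.\<close>

lemma fox_action:
  assumes "x \<in> carrier F"
  shows "free_action n (fox_gen n \<rho>) x (e, v) = (\<rho> x e, v + fox n \<rho> x e)"
proof -
  have "\<exists>f. \<forall>e v. free_action n (fox_gen n \<rho>) x (e, v) = (\<rho> x e, v + f e)" using assms
  proof (induction rule: free_grp_induct)
    case one
    show ?case by (rule exI[of _ 0]) (simp add: free_action_one fox_gen_bij rep_one fun_simps)
  next
    case (gen i)
    show ?case by (rule exI[of _ "delta i"]) (use gen in \<open>simp add: free_action_gen fox_gen_bij\<close>, simp add: fox_gen_def)
  next
    case (inv x)
    then obtain f where f: "\<And>e v. free_action n (fox_gen n \<rho>) x (e, v) = (\<rho> x e, v + f e)" by auto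
    have "free_action n (fox_gen n \<rho>) (inv\<^bsub>F\<^esub> x) (e, v) =
        (\<rho> (inv\<^bsub>F\<^esub> x) e, v + - f (\<rho> (inv\<^bsub>F\<^esub> x) e))" for e v
      using free_action_inv(2)[OF fox_gen_bij inv(1), where u = "(\<rho> (inv\<^bsub>F\<^esub> x) e, v + - f (\<rho> (inv\<^bsub>F\<^esub> x) e))"]
        inv(1) by (simp add: f rep_inv)
    then show ?case by (intro exI[of _ "\<lambda>e. - f (\<rho> (inv\<^bsub>F\<^esub> x) e)"]) blast
  next
    case (mult x y)
    then obtain f g where "\<And>e v. free_action n (fox_gen n \<rho>) x (e, v) = (\<rho> x e, v + f e)"
      "\<And>e v. free_action n (fox_gen n \<rho>) y (e, v) = (\<rho> y e, v + g e)" by auto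
    then have "\<forall>e v. free_action n (fox_gen n \<rho>) (x \<otimes>\<^bsub>F\<^esub> y) (e, v) =
        (\<rho> (x \<otimes>\<^bsub>F\<^esub> y) e, v + (g e + f (\<rho> y e)))"
      using mult by (simp add: free_action_mult fox_gen_bij rep_mult add.assoc)
    then show ?case by (intro exI[of _ "\<lambda>e. g e + f (\<rho> y e)"]) simp
  qed
  then obtain f where f: "\<And>e v. free_action n (fox_gen n \<rho>) x (e, v) = (\<rho> x e, v + f e)" by auto
  moreover have "fox n \<rho> x e = f e" by (simp add: fox_def f)
  ultimately show ?thesis by simp
qed

lemma fox_one: "fox n \<rho> \<one>\<^bsub>F\<^esub> e = 0"
  by (simp add: fox_def free_action_one fox_gen_bij)

lemma fox_gen: "i \<in> {1..n} \<Longrightarrow> fox n \<rho> (fgen n i) e = delta i e"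
  by (simp add: fox_def free_action_gen fox_gen_bij) (simp add: fox_gen_def)

lemma fox_mult:
  "x \<in> carrier F \<Longrightarrow> y \<in> carrier F \<Longrightarrow> fox n \<rho> (x \<otimes>\<^bsub>F\<^esub> y) e = fox n \<rho> x (\<rho> y e) + fox n \<rho> y e"
  by (simp add: fox_def[of n \<rho> "x \<otimes>\<^bsub>F\<^esub> y"] free_action_mult fox_gen_bij fox_action)

lemma fox_inv:
  assumes "x \<in> carrier F"
  shows "fox n \<rho> (inv\<^bsub>F\<^esub> x) e = - fox n \<rho> x (\<rho> (inv\<^bsub>F\<^esub> x) e)"
  using fox_mult[of x "inv\<^bsub>F\<^esub> x" e] assms by (simp add: fox_one add_eq_0_iff)

lemma fox_linear:
  assumes "x \<in> carrier F"
  shows "fox n \<rho> x (u + v) = fox n \<rho> x u + fox n \<rho> x v"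
    and "fox n \<rho> x (sc c u) = fscale sc c (fox n \<rho> x u)"
proof -
  interpret n: vector_space "fscale sc :: _ \<Rightarrow> (nat \<Rightarrow> 'e) \<Rightarrow> _"
    by (intro vector_space_fscale vector_space_axioms)
  have "(\<forall>u v. fox n \<rho> x (u + v) = fox n \<rho> x u + fox n \<rho> x v) \<and>
      (\<forall>c u. fox n \<rho> x (sc c u) = fscale sc c (fox n \<rho> x u))"
    using assms
  proof (induction rule: free_grp_induct)
    case (gen i)
    have "delta i (sc c u) = fscale sc c (delta i u)" for c u
      by (auto simp: delta_def fscale_def)
    then show ?case using gen by (simp add: fox_gen delta_add)
  next
    case (mult x y)
    then show ?case
      by (simp add: fox_mult rep_add rep_scale n.scale_right_distrib algebra_simps)
  qed (simp_all add: fox_one fox_inv rep_add rep_scale n.scale_minus_right)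
  then show "fox n \<rho> x (u + v) = fox n \<rho> x u + fox n \<rho> x v"
    "fox n \<rho> x (sc c u) = fscale sc c (fox n \<rho> x u)" by auto
qed

lemma fox_zero: "x \<in> carrier F \<Longrightarrow> fox n \<rho> x 0 = 0"
  using fox_linear(1)[of x 0 0] by simp

lemma fox_sum: "x \<in> carrier F \<Longrightarrow> fox n \<rho> x (\<Sum>i\<in>I. f i) = (\<Sum>i\<in>I. fox n \<rho> x (f i))"
  by (induction I rule: infinite_finite_induct) (auto simp: fox_zero fox_linear)

lemma fox_outside: "x \<in> carrier F \<Longrightarrow> j \<notin> {1..n} \<Longrightarrow> fox n \<rho> x e j = 0"
proof -
  assume x: "x \<in> carrier F" and j: "j \<notin> {1..n}"
  have "\<forall>e. fox n \<rho> x e j = 0" using x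
    by (induction rule: free_grp_induct)
      (use j in \<open>auto simp: fox_one fox_gen fox_inv fox_mult delta_def fun_simps\<close>)
  then show ?thesis by simp
qed

lemma fox_stable:
  assumes Z: "0 \<in> Z" "\<And>u v. u \<in> Z \<Longrightarrow> v \<in> Z \<Longrightarrow> u + v \<in> Z" "\<And>u. u \<in> Z \<Longrightarrow> - u \<in> Z"
      "\<And>x u. x \<in> carrier F \<Longrightarrow> u \<in> Z \<Longrightarrow> \<rho> x u \<in> Z"
    and "x \<in> carrier F" "e \<in> Z"
  shows "fox n \<rho> x e j \<in> Z"
proof -
  have "\<forall>e\<in>Z. fox n \<rho> x e j \<in> Z" using assms(5)
    by (induction rule: free_grp_induct)
      (use Z in \<open>auto simp: fox_one fox_gen fox_inv fox_mult delta_def fun_simps\<close>)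
  with assms(6) show ?thesis by simp
qed

lemma aug_sum_add: "aug_sum n \<rho> (u + v) = aug_sum n \<rho> u + aug_sum n \<rho> v"
  by (simp add: aug_sum_def fun_simps gdiff_add sum.distrib)

lemma aug_sum_scale: "aug_sum n \<rho> (fscale sc c v) = sc c (aug_sum n \<rho> v)"
  by (simp add: aug_sum_def fun_simps gdiff_scale scale_sum_right)

lemma aug_sum_uminus: "aug_sum n \<rho> (- v) = - aug_sum n \<rho> v"
  using aug_sum_add[of "- v" v] aug_sum_add[of 0 0] by (simp add: eq_neg_iff_add_eq_0)

lemma aug_sum_delta: "j \<in> {1..n} \<Longrightarrow> aug_sum n \<rho> (delta j e) = D j e"
proof -
  assume j: "j \<in> {1..n}"
  have "aug_sum n \<rho> (delta j e) = (\<Sum>l\<in>{1..n}. if l = j then D j e else 0)"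
    unfolding aug_sum_def by (intro sum.cong) (auto simp: delta_def)
  then show ?thesis using j by simp
qed

text \<open>The fundamental formula of Fox calculus, \<open>x - 1 = \<Sum>\<^sub>j (x\<^sub>j - 1) \<partial>x/\<partial>x\<^sub>j\<close>.\<close>

lemma aug_sum_fox: "x \<in> carrier F \<Longrightarrow> aug_sum n \<rho> (fox n \<rho> x e) = \<rho> x e - e"
proof -
  assume x: "x \<in> carrier F"
  have z: "aug_sum n \<rho> 0 = 0" using aug_sum_add[of 0 0] by simp
  have "\<forall>e. aug_sum n \<rho> (fox n \<rho> x e) = \<rho> x e - e" using x
  proof (induction rule: free_grp_induct)
    case (gen i)
    then show ?case by (simp add: fox_gen aug_sum_delta gdiff_def)
  qed (simp_all add: z fox_one rep_one fox_inv aug_sum_uminus rep_inv fox_mult aug_sum_add rep_mult)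
  then show ?thesis by simp
qed

lemma fox_change_add:
  assumes "\<forall>j\<in>{1..n}. a (fgen n j) \<in> carrier F"
  shows "fox_change n \<rho> a (u + v) = fox_change n \<rho> a u + fox_change n \<rho> a v"
  using assms by (auto simp: fox_change_def fun_eq_iff fun_simps fox_linear sum.distrib)

lemma fox_change_scale:
  assumes "\<forall>j\<in>{1..n}. a (fgen n j) \<in> carrier F"
  shows "fox_change n \<rho> a (fscale sc c v) = fscale sc c (fox_change n \<rho> a v)"
  using assms by (auto simp: fox_change_def fun_eq_iff fun_simps fox_linear scale_sum_right)

lemma fox_change_zero:
  assumes "\<forall>j\<in>{1..n}. a (fgen n j) \<in> carrier F"
  shows "fox_change n \<rho> a 0 = 0"
  using fox_change_add[OF assms, of 0 0] by simp

lemma fox_change_uminus: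
  assumes "\<forall>j\<in>{1..n}. a (fgen n j) \<in> carrier F"
  shows "fox_change n \<rho> a (- u) = - fox_change n \<rho> a u"
  using fox_change_add[OF assms, of u "- u"] fox_change_zero[OF assms]
  by (simp add: add_eq_0_iff)

lemma fox_change_delta:
  assumes "\<forall>j\<in>{1..n}. a (fgen n j) \<in> carrier F" "i \<in> {1..n}"
  shows "fox_change n \<rho> a (delta i e) = fox n \<rho> (a (fgen n i)) e"
proof
  fix l
  have "(\<Sum>j\<in>{1..n}. fox n \<rho> (a (fgen n j)) (delta i e j) l) =
      (\<Sum>j\<in>{1..n}. if j = i then fox n \<rho> (a (fgen n i)) e l else 0)"
    using assms by (intro sum.cong) (auto simp: delta_def fox_zero fun_simps)
  then show "fox_change n \<rho> a (delta i e) l = fox n \<rho> (a (fgen n i)) e l"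
    using assms by (auto simp: fox_change_def fox_outside delta_def)
qed

lemma rep_comp: "a \<in> hom F F \<Longrightarrow> free_rep sc n (\<lambda>x. \<rho> (a x))"
  unfolding free_rep_def
  by (intro group_rep.intro vector_space_axioms group_rep_axioms.intro F.is_group)
    (auto simp: hom_in_carrier rep_add rep_scale hom_mult rep_mult hom_one[OF _ F.is_group F.is_group] rep_one)

text \<open>The chain rule.  Both sides are crossed homomorphisms in \<open>y\<close> that agree on generators.\<close>

lemma fox_chain:
  assumes a: "a \<in> hom F F" and y: "y \<in> carrier F"
  shows "fox n \<rho> (a y) u = fox_change n \<rho> a (fox n (\<lambda>x. \<rho> (a x)) y u)"
proof -
  interpret a: free_rep sc n "\<lambda>x. \<rho> (a x)" by (rule rep_comp[OF a])
  interpret ah: group_hom F F a using a by unfold_locales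
  have ag: "\<forall>j\<in>{1..n}. a (fgen n j) \<in> carrier F" using a by (simp add: hom_in_carrier)
  have "\<forall>u. fox n \<rho> (a y) u = fox_change n \<rho> a (fox n (\<lambda>x. \<rho> (a x)) y u)" using y
  proof (induction rule: free_grp_induct)
    case one
    show ?case using fox_change_zero[OF ag] by (simp add: a.fox_one fox_one)
  next
    case (gen i)
    then show ?case using fox_change_delta[OF ag] by (simp add: a.fox_gen)
  next
    case (inv x)
    then show ?case using fox_change_uminus[OF ag]
      by (simp add: fox_inv a.fox_inv)
  next
    case (mult x y)
    then show ?case using fox_change_add[OF ag]
      by (simp add: fox_mult a.fox_mult)
  qed
  then show ?thesis by simp
qed

lemma fox_change_comp:
  assumes a: "a \<in> hom F F" and b: "\<forall>j\<in>{1..n}. b (fgen n j) \<in> carrier F"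
  shows "fox_change n \<rho> (\<lambda>x. a (b x)) v = fox_change n \<rho> a (fox_change n (\<lambda>x. \<rho> (a x)) b v)"
proof
  fix l
  interpret a: free_rep sc n "\<lambda>x. \<rho> (a x)" by (rule rep_comp[OF a])
  have ag: "\<forall>j\<in>{1..n}. a (fgen n j) \<in> carrier F" using a by (simp add: hom_in_carrier)
  show "fox_change n \<rho> (\<lambda>x. a (b x)) v l = fox_change n \<rho> a (fox_change n (\<lambda>x. \<rho> (a x)) b v) l"
  proof (cases "l \<in> {1..n}")
    case True
    have "fox_change n \<rho> (\<lambda>x. a (b x)) v l =
        (\<Sum>j\<in>{1..n}. fox_change n \<rho> a (fox n (\<lambda>x. \<rho> (a x)) (b (fgen n j)) (v j)) l)"
      using True b by (simp add: fox_change_def[of _ _ _ v] fox_chain[OF a])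
    also have "\<dots> = (\<Sum>j\<in>{1..n}. \<Sum>i\<in>{1..n}.
        fox n \<rho> (a (fgen n i)) (fox n (\<lambda>x. \<rho> (a x)) (b (fgen n j)) (v j) i) l)"
      using True by (simp add: fox_change_def)
    also have "\<dots> = (\<Sum>i\<in>{1..n}. \<Sum>j\<in>{1..n}.
        fox n \<rho> (a (fgen n i)) (fox n (\<lambda>x. \<rho> (a x)) (b (fgen n j)) (v j) i) l)"
      by (rule sum.swap)
    also have "\<dots> = fox_change n \<rho> a (fox_change n (\<lambda>x. \<rho> (a x)) b v) l"
      using True ag by (simp add: fox_change_def fox_sum sum_fun_apply)
    finally show ?thesis .
  next
    case False
    then show ?thesis by (auto simp: fox_change_def)
  qed
qed

lemma fox_change_id:
  assumes "\<And>j. j \<in> {1..n} \<Longrightarrow> a (fgen n j) = fgen n j"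
  shows "fox_change n \<rho> a v = v"
proof
  fix l
  have "(\<Sum>j\<in>{1..n}. fox n \<rho> (a (fgen n j)) (v j) l) = (\<Sum>j\<in>{1..n}. if l = j then v l else 0)"
    using assms by (intro sum.cong) (auto simp: fox_gen delta_def)
  then show "fox_change n \<rho> a v l = v l" by (simp add: fox_change_def)
qed

end

text \<open>All constructions are natural in linear maps that intertwine two representations.\<close>

locale free_rep_map = V: free_rep sc n \<rho> + W: free_rep sc' n \<rho>'
  for sc :: "'k::field \<Rightarrow> 'e::ab_group_add \<Rightarrow> 'e" and sc' :: "'k \<Rightarrow> 'f::ab_group_add \<Rightarrow> 'f" and n \<rho> \<rho>' +
  fixes L :: "'e \<Rightarrow> 'f"
  assumes L_add: "L (u + v) = L u + L v"
    and L_scale: "L (sc c u) = sc' c (L u)"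
    and L_rep: "x \<in> carrier (free_grp n) \<Longrightarrow> L (\<rho> x u) = \<rho>' x (L u)"
begin

lemma L_zero: "L 0 = 0"
  using L_add[of 0 0] by simp

lemma L_uminus: "L (- u) = - L u"
  using L_add[of u "- u"] L_zero by (simp add: add_eq_0_iff)

lemma L_diff: "L (u - v) = L u - L v"
  using L_add[of u "- v"] by (simp add: L_uminus)

lemma L_sum: "L (\<Sum>i\<in>I. f i) = (\<Sum>i\<in>I. L (f i))"
  by (induction I rule: infinite_finite_induct) (auto simp: L_zero L_add)

lemma L_gdiff: "j \<in> {1..n} \<Longrightarrow> L (gdiff n \<rho> j u) = gdiff n \<rho>' j (L u)"
  by (simp add: gdiff_def L_diff L_rep)

lemma L_row: "L (row sc n \<rho> lam i v) = row sc' n \<rho>' lam i (\<lambda>j. L (v j))"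
  by (simp add: row_def L_add L_scale L_sum L_gdiff)

lemma L_aug_sum: "L (aug_sum n \<rho> v) = aug_sum n \<rho>' (\<lambda>j. L (v j))"
  by (simp add: aug_sum_def L_sum L_gdiff)

lemma L_conv:
  assumes "lam \<noteq> 0" "x \<in> carrier (free_grp n)"
  shows "(\<lambda>j. L (conv_act sc n \<rho> lam x v j)) = conv_act sc' n \<rho>' lam x (\<lambda>j. L (v j))"
  unfolding conv_act_def using assms
  by (intro free_action_intertwine[where L = "\<lambda>v j. L (v j)"] V.conv_gen_bij W.conv_gen_bij)
    (auto simp: conv_gen_def fun_eq_iff L_add L_row)

lemma L_fox:
  assumes "x \<in> carrier (free_grp n)"
  shows "L (fox n \<rho> x u j) = fox n \<rho>' x (L u) j"
proof -
  have "\<forall>u. L (fox n \<rho> x u j) = fox n \<rho>' x (L u) j" using assms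
    by (induction rule: free_grp_induct)
      (auto simp: V.fox_one W.fox_one V.fox_gen W.fox_gen V.fox_inv W.fox_inv V.fox_mult W.fox_mult
        fun_simps delta_def L_zero L_uminus L_add L_rep)
  then show ?thesis by simp
qed

lemma L_fox_change:
  assumes "\<forall>j\<in>{1..n}. a (fgen n j) \<in> carrier (free_grp n)"
  shows "(\<lambda>j. L (fox_change n \<rho> a v j)) = fox_change n \<rho>' a (\<lambda>j. L (v j))"
  using assms by (auto simp: fox_change_def fun_eq_iff L_sum L_fox)

end

section \<open>The kernel of the middle convolution\<close>

text \<open>The kernel of \<open>v \<mapsto> ((x\<^sub>i - 1) R\<^sub>i v)\<^sub>i\<close> modulo \<open>Z\<close>.\<close>

definition klm_ker ::
  "('k::field \<Rightarrow> 'e \<Rightarrow> 'e) \<Rightarrow> nat \<Rightarrow> (fgrp \<Rightarrow> 'e \<Rightarrow> 'e) \<Rightarrow> 'k \<Rightarrow> 'e set \<Rightarrow> (nat \<Rightarrow> 'e::ab_group_add) set" where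
  "klm_ker sc n \<rho> lam Z = {v. \<forall>i\<in>{1..n}. gdiff n \<rho> i (row sc n \<rho> lam i v) \<in> Z}"

text \<open>Property (P1) for the quotient by \<open>Z\<close>: an almost trivial submodule is spanned by a common
  eigenvector on which all but one of the generators act trivially.\<close>

definition no_sub ::
  "('k::field \<Rightarrow> 'e \<Rightarrow> 'e) \<Rightarrow> nat \<Rightarrow> (fgrp \<Rightarrow> 'e \<Rightarrow> 'e) \<Rightarrow> 'e::ab_group_add set \<Rightarrow> bool" where
  "no_sub sc n \<rho> Z \<longleftrightarrow> (\<forall>i\<in>{1..n}. \<forall>c e. c \<noteq> 0 \<longrightarrow> (\<forall>j\<in>{1..n} - {i}. gdiff n \<rho> j e \<in> Z) \<longrightarrow>
     \<rho> (fgen n i) e - sc c e \<in> Z \<longrightarrow> e \<in> Z)"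

text \<open>Property (P2) for the quotient by \<open>Z\<close>.  An almost trivial quotient is a linear form that vanishes on the images
  of \<open>x\<^sub>j - 1\<close> for \<open>j \<noteq> i\<close> and of \<open>x\<^sub>i - c\<close>; there is no non-zero one iff these images span the space.\<close>

definition no_quot ::
  "('k::field \<Rightarrow> 'e \<Rightarrow> 'e) \<Rightarrow> nat \<Rightarrow> (fgrp \<Rightarrow> 'e \<Rightarrow> 'e) \<Rightarrow> 'e::ab_group_add set \<Rightarrow> bool" where
  "no_quot sc n \<rho> Z \<longleftrightarrow> (\<forall>i\<in>{1..n}. \<forall>c e. c \<noteq> 0 \<longrightarrow>
     (\<exists>w. e - ((\<Sum>j\<in>{1..n} - {i}. gdiff n \<rho> j (w j)) + (\<rho> (fgen n i) (w i) - sc c (w i))) \<in> Z))"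

(* Membership in {1..n} stays an atom, so that hypotheses quantified over it apply. *)
declare atLeastAtMost_iff [simp del]

lemma lam_ge_nonzero: "lam \<noteq> 0 \<Longrightarrow> lam_ge lam i j \<noteq> 0"
  by (simp add: lam_ge_def)

context free_rep
begin

lemma gdiff_diff: "j \<in> {1..n} \<Longrightarrow> D j (u - v) = D j u - D j v"
  by (simp add: gdiff_def rep_diff)

lemma gdiff_sum: "j \<in> {1..n} \<Longrightarrow> D j (\<Sum>i\<in>I. f i) = (\<Sum>i\<in>I. D j (f i))"
  by (induction I rule: infinite_finite_induct) (auto simp: gdiff_add)

lemma row_one: "row sc n \<rho> 1 i v = aug_sum n \<rho> v"
  by (auto simp: row_def aug_sum_def lam_ge_def intro!: sum.cong)

text \<open>Each \<open>x\<^sub>j - 1\<close> maps into the \<open>j\<close>-th component, so the components of the multiplication do not mix.\<close>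

lemma aug_sum_conv_apply:
  assumes "\<tau> \<noteq> 0"
  shows "aug_sum n (conv_act sc n \<rho> \<tau>) w = (\<lambda>j. if j \<in> {1..n} then row sc n \<rho> \<tau> j (w j) else 0)"
proof
  fix m
  have "aug_sum n (conv_act sc n \<rho> \<tau>) w m = (\<Sum>j\<in>{1..n}. if j = m then row sc n \<rho> \<tau> m (w m) else 0)"
    unfolding aug_sum_def sum_fun_apply using assms
    by (intro sum.cong) (auto simp: conv_gdiff delta_def)
  then show "aug_sum n (conv_act sc n \<rho> \<tau>) w m = (if m \<in> {1..n} then row sc n \<rho> \<tau> m (w m) else 0)"
    by simp
qed

text \<open>The \<open>i\<close>-th row of the outer convolution is \<open>(\<lambda> - 1) w\<^sub>i\<close> plus the components of \<open>m w\<close>, those up to the \<open>i\<close>-th scaled by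
  \<open>\<lambda>\<close>.  Applying the inner row turns the first summand into \<open>(\<lambda> - 1)\<close> times the \<open>i\<close>-th component of \<open>m w\<close>, and the scalars
  combine to those of the row for \<open>\<lambda>\<tau>\<close>.\<close>

lemma row_row:
  assumes "\<tau> \<noteq> 0" and i: "i \<in> {1..n}"
  shows "row sc n \<rho> \<tau> i (row (fscale sc) n (conv_act sc n \<rho> \<tau>) lam i w) =
    row sc n \<rho> (lam * \<tau>) i (aug_sum n (conv_act sc n \<rho> \<tau>) w)"
proof -
  let ?y = "aug_sum n (conv_act sc n \<rho> \<tau>) w"
  let ?z = "\<lambda>l. if l \<in> {1..n} then sc (lam_ge lam i l) (?y l) else 0"
  have "(\<Sum>j\<in>{1..n}. fscale sc (lam_ge lam i j) (gdiff n (conv_act sc n \<rho> \<tau>) j (w j))) l = ?z l" for l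
  proof -
    have "(\<Sum>j\<in>{1..n}. fscale sc (lam_ge lam i j) (gdiff n (conv_act sc n \<rho> \<tau>) j (w j))) l =
        (\<Sum>j\<in>{1..n}. if j = l then sc (lam_ge lam i l) (?y l) else 0)"
      unfolding sum_fun_apply using assms
      by (intro sum.cong) (auto simp: conv_gdiff delta_def fscale_apply aug_sum_conv_apply)
    then show ?thesis by simp
  qed
  then have "row (fscale sc) n (conv_act sc n \<rho> \<tau>) lam i w = fscale sc (lam - 1) (w i) + ?z"
    by (simp add: row_def[of "fscale sc"] fun_eq_iff plus_fun_apply)
  then have "row sc n \<rho> \<tau> i (row (fscale sc) n (conv_act sc n \<rho> \<tau>) lam i w) =
      sc (lam - 1) (row sc n \<rho> \<tau> i (w i)) + row sc n \<rho> \<tau> i ?z"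
    using i by (simp only: row_add row_scale)
  also have "row sc n \<rho> \<tau> i (w i) = ?y i" using assms by (simp add: aug_sum_conv_apply)
  also have "row sc n \<rho> \<tau> i ?z = sc (\<tau> - 1) (sc lam (?y i)) + (\<Sum>j\<in>{1..n}. sc (lam_ge (lam * \<tau>) i j) (D j (?y j)))"
  proof -
    have "(\<Sum>j\<in>{1..n}. sc (lam_ge \<tau> i j) (D j (?z j))) = (\<Sum>j\<in>{1..n}. sc (lam_ge (lam * \<tau>) i j) (D j (?y j)))"
    proof (rule sum.cong[OF HOL.refl])
      fix j assume j: "j \<in> {1..n}"
      have "lam_ge \<tau> i j * lam_ge lam i j = lam_ge (lam * \<tau>) i j" by (simp add: lam_ge_def)
      with j show "sc (lam_ge \<tau> i j) (D j (?z j)) = sc (lam_ge (lam * \<tau>) i j) (D j (?y j))"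
        by (simp add: gdiff_scale)
    qed
    moreover have "?z i = sc lam (?y i)" using i by (simp add: lam_ge_def)
    ultimately show ?thesis by (simp add: row_def[of sc _ _ \<tau>])
  qed
  also have "sc (lam - 1) (?y i) + (sc (\<tau> - 1) (sc lam (?y i)) + (\<Sum>j\<in>{1..n}. sc (lam_ge (lam * \<tau>) i j) (D j (?y j)))) =
      row sc n \<rho> (lam * \<tau>) i ?y"
    unfolding row_def[of sc n \<rho> "lam * \<tau>"]
    by (simp add: scale_left_diff_distrib left_diff_distrib right_diff_distrib mult.commute[of \<tau>])
  finally show ?thesis .
qed

text \<open>For a generator \<open>x\<^sub>i\<close> this is \<open>row_row\<close>, as both sides change only the \<open>i\<close>-th component.\<close>

lemma aug_sum_conv:
  assumes "lam \<noteq> 0" "\<tau> \<noteq> 0" "x \<in> carrier F"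
  shows "aug_sum n (conv_act sc n \<rho> \<tau>) (conv_act (fscale sc) n (conv_act sc n \<rho> \<tau>) lam x w) =
    conv_act sc n \<rho> (lam * \<tau>) x (aug_sum n (conv_act sc n \<rho> \<tau>) w)"
proof -
  interpret N: free_rep "fscale sc" n "conv_act sc n \<rho> \<tau>" by (rule conv_rep[OF assms(2)])
  show ?thesis
    unfolding conv_act_def[of "fscale sc"] conv_act_def[of sc n \<rho> "lam * \<tau>"]
  proof (rule free_action_intertwine[where L = "aug_sum n (conv_act sc n \<rho> \<tau>)"])
    fix i w assume i: "i \<in> {1..n}"
    show "aug_sum n (conv_act sc n \<rho> \<tau>) (conv_gen (fscale sc) n (conv_act sc n \<rho> \<tau>) lam i w) =
        conv_gen sc n \<rho> (lam * \<tau>) i (aug_sum n (conv_act sc n \<rho> \<tau>) w)"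
      using i assms
      by (auto simp: aug_sum_conv_apply[of \<tau> "_(i := _)"] conv_gen_def fun_eq_iff row_add row_row)
        (auto simp: aug_sum_conv_apply)
  qed (use assms in \<open>auto intro: N.conv_gen_bij[THEN bspec] conv_gen_bij[THEN bspec]\<close>)
qed

lemma aug_sum_conv_one:
  assumes "x \<in> carrier F"
  shows "aug_sum n \<rho> (conv_act sc n \<rho> 1 x v) = \<rho> x (aug_sum n \<rho> v)"
proof -
  have "\<forall>v. aug_sum n \<rho> (conv_act sc n \<rho> 1 x v) = \<rho> x (aug_sum n \<rho> v)" using assms
  proof (induction rule: free_grp_induct)
    case one
    interpret N: free_rep "fscale sc" n "conv_act sc n \<rho> 1" by (rule conv_rep) simp
    show ?case by (simp add: N.rep_one rep_one)
  next
    case (gen i)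
    have "aug_sum n \<rho> (conv_act sc n \<rho> 1 (fgen n i) v) = \<rho> (fgen n i) (aug_sum n \<rho> v)" for v
    proof -
      have "conv_act sc n \<rho> 1 (fgen n i) v = v + delta i (aug_sum n \<rho> v)"
        using gen by (auto simp: conv_act_gen row_one fun_eq_iff delta_def plus_fun_apply)
      then show ?thesis using gen by (simp add: aug_sum_add aug_sum_delta gdiff_def)
    qed
    then show ?case by simp
  next
    case (inv x)
    interpret N: free_rep "fscale sc" n "conv_act sc n \<rho> 1" by (rule conv_rep) simp
    show ?case using inv by (metis F.inv_closed N.rep_inv(2) rep_inv(1))
  next
    case (mult x y)
    interpret N: free_rep "fscale sc" n "conv_act sc n \<rho> 1" by (rule conv_rep) simp
    show ?case using mult by (simp add: N.rep_mult rep_mult)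
  qed
  then show ?thesis by simp
qed

end

text \<open>The kernel \<open>Z\<close> of a presentation, as seen in the representation.  Statements about the presented module become
  statements modulo \<open>Z\<close>.\<close>

locale stable_subspace = free_rep sc n \<rho>
  for sc :: "'k::field \<Rightarrow> 'e::ab_group_add \<Rightarrow> 'e" and n and \<rho> +
  fixes Z :: "'e set"
  assumes Z_zero [simp]: "0 \<in> Z" and Z_add: "u \<in> Z \<Longrightarrow> v \<in> Z \<Longrightarrow> u + v \<in> Z"
    and Z_scale: "u \<in> Z \<Longrightarrow> sc c u \<in> Z" and Z_rep: "x \<in> carrier F \<Longrightarrow> u \<in> Z \<Longrightarrow> \<rho> x u \<in> Z"
begin

lemma Z_uminus: "u \<in> Z \<Longrightarrow> - u \<in> Z"
  using Z_scale[of u "- 1"] by (simp add: scale_minus_left)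

lemma Z_uminus_iff [simp]: "- u \<in> Z \<longleftrightarrow> u \<in> Z"
  using Z_uminus[of u] Z_uminus[of "- u"] by auto

lemma Z_diff: "u \<in> Z \<Longrightarrow> v \<in> Z \<Longrightarrow> u - v \<in> Z"
  using Z_add[of u "- v"] by simp

lemma Z_add_cancel: "v \<in> Z \<Longrightarrow> u + v \<in> Z \<longleftrightarrow> u \<in> Z" "v \<in> Z \<Longrightarrow> v + u \<in> Z \<longleftrightarrow> u \<in> Z"
  by (metis Z_add Z_diff add_diff_cancel_right', metis Z_add Z_diff add_diff_cancel_left')

lemma Z_scale_iff: "c \<noteq> 0 \<Longrightarrow> sc c u \<in> Z \<longleftrightarrow> u \<in> Z"
  by (metis Z_scale scale_scale left_inverse scale_one)

lemma Z_rep_iff: "x \<in> carrier F \<Longrightarrow> \<rho> x u \<in> Z \<longleftrightarrow> u \<in> Z"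
  by (metis F.inv_closed Z_rep rep_inv(1))

lemma Z_sum: "(\<And>i. i \<in> I \<Longrightarrow> f i \<in> Z) \<Longrightarrow> (\<Sum>i\<in>I. f i) \<in> Z"
  by (induction I rule: infinite_finite_induct) (auto intro: Z_add)

lemma Z_gdiff: "j \<in> {1..n} \<Longrightarrow> u \<in> Z \<Longrightarrow> gdiff n \<rho> j u \<in> Z"
  by (simp add: gdiff_def Z_diff Z_rep)

lemma Z_row: "i \<in> {1..n} \<Longrightarrow> (\<And>j. j \<in> {1..n} \<Longrightarrow> v j \<in> Z) \<Longrightarrow> row sc n \<rho> lam i v \<in> Z"
  by (auto simp: row_def intro!: Z_add Z_scale Z_sum Z_gdiff)

lemma Z_row_rest: "(\<And>j. j \<in> {1..n} - {i} \<Longrightarrow> D j (v j) \<in> Z) \<Longrightarrow> row_rest lam i v \<in> Z"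
  unfolding row_rest_def by (intro Z_sum Z_scale)

lemma row_uminus: "i \<in> {1..n} \<Longrightarrow> row sc n \<rho> lam i (- v) = - row sc n \<rho> lam i v"
  using row_add[of i lam v "- v"] row_add[of i lam 0 0] by (simp add: add_eq_0_iff)

lemma row_diff: "i \<in> {1..n} \<Longrightarrow> row sc n \<rho> lam i (u - v) = row sc n \<rho> lam i u - row sc n \<rho> lam i v"
  using row_add[of i lam u "- v"] by (simp add: row_uminus)

lemma conv_stable:
  assumes "lam \<noteq> 0" "x \<in> carrier F"
    and Y: "\<And>i v. i \<in> {1..n} \<Longrightarrow> conv_gen sc n \<rho> lam i v \<in> Y \<longleftrightarrow> v \<in> Y"
  shows "conv_act sc n \<rho> lam x v \<in> Y \<longleftrightarrow> v \<in> Y"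
  unfolding conv_act_def using assms by (intro free_action_stable conv_gen_bij) auto

lemma conv_stable_Z:
  assumes "lam \<noteq> 0" "x \<in> carrier F"
  shows "(\<forall>j\<in>{1..n}. conv_act sc n \<rho> lam x v j \<in> Z) \<longleftrightarrow> (\<forall>j\<in>{1..n}. v j \<in> Z)"
proof -
  have "conv_gen sc n \<rho> lam i v \<in> {v. \<forall>j\<in>{1..n}. v j \<in> Z} \<longleftrightarrow> v \<in> {v. \<forall>j\<in>{1..n}. v j \<in> Z}"
    if i: "i \<in> {1..n}" for i v
  proof (cases "\<forall>j\<in>{1..n} - {i}. v j \<in> Z")
    case True
    then have "row_rest lam i v \<in> Z" by (intro Z_row_rest Z_gdiff) auto
    then have "sc lam (\<rho> (fgen n i) (v i)) + row_rest lam i v \<in> Z \<longleftrightarrow> v i \<in> Z"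
      using assms(1) i by (simp add: Z_add_cancel Z_scale_iff Z_rep_iff)
    with True i show ?thesis by (auto simp: conv_gen_eq)
  next
    case False
    then show ?thesis using i by (auto simp: conv_gen_eq)
  qed
  from conv_stable[OF assms this] show ?thesis by simp
qed

lemma conv_stable_K:
  assumes "lam \<noteq> 0" "x \<in> carrier F"
  shows "(\<forall>j\<in>{1..n}. D j (conv_act sc n \<rho> lam x v j) \<in> Z) \<longleftrightarrow> (\<forall>j\<in>{1..n}. D j (v j) \<in> Z)"
proof -
  have "conv_gen sc n \<rho> lam i v \<in> {v. \<forall>j\<in>{1..n}. D j (v j) \<in> Z} \<longleftrightarrow> v \<in> {v. \<forall>j\<in>{1..n}. D j (v j) \<in> Z}"
    if i: "i \<in> {1..n}" for i v
  proof (cases "\<forall>j\<in>{1..n} - {i}. D j (v j) \<in> Z")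
    case True
    have "D i (sc lam (\<rho> (fgen n i) (v i)) + row_rest lam i v) =
        sc lam (\<rho> (fgen n i) (D i (v i))) + D i (row_rest lam i v)"
      using i by (simp add: gdiff_add gdiff_scale) (simp add: gdiff_def rep_diff)
    moreover have "D i (row_rest lam i v) \<in> Z"
      using True by (intro Z_gdiff[OF i Z_row_rest]) auto
    ultimately have "D i (sc lam (\<rho> (fgen n i) (v i)) + row_rest lam i v) \<in> Z \<longleftrightarrow> D i (v i) \<in> Z"
      using assms(1) i by (simp add: Z_add_cancel Z_scale_iff Z_rep_iff)
    with True i show ?thesis by (auto simp: conv_gen_eq)
  next
    case False
    then show ?thesis using i by (auto simp: conv_gen_eq)
  qed
  from conv_stable[OF assms this] show ?thesis by simp
qed

text \<open>A vector whose rows all vanish is fixed by the generators, hence by the free group, modulo \<open>Z\<close>.\<close>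

lemma conv_L:
  assumes lam: "lam \<noteq> 0" and x: "x \<in> carrier F" and v: "\<forall>i\<in>{1..n}. row sc n \<rho> lam i v \<in> Z"
  shows "\<forall>j\<in>{1..n}. (conv_act sc n \<rho> lam x v - v) j \<in> Z"
  using x
proof (induction rule: free_grp_induct)
  case one
  interpret N: free_rep "fscale sc" n "conv_act sc n \<rho> lam" by (rule conv_rep[OF lam])
  show ?case by (simp add: N.rep_one fun_simps)
next
  case (gen i)
  then show ?case using v by (auto simp: conv_act_gen lam fun_simps)
next
  case (inv x)
  interpret N: free_rep "fscale sc" n "conv_act sc n \<rho> lam" by (rule conv_rep[OF lam])
  have eq: "conv_act sc n \<rho> lam (inv\<^bsub>F\<^esub> x) v - v = - conv_act sc n \<rho> lam (inv\<^bsub>F\<^esub> x) (conv_act sc n \<rho> lam x v - v)"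
    using inv(1) by (simp add: N.rep_diff N.rep_inv)
  have "\<forall>j\<in>{1..n}. conv_act sc n \<rho> lam (inv\<^bsub>F\<^esub> x) (conv_act sc n \<rho> lam x v - v) j \<in> Z"
    using inv conv_stable_Z[OF lam, of "inv\<^bsub>F\<^esub> x"] by simp
  then show ?case unfolding eq by (simp add: fun_simps)
next
  case (mult x y)
  interpret N: free_rep "fscale sc" n "conv_act sc n \<rho> lam" by (rule conv_rep[OF lam])
  have eq: "conv_act sc n \<rho> lam (x \<otimes>\<^bsub>F\<^esub> y) v - v =
      conv_act sc n \<rho> lam x (conv_act sc n \<rho> lam y v - v) + (conv_act sc n \<rho> lam x v - v)"
    using mult(1,2) by (simp add: N.rep_diff N.rep_mult)
  have "\<forall>j\<in>{1..n}. conv_act sc n \<rho> lam x (conv_act sc n \<rho> lam y v - v) j \<in> Z"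
    using mult conv_stable_Z[OF lam, of x] by simp
  with mult(3) show ?case unfolding eq by (simp add: Z_add plus_fun_apply)
qed

lemma row_K:
  assumes i: "i \<in> {1..n}" and k: "\<And>j. j \<in> {1..n} \<Longrightarrow> D j (k j) \<in> Z"
  shows "row sc n \<rho> lam i k - sc (lam - 1) (k i) \<in> Z"
  using k by (auto simp: row_def intro!: Z_sum Z_scale)

lemma no_sub_const:
  assumes "n \<ge> 1" "no_sub sc n \<rho> Z" "\<forall>i\<in>{1..n}. D i e \<in> Z"
  shows "e \<in> Z"
  using assms(2)[unfolded no_sub_def, rule_format, of 1 1 e] assms(1,3)
  by (auto simp: gdiff_def atLeastAtMost_iff)

text \<open>On \<open>K\<close> the row \<open>R\<^sub>i\<close> is multiplication by \<open>\<lambda> - 1\<close>, as the terms with \<open>(x\<^sub>j - 1) v\<^sub>j\<close> vanish.  So for \<open>\<lambda> \<noteq> 1\<close> the vector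
  \<open>(\<lambda> - 1)\<^sup>-\<^sup>1 (R\<^sub>i v)\<^sub>i\<close> is the \<open>K\<close>-part of an element \<open>v\<close> of the kernel, and the rest lies in \<open>L\<close>.  For \<open>\<lambda> = 1\<close> all rows are equal,
  their common value is invariant under all generators, and vanishes because there are no trivial
  submodules.\<close>

lemma klm_ker_eq:
  assumes n: "n \<ge> 1" and P: "no_sub sc n \<rho> Z"
  shows "{k + l | k l. (\<forall>i\<in>{1..n}. D i (k i) \<in> Z) \<and> (\<forall>i\<in>{1..n}. row sc n \<rho> lam i l \<in> Z)} =
    klm_ker sc n \<rho> lam Z"
proof (intro subset_antisym subsetI)
  fix v assume "v \<in> {k + l | k l. (\<forall>i\<in>{1..n}. D i (k i) \<in> Z) \<and> (\<forall>i\<in>{1..n}. row sc n \<rho> lam i l \<in> Z)}"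
  then obtain k l where v: "v = k + l" and k: "\<forall>i\<in>{1..n}. D i (k i) \<in> Z"
    and l: "\<forall>i\<in>{1..n}. row sc n \<rho> lam i l \<in> Z" by auto
  have "D i (row sc n \<rho> lam i v) \<in> Z" if i: "i \<in> {1..n}" for i
  proof -
    have "D i (row sc n \<rho> lam i k - sc (lam - 1) (k i)) \<in> Z"
      using row_K[OF i, of k] k by (intro Z_gdiff i) auto
    then have "D i (row sc n \<rho> lam i k) - sc (lam - 1) (D i (k i)) \<in> Z"
      using i by (simp add: gdiff_diff gdiff_scale)
    then have "D i (row sc n \<rho> lam i k) \<in> Z"
      using Z_add[OF _ Z_scale[of "D i (k i)" "lam - 1"]] k i by fastforce
    moreover have "D i (row sc n \<rho> lam i l) \<in> Z" using l i by (intro Z_gdiff) auto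
    ultimately show ?thesis using i by (simp add: v row_add gdiff_add Z_add)
  qed
  then show "v \<in> klm_ker sc n \<rho> lam Z" by (simp add: klm_ker_def)
next
  fix v assume v: "v \<in> klm_ker sc n \<rho> lam Z"
  show "v \<in> {k + l | k l. (\<forall>i\<in>{1..n}. D i (k i) \<in> Z) \<and> (\<forall>i\<in>{1..n}. row sc n \<rho> lam i l \<in> Z)}"
  proof (cases "lam = 1")
    case True
    have "aug_sum n \<rho> v \<in> Z"
      using v by (intro no_sub_const[OF n P]) (simp add: klm_ker_def True row_one)
    then have "(\<forall>i\<in>{1..n}. D i ((0 :: nat \<Rightarrow> 'e) i) \<in> Z) \<and> (\<forall>i\<in>{1..n}. row sc n \<rho> lam i v \<in> Z)"
      by (simp add: True row_one fun_simps)
    then show ?thesis by (intro CollectI exI[of _ 0] exI[of _ v]) simp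
  next
    case False
    (* the K-part of v: on K the rows are multiplication by lam - 1 *)
    define k where "k = (\<lambda>i. sc (inverse (lam - 1)) (row sc n \<rho> lam i v))"
    have k: "\<forall>i\<in>{1..n}. D i (k i) \<in> Z"
      using v by (auto simp: k_def klm_ker_def gdiff_scale Z_scale)
    have "row sc n \<rho> lam i (v - k) \<in> Z" if i: "i \<in> {1..n}" for i
    proof -
      have "row sc n \<rho> lam i k - row sc n \<rho> lam i v \<in> Z"
        using row_K[OF i, of k lam] k False by (simp add: k_def)
      then show ?thesis using Z_uminus i by (fastforce simp: row_diff)
    qed
    then show ?thesis using k by (intro CollectI exI[of _ k] exI[of _ "v - k"]) auto
  qed
qed

lemma delta_row: "row sc n \<rho> lam m (delta j u) = (if m = j then sc (lam - 1) u else 0) + sc (lam_ge lam m j) (D j u)"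
  if "j \<in> {1..n}"
  using row_delta[OF that, of lam m u] by simp

lemma gdiff_row_delta:
  assumes "j \<in> {1..n}" "m \<in> {1..n}"
  shows "D m (row sc n \<rho> lam m (delta j u)) =
    (if m = j then sc lam (\<rho> (fgen n j) (D j u)) - D j u else sc (lam_ge lam m j) (D m (D j u)))"
proof (cases "m = j")
  case True
  have "D j (sc (lam - 1) u + sc lam (D j u)) = sc (lam - 1) (D j u) + sc lam (\<rho> (fgen n j) (D j u) - D j u)"
    using assms by (simp add: gdiff_add gdiff_scale) (simp add: gdiff_def)
  also have "\<dots> = sc lam (\<rho> (fgen n j) (D j u)) - D j u"
    by (simp add: scale_left_diff_distrib scale_right_diff_distrib)
  finally show ?thesis using assms True by (simp add: delta_row lam_ge_def)
next
  case False
  then show ?thesis using assms by (simp add: delta_row gdiff_scale)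
qed

lemma klm_ker_Z: "(\<And>j. j \<in> {1..n} \<Longrightarrow> v j \<in> Z) \<Longrightarrow> v \<in> klm_ker sc n \<rho> lam Z"
  unfolding klm_ker_def by (blast intro: Z_gdiff Z_row)

text \<open>If \<open>u\<close> in the \<open>j\<close>-th place lies in the kernel, then \<open>(x\<^sub>j - 1) u\<close> is fixed by the other generators and is an eigenvector of \<open>x\<^sub>j\<close>
  for \<open>\<lambda>\<^sup>-\<^sup>1\<close>; hence it vanishes.\<close>

lemma delta_klm_ker:
  assumes "lam \<noteq> 0" "no_sub sc n \<rho> Z" "j \<in> {1..n}"
  shows "delta j u \<in> klm_ker sc n \<rho> lam Z \<longleftrightarrow> D j u \<in> Z"
proof
  assume "delta j u \<in> klm_ker sc n \<rho> lam Z"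
  then have *: "D m (row sc n \<rho> lam m (delta j u)) \<in> Z" if "m \<in> {1..n}" for m
    using that by (simp add: klm_ker_def)
  have "D m (D j u) \<in> Z" if "m \<in> {1..n} - {j}" for m
    using *[of m] that assms by (simp add: gdiff_row_delta Z_scale_iff lam_ge_nonzero)
  moreover have "\<rho> (fgen n j) (D j u) - sc (inverse lam) (D j u) \<in> Z"
  proof -
    have "sc lam (\<rho> (fgen n j) (D j u) - sc (inverse lam) (D j u)) \<in> Z"
      using *[of j] assms by (simp add: gdiff_row_delta scale_right_diff_distrib)
    then show ?thesis using assms(1) by (simp add: Z_scale_iff)
  qed
  ultimately show "D j u \<in> Z"
    using assms(1,3) assms(2)[unfolded no_sub_def, rule_format, of j "inverse lam" "D j u"] by simp
next
  assume "D j u \<in> Z"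
  then show "delta j u \<in> klm_ker sc n \<rho> lam Z"
    using assms by (auto simp: klm_ker_def gdiff_row_delta intro!: Z_diff Z_scale Z_rep Z_gdiff)
qed

text \<open>Let \<open>w\<^sub>j = (x\<^sub>j - 1) R\<^sub>j v\<close>.  If \<open>v\<close> is fixed by \<open>x\<^sub>j\<close> for \<open>j \<noteq> i\<close> in the quotient, then \<open>w\<^sub>j = 0\<close> for these \<open>j\<close>, and that \<open>v\<close> is
  an eigenvector of \<open>x\<^sub>i\<close> for \<open>c\<close> means that \<open>w\<^sub>i\<close> is fixed by the \<open>x\<^sub>j\<close> and an eigenvector of \<open>x\<^sub>i\<close> for \<open>c/\<lambda>\<close>.  So \<open>w\<^sub>i = 0\<close> as
  well.\<close>

lemma no_sub_conv:
  assumes lam: "lam \<noteq> 0" and P: "no_sub sc n \<rho> Z"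
  shows "no_sub (fscale sc) n (conv_act sc n \<rho> lam) (klm_ker sc n \<rho> lam Z)"
  unfolding no_sub_def
proof (intro ballI allI impI)
  fix i c v
  assume i: "i \<in> {1..n}" and c: "c \<noteq> 0"
    and j: "\<forall>j\<in>{1..n} - {i}. gdiff n (conv_act sc n \<rho> lam) j v \<in> klm_ker sc n \<rho> lam Z"
    and ev: "conv_act sc n \<rho> lam (fgen n i) v - fscale sc c v \<in> klm_ker sc n \<rho> lam Z"
  let ?w = "\<lambda>j. D j (row sc n \<rho> lam j v)"
  have w: "?w m \<in> Z" if "m \<in> {1..n} - {i}" for m
    using j that lam P by (auto simp: conv_gdiff delta_klm_ker)
  have eq: "conv_act sc n \<rho> lam (fgen n i) v - fscale sc c v =
      delta i (row sc n \<rho> lam i v) + fscale sc (1 - c) v"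
    using i lam by (auto simp: conv_act_gen delta_def fun_eq_iff fun_simps scale_left_diff_distrib)
  have *: "D m (row sc n \<rho> lam m (delta i (row sc n \<rho> lam i v))) + sc (1 - c) (?w m) \<in> Z" if "m \<in> {1..n}" for m
    using ev that unfolding eq klm_ker_def by (simp add: row_add row_scale gdiff_add gdiff_scale)
  have "D m (?w i) \<in> Z" if m: "m \<in> {1..n} - {i}" for m
    using *[of m] w[OF m] m i lam
    by (simp add: gdiff_row_delta Z_add_cancel Z_scale Z_scale_iff lam_ge_nonzero)
  moreover have "\<rho> (fgen n i) (?w i) - sc (c / lam) (?w i) \<in> Z"
  proof -
    have "sc lam (\<rho> (fgen n i) (?w i)) - ?w i + sc (1 - c) (?w i) \<in> Z"
      using *[of i] i by (simp add: gdiff_row_delta)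
    also have "sc lam (\<rho> (fgen n i) (?w i)) - ?w i + sc (1 - c) (?w i) =
        sc lam (\<rho> (fgen n i) (?w i) - sc (c / lam) (?w i))"
      using lam by (simp add: scale_left_diff_distrib scale_right_diff_distrib)
    finally show ?thesis using lam by (simp add: Z_scale_iff)
  qed
  ultimately have wi: "?w i \<in> Z"
    using c lam i P[unfolded no_sub_def, rule_format, of i "c / lam" "?w i"] by simp
  have "?w m \<in> Z" if "m \<in> {1..n}" for m
    using w[of m] wi that by (cases "m = i") auto
  then show "v \<in> klm_ker sc n \<rho> lam Z" by (simp add: klm_ker_def)
qed

text \<open>Up to invertible scalars in the coordinates this is property (P2) for \<open>x\<^sub>i\<close> and the eigenvalue \<open>c/\<lambda>\<close>.\<close>

lemma row_surj:
  assumes lam: "lam \<noteq> 0" "c \<noteq> 0" and P: "no_quot sc n \<rho> Z" and i: "i \<in> {1..n}"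
  shows "\<exists>u. e - (row sc n \<rho> lam i u + sc (1 - c) (u i)) \<in> Z"
proof -
  obtain w where w: "e - ((\<Sum>j\<in>{1..n} - {i}. D j (w j)) +
      (\<rho> (fgen n i) (w i) - sc (c / lam) (w i))) \<in> Z"
    using P[unfolded no_quot_def, rule_format, of i "c / lam" e] lam i by auto
  define u where "u = (\<lambda>j. sc (inverse (lam_ge lam i j)) (w j))"
  have ui: "sc lam (u i) = w i" using lam by (simp add: u_def lam_ge_def)
  have "row_rest lam i u = (\<Sum>j\<in>{1..n} - {i}. D j (w j))"
    unfolding row_rest_def u_def using lam_ge_nonzero[OF lam(1)]
    by (intro sum.cong) (auto simp: gdiff_scale)
  moreover have "row sc n \<rho> lam i u = sc lam (\<rho> (fgen n i) (u i)) + row_rest lam i u - u i"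
    using row_split[OF i, of u lam] by (simp add: algebra_simps)
  moreover have "sc lam (\<rho> (fgen n i) (u i)) = \<rho> (fgen n i) (w i)"
    using i ui[symmetric] by (simp add: rep_scale)
  moreover have "sc (c / lam) (w i) = sc c (u i)"
    using ui[symmetric] lam by simp
  ultimately have "row sc n \<rho> lam i u + sc (1 - c) (u i) =
      (\<Sum>j\<in>{1..n} - {i}. D j (w j)) + (\<rho> (fgen n i) (w i) - sc (c / lam) (w i))"
    by (simp add: scale_left_diff_distrib)
  with w show ?thesis by metis
qed

text \<open>The \<open>j\<close>-th component of a given vector can be hit through \<open>x\<^sub>j - 1\<close>, and the \<open>i\<close>-th one through \<open>x\<^sub>i - c\<close>, because
  the rows are surjective.  As \<open>x\<^sub>i - c\<close> also adds a multiple of \<open>u\<close> to the other components, \<open>u\<close> is chosen first.\<close>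

lemma no_quot_conv:
  assumes lam: "lam \<noteq> 0" and P: "no_quot sc n \<rho> Z"
  shows "no_quot (fscale sc) n (conv_act sc n \<rho> lam) (klm_ker sc n \<rho> lam Z)"
  unfolding no_quot_def
proof (intro ballI allI impI)
  fix i c y
  assume i: "i \<in> {1..n}" and c: "(c::'k) \<noteq> 0"
  obtain u where u: "y i - (row sc n \<rho> lam i u + sc (1 - c) (u i)) \<in> Z"
    using row_surj[OF lam c P i] by blast
  have "\<exists>t. (y j - sc (1 - c) (u j)) - row sc n \<rho> lam j t \<in> Z" if "j \<in> {1..n}" for j
    using row_surj[OF lam one_neq_zero P that] by simp
  then obtain t where t: "\<And>j. j \<in> {1..n} \<Longrightarrow> (y j - sc (1 - c) (u j)) - row sc n \<rho> lam j (t j) \<in> Z"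
    by metis
  (* t serves the generators other than the i-th, u the i-th one *)
  define w where "w = t(i := u)"
  let ?N = "conv_act sc n \<rho> lam"
  have "(y - ((\<Sum>j\<in>{1..n} - {i}. gdiff n ?N j (w j)) + (?N (fgen n i) (w i) - fscale sc c (w i)))) m \<in> Z"
    if m: "m \<in> {1..n}" for m
  proof -
    have "(\<Sum>j\<in>{1..n} - {i}. gdiff n ?N j (w j)) m =
        (\<Sum>j\<in>{1..n} - {i}. if j = m then row sc n \<rho> lam m (t m) else 0)"
      unfolding sum_fun_apply using lam
      by (intro sum.cong) (auto simp: w_def conv_gdiff delta_def)
    also have "\<dots> = (if m = i then 0 else row sc n \<rho> lam m (t m))"
      using m by simp
    finally have s: "(\<Sum>j\<in>{1..n} - {i}. gdiff n ?N j (w j)) m = (if m = i then 0 else row sc n \<rho> lam m (t m))" .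
    have g: "(?N (fgen n i) (w i) - fscale sc c (w i)) m =
        (if m = i then row sc n \<rho> lam i u else 0) + sc (1 - c) (u m)"
      using i lam by (auto simp: w_def conv_act_gen fun_simps scale_left_diff_distrib)
    have eq: "(y - ((\<Sum>j\<in>{1..n} - {i}. gdiff n ?N j (w j)) + (?N (fgen n i) (w i) - fscale sc c (w i)))) m =
        y m - ((if m = i then 0 else row sc n \<rho> lam m (t m)) +
          ((if m = i then row sc n \<rho> lam i u else 0) + sc (1 - c) (u m)))"
      by (simp only: minus_apply[of y] plus_fun_apply s g)
    show ?thesis unfolding eq using u t[OF m] by (cases "m = i") (simp_all add: diff_diff_eq add.commute)
  qed
  then show "\<exists>w. y - ((\<Sum>j\<in>{1..n} - {i}. gdiff n ?N j (w j)) + (?N (fgen n i) (w i) - fscale sc c (w i)))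
      \<in> klm_ker sc n \<rho> lam Z"
    by (intro exI[of _ w] klm_ker_Z)
qed

text \<open>In the convolution for \<open>\<tau>\<close>, \<open>(x\<^sub>i - 1) R\<^sub>i w\<close> is concentrated in the \<open>i\<close>-th place, so \<open>delta_klm_ker\<close> decides whether it lies in
  the inner kernel, and its entry is given by \<open>row_row\<close>.\<close>

lemma klm_ker_klm_ker:
  assumes "lam \<noteq> 0" "\<tau> \<noteq> 0" and P: "no_sub sc n \<rho> Z"
  shows "w \<in> klm_ker (fscale sc) n (conv_act sc n \<rho> \<tau>) lam (klm_ker sc n \<rho> \<tau> Z) \<longleftrightarrow>
    aug_sum n (conv_act sc n \<rho> \<tau>) w \<in> klm_ker sc n \<rho> (lam * \<tau>) Z"
  using assms by (simp add: klm_ker_def[of "fscale sc"] conv_gdiff delta_klm_ker row_row klm_ker_def[of sc n \<rho> "lam * \<tau>"])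

text \<open>For \<open>\<lambda> = 1\<close> every row is the multiplication map, and an invariant vector of the quotient vanishes.\<close>

lemma klm_ker_one:
  assumes "n \<ge> 1" "no_sub sc n \<rho> Z"
  shows "v \<in> klm_ker sc n \<rho> 1 Z \<longleftrightarrow> aug_sum n \<rho> v \<in> Z"
  using no_sub_const[OF assms, of "aug_sum n \<rho> v"]
  by (auto simp: klm_ker_def row_one Z_gdiff)

lemma aug_sum_conv_surj:
  assumes "\<tau> \<noteq> 0" "no_quot sc n \<rho> Z"
  shows "\<exists>w. \<forall>j\<in>{1..n}. (y - aug_sum n (conv_act sc n \<rho> \<tau>) w) j \<in> Z"
proof -
  have "\<exists>t. y j - row sc n \<rho> \<tau> j t \<in> Z" if "j \<in> {1..n}" for j
    using row_surj[OF assms(1) one_neq_zero assms(2) that] by simp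
  then obtain w where "\<And>j. j \<in> {1..n} \<Longrightarrow> y j - row sc n \<rho> \<tau> j (w j) \<in> Z" by metis
  then show ?thesis using assms(1) by (intro exI[of _ w]) (auto simp: aug_sum_conv_apply minus_apply)
qed

lemma aug_sum_surj:
  assumes "n \<ge> 1" "no_quot sc n \<rho> Z"
  shows "\<exists>v. e - aug_sum n \<rho> v \<in> Z"
proof -
  have "aug_sum n \<rho> w = (\<Sum>j\<in>{1..n} - {1}. D j (w j)) + (\<rho> (fgen n 1) (w 1) - sc 1 (w 1))" for w
    unfolding aug_sum_def using assms(1)
    by (subst sum.remove[of _ 1]) (auto simp: gdiff_def add.commute atLeastAtMost_iff)
  then show ?thesis using assms(2)[unfolded no_quot_def, rule_format, of 1 1 e] assms(1)
    by (auto simp: atLeastAtMost_iff)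
qed

end

section \<open>Braid equivariance\<close>

lemma free_action_cong:
  assumes "\<And>i. i \<in> {1..n} \<Longrightarrow> T i = T' i"
  shows "free_action n T = free_action n T'"
proof -
  have "(\<lambda>\<phi>. \<phi> \<in> hom (free_grp n) (BijGroup UNIV) \<and> (\<forall>i\<in>{1..n}. \<phi> (fgen n i) = T i)) =
      (\<lambda>\<phi>. \<phi> \<in> hom (free_grp n) (BijGroup UNIV) \<and> (\<forall>i\<in>{1..n}. \<phi> (fgen n i) = T' i))"
    using assms by auto
  then show ?thesis by (simp add: free_action_def)
qed

context
  fixes n :: nat and \<rho> \<rho>' :: "fgrp \<Rightarrow> 'e::ab_group_add \<Rightarrow> 'e"
  assumes eq: "\<forall>j\<in>{1..n}. \<rho> (fgen n j) = \<rho>' (fgen n j)"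
begin

lemma gdiff_cong: "j \<in> {1..n} \<Longrightarrow> gdiff n \<rho> j = gdiff n \<rho>' j"
  using eq by (simp add: gdiff_def fun_eq_iff)

lemma row_cong: "row sc n \<rho> lam i v = row sc n \<rho>' lam i v"
  by (simp add: row_def gdiff_cong)

lemma conv_act_cong: "conv_act sc n \<rho> lam = conv_act sc n \<rho>' lam"
  unfolding conv_act_def by (intro free_action_cong) (auto simp: conv_gen_def row_cong)

lemma fox_cong: "fox n \<rho> = fox n \<rho>'"
proof -
  have "free_action n (fox_gen n \<rho>) = free_action n (fox_gen n \<rho>')"
    using eq by (intro free_action_cong) (auto simp: fox_gen_def)
  then show ?thesis by (simp add: fox_def fun_eq_iff)
qed

lemma fox_change_cong: "fox_change n \<rho> = fox_change n \<rho>'"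
  by (simp add: fox_change_def fox_cong fun_eq_iff)

end

text \<open>The Jacobian of \<open>a\<close> intertwines the twisted actions.  The property is quantified over all representations on a type because its
  proof for a composite applies it to the representation pulled back along one factor.\<close>

definition braid_equivariant ::
  "('k::field \<Rightarrow> 'e::ab_group_add \<Rightarrow> 'e) \<Rightarrow> nat \<Rightarrow> 'k \<Rightarrow> (fgrp \<Rightarrow> fgrp) \<Rightarrow> bool" where
  "braid_equivariant sc n lam a \<longleftrightarrow>
    (\<forall>\<rho> x v. free_rep sc n \<rho> \<longrightarrow> x \<in> carrier (free_grp n) \<longrightarrow>
       fox_change n \<rho> a (conv_act sc n (\<lambda>y. \<rho> (a y)) lam x v) =
       conv_act sc n \<rho> lam (a x) (fox_change n \<rho> a v))"

text \<open>An endomorphism of the free group that acts on the generators like \<open>\<sigma>\<^sub>i\<close>.\<close>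

locale braid_generator = free_rep sc n \<rho>
  for sc :: "'k::field \<Rightarrow> 'e::ab_group_add \<Rightarrow> 'e" and n and \<rho> +
  fixes a :: "fgrp \<Rightarrow> fgrp" and i :: nat
  assumes a: "a \<in> hom F F" and i: "i \<in> {1..<n}"
    and a_i: "a (fgen n i) = fgen n (i + 1)"
    and a_Suc: "a (fgen n (i + 1)) = inv\<^bsub>F\<^esub> (fgen n (i + 1)) \<otimes>\<^bsub>F\<^esub> fgen n i \<otimes>\<^bsub>F\<^esub> fgen n (i + 1)"
    and a_other: "\<forall>j\<in>{1..n} - {i, i + 1}. a (fgen n j) = fgen n j"
begin

text \<open>The part of a row that comes from the coordinates other than \<open>i\<close> and \<open>i + 1\<close>, on which \<open>\<sigma>\<^sub>i\<close> acts trivially.\<close>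

definition rest :: "'k \<Rightarrow> nat \<Rightarrow> (fgrp \<Rightarrow> 'e \<Rightarrow> 'e) \<Rightarrow> (nat \<Rightarrow> 'e) \<Rightarrow> 'e" where
  "rest lam m \<rho>' v = (\<Sum>j\<in>{1..n} - {i, i + 1}. sc (lam_ge lam m j) (gdiff n \<rho>' j (v j)))"

abbreviation "X \<equiv> \<rho> (fgen n i)"
abbreviation "Y \<equiv> \<rho> (fgen n (i + 1))"
abbreviation "Y' \<equiv> \<rho> (inv\<^bsub>F\<^esub> (fgen n (i + 1)))"
abbreviation "\<rho>a \<equiv> \<lambda>x. \<rho> (a x)"

lemma i_mem: "i \<in> {1..n}" "i + 1 \<in> {1..n}"
  using i by (auto simp: atLeastAtMost_iff)

sublocale a: free_rep sc n \<rho>a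
  by (rule rep_comp[OF a])

lemma rho_a_i: "\<rho>a (fgen n i) = Y"
  by (simp only: a_i)

lemma rho_a_Suc: "\<rho>a (fgen n (i + 1)) u = Y' (X (Y u))"
  using i_mem by (simp only: a_Suc rep_mult F.m_closed F.inv_closed fgen_carrier)

lemma sum_split:
  "(\<Sum>j\<in>{1..n}. f j) = f i + f (i + 1) + (\<Sum>j\<in>{1..n} - {i, i + 1}. f j :: 'd::comm_monoid_add)"
proof -
  have "{1..n} = insert i (insert (i + 1) ({1..n} - {i, i + 1}))" using i_mem by auto
  then have "(\<Sum>j\<in>{1..n}. f j) = (\<Sum>j\<in>insert i (insert (i + 1) ({1..n} - {i, i + 1})). f j)" by simp
  then show ?thesis by (simp add: add.assoc)
qed

lemma row_split2:
  "row sc n \<rho>' lam m v = sc (lam - 1) (v m) + (sc (lam_ge lam m i) (gdiff n \<rho>' i (v i)) +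
    sc (lam_ge lam m (i + 1)) (gdiff n \<rho>' (i + 1) (v (i + 1))) + rest lam m \<rho>' v)"
  unfolding row_def rest_def by (subst sum_split) (rule HOL.refl)

lemma fox_change_braid:
  "fox_change n \<rho> a v = v(i := Y (v (i + 1)), i + 1 := v i + v (i + 1) - Y' (X (Y (v (i + 1)))))"
proof
  fix l
  show "fox_change n \<rho> a v l =
      (v(i := Y (v (i + 1)), i + 1 := v i + v (i + 1) - Y' (X (Y (v (i + 1)))))) l"
  proof (cases "l \<in> {1..n}")
    case True
    have "fox n \<rho> (a (fgen n (i + 1))) u = - delta (i + 1) (Y' (X (Y u))) + delta i (Y u) + delta (i + 1) u" for u
      using i_mem by (simp only: a_Suc fox_mult F.m_closed F.inv_closed fgen_carrier fox_inv fox_gen)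
    moreover have "(\<Sum>j\<in>{1..n} - {i, i + 1}. fox n \<rho> (a (fgen n j)) (v j) l) =
        (\<Sum>j\<in>{1..n} - {i, i + 1}. if j = l then v l else 0)"
      using a_other by (intro sum.cong) (auto simp: fox_gen delta_def)
    ultimately show ?thesis
      using True i_mem unfolding fox_change_def sum_split
      by (auto simp: a_i fox_gen delta_def fun_simps)
  next
    case False
    then show ?thesis using i_mem by (auto simp: fox_change_def)
  qed
qed

lemma rest_cong:
  assumes "\<And>j. j \<noteq> i \<Longrightarrow> j \<noteq> i + 1 \<Longrightarrow> u j = v j"
  shows "rest lam m \<rho>' u = rest lam m \<rho>' v"
  unfolding rest_def using assms by (intro sum.cong) auto

lemma rest_a: "rest lam m \<rho>a v = rest lam m \<rho> v"
  unfolding rest_def using a_other by (intro sum.cong) (auto simp: gdiff_def)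

lemma rest_Suc: "rest lam (i + 1) \<rho> v = rest lam i \<rho> v"
  unfolding rest_def by (intro sum.cong) (auto simp: lam_ge_def)

lemma row_eqs:
  "v i + row sc n \<rho>a lam i v = sc lam (Y (v i)) + (Y' (X (Y (v (i + 1)))) - v (i + 1)) + rest lam i \<rho> v"
  "v (i + 1) + row sc n \<rho>a lam (i + 1) v =
    sc lam (Y' (X (Y (v (i + 1))))) + sc lam (Y (v i) - v i) + rest lam i \<rho> v"
  "u (i + 1) + row sc n \<rho> lam (i + 1) u = sc lam (Y (u (i + 1))) + sc lam (X (u i) - u i) + rest lam i \<rho> u"
  "u i + row sc n \<rho> lam i u = sc lam (X (u i)) + (Y (u (i + 1)) - u (i + 1)) + rest lam i \<rho> u"
  by (simp_all add: row_split2 rest_a rest_Suc[simplified] lam_ge_def gdiff_def rho_a_i rho_a_Suc[simplified]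
      scale_left_diff_distrib scale_right_diff_distrib)

text \<open>Only the components \<open>i\<close> and \<open>i + 1\<close> are affected, so this is an identity between \<open>2 \<times> 2\<close> block matrices.  It uses
  that \<open>\<lambda>\<^bsub>\<ge>i\<^esub>\<close> and \<open>\<lambda>\<^bsub>\<ge>i+1\<^esub>\<close> differ only at \<open>i + 1\<close>.\<close>

lemma generator_equivariant:
  assumes lam: "lam \<noteq> 0" and j: "j \<in> {1..n}"
  shows "fox_change n \<rho> a (conv_act sc n \<rho>a lam (fgen n j) v) =
    conv_act sc n \<rho> lam (a (fgen n j)) (fox_change n \<rho> a v)"
proof -
  interpret N: free_rep "fscale sc" n "conv_act sc n \<rho> lam" by (rule conv_rep[OF lam])
  let ?C = "fox_change n \<rho> a"
  let ?N = "\<lambda>m v. v(m := v m + row sc n \<rho> lam m v)"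
  have gen: "conv_act sc n \<rho> lam (fgen n m) v = ?N m v" if "m \<in> {1..n}" for m v
    using conv_act_gen[OF lam that] .
  have gen': "conv_act sc n \<rho>a lam (fgen n m) v = v(m := v m + row sc n \<rho>a lam m v)" if "m \<in> {1..n}" for m
    using a.conv_act_gen[OF lam that] .
  note rep = rep_add rep_diff rep_scale rep_inv
  have x: "fgen n i \<in> carrier F" "fgen n (i + 1) \<in> carrier F" using i_mem by auto
  have C: "?C v i = Y (v (i + 1))" "?C v (i + 1) = v i + v (i + 1) - Y' (X (Y (v (i + 1))))"
    "m \<noteq> i \<Longrightarrow> m \<noteq> i + 1 \<Longrightarrow> ?C v m = v m" for v m
    by (simp_all add: fox_change_braid)
  have restC: "rest lam m \<rho> (?C v) = rest lam m \<rho> v" for m v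
    by (rule rest_cong) (simp add: C(3))
  have rest_upd: "rest lam m \<rho> (v(i := e)) = rest lam m \<rho> v" "rest lam m \<rho> (v(i + 1 := e)) = rest lam m \<rho> v"
    for m v e by (rule rest_cong; simp)+
  consider "j = i" | "j = i + 1" | "j \<noteq> i" "j \<noteq> i + 1" by blast
  then show ?thesis
  proof cases
    case 1
    let ?v = "v(i := v i + row sc n \<rho>a lam i v)"
    have "?C ?v = ?N (i + 1) (?C v)"
    proof
      fix l
      consider "l = i" | "l = i + 1" | "l \<noteq> i" "l \<noteq> i + 1" by blast
      then show "?C ?v l = ?N (i + 1) (?C v) l"
      proof cases
        case 2
        have "?C ?v (i + 1) = (v i + row sc n \<rho>a lam i v) + v (i + 1) - Y' (X (Y (v (i + 1))))"
          by (simp add: C(2)[simplified])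
        also have "\<dots> = sc lam (Y (v i)) + rest lam i \<rho> v" unfolding row_eqs(1) by simp
        also have "\<dots> = ?C v (i + 1) + row sc n \<rho> lam (i + 1) (?C v)"
          unfolding row_eqs(3) unfolding C restC using x
          by (simp add: rep rep[simplified] scale_right_diff_distrib scale_right_distrib)
        finally show ?thesis using 2 by simp
      qed (simp_all add: C C[simplified])
    qed
    then show ?thesis using 1 i_mem by (simp add: gen gen' a_i gen[simplified] a_i[simplified])
  next
    case 2
    let ?w = "v (i + 1) + row sc n \<rho>a lam (i + 1) v"
    let ?v = "v(i + 1 := ?w)"
    have "?N (i + 1) (?C ?v) = ?N i (?N (i + 1) (?C v))"
    proof -
      have l: "?C ?v (i + 1) + row sc n \<rho> lam (i + 1) (?C ?v) = sc lam (Y (v i)) + rest lam i \<rho> v"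
        unfolding row_eqs(3) unfolding C restC rest_upd using x
        by (simp add: rep rep[simplified] scale_right_diff_distrib scale_right_distrib)
      have r: "?C v (i + 1) + row sc n \<rho> lam (i + 1) (?C v) = sc lam (Y (v i)) + rest lam i \<rho> v"
        unfolding row_eqs(3) unfolding C restC using x
        by (simp add: rep rep[simplified] scale_right_diff_distrib scale_right_distrib)
      let ?u = "?N (i + 1) (?C v)"
      have "?u i + row sc n \<rho> lam i ?u = Y ?w"
        unfolding row_eqs(4) row_eqs(2) unfolding rest_upd restC r using x
        by (simp add: r r[simplified] C C[simplified] rep rep[simplified] scale_right_diff_distrib scale_right_distrib)
      moreover have "?C ?v i = Y ?w" by (simp add: C(1)[simplified])
      ultimately show ?thesis
        using l r C(3) by (auto simp: fun_eq_iff)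
    qed
    then have "conv_act sc n \<rho> lam (fgen n (i + 1)) (?C ?v) =
        conv_act sc n \<rho> lam (fgen n i) (conv_act sc n \<rho> lam (fgen n (i + 1)) (?C v))"
      using i_mem gen by metis
    then have "conv_act sc n \<rho> lam (inv\<^bsub>F\<^esub> (fgen n (i + 1))) (conv_act sc n \<rho> lam (fgen n (i + 1)) (?C ?v)) =
        conv_act sc n \<rho> lam (a (fgen n (i + 1))) (?C v)"
      using x by (simp only: a_Suc N.rep_mult F.m_closed F.inv_closed)
    then have "?C ?v = conv_act sc n \<rho> lam (a (fgen n (i + 1))) (?C v)"
      using x(2) by (simp only: N.rep_inv)
    then show ?thesis using 2 gen'[OF i_mem(2)] by metis
  next
    case 3
    have c: "lam_ge lam j (i + 1) = lam_ge lam j i" using 3 by (auto simp: lam_ge_def)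
    have "row sc n \<rho>a lam j v = row sc n \<rho> lam j (?C v)"
    proof -
      have "gdiff n \<rho>a i (v i) + gdiff n \<rho>a (i + 1) (v (i + 1)) =
          D i (?C v i) + D (i + 1) (?C v (i + 1))"
        using x unfolding gdiff_def rho_a_i rho_a_Suc C by (simp add: rep rep[simplified])
      then have "sc (lam_ge lam j i) (gdiff n \<rho>a i (v i)) + sc (lam_ge lam j i) (gdiff n \<rho>a (i + 1) (v (i + 1))) =
          sc (lam_ge lam j i) (D i (?C v i)) + sc (lam_ge lam j i) (D (i + 1) (?C v (i + 1)))"
        by (metis scale_right_distrib)
      then show ?thesis
        using 3 unfolding row_split2[of \<rho>] row_split2[of \<rho>a] rest_a restC c by (simp add: C(3))
    qed
    then have "?C (v(j := v j + row sc n \<rho>a lam j v)) = ?N j (?C v)"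
      using 3 by (auto simp: fox_change_braid fun_eq_iff)
    then show ?thesis using j 3 a_other by (simp add: gen gen')
  qed
qed

lemma generator_equivariant':
  assumes lam: "lam \<noteq> 0" and x: "x \<in> carrier F"
  shows "fox_change n \<rho> a (conv_act sc n \<rho>a lam x v) = conv_act sc n \<rho> lam (a x) (fox_change n \<rho> a v)"
proof -
  interpret ah: group_hom F F a using a by unfold_locales
  interpret N: free_rep "fscale sc" n "conv_act sc n \<rho> lam" by (rule conv_rep[OF lam])
  interpret N': free_rep "fscale sc" n "conv_act sc n \<rho>a lam" by (rule a.conv_rep[OF lam])
  have "\<forall>v. fox_change n \<rho> a (conv_act sc n \<rho>a lam x v) = conv_act sc n \<rho> lam (a x) (fox_change n \<rho> a v)"
    using x
  proof (induction rule: free_grp_induct)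
    case (inv x)
    then have "fox_change n \<rho> a v = conv_act sc n \<rho> lam (a x) (fox_change n \<rho> a (conv_act sc n \<rho>a lam (inv\<^bsub>F\<^esub> x) v))" for v
      using N'.rep_inv(2)[of x v] by metis
    then show ?case using inv(1) N.rep_inv(1)[of "a x"] by (metis ah.hom_inv ah.hom_closed)
  next
    case (mult x y)
    then show ?case by (simp add: N.rep_mult N'.rep_mult)
  qed (use lam in \<open>simp_all add: N.rep_one N'.rep_one generator_equivariant\<close>)
  then show ?thesis by simp
qed

end

lemma braid_equivariant_cong:
  fixes sc :: "'k::field \<Rightarrow> 'e::ab_group_add \<Rightarrow> 'e"
  assumes "\<And>x. x \<in> carrier (free_grp n) \<Longrightarrow> a x = b x" "braid_equivariant sc n lam b"
  shows "braid_equivariant sc n lam a"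
proof -
  have "fox_change n \<rho> a v = fox_change n \<rho> b v" for \<rho> :: "fgrp \<Rightarrow> 'e \<Rightarrow> 'e" and v
    unfolding fox_change_def using assms(1) by (auto simp: fun_eq_iff intro!: sum.cong)
  moreover have "conv_act sc n (\<lambda>y. \<rho> (a y)) lam = conv_act sc n (\<lambda>y. \<rho> (b y)) lam" for \<rho> :: "fgrp \<Rightarrow> 'e \<Rightarrow> 'e"
    using assms(1) by (intro conv_act_cong) simp
  ultimately show ?thesis using assms unfolding braid_equivariant_def by simp
qed

lemma braid_equivariant_comp:
  assumes a: "a \<in> hom (free_grp n) (free_grp n)" and b: "b \<in> hom (free_grp n) (free_grp n)"
    and "braid_equivariant sc n lam a" "braid_equivariant sc n lam b"
  shows "braid_equivariant sc n lam (\<lambda>x. a (b x))"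
  unfolding braid_equivariant_def
proof (intro allI impI)
  fix \<rho> x v assume rep: "free_rep sc n \<rho>" and x: "x \<in> carrier (free_grp n)"
  interpret free_rep sc n \<rho> by (rule rep)
  have bg: "\<forall>j\<in>{1..n}. b (fgen n j) \<in> carrier F" using b by (auto simp: hom_in_carrier)
  show "fox_change n \<rho> (\<lambda>x. a (b x)) (conv_act sc n (\<lambda>y. \<rho> (a (b y))) lam x v) =
      conv_act sc n \<rho> lam (a (b x)) (fox_change n \<rho> (\<lambda>x. a (b x)) v)"
    unfolding fox_change_comp[OF a bg]
    using assms(4)[unfolded braid_equivariant_def, rule_format, OF rep_comp[OF a] x, of v]
      assms(3)[unfolded braid_equivariant_def, rule_format, OF rep hom_in_carrier[OF b x]]
    by simp
qed

text \<open>The Jacobians of \<open>a\<close> and \<open>b\<close> are inverse to each other by the chain rule.\<close>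

lemma braid_equivariant_inverse:
  assumes a: "a \<in> hom (free_grp n) (free_grp n)" and b: "b \<in> hom (free_grp n) (free_grp n)"
    and ab: "\<And>x. x \<in> carrier (free_grp n) \<Longrightarrow> a (b x) = x" "\<And>x. x \<in> carrier (free_grp n) \<Longrightarrow> b (a x) = x"
    and "braid_equivariant sc n lam a"
  shows "braid_equivariant sc n lam b"
  unfolding braid_equivariant_def
proof (intro allI impI)
  fix \<rho> x v assume rep: "free_rep sc n \<rho>" and x: "x \<in> carrier (free_grp n)"
  interpret free_rep sc n \<rho> by (rule rep)
  let ?\<rho>b = "\<lambda>x. \<rho> (b x)"
  interpret b: free_rep sc n ?\<rho>b by (rule rep_comp[OF b])
  have bg: "\<forall>j\<in>{1..n}. b (fgen n j) \<in> carrier F" using b by (auto simp: hom_in_carrier)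
  have ag: "\<forall>j\<in>{1..n}. a (fgen n j) \<in> carrier F" using a by (auto simp: hom_in_carrier)
  have eq: "\<forall>j\<in>{1..n}. \<rho> (b (a (fgen n j))) = \<rho> (fgen n j)" using ab(2) by simp
  have C1: "fox_change n ?\<rho>b a (fox_change n \<rho> b v) = v" for v
    using b.fox_change_comp[OF a bg, of v] b.fox_change_id[of "\<lambda>x. a (b x)" v] ab(1)
    by (simp add: fox_change_cong[OF eq])
  have C2: "fox_change n \<rho> b (fox_change n ?\<rho>b a v) = v" for v
    using fox_change_comp[OF b ag, of v] fox_change_id[of "\<lambda>x. b (a x)" v] ab(2) by simp
  have "fox_change n ?\<rho>b a (conv_act sc n \<rho> lam (b x) (fox_change n \<rho> b v)) = conv_act sc n ?\<rho>b lam x v"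
    using assms(5)[unfolded braid_equivariant_def, rule_format, OF b.free_rep_axioms hom_in_carrier[OF b x],
        of "fox_change n \<rho> b v"] x
    by (simp add: C1 ab(1) conv_act_cong[OF eq])
  then show "fox_change n \<rho> b (conv_act sc n ?\<rho>b lam x v) = conv_act sc n \<rho> lam (b x) (fox_change n \<rho> b v)"
    by (metis C2)
qed

section \<open>Artin representations\<close>

text \<open>All braids have this property.  It is what makes \<open>K\<close> stable under \<open>G\<close>: if \<open>a(x\<^sub>j)\<close> is a
  conjugate of \<open>x\<^sub>l\<close>, its Jacobian sends a vector fixed by \<open>x\<^sub>j\<close> to one fixed by \<open>x\<^sub>l\<close>.\<close>

definition gens_conj :: "nat \<Rightarrow> (fgrp \<Rightarrow> fgrp) \<Rightarrow> bool" where
  "gens_conj n a \<longleftrightarrow> (\<forall>j\<in>{1..n}. \<exists>l\<in>{1..n}. \<exists>u\<in>carrier (free_grp n).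
     a (fgen n j) = u \<otimes>\<^bsub>free_grp n\<^esub> fgen n l \<otimes>\<^bsub>free_grp n\<^esub> inv\<^bsub>free_grp n\<^esub> u)"

lemma gens_conj_comp:
  assumes "a \<in> hom (free_grp n) (free_grp n)" "gens_conj n a" "gens_conj n b"
  shows "gens_conj n (\<lambda>x. a (b x))"
  unfolding gens_conj_def
proof
  interpret F: group "free_grp n" by (rule group_free_grp)
  interpret ah: group_hom "free_grp n" "free_grp n" a using assms(1) by unfold_locales
  fix j assume "j \<in> {1..n}"
  then obtain l u where l: "l \<in> {1..n}" "u \<in> carrier (free_grp n)"
    "b (fgen n j) = u \<otimes>\<^bsub>free_grp n\<^esub> fgen n l \<otimes>\<^bsub>free_grp n\<^esub> inv\<^bsub>free_grp n\<^esub> u"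
    using assms(3) by (auto simp: gens_conj_def)
  obtain m w where m: "m \<in> {1..n}" "w \<in> carrier (free_grp n)"
    "a (fgen n l) = w \<otimes>\<^bsub>free_grp n\<^esub> fgen n m \<otimes>\<^bsub>free_grp n\<^esub> inv\<^bsub>free_grp n\<^esub> w"
    using assms(2) l(1) by (auto simp: gens_conj_def)
  have "a (b (fgen n j)) = (a u \<otimes>\<^bsub>free_grp n\<^esub> w) \<otimes>\<^bsub>free_grp n\<^esub> fgen n m \<otimes>\<^bsub>free_grp n\<^esub>
      inv\<^bsub>free_grp n\<^esub> (a u \<otimes>\<^bsub>free_grp n\<^esub> w)"
    using l m by (simp add: F.inv_mult_group F.m_assoc)
  then show "\<exists>l\<in>{1..n}. \<exists>u\<in>carrier (free_grp n).
      a (b (fgen n j)) = u \<otimes>\<^bsub>free_grp n\<^esub> fgen n l \<otimes>\<^bsub>free_grp n\<^esub> inv\<^bsub>free_grp n\<^esub> u"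
    using l m by (meson F.m_closed ah.hom_closed)
qed

lemma AutoGroup_apply:
  assumes "group F"
  shows "f \<in> carrier (AutoGroup F) \<Longrightarrow> f \<in> hom F F"
    and "f \<in> carrier (AutoGroup F) \<Longrightarrow> g \<in> carrier (AutoGroup F) \<Longrightarrow> x \<in> carrier F \<Longrightarrow>
      (f \<otimes>\<^bsub>AutoGroup F\<^esub> g) x = f (g x)"
    and "x \<in> carrier F \<Longrightarrow> \<one>\<^bsub>AutoGroup F\<^esub> x = x"
proof -
  interpret group F by fact
  show "f \<in> carrier (AutoGroup F) \<Longrightarrow> f \<in> hom F F" by (simp add: AutoGroup_def auto_def)
  show "f \<in> carrier (AutoGroup F) \<Longrightarrow> g \<in> carrier (AutoGroup F) \<Longrightarrow> x \<in> carrier F \<Longrightarrow>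
      (f \<otimes>\<^bsub>AutoGroup F\<^esub> g) x = f (g x)"
    by (auto simp: AutoGroup_def BijGroup_def auto_def compose_def)
  show "x \<in> carrier F \<Longrightarrow> \<one>\<^bsub>AutoGroup F\<^esub> x = x" by (simp add: AutoGroup_def BijGroup_def)
qed

locale artin_map =
  fixes n :: nat and \<theta>
  assumes artin_hom: "artin_hom n \<theta>"
begin

abbreviation "B \<equiv> braid_group n"
abbreviation "F \<equiv> free_grp n"

sublocale F: group F by (rule group_free_grp)

lemma group_B: "group B"
  by (simp add: braid_group_def group_pres_group)

sublocale B: group B by (rule group_B)

lemma theta_hom: "\<theta> \<in> hom B (AutoGroup F)"
  using artin_hom by (simp add: artin_hom_def)

lemma theta_Auto: "b \<in> carrier B \<Longrightarrow> \<theta> b \<in> carrier (AutoGroup F)"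
  by (rule hom_in_carrier[OF theta_hom])

lemma theta_endo: "b \<in> carrier B \<Longrightarrow> \<theta> b \<in> hom F F"
  by (rule AutoGroup_apply(1)[OF group_free_grp theta_Auto])

lemma theta_mult: "b \<in> carrier B \<Longrightarrow> c \<in> carrier B \<Longrightarrow> x \<in> carrier F \<Longrightarrow> \<theta> (b \<otimes>\<^bsub>B\<^esub> c) x = \<theta> b (\<theta> c x)"
  by (simp add: hom_mult[OF theta_hom] AutoGroup_apply(2)[OF group_free_grp] theta_Auto)

lemma theta_one: "x \<in> carrier F \<Longrightarrow> \<theta> \<one>\<^bsub>B\<^esub> x = x"
  using hom_one[OF theta_hom group_B F.AutoGroup] by (simp add: AutoGroup_apply(3)[OF group_free_grp])

lemma theta_inv:
  assumes "b \<in> carrier B" "x \<in> carrier F"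
  shows "\<theta> b (\<theta> (inv\<^bsub>B\<^esub> b) x) = x" "\<theta> (inv\<^bsub>B\<^esub> b) (\<theta> b x) = x"
  using assms by (simp_all add: theta_mult[symmetric] theta_one)

lemma bgen_carrier: "i \<in> {1..<n} \<Longrightarrow> bgen n i \<in> carrier B"
  by (auto simp: bgen_def braid_group_def carrier_pres_group)

lemmas braid_induct [consumes 1, case_names one gen inv mult] =
  pres_group_induct[where S = "{1..<n}" and R = "braid_rels n", folded braid_group_def bgen_def]

lemma theta_gen:
  assumes "i \<in> {1..<n}"
  shows "\<theta> (bgen n i) (fgen n i) = fgen n (i + 1)"
    and "\<theta> (bgen n i) (fgen n (i + 1)) = inv\<^bsub>F\<^esub> (fgen n (i + 1)) \<otimes>\<^bsub>F\<^esub> fgen n i \<otimes>\<^bsub>F\<^esub> fgen n (i + 1)"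
    and "\<forall>j\<in>{1..n} - {i, i + 1}. \<theta> (bgen n i) (fgen n j) = fgen n j"
  using artin_hom assms by (auto simp: artin_hom_def)

lemma theta_equivariant:
  assumes "b \<in> carrier B" "lam \<noteq> 0"
  shows "braid_equivariant sc n lam (\<theta> b)"
  using assms(1)
proof (induction rule: braid_induct)
  case one
  show ?case
    by (rule braid_equivariant_cong[of _ _ "\<lambda>x. x"])
      (auto simp: theta_one braid_equivariant_def free_rep.fox_change_id)
next
  case (gen i)
  show ?case unfolding braid_equivariant_def
  proof (intro allI impI)
    fix \<rho> x v assume rep: "free_rep sc n \<rho>" and x: "x \<in> carrier F"
    interpret g: braid_generator sc n \<rho> "\<theta> (bgen n i)" i
      using rep gen theta_gen[OF gen] theta_endo[OF bgen_carrier[OF gen]]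
      by (intro braid_generator.intro braid_generator_axioms.intro) auto
    show "fox_change n \<rho> (\<theta> (bgen n i)) (conv_act sc n (\<lambda>y. \<rho> (\<theta> (bgen n i) y)) lam x v) =
        conv_act sc n \<rho> lam (\<theta> (bgen n i) x) (fox_change n \<rho> (\<theta> (bgen n i)) v)"
      by (rule g.generator_equivariant'[OF assms(2) x])
  qed
next
  case (inv b)
  show ?case
    using theta_endo[OF inv(1)] theta_endo[OF B.inv_closed[OF inv(1)]] theta_inv(1)[OF inv(1)]
      theta_inv(2)[OF inv(1)] inv(2)
    by (rule braid_equivariant_inverse)
next
  case (mult b c)
  show ?case
    using theta_mult[OF mult(1,2)]
      braid_equivariant_comp[OF theta_endo[OF mult(1)] theta_endo[OF mult(2)] mult(3,4)]
    by (rule braid_equivariant_cong)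
qed

lemma gens_conj_cong: "(\<And>x. x \<in> carrier F \<Longrightarrow> a x = b x) \<Longrightarrow> gens_conj n a \<longleftrightarrow> gens_conj n b"
  by (simp add: gens_conj_def)

text \<open>The induction runs over a braid and its inverse together, as a generator and its inverse have to be checked separately.\<close>

lemma theta_conj:
  assumes "b \<in> carrier B"
  shows "gens_conj n (\<theta> b)"
proof -
  have "gens_conj n (\<theta> b) \<and> gens_conj n (\<theta> (inv\<^bsub>B\<^esub> b))" using assms
  proof (induction rule: braid_induct)
    case one
    have "gens_conj n (\<theta> \<one>\<^bsub>B\<^esub>)" unfolding gens_conj_def
    proof
      fix j assume "j \<in> {1..n}"
      then show "\<exists>l\<in>{1..n}. \<exists>u\<in>carrier F. \<theta> \<one>\<^bsub>B\<^esub> (fgen n j) = u \<otimes>\<^bsub>F\<^esub> fgen n l \<otimes>\<^bsub>F\<^esub> inv\<^bsub>F\<^esub> u"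
        by (intro bexI[of _ j] bexI[of _ "\<one>\<^bsub>F\<^esub>"]) (simp_all add: theta_one)
    qed
    then show ?case by simp
  next
    case (gen i)
    let ?x = "fgen n i" and ?y = "fgen n (i + 1)" and ?b = "bgen n i"
    have mem: "i \<in> {1..n}" "i + 1 \<in> {1..n}" using gen by (auto simp: atLeastAtMost_iff)
    note xy = mem[THEN fgen_carrier]
    have b: "?b \<in> carrier B" by (rule bgen_carrier[OF gen])
    have "\<exists>l\<in>{1..n}. \<exists>u\<in>carrier F. \<theta> ?b (fgen n j) = u \<otimes>\<^bsub>F\<^esub> fgen n l \<otimes>\<^bsub>F\<^esub> inv\<^bsub>F\<^esub> u"
      if j: "j \<in> {1..n}" for j
    proof -
      consider "j = i" | "j = i + 1" | "j \<in> {1..n} - {i, i + 1}" using j by blast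
      then show ?thesis
      proof cases
        case 1
        then show ?thesis using mem xy theta_gen(1)[OF gen]
          by (intro bexI[of _ "i + 1"] bexI[of _ "\<one>\<^bsub>F\<^esub>"]) simp_all
      next
        case 2
        have "\<theta> ?b ?y = inv\<^bsub>F\<^esub> ?y \<otimes>\<^bsub>F\<^esub> ?x \<otimes>\<^bsub>F\<^esub> inv\<^bsub>F\<^esub> (inv\<^bsub>F\<^esub> ?y)"
          using theta_gen(2)[OF gen] xy by (simp only: F.inv_inv)
        then show ?thesis using 2 mem xy by (metis F.inv_closed)
      next
        case 3
        then show ?thesis using theta_gen(3)[OF gen]
          by (intro bexI[of _ j] bexI[of _ "\<one>\<^bsub>F\<^esub>"]) simp_all
      qed
    qed
    moreover have "\<exists>l\<in>{1..n}. \<exists>u\<in>carrier F. \<theta> (inv\<^bsub>B\<^esub> ?b) (fgen n j) = u \<otimes>\<^bsub>F\<^esub> fgen n l \<otimes>\<^bsub>F\<^esub> inv\<^bsub>F\<^esub> u"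
      if j: "j \<in> {1..n}" for j
    proof -
      interpret I: group_hom F F "\<theta> (inv\<^bsub>B\<^esub> ?b)"
        using theta_endo[of "inv\<^bsub>B\<^esub> ?b"] b by unfold_locales simp
      have y: "\<theta> (inv\<^bsub>B\<^esub> ?b) ?y = ?x"
        using theta_inv(2)[OF b xy(1)] theta_gen(1)[OF gen] by simp
      consider "j = i + 1" | "j = i" | "j \<in> {1..n} - {i, i + 1}" using j by blast
      then show ?thesis
      proof cases
        case 1
        then show ?thesis using mem xy y by (intro bexI[of _ i] bexI[of _ "\<one>\<^bsub>F\<^esub>"]) simp_all
      next
        case 2
        have "?y = \<theta> (inv\<^bsub>B\<^esub> ?b) (inv\<^bsub>F\<^esub> ?y \<otimes>\<^bsub>F\<^esub> ?x \<otimes>\<^bsub>F\<^esub> ?y)"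
          using theta_inv(2)[OF b xy(2)] theta_gen(2)[OF gen] by simp
        also have "\<dots> = inv\<^bsub>F\<^esub> ?x \<otimes>\<^bsub>F\<^esub> \<theta> (inv\<^bsub>B\<^esub> ?b) ?x \<otimes>\<^bsub>F\<^esub> ?x"
          using xy y by (simp add: y[simplified])
        finally have "\<theta> (inv\<^bsub>B\<^esub> ?b) ?x = ?x \<otimes>\<^bsub>F\<^esub> ?y \<otimes>\<^bsub>F\<^esub> inv\<^bsub>F\<^esub> ?x"
          using xy I.hom_closed[of ?x]
          by (metis F.inv_closed F.inv_solve_right F.inv_solve_left F.m_assoc F.m_closed)
        then show ?thesis using 2 mem xy by metis
      next
        case 3
        then have "\<theta> (inv\<^bsub>B\<^esub> ?b) (fgen n j) = fgen n j"
          using theta_gen(3)[OF gen] theta_inv(2)[OF b, of "fgen n j"] by auto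
        then show ?thesis using 3
          by (intro bexI[of _ j] bexI[of _ "\<one>\<^bsub>F\<^esub>"]) simp_all
      qed
    qed
    ultimately show ?case by (simp add: gens_conj_def)
  next
    case (inv b)
    then show ?case by simp
  next
    case (mult b c)
    have "gens_conj n (\<theta> (b \<otimes>\<^bsub>B\<^esub> c)) \<longleftrightarrow> gens_conj n (\<lambda>x. \<theta> b (\<theta> c x))"
      using mult by (intro gens_conj_cong) (simp add: theta_mult)
    moreover have "gens_conj n (\<theta> (inv\<^bsub>B\<^esub> (b \<otimes>\<^bsub>B\<^esub> c))) \<longleftrightarrow> gens_conj n (\<lambda>x. \<theta> (inv\<^bsub>B\<^esub> c) (\<theta> (inv\<^bsub>B\<^esub> b) x))"
      using mult by (intro gens_conj_cong) (simp add: theta_mult B.inv_mult_group)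
    ultimately show ?case
      using mult by (simp add: gens_conj_comp theta_endo)
  qed
  then show ?thesis ..
qed

end

section \<open>The semidirect product\<close>

locale artin =
  fixes n :: nat and G :: "('g, 'z) monoid_scheme" and \<alpha> :: "'g \<Rightarrow> fgrp \<Rightarrow> fgrp"
  assumes artin: "artin_rep n G \<alpha>"
begin

abbreviation "F \<equiv> free_grp n"
abbreviation "H \<equiv> semidirect (free_grp n) G \<alpha>"

lemma group_G: "group G"
  using artin by (simp add: artin_rep_def)

sublocale F: group F by (rule group_free_grp)
sublocale G: group G by (rule group_G)

lemma alpha_hom: "\<alpha> \<in> hom G (AutoGroup F)"
  using artin by (simp add: artin_rep_def)

lemma alpha_endo: "g \<in> carrier G \<Longrightarrow> \<alpha> g \<in> hom F F"
  using hom_in_carrier[OF alpha_hom] by (simp add: AutoGroup_apply(1)[OF group_free_grp])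

lemma alpha_closed [simp]: "g \<in> carrier G \<Longrightarrow> x \<in> carrier F \<Longrightarrow> \<alpha> g x \<in> carrier F"
  using hom_in_carrier[OF alpha_endo] by simp

lemma alpha_x_mult:
  "g \<in> carrier G \<Longrightarrow> x \<in> carrier F \<Longrightarrow> y \<in> carrier F \<Longrightarrow> \<alpha> g (x \<otimes>\<^bsub>F\<^esub> y) = \<alpha> g x \<otimes>\<^bsub>F\<^esub> \<alpha> g y"
  by (rule hom_mult[OF alpha_endo])

lemma alpha_x_one: "g \<in> carrier G \<Longrightarrow> \<alpha> g \<one>\<^bsub>F\<^esub> = \<one>\<^bsub>F\<^esub>"
  by (rule hom_one[OF alpha_endo F.is_group F.is_group])

lemma alpha_mult:
  "g \<in> carrier G \<Longrightarrow> h \<in> carrier G \<Longrightarrow> x \<in> carrier F \<Longrightarrow> \<alpha> (g \<otimes>\<^bsub>G\<^esub> h) x = \<alpha> g (\<alpha> h x)"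
  by (simp add: hom_mult[OF alpha_hom] AutoGroup_apply(2)[OF group_free_grp] hom_in_carrier[OF alpha_hom])

lemma alpha_one: "x \<in> carrier F \<Longrightarrow> \<alpha> \<one>\<^bsub>G\<^esub> x = x"
  using hom_one[OF alpha_hom group_G F.AutoGroup] by (simp add: AutoGroup_apply(3)[OF group_free_grp])

lemma alpha_inv:
  "g \<in> carrier G \<Longrightarrow> x \<in> carrier F \<Longrightarrow> \<alpha> g (\<alpha> (inv\<^bsub>G\<^esub> g) x) = x"
  "g \<in> carrier G \<Longrightarrow> x \<in> carrier F \<Longrightarrow> \<alpha> (inv\<^bsub>G\<^esub> g) (\<alpha> g x) = x"
  by (simp_all add: alpha_mult[symmetric] alpha_one)

lemma alpha_gens: "g \<in> carrier G \<Longrightarrow> \<forall>j\<in>{1..n}. \<alpha> g (fgen n j) \<in> carrier F"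
  by simp

lemma alpha_equivariant: "g \<in> carrier G \<Longrightarrow> lam \<noteq> 0 \<Longrightarrow> braid_equivariant sc n lam (\<alpha> g)"
  and alpha_conj: "g \<in> carrier G \<Longrightarrow> gens_conj n (\<alpha> g)"
proof -
  obtain \<theta> \<beta> where t: "artin_hom n \<theta>" "\<beta> \<in> hom G (braid_group n)" "\<forall>g\<in>carrier G. \<alpha> g = \<theta> (\<beta> g)"
    using artin by (auto simp: artin_rep_def)
  interpret t: artin_map n \<theta> by unfold_locales (rule t)
  assume "g \<in> carrier G"
  with t have g: "\<alpha> g = \<theta> (\<beta> g)" "\<beta> g \<in> carrier (braid_group n)" by (auto simp: hom_in_carrier)
  show "lam \<noteq> 0 \<Longrightarrow> braid_equivariant sc n lam (\<alpha> g)" using g t.theta_equivariant by simp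
  show "gens_conj n (\<alpha> g)" using g t.theta_conj by simp
qed

lemma H_sel: "carrier H = carrier F \<times> carrier G"
  "(x, g) \<otimes>\<^bsub>H\<^esub> (y, h) = (x \<otimes>\<^bsub>F\<^esub> \<alpha> g y, g \<otimes>\<^bsub>G\<^esub> h)" "\<one>\<^bsub>H\<^esub> = (\<one>\<^bsub>F\<^esub>, \<one>\<^bsub>G\<^esub>)"
  by (simp_all add: semidirect_def)

lemma group_H: "group H"
proof (rule groupI)
  fix p assume "p \<in> carrier H"
  then obtain x g where p: "p = (x, g)" "x \<in> carrier F" "g \<in> carrier G" by (auto simp: H_sel)
  have "(\<alpha> (inv\<^bsub>G\<^esub> g) (inv\<^bsub>F\<^esub> x), inv\<^bsub>G\<^esub> g) \<otimes>\<^bsub>H\<^esub> p = \<one>\<^bsub>H\<^esub>"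
    using p by (simp add: H_sel alpha_x_mult[symmetric] alpha_x_one)
  then show "\<exists>q\<in>carrier H. q \<otimes>\<^bsub>H\<^esub> p = \<one>\<^bsub>H\<^esub>"
    using p by (intro bexI[of _ "(\<alpha> (inv\<^bsub>G\<^esub> g) (inv\<^bsub>F\<^esub> x), inv\<^bsub>G\<^esub> g)"]) (auto simp: H_sel)
qed (auto simp: H_sel alpha_x_mult alpha_mult alpha_one F.m_assoc G.m_assoc)

lemma embed_hom: "(\<lambda>x. (x, \<one>\<^bsub>G\<^esub>)) \<in> hom F H"
  by (auto simp: hom_def H_sel alpha_one)

end

text \<open>The Long-Moody action in coordinates: \<open>g\<close> acts on \<open>I\<close> through its Jacobian and on \<open>V\<close> by \<open>\<rho>\<close>, and then \<open>x\<close> acts by the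
  convolution.\<close>

definition lm_act ::
  "('k::field \<Rightarrow> 'e \<Rightarrow> 'e) \<Rightarrow> nat \<Rightarrow> ('g, 'z) monoid_scheme \<Rightarrow> ('g \<Rightarrow> fgrp \<Rightarrow> fgrp) \<Rightarrow> (fgrp \<times> 'g \<Rightarrow> 'e \<Rightarrow> 'e) \<Rightarrow>
   'k \<Rightarrow> fgrp \<times> 'g \<Rightarrow> (nat \<Rightarrow> 'e) \<Rightarrow> nat \<Rightarrow> 'e::ab_group_add" where
  "lm_act sc n G \<alpha> \<rho> lam = (\<lambda>(x, g) v.
     conv_act sc n (\<lambda>x. \<rho> (x, \<one>\<^bsub>G\<^esub>)) lam x
       (fox_change n (\<lambda>x. \<rho> (x, \<one>\<^bsub>G\<^esub>)) (\<alpha> g) (\<lambda>j. \<rho> (\<one>\<^bsub>free_grp n\<^esub>, g) (v j))))"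

locale artin_module = artin n G \<alpha> + group_rep sc "semidirect (free_grp n) G \<alpha>" \<rho>
  for n and G :: "('g, 'z) monoid_scheme" and \<alpha> and sc :: "'k::field \<Rightarrow> 'e::ab_group_add \<Rightarrow> 'e" and \<rho>
begin

abbreviation "\<rho>F \<equiv> \<lambda>x. \<rho> (x, \<one>\<^bsub>G\<^esub>)"
abbreviation "\<rho>G \<equiv> \<lambda>g. \<rho> (\<one>\<^bsub>F\<^esub>, g)"

sublocale f: free_rep sc n \<rho>F
proof (intro free_rep.intro group_rep.intro vector_space_axioms group_rep_axioms.intro F.is_group)
  fix x y u assume "x \<in> carrier F" "y \<in> carrier F"
  then show "\<rho> (x \<otimes>\<^bsub>F\<^esub> y, \<one>\<^bsub>G\<^esub>) u = \<rho> (x, \<one>\<^bsub>G\<^esub>) (\<rho> (y, \<one>\<^bsub>G\<^esub>) u)"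
    using rep_mult[of "(x, \<one>\<^bsub>G\<^esub>)" "(y, \<one>\<^bsub>G\<^esub>)" u] by (simp add: H_sel alpha_one)
next
  fix u show "\<rho> (\<one>\<^bsub>F\<^esub>, \<one>\<^bsub>G\<^esub>) u = u" using rep_one by (simp add: H_sel)
qed (simp_all add: rep_add rep_scale H_sel)

lemma rho_split: "x \<in> carrier F \<Longrightarrow> g \<in> carrier G \<Longrightarrow> \<rho> (x, g) u = \<rho>F x (\<rho>G g u)"
  using rep_mult[of "(x, \<one>\<^bsub>G\<^esub>)" "(\<one>\<^bsub>F\<^esub>, g)" u] by (simp add: H_sel alpha_x_one)

lemma rho_commute: "x \<in> carrier F \<Longrightarrow> g \<in> carrier G \<Longrightarrow> \<rho>G g (\<rho>F x u) = \<rho>F (\<alpha> g x) (\<rho>G g u)"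
  using rep_mult[of "(\<one>\<^bsub>F\<^esub>, g)" "(x, \<one>\<^bsub>G\<^esub>)" u] rho_split[of "\<alpha> g x" g u] by (simp add: H_sel)

lemma rhoG_mult: "g \<in> carrier G \<Longrightarrow> h \<in> carrier G \<Longrightarrow> \<rho>G (g \<otimes>\<^bsub>G\<^esub> h) u = \<rho>G g (\<rho>G h u)"
  using rep_mult[of "(\<one>\<^bsub>F\<^esub>, g)" "(\<one>\<^bsub>F\<^esub>, h)" u] by (simp add: H_sel alpha_x_one)

lemma rhoG_map: "g \<in> carrier G \<Longrightarrow> free_rep_map sc sc n \<rho>F (\<lambda>x. \<rho>F (\<alpha> g x)) (\<rho>G g)"
  by (intro free_rep_map.intro free_rep_map_axioms.intro f.free_rep_axioms f.rep_comp alpha_endo)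
    (auto simp: rep_add rep_scale H_sel rho_commute)

abbreviation "lm_G \<equiv> \<lambda>g v. fox_change n \<rho>F (\<alpha> g) (\<lambda>j. \<rho>G g (v j))"

lemma lm_act_eq: "lm_act sc n G \<alpha> \<rho> lam (x, g) v = conv_act sc n \<rho>F lam x (lm_G g v)"
  by (simp add: lm_act_def)

lemma lm_G_mult:
  assumes "g \<in> carrier G" "h \<in> carrier G"
  shows "lm_G (g \<otimes>\<^bsub>G\<^esub> h) v = lm_G g (lm_G h v)"
proof -
  interpret g: free_rep_map sc sc n \<rho>F "\<lambda>x. \<rho>F (\<alpha> g x)" "\<rho>G g" by (rule rhoG_map[OF assms(1)])
  have "lm_G (g \<otimes>\<^bsub>G\<^esub> h) v = fox_change n \<rho>F (\<lambda>x. \<alpha> g (\<alpha> h x)) (\<lambda>j. \<rho>G g (\<rho>G h (v j)))"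
    unfolding fox_change_def using assms by (auto simp: fun_eq_iff rhoG_mult alpha_mult intro!: sum.cong)
  also have "\<dots> = fox_change n \<rho>F (\<alpha> g) (fox_change n (\<lambda>x. \<rho>F (\<alpha> g x)) (\<alpha> h) (\<lambda>j. \<rho>G g (\<rho>G h (v j))))"
    using assms by (intro f.fox_change_comp alpha_endo alpha_gens)
  also have "fox_change n (\<lambda>x. \<rho>F (\<alpha> g x)) (\<alpha> h) (\<lambda>j. \<rho>G g (\<rho>G h (v j))) = (\<lambda>j. \<rho>G g (lm_G h v j))"
    by (rule g.L_fox_change[OF alpha_gens[OF assms(2)], symmetric])
  finally show ?thesis .
qed

lemma lm_G_one: "lm_G \<one>\<^bsub>G\<^esub> v = v"
  using f.fox_change_id[of "\<alpha> \<one>\<^bsub>G\<^esub>"] by (simp add: alpha_one f.rep_one)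

lemma lm_G_conv:
  assumes "lam \<noteq> 0" "x \<in> carrier F" "g \<in> carrier G"
  shows "lm_G g (conv_act sc n \<rho>F lam x v) = conv_act sc n \<rho>F lam (\<alpha> g x) (lm_G g v)"
proof -
  interpret g: free_rep_map sc sc n \<rho>F "\<lambda>x. \<rho>F (\<alpha> g x)" "\<rho>G g" by (rule rhoG_map[OF assms(3)])
  show ?thesis
    unfolding g.L_conv[OF assms(1,2)]
    using alpha_equivariant[OF assms(3,1), unfolded braid_equivariant_def, rule_format, OF f.free_rep_axioms assms(2)] .
qed

lemma lm_G_add: "g \<in> carrier G \<Longrightarrow> lm_G g (u + v) = lm_G g u + lm_G g v"
proof -
  assume g: "g \<in> carrier G"
  have "(\<lambda>j. \<rho>G g ((u + v) j)) = (\<lambda>j. \<rho>G g (u j)) + (\<lambda>j. \<rho>G g (v j))"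
    using g by (auto simp: fun_simps rep_add H_sel)
  then show ?thesis by (simp only: f.fox_change_add[OF alpha_gens[OF g]])
qed

lemma lm_G_scale: "g \<in> carrier G \<Longrightarrow> lm_G g (fscale sc c v) = fscale sc c (lm_G g v)"
proof -
  assume g: "g \<in> carrier G"
  have "(\<lambda>j. \<rho>G g (fscale sc c v j)) = fscale sc c (\<lambda>j. \<rho>G g (v j))"
    using g by (auto simp: fun_simps rep_scale H_sel fun_eq_iff)
  then show ?thesis by (simp only: f.fox_change_scale[OF alpha_gens[OF g]])
qed

text \<open>The relation \<open>g x = \<alpha>(g)(x) g\<close> of the semidirect product holds by braid equivariance.\<close>

lemma lm_rep:
  assumes lam: "lam \<noteq> 0"
  shows "artin_module n G \<alpha> (fscale sc) (lm_act sc n G \<alpha> \<rho> lam)"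
proof -
  interpret N: free_rep "fscale sc" n "conv_act sc n \<rho>F lam" by (rule f.conv_rep[OF lam])
  have "group_rep (fscale sc) H (lm_act sc n G \<alpha> \<rho> lam)"
  proof (intro group_rep.intro N.vector_space_axioms group_rep_axioms.intro group_H)
    fix p assume "p \<in> carrier H"
    then obtain x g where p: "p = (x, g)" "x \<in> carrier F" "g \<in> carrier G" by (auto simp: H_sel)
    show "lm_act sc n G \<alpha> \<rho> lam p (u + v) = lm_act sc n G \<alpha> \<rho> lam p u + lm_act sc n G \<alpha> \<rho> lam p v" for u v
      using p by (simp only: lm_act_eq lm_G_add N.rep_add)
    show "lm_act sc n G \<alpha> \<rho> lam p (fscale sc c u) = fscale sc c (lm_act sc n G \<alpha> \<rho> lam p u)" for c u
      using p by (simp only: lm_act_eq lm_G_scale N.rep_scale)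
    fix p' v assume "p' \<in> carrier H"
    then obtain y h where p': "p' = (y, h)" "y \<in> carrier F" "h \<in> carrier G" by (auto simp: H_sel)
    show "lm_act sc n G \<alpha> \<rho> lam (p \<otimes>\<^bsub>H\<^esub> p') v = lm_act sc n G \<alpha> \<rho> lam p (lm_act sc n G \<alpha> \<rho> lam p' v)"
      using p p' by (simp only: H_sel lm_act_eq lm_G_mult lm_G_conv[OF lam p'(2) p(3)] N.rep_mult alpha_closed)
  next
    fix v show "lm_act sc n G \<alpha> \<rho> lam \<one>\<^bsub>H\<^esub> v = v"
      by (simp only: H_sel lm_act_eq lm_G_one N.rep_one)
  qed
  then show ?thesis by (intro artin_module.intro artin_axioms)
qed

lemma lm_act_F: "lm_act sc n G \<alpha> \<rho> lam (x, \<one>\<^bsub>G\<^esub>) = conv_act sc n \<rho>F lam x"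
  by (rule ext) (simp only: lm_act_eq lm_G_one)

lemma lm_act_G: "lam \<noteq> 0 \<Longrightarrow> lm_act sc n G \<alpha> \<rho> lam (\<one>\<^bsub>F\<^esub>, g) = lm_G g"
proof -
  assume lam: "lam \<noteq> 0"
  interpret N: free_rep "fscale sc" n "conv_act sc n \<rho>F lam" by (rule f.conv_rep[OF lam])
  show ?thesis by (rule ext) (simp only: lm_act_eq N.rep_one)
qed

text \<open>By the fundamental formula, the Jacobian sends the multiplication by \<open>x\<^sub>j - 1\<close> to the one by \<open>\<alpha>(g)(x\<^sub>j) - 1\<close>.\<close>

lemma aug_sum_lm_G:
  assumes g: "g \<in> carrier G"
  shows "aug_sum n \<rho>F (lm_G g v) = \<rho>G g (aug_sum n \<rho>F v)"
proof -
  have "aug_sum n \<rho>F (lm_G g v) = (\<Sum>l\<in>{1..n}. gdiff n \<rho>F l (\<Sum>j\<in>{1..n}. fox n \<rho>F (\<alpha> g (fgen n j)) (\<rho>G g (v j)) l))"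
    unfolding aug_sum_def fox_change_def by (intro sum.cong) auto
  also have "\<dots> = (\<Sum>l\<in>{1..n}. \<Sum>j\<in>{1..n}. gdiff n \<rho>F l (fox n \<rho>F (\<alpha> g (fgen n j)) (\<rho>G g (v j)) l))"
  proof (rule sum.cong[OF HOL.refl])
    fix l assume l: "l \<in> {1..n}"
    show "gdiff n \<rho>F l (\<Sum>j\<in>{1..n}. f j) = (\<Sum>j\<in>{1..n}. gdiff n \<rho>F l (f j))" for f
      using l by (induction "{1..n}" rule: infinite_finite_induct) (auto simp: gdiff_def f.rep_sum sum_subtractf)
  qed
  also have "\<dots> = (\<Sum>j\<in>{1..n}. aug_sum n \<rho>F (fox n \<rho>F (\<alpha> g (fgen n j)) (\<rho>G g (v j))))"
    unfolding aug_sum_def by (rule sum.swap)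
  also have "\<dots> = (\<Sum>j\<in>{1..n}. \<rho>G g (gdiff n \<rho>F j (v j)))"
    using g by (intro sum.cong HOL.refl) (simp add: f.aug_sum_fox gdiff_def rep_diff H_sel rho_commute)
  also have "\<dots> = \<rho>G g (aug_sum n \<rho>F v)"
    using g by (simp add: aug_sum_def rep_sum H_sel)
  finally show ?thesis .
qed

text \<open>The multiplication map \<open>I \<otimes> V \<rightarrow> V\<close> is equivariant for the untwisted action, and applied to
  \<open>I \<otimes> (I \<otimes> V)\<close> it multiplies the twisting parameters.\<close>

lemma aug_sum_lm_one:
  assumes "h \<in> carrier H"
  shows "aug_sum n \<rho>F (lm_act sc n G \<alpha> \<rho> 1 h v) = \<rho> h (aug_sum n \<rho>F v)"
proof -
  obtain x g where h: "h = (x, g)" "x \<in> carrier F" "g \<in> carrier G" using assms by (auto simp: H_sel)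
  show ?thesis
    unfolding h(1) lm_act_eq f.aug_sum_conv_one[OF h(2)] aug_sum_lm_G[OF h(3)] rho_split[OF h(2,3)] ..
qed

lemma aug_sum_lm_mult:
  assumes "lam \<noteq> 0" "\<tau> \<noteq> 0" "h \<in> carrier H"
  shows "aug_sum n (conv_act sc n \<rho>F \<tau>) (lm_act (fscale sc) n G \<alpha> (lm_act sc n G \<alpha> \<rho> \<tau>) lam h w) =
    lm_act sc n G \<alpha> \<rho> (lam * \<tau>) h (aug_sum n (conv_act sc n \<rho>F \<tau>) w)"
proof -
  interpret L: artin_module n G \<alpha> "fscale sc" "lm_act sc n G \<alpha> \<rho> \<tau>" by (rule lm_rep[OF assms(2)])
  obtain x g where h: "h = (x, g)" "x \<in> carrier F" "g \<in> carrier G" using assms(3) by (auto simp: H_sel)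
  have "aug_sum n (conv_act sc n \<rho>F \<tau>) (lm_act (fscale sc) n G \<alpha> (lm_act sc n G \<alpha> \<rho> \<tau>) lam h w) =
      aug_sum n (conv_act sc n \<rho>F \<tau>) (conv_act (fscale sc) n (conv_act sc n \<rho>F \<tau>) lam x (L.lm_G g w))"
    by (simp only: h L.lm_act_eq lm_act_F)
  also have "\<dots> = conv_act sc n \<rho>F (lam * \<tau>) x (aug_sum n (conv_act sc n \<rho>F \<tau>) (L.lm_G g w))"
    by (rule f.aug_sum_conv[OF assms(1,2) h(2)])
  also have "aug_sum n (conv_act sc n \<rho>F \<tau>) (L.lm_G g w) = lm_G g (aug_sum n (conv_act sc n \<rho>F \<tau>) w)"
    using L.aug_sum_lm_G[OF h(3), of w] by (simp only: lm_act_F lm_act_G[OF assms(2)])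
  finally show ?thesis by (simp only: h lm_act_eq)
qed

end

context stable_subspace
begin

text \<open>The submodule \<open>K + L\<close> of the convolution, as a subspace that contains all tuples with entries in \<open>Z\<close>.\<close>

definition KL :: "'k \<Rightarrow> (nat \<Rightarrow> 'e) set" where
  "KL lam = {k + l | k l. (\<forall>i\<in>{1..n}. gdiff n \<rho> i (k i) \<in> Z) \<and> (\<forall>i\<in>{1..n}. row sc n \<rho> lam i l \<in> Z)}"

lemma KL_I: "(\<forall>i\<in>{1..n}. gdiff n \<rho> i (k i) \<in> Z) \<Longrightarrow> (\<forall>i\<in>{1..n}. row sc n \<rho> lam i l \<in> Z) \<Longrightarrow> k + l \<in> KL lam"
  unfolding KL_def by blast

lemma row_conv_L:
  assumes lam: "lam \<noteq> 0" and x: "x \<in> carrier F" and v: "\<forall>i\<in>{1..n}. row sc n \<rho> lam i v \<in> Z" and i: "i \<in> {1..n}"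
  shows "row sc n \<rho> lam i (conv_act sc n \<rho> lam x v) \<in> Z"
proof -
  let ?d = "conv_act sc n \<rho> lam x v - v"
  have "row sc n \<rho> lam i ?d \<in> Z" using conv_L[OF lam x v] by (intro Z_row i) auto
  then have "row sc n \<rho> lam i ?d + row sc n \<rho> lam i v \<in> Z" using v i by (intro Z_add) auto
  then show ?thesis using row_add[OF i, of lam ?d v] by simp
qed

lemma KL_zero: "0 \<in> KL lam"
  using KL_I[of 0 lam 0] by (simp add: zero_fun_apply row_def gdiff_zero)

lemma KL_add: "u \<in> KL lam \<Longrightarrow> v \<in> KL lam \<Longrightarrow> u + v \<in> KL lam"
proof -
  assume "u \<in> KL lam" "v \<in> KL lam"
  then obtain k l k' l' where *: "u = k + l" "v = k' + l'"
    "\<forall>i\<in>{1..n}. gdiff n \<rho> i (k i) \<in> Z" "\<forall>i\<in>{1..n}. row sc n \<rho> lam i l \<in> Z"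
    "\<forall>i\<in>{1..n}. gdiff n \<rho> i (k' i) \<in> Z" "\<forall>i\<in>{1..n}. row sc n \<rho> lam i l' \<in> Z"
    unfolding KL_def by blast
  have "(k + k') + (l + l') \<in> KL lam"
    using * by (intro KL_I) (simp_all add: plus_fun_apply gdiff_add row_add Z_add)
  then show ?thesis using * by (simp add: algebra_simps)
qed

lemma KL_scale: "u \<in> KL lam \<Longrightarrow> fscale sc c u \<in> KL lam"
proof -
  assume "u \<in> KL lam"
  then obtain k l where *: "u = k + l"
    "\<forall>i\<in>{1..n}. gdiff n \<rho> i (k i) \<in> Z" "\<forall>i\<in>{1..n}. row sc n \<rho> lam i l \<in> Z"
    unfolding KL_def by blast
  interpret n: vector_space "fscale sc :: _ \<Rightarrow> (nat \<Rightarrow> 'e) \<Rightarrow> _"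
    by (intro vector_space_fscale vector_space_axioms)
  have "fscale sc c k + fscale sc c l \<in> KL lam"
    using * by (intro KL_I) (simp_all add: fscale_apply gdiff_scale row_scale Z_scale)
  then show ?thesis using * by (simp add: n.scale_right_distrib)
qed

lemma KL_Z: "(\<And>j. j \<in> {1..n} \<Longrightarrow> v j \<in> Z) \<Longrightarrow> v \<in> KL lam"
  using KL_I[of v lam 0] KL_zero by (auto simp: row_def gdiff_zero zero_fun_apply Z_gdiff)

lemma KL_eq: "n \<ge> 1 \<Longrightarrow> no_sub sc n \<rho> Z \<Longrightarrow> KL lam = klm_ker sc n \<rho> lam Z"
  unfolding KL_def by (rule klm_ker_eq)

lemma KL_conv:
  assumes lam: "lam \<noteq> 0" and x: "x \<in> carrier F" and v: "v \<in> KL lam"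
  shows "conv_act sc n \<rho> lam x v \<in> KL lam"
proof -
  interpret N: free_rep "fscale sc" n "conv_act sc n \<rho> lam" by (rule conv_rep[OF lam])
  obtain k l where v: "v = k + l" and k: "\<forall>i\<in>{1..n}. gdiff n \<rho> i (k i) \<in> Z"
    and l: "\<forall>i\<in>{1..n}. row sc n \<rho> lam i l \<in> Z" using v by (auto simp: KL_def)
  show ?thesis
    unfolding v N.rep_add[OF x]
    by (intro KL_I iffD2[OF conv_stable_K[OF lam x]] ballI row_conv_L[OF lam x l] k)
qed

end

text \<open>A representation of the semidirect product with a stable subspace \<open>Z\<close>, which is the kernel of a presentation later on.\<close>

locale artin_quotient = artin_module n G \<alpha> sc \<rho>
  for n and G :: "('g, 'z) monoid_scheme" and \<alpha> and sc :: "'k::field \<Rightarrow> 'e::ab_group_add \<Rightarrow> 'e" and \<rho> +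
  fixes Z :: "'e set"
  assumes zero: "0 \<in> Z" and add: "u \<in> Z \<Longrightarrow> v \<in> Z \<Longrightarrow> u + v \<in> Z"
    and scale: "u \<in> Z \<Longrightarrow> sc c u \<in> Z" and rep: "h \<in> carrier H \<Longrightarrow> u \<in> Z \<Longrightarrow> \<rho> h u \<in> Z"
begin

sublocale s: stable_subspace sc n \<rho>F Z
  by (intro stable_subspace.intro f.free_rep_axioms stable_subspace_axioms.intro)
    (auto simp: zero add scale rep H_sel)

lemma lm_G_Z:
  assumes g: "g \<in> carrier G" and v: "\<And>j. j \<in> {1..n} \<Longrightarrow> v j \<in> Z" and l: "l \<in> {1..n}"
  shows "lm_G g v l \<in> Z"
proof -
  have "fox n \<rho>F (\<alpha> g (fgen n j)) (\<rho>G g (v j)) l \<in> Z" if j: "j \<in> {1..n}" for j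
  proof (rule f.fox_stable[OF zero add s.Z_uminus s.Z_rep])
    show "\<alpha> g (fgen n j) \<in> carrier F" using g j by simp
    show "\<rho>G g (v j) \<in> Z" using g v[OF j] by (simp add: rep H_sel)
  qed
  then have "(\<Sum>j\<in>{1..n}. fox n \<rho>F (\<alpha> g (fgen n j)) (\<rho>G g (v j)) l) \<in> Z" by (intro s.Z_sum)
  then show ?thesis using l by (simp add: fox_change_def)
qed

text \<open>Write \<open>\<alpha>(g)(x\<^sub>j) = u x\<^sub>m u\<^sup>-\<^sup>1\<close>.  If \<open>x\<^sub>j\<close> fixes the \<open>j\<close>-th entry modulo \<open>Z\<close>, then the derivative of the conjugate at \<open>e\<close> is concentrated in the
  \<open>m\<close>-th place, with the value \<open>u\<^sup>-\<^sup>1 e\<close>, which \<open>x\<^sub>m\<close> fixes.\<close>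

lemma lm_G_K:
  assumes g: "g \<in> carrier G" and v: "\<And>j. j \<in> {1..n} \<Longrightarrow> gdiff n \<rho>F j (v j) \<in> Z" and l: "l \<in> {1..n}"
  shows "gdiff n \<rho>F l (lm_G g v l) \<in> Z"
proof -
  have "gdiff n \<rho>F l (fox n \<rho>F (\<alpha> g (fgen n j)) (\<rho>G g (v j)) l) \<in> Z" if j: "j \<in> {1..n}" for j
  proof -
    obtain m u where m: "m \<in> {1..n}" "u \<in> carrier F"
      "\<alpha> g (fgen n j) = u \<otimes>\<^bsub>F\<^esub> fgen n m \<otimes>\<^bsub>F\<^esub> inv\<^bsub>F\<^esub> u"
      using alpha_conj[OF g] j by (auto simp: gens_conj_def)
    let ?e = "\<rho>G g (v j)"
    let ?w = "\<rho>F (inv\<^bsub>F\<^esub> u) ?e"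
    have "\<rho>F (\<alpha> g (fgen n j)) ?e - ?e = \<rho>G g (gdiff n \<rho>F j (v j))"
      using g j by (simp add: gdiff_def rep_diff H_sel rho_commute)
    then have z: "\<rho>F (\<alpha> g (fgen n j)) ?e - ?e \<in> Z" using g v[OF j] by (simp add: rep H_sel)
    have e: "\<rho>F (inv\<^bsub>F\<^esub> u) (\<rho>F (\<alpha> g (fgen n j)) ?e - ?e) = gdiff n \<rho>F m ?w"
      using m by (simp add: f.rep_diff f.rep_mult f.rep_inv gdiff_def)
    have w: "gdiff n \<rho>F m ?w \<in> Z" using s.Z_rep[OF F.inv_closed[OF m(2)] z] unfolding e .
    have "fox n \<rho>F (\<alpha> g (fgen n j)) ?e = fox n \<rho>F u (\<rho>F (fgen n m) ?w) + delta m ?w - fox n \<rho>F u ?w"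
      using m by (simp add: f.fox_mult f.fox_inv f.fox_gen algebra_simps)
    also have "\<dots> = fox n \<rho>F u (gdiff n \<rho>F m ?w) + delta m ?w"
    proof -
      have "fox n \<rho>F u (\<rho>F (fgen n m) ?w) = fox n \<rho>F u (gdiff n \<rho>F m ?w) + fox n \<rho>F u ?w"
        using f.fox_linear(1)[OF m(2), of "gdiff n \<rho>F m ?w" ?w] by (simp add: gdiff_def)
      then show ?thesis by simp
    qed
    finally have eq: "fox n \<rho>F (\<alpha> g (fgen n j)) ?e l = fox n \<rho>F u (gdiff n \<rho>F m ?w) l + delta m ?w l"
      by (simp add: plus_fun_apply)
    have "fox n \<rho>F u (gdiff n \<rho>F m ?w) l \<in> Z"
      by (rule f.fox_stable[OF zero add s.Z_uminus s.Z_rep m(2) w])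
    moreover have "gdiff n \<rho>F l (delta m ?w l) \<in> Z" using w l by (auto simp: delta_def)
    ultimately show ?thesis
      unfolding eq using l by (simp add: f.gdiff_add add s.Z_gdiff)
  qed
  then have "(\<Sum>j\<in>{1..n}. gdiff n \<rho>F l (fox n \<rho>F (\<alpha> g (fgen n j)) (\<rho>G g (v j)) l)) \<in> Z"
    by (intro s.Z_sum)
  then show ?thesis using l by (simp add: fox_change_def f.gdiff_sum)
qed

text \<open>The vectors with vanishing rows are the invariants of the free group, and \<open>\<alpha>(g)\<close> is an automorphism of it: the invariance
  under \<open>x\<^sub>i\<close> is the image of the invariance under \<open>\<alpha>(g\<^sup>-\<^sup>1)(x\<^sub>i)\<close>.\<close>

lemma lm_G_L:
  assumes lam: "lam \<noteq> 0" and g: "g \<in> carrier G" and v: "\<forall>i\<in>{1..n}. row sc n \<rho>F lam i v \<in> Z"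
    and i: "i \<in> {1..n}"
  shows "row sc n \<rho>F lam i (lm_G g v) \<in> Z"
proof -
  (* the element that g sends to the i-th generator *)
  define y where "y = \<alpha> (inv\<^bsub>G\<^esub> g) (fgen n i)"
  have y: "y \<in> carrier F" "\<alpha> g y = fgen n i" using g i by (simp_all add: y_def alpha_inv)
  let ?d = "conv_act sc n \<rho>F lam y v - v"
  have "lm_G g (conv_act sc n \<rho>F lam y v) = lm_G g ?d + lm_G g v"
    using lm_G_add[OF g, of ?d v] by simp
  then have "conv_act sc n \<rho>F lam (fgen n i) (lm_G g v) = lm_G g ?d + lm_G g v"
    by (simp only: lm_G_conv[OF lam y(1) g] y(2))
  then have "conv_act sc n \<rho>F lam (fgen n i) (lm_G g v) i = (lm_G g ?d + lm_G g v) i" by (rule fun_cong)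
  then have "lm_G g v i + row sc n \<rho>F lam i (lm_G g v) = lm_G g ?d i + lm_G g v i"
    by (simp only: f.conv_act_gen[OF lam i] fun_upd_same plus_fun_apply)
  then have "row sc n \<rho>F lam i (lm_G g v) = lm_G g ?d i" by (simp add: add.commute)
  moreover have "lm_G g ?d i \<in> Z"
    using s.conv_L[OF lam y(1) v] by (intro lm_G_Z g i) auto
  ultimately show ?thesis by simp
qed

lemma KL_rep:
  assumes lam: "lam \<noteq> 0" and h: "h \<in> carrier H" and v: "v \<in> s.KL lam"
  shows "lm_act sc n G \<alpha> \<rho> lam h v \<in> s.KL lam"
proof -
  interpret L: artin_module n G \<alpha> "fscale sc" "lm_act sc n G \<alpha> \<rho> lam" by (rule lm_rep[OF lam])
  obtain k l where v: "v = k + l" and k: "\<forall>i\<in>{1..n}. gdiff n \<rho>F i (k i) \<in> Z"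
    and l: "\<forall>i\<in>{1..n}. row sc n \<rho>F lam i l \<in> Z" using v by (auto simp: s.KL_def)
  obtain x g where x: "h = (x, g)" "x \<in> carrier F" "g \<in> carrier G" using h by (auto simp: H_sel)
  have "\<forall>i\<in>{1..n}. gdiff n \<rho>F i (lm_act sc n G \<alpha> \<rho> lam h k i) \<in> Z"
    unfolding x(1) lm_act_eq s.conv_stable_K[OF lam x(2)]
    by (intro ballI lm_G_K[OF x(3)] k[rule_format])
  moreover have "\<forall>i\<in>{1..n}. row sc n \<rho>F lam i (lm_act sc n G \<alpha> \<rho> lam h l) \<in> Z"
    unfolding x(1) lm_act_eq by (intro ballI s.row_conv_L[OF lam x(2)] lm_G_L[OF lam x(3) l])
  ultimately show ?thesis unfolding v L.rep_add[OF h] by (rule s.KL_I)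
qed

end

section \<open>The augmentation ideal\<close>

definition augm :: "(fgrp \<Rightarrow> 'k::field) \<Rightarrow> 'k" where
  "augm f = (\<Sum>x\<in>{x. f x \<noteq> 0}. f x)"

lemma augm_eq: "augm f = galg_map (\<lambda>_. ()) f ()"
  by (simp add: augm_def galg_map_def)

lemma augm_add:
  "f \<in> carrier (group_algebra F) \<Longrightarrow> g \<in> carrier (group_algebra F) \<Longrightarrow> augm (f + g) = augm f + augm g"
  by (simp add: augm_eq galg_map_add[where H = F] plus_fun_apply)

lemma augm_single [simp]: "augm (gsingle c x) = c"
  by (simp add: augm_eq galg_map_single) (simp add: gsingle_def)

lemma augm_zero [simp]: "augm 0 = 0"
  by (simp add: augm_def zero_fun_apply)

lemma aug_ideal_iff: "f \<in> aug_ideal n \<longleftrightarrow> f \<in> carrier (group_algebra (free_grp n)) \<and> augm f = 0"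
  by (simp add: aug_ideal_def augm_def)

lemma gsingle_uminus: "gsingle (- c) x = - gsingle c x"
  by (auto simp: gsingle_def fun_simps)

lemma upd_delta: "v(i := v i + u) = v + delta i (u :: 'e::ab_group_add)"
  by (auto simp: delta_def fun_eq_iff plus_fun_apply)

lemma delta_insert:
  "j \<notin> J \<Longrightarrow> delta j (v j) + (\<lambda>k. if k \<in> J then v k else 0) =
    (\<lambda>k. if k = j \<or> k \<in> J then v k else (0 :: 'e::ab_group_add))"
  by (auto simp: delta_def fun_eq_iff plus_fun_apply)

text \<open>The coordinates of \<open>f \<otimes> e\<close> in the basis \<open>x\<^sub>j - 1\<close>.  They are defined by Fox derivatives for all \<open>f\<close> in the group algebra, although they
  have this meaning only on the augmentation ideal.\<close>

definition coord :: "('k::field \<Rightarrow> 'e \<Rightarrow> 'e) \<Rightarrow> nat \<Rightarrow> (fgrp \<Rightarrow> 'e \<Rightarrow> 'e) \<Rightarrow> 'e \<Rightarrow> (fgrp \<Rightarrow> 'k) \<Rightarrow> nat \<Rightarrow> 'e::ab_group_add"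
  where "coord sc n \<rho> e f = (\<Sum>x | f x \<noteq> 0. fscale sc (f x) (fox n \<rho> x e))"

locale aug =
  fixes n :: nat and ty :: "'k::field itself"
begin

abbreviation "Fn \<equiv> free_grp n"
abbreviation "An \<equiv> group_algebra Fn :: (fgrp \<Rightarrow> 'k) ring"
abbreviation "I \<equiv> aug_ideal n :: (fgrp \<Rightarrow> 'k) set"
abbreviation "e \<equiv> aug_gen n :: nat \<Rightarrow> fgrp \<Rightarrow> 'k"
abbreviation "kscale \<equiv> fscale (*) :: 'k \<Rightarrow> (fgrp \<Rightarrow> 'k) \<Rightarrow> _"

sublocale F: group Fn by (rule group_free_grp)
sublocale A: ring An by (rule ring_group_algebra[OF group_free_grp])
sublocale reg: free_rep kscale n "ltrans Fn"
  by (intro free_rep.intro regular_rep group_free_grp)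

lemma mult_act: "a \<in> carrier An \<Longrightarrow> b \<in> carrier An \<Longrightarrow> a \<otimes>\<^bsub>An\<^esub> b = galg_act kscale (ltrans Fn) a b"
  by (rule galg_mult_eq_act[OF group_free_grp])

lemma mult_single: "x \<in> carrier Fn \<Longrightarrow> b \<in> carrier An \<Longrightarrow> gsingle c x \<otimes>\<^bsub>An\<^esub> b = kscale c (ltrans Fn x b)"
  by (simp add: mult_act)

lemma A_distr:
  assumes "a \<in> carrier An" "b \<in> carrier An" "c \<in> carrier An"
  shows "(a + b) \<otimes>\<^bsub>An\<^esub> c = a \<otimes>\<^bsub>An\<^esub> c + b \<otimes>\<^bsub>An\<^esub> c" "c \<otimes>\<^bsub>An\<^esub> (a + b) = c \<otimes>\<^bsub>An\<^esub> a + c \<otimes>\<^bsub>An\<^esub> b"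
    "(a - b) \<otimes>\<^bsub>An\<^esub> c = a \<otimes>\<^bsub>An\<^esub> c - b \<otimes>\<^bsub>An\<^esub> c"
proof -
  have *: "(a + b) \<otimes>\<^bsub>An\<^esub> c = a \<otimes>\<^bsub>An\<^esub> c + b \<otimes>\<^bsub>An\<^esub> c" if "a \<in> carrier An" "b \<in> carrier An" for a b
    using A.l_distr[OF that assms(3)] by simp
  then show "(a + b) \<otimes>\<^bsub>An\<^esub> c = a \<otimes>\<^bsub>An\<^esub> c + b \<otimes>\<^bsub>An\<^esub> c" using assms by blast
  show "c \<otimes>\<^bsub>An\<^esub> (a + b) = c \<otimes>\<^bsub>An\<^esub> a + c \<otimes>\<^bsub>An\<^esub> b" using A.r_distr[OF assms] by simp
  show "(a - b) \<otimes>\<^bsub>An\<^esub> c = a \<otimes>\<^bsub>An\<^esub> c - b \<otimes>\<^bsub>An\<^esub> c"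
    using *[of "a - b" b] assms by simp
qed

lemma augm_mult:
  assumes "a \<in> carrier An" "b \<in> carrier An"
  shows "augm (a \<otimes>\<^bsub>An\<^esub> b) = augm a * augm b"
  using assms(1)
proof (induction a rule: galg_induct)
  case zero
  have "augm (0 \<otimes>\<^bsub>An\<^esub> b) = augm (0 :: fgrp \<Rightarrow> 'k) * augm b" using A.l_null[OF assms(2)] by simp
  then show ?case .
next
  case (single c x)
  show ?case using assms(2)
  proof (induction b rule: galg_induct)
    case zero
    have "augm (gsingle c x \<otimes>\<^bsub>An\<^esub> 0) = augm (gsingle c x) * augm (0 :: fgrp \<Rightarrow> 'k)"
      using A.r_null[of "gsingle c x"] single by simp
    then show ?case .
  next
    case (add a b)
    have "augm (gsingle c x \<otimes>\<^bsub>An\<^esub> (a + b)) = augm (gsingle c x) * augm (a + b)"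
      using add single A.m_closed[of "gsingle c x"]
      by (simp add: A_distr augm_add[where F = Fn] distrib_left)
    then show ?case .
  qed (use single in \<open>simp add: reg.galg_mult_single\<close>)
next
  case (add a a')
  have "augm ((a + a') \<otimes>\<^bsub>An\<^esub> b) = augm (a + a') * augm b"
    using add assms A.m_closed[OF _ assms(2)] by (simp add: A_distr augm_add[where F = Fn] distrib_right)
  then show ?case .
qed

lemma I_A: "f \<in> I \<Longrightarrow> f \<in> carrier An"
  by (simp add: aug_ideal_iff)

lemma I_zero [simp]: "0 \<in> I"
  by (simp add: aug_ideal_iff)

lemma I_add: "f \<in> I \<Longrightarrow> g \<in> I \<Longrightarrow> f + g \<in> I"
  by (simp add: aug_ideal_iff augm_add[where F = Fn])

lemma I_mult: "f \<in> I \<Longrightarrow> a \<in> carrier An \<Longrightarrow> f \<otimes>\<^bsub>An\<^esub> a \<in> I"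
  by (simp add: aug_ideal_iff augm_mult A.m_closed)

lemma I_mult_left: "f \<in> I \<Longrightarrow> a \<in> carrier An \<Longrightarrow> a \<otimes>\<^bsub>An\<^esub> f \<in> I"
  by (simp add: aug_ideal_iff augm_mult A.m_closed)

lemma one_single: "\<one>\<^bsub>An\<^esub> = gsingle 1 \<one>\<^bsub>Fn\<^esub>"
  by (rule galg_one)

lemma e_eq: "j \<in> {1..n} \<Longrightarrow> e j = gsingle 1 (fgen n j) - gsingle 1 \<one>\<^bsub>Fn\<^esub>"
  by (simp add: aug_gen_def one_single galg_minus[OF group_free_grp])

lemma e_I: "j \<in> {1..n} \<Longrightarrow> e j \<in> I"
  using augm_add[of "e j" Fn "gsingle 1 \<one>\<^bsub>Fn\<^esub>"] by (simp add: aug_ideal_iff e_eq)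

lemma e_A: "j \<in> {1..n} \<Longrightarrow> e j \<in> carrier An"
  by (rule I_A[OF e_I])

lemma e_mult: "j \<in> {1..n} \<Longrightarrow> b \<in> carrier An \<Longrightarrow> e j \<otimes>\<^bsub>An\<^esub> b = gdiff n (ltrans Fn) j b"
  by (simp add: e_eq A_distr mult_single gdiff_def reg.rep_one)

text \<open>The augmentation ideal is generated as a right ideal by the \<open>x\<^sub>j - 1\<close>, since \<open>xy - 1 = (x - 1) y + (y - 1)\<close>.\<close>

lemma aug_induct [consumes 1, case_names zero gen add]:
  assumes f: "f \<in> I" and P0: "P 0"
    and Pg: "\<And>l c y. l \<in> {1..n} \<Longrightarrow> y \<in> carrier Fn \<Longrightarrow> P (e l \<otimes>\<^bsub>An\<^esub> gsingle c y)"
    and Pa: "\<And>f g. f \<in> I \<Longrightarrow> g \<in> I \<Longrightarrow> P f \<Longrightarrow> P g \<Longrightarrow> P (f + g)"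
  shows "P f"
proof -
  let ?Q = "\<lambda>f. f \<in> I \<and> P f"
  have Qa: "?Q (f + g)" if "?Q f" "?Q g" for f g using that Pa I_add by blast
  have Q: "\<forall>y\<in>carrier Fn. \<forall>c. ?Q (gsingle c (x \<otimes>\<^bsub>Fn\<^esub> y) - gsingle c y)" if "x \<in> carrier Fn" for x
    using that
  proof (induction rule: free_grp_induct)
    case one
    have "?Q (gsingle c (\<one>\<^bsub>Fn\<^esub> \<otimes>\<^bsub>Fn\<^esub> y) - gsingle c y)" if "y \<in> carrier Fn" for y c
      using P0 F.l_one[OF that] by simp
    then show ?case by blast
  next
    case (gen l)
    have "gsingle c (fgen n l \<otimes>\<^bsub>Fn\<^esub> y) - gsingle c y = e l \<otimes>\<^bsub>An\<^esub> gsingle c y" if "y \<in> carrier Fn" for c y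
      using that gen by (simp add: e_eq A_distr reg.galg_mult_single)
    then show ?case using gen Pg e_I I_mult by simp
  next
    case (inv x)
    show ?case
    proof (intro ballI allI)
      fix y c assume y: "y \<in> carrier Fn"
      have "?Q (gsingle (- c) (x \<otimes>\<^bsub>Fn\<^esub> (inv\<^bsub>Fn\<^esub> x \<otimes>\<^bsub>Fn\<^esub> y)) - gsingle (- c) (inv\<^bsub>Fn\<^esub> x \<otimes>\<^bsub>Fn\<^esub> y))"
        using inv y by blast
      moreover have "gsingle (- c) (x \<otimes>\<^bsub>Fn\<^esub> (inv\<^bsub>Fn\<^esub> x \<otimes>\<^bsub>Fn\<^esub> y)) - gsingle (- c) (inv\<^bsub>Fn\<^esub> x \<otimes>\<^bsub>Fn\<^esub> y) =
          gsingle c (inv\<^bsub>Fn\<^esub> x \<otimes>\<^bsub>Fn\<^esub> y) - gsingle c y"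
        using inv(1) y by (simp add: F.m_assoc[symmetric] gsingle_uminus)
      ultimately show "?Q (gsingle c (inv\<^bsub>Fn\<^esub> x \<otimes>\<^bsub>Fn\<^esub> y) - gsingle c y)" by simp
    qed
  next
    case (mult x x')
    show ?case
    proof (intro ballI allI)
      fix y c assume y: "y \<in> carrier Fn"
      have "?Q ((gsingle c (x \<otimes>\<^bsub>Fn\<^esub> (x' \<otimes>\<^bsub>Fn\<^esub> y)) - gsingle c (x' \<otimes>\<^bsub>Fn\<^esub> y)) + (gsingle c (x' \<otimes>\<^bsub>Fn\<^esub> y) - gsingle c y))"
        using mult y by (intro Qa) auto
      then show "?Q (gsingle c (x \<otimes>\<^bsub>Fn\<^esub> x' \<otimes>\<^bsub>Fn\<^esub> y) - gsingle c y)"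
        using mult y by (simp add: F.m_assoc)
    qed
  qed
  have "?Q (f - gsingle (augm f) \<one>\<^bsub>Fn\<^esub>)" if "f \<in> carrier An" for f
    using that
  proof (induction f rule: galg_induct)
    case zero
    have "?Q (0 - gsingle (augm 0) \<one>\<^bsub>Fn\<^esub>)" using P0 by simp
    then show ?case .
  next
    case (single c h)
    then show ?case using Q[of h] by (auto dest!: bspec[of _ _ "\<one>\<^bsub>Fn\<^esub>"])
  next
    case (add f g)
    have "?Q ((f + g) - gsingle (augm (f + g)) \<one>\<^bsub>Fn\<^esub>)"
      using Qa[OF add(3,4)] add(1,2) by (simp add: augm_add[where F = Fn] gsingle_add algebra_simps)
    then show ?case .
  qed
  from this[of f] f show ?thesis by (simp add: aug_ideal_iff)
qed

end

locale aug_rep = free_rep sc n \<rho> + aug n "TYPE('k)"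
  for sc :: "'k::field \<Rightarrow> 'e::ab_group_add \<Rightarrow> 'e" and n and \<rho>
begin

abbreviation "co \<equiv> coord sc n \<rho>"

sublocale nn: vector_space "fscale sc :: _ \<Rightarrow> (nat \<Rightarrow> 'e) \<Rightarrow> _"
  by (intro vector_space_fscale vector_space_axioms)

lemma coord_superset:
  assumes "finite X" "{x. f x \<noteq> 0} \<subseteq> X"
  shows "co u f = (\<Sum>x\<in>X. fscale sc (f x) (fox n \<rho> x u))"
  unfolding coord_def using assms by (intro sum.mono_neutral_left) auto

lemma coord_add:
  assumes "f \<in> carrier A" "g \<in> carrier A"
  shows "co u (f + g) = co u f + co u g"
proof -
  have "finite ({h. f h \<noteq> 0} \<union> {h. g h \<noteq> 0})" (is "finite ?X") using assms by (auto simp: galg_carrier)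
  then have "co u (f + g) = (\<Sum>h\<in>?X. fscale sc ((f + g) h) (fox n \<rho> h u))"
    "co u f = (\<Sum>h\<in>?X. fscale sc (f h) (fox n \<rho> h u))"
    "co u g = (\<Sum>h\<in>?X. fscale sc (g h) (fox n \<rho> h u))"
    by (rule coord_superset; auto simp: fun_simps)+
  then show ?thesis by (simp add: plus_fun_apply nn.scale_left_distrib sum.distrib)
qed

lemma coord_zero [simp]: "co u 0 = 0"
  by (simp add: coord_def zero_fun_apply)

lemma coord_single [simp]: "co u (gsingle c x) = fscale sc c (fox n \<rho> x u)"
proof -
  have "co u (gsingle c x) = (\<Sum>h\<in>{x}. fscale sc (gsingle c x h) (fox n \<rho> h u))"
    by (rule coord_superset) (auto simp: gsingle_def)
  then show ?thesis by (simp add: gsingle_def)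
qed

lemma coord_diff:
  assumes "f \<in> carrier A" "g \<in> carrier A"
  shows "co u (f - g) = co u f - co u g"
  using coord_add[of "f - g" g u] assms by simp

lemma coord_linear:
  assumes "f \<in> carrier A"
  shows "co (u + v) f = co u f + co v f" "co (sc c u) f = fscale sc c (co u f)"
  using assms
  by (auto simp: coord_def galg_carrier fox_linear nn.scale_right_distrib sum.distrib nn.scale_sum_right
      nn.scale_left_commute subset_iff mult.commute intro!: sum.cong)

lemma coord_outside: "f \<in> carrier A \<Longrightarrow> j \<notin> {1..n} \<Longrightarrow> co u f j = 0"
  by (auto simp: coord_def galg_carrier fun_simps fox_outside subset_iff intro!: sum.neutral)

text \<open>The product rule for Fox derivatives; on the augmentation ideal the second term vanishes, and \<open>coord\<close> is compatible with
  moving \<open>a\<close> across the tensor sign.\<close>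

lemma coord_mult:
  assumes "f \<in> carrier A" "a \<in> carrier A"
  shows "co u (f \<otimes>\<^bsub>A\<^esub> a) = co (galg_act sc \<rho> a u) f + fscale sc (augm f) (co u a)"
  using assms(1)
proof (induction f rule: galg_induct)
  case zero
  have "co u (0 \<otimes>\<^bsub>A\<^esub> a) = co (galg_act sc \<rho> a u) 0 + fscale sc (augm 0) (co u a)"
    using A.l_null[OF assms(2)] by simp
  then show ?case .
next
  case (single c x)
  show ?case using assms(2)
  proof (induction a rule: galg_induct)
    case zero
    have "co u (gsingle c x \<otimes>\<^bsub>A\<^esub> 0) =
        co (galg_act sc \<rho> 0 u) (gsingle c x) + fscale sc (augm (gsingle c x)) (co u 0)"
      using A.r_null[of "gsingle c x"] single by (simp add: fox_zero)
    then show ?case .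
  next
    case (single d y)
    then show ?case using \<open>x \<in> carrier F\<close>
      by (simp add: galg_mult_single fox_mult fox_linear nn.scale_right_distrib)
  next
    case (add a b)
    have "co u (gsingle c x \<otimes>\<^bsub>A\<^esub> (a + b)) =
        co (galg_act sc \<rho> (a + b) u) (gsingle c x) + fscale sc (augm (gsingle c x)) (co u (a + b))"
      using add \<open>x \<in> carrier F\<close> A.m_closed[of "gsingle c x"]
      by (simp add: A_distr coord_add galg_act_add fox_linear nn.scale_right_distrib algebra_simps)
    then show ?case .
  qed
next
  case (add f g)
  have "co u ((f + g) \<otimes>\<^bsub>A\<^esub> a) = co (galg_act sc \<rho> a u) (f + g) + fscale sc (augm (f + g)) (co u a)"
    using add assms A.m_closed[OF _ assms(2)]
    by (simp add: A_distr coord_add augm_add[where F = F] nn.scale_left_distrib algebra_simps)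
  then show ?case .
qed

lemma coord_I_mult: "f \<in> I \<Longrightarrow> a \<in> carrier A \<Longrightarrow> co u (f \<otimes>\<^bsub>A\<^esub> a) = co (galg_act sc \<rho> a u) f"
  using coord_mult[of f a u] by (simp add: aug_ideal_iff)

lemma coord_e: "j \<in> {1..n} \<Longrightarrow> co u (e j) = delta j u"
  by (simp add: e_eq coord_diff fox_gen fox_one)

lemma aug_sum_coord:
  assumes "f \<in> carrier A"
  shows "aug_sum n \<rho> (co u f) = galg_act sc \<rho> f u - sc (augm f) u"
  using assms
proof (induction f rule: galg_induct)
  case zero
  have "aug_sum n \<rho> (co u 0) = galg_act sc \<rho> 0 u - sc (augm 0) u"
    using aug_sum_add[of 0 0] by simp
  then show ?case .
next
  case (single c x)
  then show ?case by (simp add: aug_sum_scale aug_sum_fox scale_right_diff_distrib)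
next
  case (add f g)
  have "aug_sum n \<rho> (co u (f + g)) = galg_act sc \<rho> (f + g) u - sc (augm (f + g)) u"
    using add by (simp add: coord_add aug_sum_add galg_act_add augm_add[where F = F] scale_left_distrib)
  then show ?case .
qed

lemma coord_stable:
  assumes Z: "0 \<in> Z" "\<And>u v. u \<in> Z \<Longrightarrow> v \<in> Z \<Longrightarrow> u + v \<in> Z" "\<And>c u. u \<in> Z \<Longrightarrow> sc c u \<in> Z"
      "\<And>x u. x \<in> carrier F \<Longrightarrow> u \<in> Z \<Longrightarrow> \<rho> x u \<in> Z"
    and f: "f \<in> carrier A" and u: "u \<in> Z"
  shows "co u f j \<in> Z"
proof -
  have neg: "- u \<in> Z" if "u \<in> Z" for u using Z(3)[OF that, of "- 1"] by (simp add: scale_minus_left)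
  show ?thesis using f
  proof (induction f rule: galg_induct)
    case zero
    have "co u 0 j \<in> Z" using Z(1) by (simp add: zero_fun_apply)
    then show ?case .
  next
    case (single c x)
    have "fox n \<rho> x u j \<in> Z" by (rule fox_stable[OF Z(1,2) neg Z(4) single u])
    then show ?case by (simp add: fscale_apply Z(3))
  next
    case (add f g)
    have "co u (f + g) j \<in> Z" using add Z(2) by (simp add: coord_add plus_fun_apply)
    then show ?case .
  qed
qed

text \<open>The twisted action is determined by its values on the \<open>x\<^sub>j - 1\<close> and by right linearity, and the rows of the
  convolution are the coordinates of these values.\<close>

lemma coord_twisted:
  assumes lam: "lam \<noteq> 0" and t: "is_twisted_action n lam t" and x: "x \<in> carrier F" and f: "f \<in> I"
  shows "t x f \<in> I" and "co u (t x f) = conv_act sc n \<rho> lam x (co u f)"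
proof -
  interpret N: free_rep "fscale sc" n "conv_act sc n \<rho> lam" by (rule conv_rep[OF lam])
  have hom: "t \<in> hom F (BijGroup I)" using t by (simp add: is_twisted_action_def Let_def)
  have closed: "t x f \<in> I" if "x \<in> carrier F" "f \<in> I" for x f
    using hom_in_carrier[OF hom that(1)] Bij_imp_funcset that(2) by (fastforce simp: BijGroup_def)
  then show "t x f \<in> I" using x f .
  have t_mult: "t (x \<otimes>\<^bsub>F\<^esub> y) f = t x (t y f)" if "x \<in> carrier F" "y \<in> carrier F" "f \<in> I" for x y f
    using hom_mult[OF hom that(1,2)] hom_in_carrier[OF hom] that
    by (simp add: BijGroup_def compose_def)
  have t_one: "t \<one>\<^bsub>F\<^esub> f = f" if "f \<in> I" for f
    using hom_one[OF hom F.is_group group_BijGroup] that by (simp add: BijGroup_def)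
  have t_add: "t x (f + g) = t x f + t x g" if "x \<in> carrier F" "f \<in> I" "g \<in> I" for x f g
    using t that by (simp add: is_twisted_action_def Let_def)
  have t_right: "t x (f \<otimes>\<^bsub>A\<^esub> a) = t x f \<otimes>\<^bsub>A\<^esub> a" if "x \<in> carrier F" "f \<in> I" "a \<in> carrier A" for x f a
    using t that by (simp add: is_twisted_action_def Let_def)
  have t_gen: "t (fgen n i) (e l) = gsingle (lam_ge lam i l) (fgen n i) \<otimes>\<^bsub>A\<^esub> e l -
      gsingle (lam_ge lam (i - 1) l - 1) \<one>\<^bsub>F\<^esub> \<otimes>\<^bsub>A\<^esub> e l" if "i \<in> {1..n}" "l \<in> {1..n}" for i l
    using t that e_A by (simp add: is_twisted_action_def Let_def galg_minus[OF group_free_grp] A.m_closed)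
  have t_co: "co u (t (fgen n i) (e l)) = conv_act sc n \<rho> lam (fgen n i) (delta l u)"
    if i: "i \<in> {1..n}" and l: "l \<in> {1..n}" for i l u
  proof -
    have s: "gsingle c x \<otimes>\<^bsub>A\<^esub> e l = gsingle c (x \<otimes>\<^bsub>F\<^esub> fgen n l) - gsingle c x" if "x \<in> carrier F" for c x
    proof -
      have "kscale c (ltrans F x (e l)) = gsingle c (x \<otimes>\<^bsub>F\<^esub> fgen n l) - gsingle c x"
        using that l by (simp add: e_eq reg.rep_diff ltrans_single[OF group_free_grp] reg.scale_right_diff_distrib)
          (auto simp: gsingle_def fun_simps)
      then show ?thesis using that l e_A by (simp add: mult_single)
    qed
    have "co u (t (fgen n i) (e l)) =
        fscale sc (lam_ge lam i l) (delta i (D l u) + delta l u) - fscale sc (lam_ge lam (i - 1) l - 1) (delta l u)"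
      using i l by (simp add: t_gen s coord_diff fox_mult fox_gen fox_one nn.scale_right_diff_distrib[symmetric])
        (simp add: gdiff_def delta_def fun_eq_iff fun_simps)
    also have "\<dots> = (delta l u)(i := delta l u i + ((if i = l then sc (lam - 1) u else 0) + sc (lam_ge lam i l) (D l u)))"
    proof
      fix m
      have c: "lam_ge lam (i - 1) l = 1" if "i = l" using that i by (auto simp: lam_ge_def atLeastAtMost_iff)
      have c': "lam_ge lam (i - 1) l = lam_ge lam i l" if "i \<noteq> l" using that by (auto simp: lam_ge_def)
      show "(fscale sc (lam_ge lam i l) (delta i (D l u) + delta l u) - fscale sc (lam_ge lam (i - 1) l - 1) (delta l u)) m =
          ((delta l u)(i := delta l u i + ((if i = l then sc (lam - 1) u else 0) + sc (lam_ge lam i l) (D l u)))) m"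
        using c c' by (auto simp: delta_apply fun_simps scale_left_diff_distrib scale_right_distrib lam_ge_def)
    qed
    also have "\<dots> = (delta l u)(i := delta l u i + row sc n \<rho> lam i (delta l u))"
      by (simp add: row_delta[OF l])
    finally show ?thesis using i lam by (simp add: conv_act_gen)
  qed
  have "\<forall>f\<in>I. \<forall>u. co u (t x f) = conv_act sc n \<rho> lam x (co u f)" using x
  proof (induction rule: free_grp_induct)
    case one
    then show ?case by (simp add: t_one N.rep_one)
  next
    case (gen i)
    have "\<forall>u. co u (t (fgen n i) f) = conv_act sc n \<rho> lam (fgen n i) (co u f)" if "f \<in> I" for f
      using that
    proof (induction f rule: aug_induct)
      case zero
      have "t (fgen n i) 0 = 0" using t_add[of "fgen n i" 0 0] gen by simp
      then have "\<forall>u. co u (t (fgen n i) 0) = conv_act sc n \<rho> lam (fgen n i) (co u 0)"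
        using gen by (simp add: N.rep_zero)
      then show ?case .
    next
      case (gen l c y)
      then show ?case using \<open>i \<in> {1..n}\<close>
        by (simp add: t_right e_I closed coord_I_mult coord_e t_co)
    next
      case (add f g)
      have "\<forall>u. co u (t (fgen n i) (f + g)) = conv_act sc n \<rho> lam (fgen n i) (co u (f + g))"
        using add gen closed[of "fgen n i"] by (simp add: t_add coord_add I_A N.rep_add)
      then show ?case .
    qed
    then show ?case by blast
  next
    case (inv x)
    show ?case
    proof (intro ballI allI)
      fix f u assume f: "f \<in> I"
      have g: "t (inv\<^bsub>F\<^esub> x) f \<in> I" using inv f closed by simp
      have "t x (t (inv\<^bsub>F\<^esub> x) f) = f" using inv f by (simp add: t_mult[symmetric] t_one)
      then have "co u f = conv_act sc n \<rho> lam x (co u (t (inv\<^bsub>F\<^esub> x) f))" using inv(2) g by metis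
      then show "co u (t (inv\<^bsub>F\<^esub> x) f) = conv_act sc n \<rho> lam (inv\<^bsub>F\<^esub> x) (co u f)"
        using inv(1) by (simp add: N.rep_inv)
    qed
  next
    case (mult x y)
    then show ?case by (simp add: t_mult closed N.rep_mult)
  qed
  then show "co u (t x f) = conv_act sc n \<rho> lam x (co u f)" using f by blast
qed

end

section \<open>Existence of the twisted action\<close>

context aug
begin

interpretation r: aug_rep kscale n "ltrans Fn"
  by unfold_locales

abbreviation "rc \<equiv> coord kscale n (ltrans Fn) (gsingle 1 \<one>\<^bsub>Fn\<^esub>)"
abbreviation "rs \<equiv> aug_sum n (ltrans Fn) :: (nat \<Rightarrow> fgrp \<Rightarrow> 'k) \<Rightarrow> fgrp \<Rightarrow> 'k"

lemma act_one: "a \<in> carrier An \<Longrightarrow> galg_act kscale (ltrans Fn) a (gsingle 1 \<one>\<^bsub>Fn\<^esub>) = a"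
  using A.r_one[of a] mult_act[of a "gsingle 1 \<one>\<^bsub>Fn\<^esub>"] by (simp add: one_single)

lemma rs_rc: "f \<in> I \<Longrightarrow> rs (rc f) = f"
  by (simp add: r.aug_sum_coord I_A act_one) (simp add: aug_ideal_iff)

text \<open>The coordinate vectors of elements of the augmentation ideal, whose entries lie in the group algebra.\<close>

definition fam :: "(nat \<Rightarrow> fgrp \<Rightarrow> 'k) set" where
  "fam = {v. (\<forall>j\<in>{1..n}. v j \<in> carrier An) \<and> (\<forall>j. j \<notin> {1..n} \<longrightarrow> v j = 0)}"

sublocale st: stable_subspace kscale n "ltrans Fn" "carrier An"
proof (intro stable_subspace.intro reg.free_rep_axioms stable_subspace_axioms.intro)
  fix c x and b :: "fgrp \<Rightarrow> 'k" assume b: "b \<in> carrier An"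
  show "kscale c b \<in> carrier An"
    using mult_single[OF F.one_closed b, of c] A.m_closed[of "gsingle c \<one>\<^bsub>Fn\<^esub>" b] b by (simp add: reg.rep_one)
  show "ltrans Fn x b \<in> carrier An" if "x \<in> carrier Fn"
    using mult_single[OF that b, of 1] A.m_closed[of "gsingle 1 x" b] b that by simp
qed auto

lemma rc_fam: "f \<in> I \<Longrightarrow> rc f \<in> fam"
  using r.coord_stable[of "carrier An" f "gsingle 1 \<one>\<^bsub>Fn\<^esub>"] r.coord_outside[of f]
  by (auto simp: fam_def I_A st.Z_scale st.Z_rep)

lemma rs_I: "v \<in> fam \<Longrightarrow> rs v \<in> I"
proof -
  assume v: "v \<in> fam"
  have "(\<Sum>j\<in>J. gdiff n (ltrans Fn) j (v j)) \<in> I" if "finite J" "J \<subseteq> {1..n}" for J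
    using that
  proof induction
    case (insert j J)
    then have "e j \<otimes>\<^bsub>An\<^esub> v j \<in> I" using v by (intro I_mult e_I) (auto simp: fam_def)
    then show ?case using insert v by (auto simp: e_mult fam_def intro: I_add)
  qed simp
  then show ?thesis by (simp add: aug_sum_def)
qed

lemma rc_e: "j \<in> {1..n} \<Longrightarrow> b \<in> carrier An \<Longrightarrow> rc (e j \<otimes>\<^bsub>An\<^esub> b) = delta j b"
  by (simp add: r.coord_I_mult e_I act_one r.coord_e)

lemma rc_rs: "v \<in> fam \<Longrightarrow> rc (rs v) = v"
proof -
  assume v: "v \<in> fam"
  have "(\<Sum>j\<in>J. gdiff n (ltrans Fn) j (v j)) \<in> carrier An \<and>
      rc (\<Sum>j\<in>J. gdiff n (ltrans Fn) j (v j)) = (\<lambda>j. if j \<in> J then v j else 0)" if "finite J" "J \<subseteq> {1..n}" for J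
    using that
  proof induction
    case empty
    have "(\<lambda>j. if j \<in> {} then v j else 0) = 0" by (simp add: zero_fun_def)
    then show ?case by (simp only: sum.empty r.coord_zero galg_zero_closed simp_thms)
  next
    case (insert j J)
    have b: "v j \<in> carrier An" "j \<in> {1..n}" using insert v by (auto simp: fam_def)
    have "rc (gdiff n (ltrans Fn) j (v j)) = delta j (v j)" using rc_e b by (simp add: e_mult)
    moreover have "gdiff n (ltrans Fn) j (v j) \<in> carrier An" using b by (intro st.Z_gdiff)
    ultimately show ?case using insert by (simp add: r.coord_add delta_insert)
  qed
  from this[of "{1..n}"] v show ?thesis by (auto simp: aug_sum_def fam_def fun_eq_iff)
qed

text \<open>The convolution of the regular representation, transported to the ideal along the coordinates.  The formula for the
  generators only has to be compared on the basis.\<close>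

lemma twisted_action_exists:
  assumes lam: "lam \<noteq> 0"
  shows "\<exists>t. is_twisted_action n (lam :: 'k) t"
proof -
  let ?N = "conv_act kscale n (ltrans Fn) lam"
  interpret N: free_rep "fscale kscale" n ?N by (rule reg.conv_rep[OF lam])
  (* from the ideal to coordinates, convolution, and back *)
  define t where "t x = (\<lambda>f\<in>I. rs (?N x (rc f)))" for x
  have Nfam: "?N x v \<in> fam" if "x \<in> carrier Fn" "v \<in> fam" for x v
    using that st.conv_stable_Z[OF lam that(1), of v] reg.conv_act_outside[OF lam that(1)]
    by (auto simp: fam_def)
  have tI: "t x f \<in> I" if "x \<in> carrier Fn" "f \<in> I" for x f
    using that by (simp add: t_def rs_I Nfam rc_fam)
  have t_mult: "t (x \<otimes>\<^bsub>Fn\<^esub> y) f = t x (t y f)" if "x \<in> carrier Fn" "y \<in> carrier Fn" "f \<in> I" for x y f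
  proof -
    have "t x (t y f) = rs (?N x (rc (rs (?N y (rc f)))))" using that tI by (simp add: t_def)
    also have "rc (rs (?N y (rc f))) = ?N y (rc f)" using that by (intro rc_rs Nfam rc_fam)
    finally show ?thesis using that by (simp add: t_def N.rep_mult)
  qed
  have t_one: "t \<one>\<^bsub>Fn\<^esub> f = f" if "f \<in> I" for f
    using that by (simp add: t_def N.rep_one rs_rc)
  have bij: "t x \<in> Bij I" if x: "x \<in> carrier Fn" for x
  proof -
    have "bij_betw (t x) I I"
      by (rule bij_betw_byWitness[of _ "t (inv\<^bsub>Fn\<^esub> x)"])
        (use x tI in \<open>auto simp: t_mult[symmetric] t_one\<close>)
    then show ?thesis by (simp add: Bij_def t_def)
  qed
  have hom: "t \<in> hom Fn (BijGroup I)"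
    using bij t_mult by (auto simp: hom_def BijGroup_def compose_def fun_eq_iff t_def)
  have t_add: "t x (f + g) = t x f + t x g" if "x \<in> carrier Fn" "f \<in> I" "g \<in> I" for x f g
    using that by (simp add: t_def I_add r.coord_add I_A N.rep_add reg.aug_sum_add)
  (* the coefficient of the right multiplication by which the i-th generator acts on the l-th basis element *)
  define T where "T i l = e l + e i \<otimes>\<^bsub>An\<^esub> ((if i = l then gsingle (lam - 1) \<one>\<^bsub>Fn\<^esub> else 0) + gsingle (lam_ge lam i l) \<one>\<^bsub>Fn\<^esub> \<otimes>\<^bsub>An\<^esub> e l)" for i l
  have T_A: "T i l \<in> carrier An" if "i \<in> {1..n}" "l \<in> {1..n}" for i l
    using that by (auto simp: T_def e_A A.m_closed)
  have t_gen: "t (fgen n i) (e l \<otimes>\<^bsub>An\<^esub> b) = T i l \<otimes>\<^bsub>An\<^esub> b"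
    if i: "i \<in> {1..n}" and l: "l \<in> {1..n}" and b: "b \<in> carrier An" for i l b
  proof -
    let ?c = "(if i = l then kscale (lam - 1) b else 0) + kscale (lam_ge lam i l) (e l \<otimes>\<^bsub>An\<^esub> b)"
    have c: "?c \<in> carrier An" using l b by (auto intro!: galg_add_closed st.Z_scale A.m_closed e_A)
    have "?N (fgen n i) (delta l b) = delta l b + delta i ?c"
      using i l b lam by (simp add: reg.conv_act_gen upd_delta reg.row_delta[OF l] e_mult)
    then have N: "?N (fgen n i) (rc (e l \<otimes>\<^bsub>An\<^esub> b)) = delta l b + delta i ?c" by (simp only: rc_e[OF l b])
    have "t (fgen n i) (e l \<otimes>\<^bsub>An\<^esub> b) = rs (?N (fgen n i) (rc (e l \<otimes>\<^bsub>An\<^esub> b)))"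
      unfolding t_def by (rule restrict_apply', rule I_mult[OF e_I[OF l] b])
    also have "\<dots> = rs (delta l b + delta i ?c)" by (simp only: N)
    also have "\<dots> = gdiff n (ltrans Fn) l b + gdiff n (ltrans Fn) i ?c"
      by (simp only: reg.aug_sum_add reg.aug_sum_delta[OF l] reg.aug_sum_delta[OF i])
    also have "\<dots> = e l \<otimes>\<^bsub>An\<^esub> b + e i \<otimes>\<^bsub>An\<^esub> ?c"
      by (simp only: e_mult[OF l b, symmetric] e_mult[OF i c, symmetric])
    also have "?c = ((if i = l then gsingle (lam - 1) \<one>\<^bsub>Fn\<^esub> else 0) + gsingle (lam_ge lam i l) \<one>\<^bsub>Fn\<^esub> \<otimes>\<^bsub>An\<^esub> e l) \<otimes>\<^bsub>An\<^esub> b"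
    proof -
      have k: "gsingle d \<one>\<^bsub>Fn\<^esub> \<otimes>\<^bsub>An\<^esub> a = kscale d a" if "a \<in> carrier An" for d a
        using that by (simp add: mult_single reg.rep_one)
      have one: "gsingle d \<one>\<^bsub>Fn\<^esub> \<in> carrier An" for d by simp
      have e: "(w + gsingle d \<one>\<^bsub>Fn\<^esub> \<otimes>\<^bsub>An\<^esub> e l) \<otimes>\<^bsub>An\<^esub> b = w \<otimes>\<^bsub>An\<^esub> b + kscale d (e l \<otimes>\<^bsub>An\<^esub> b)"
        if "w \<in> carrier An" for w d
        by (simp only: A_distr(1)[OF that A.m_closed[OF one e_A[OF l]] b] A.m_assoc[OF one e_A[OF l] b]
            k[OF A.m_closed[OF e_A[OF l] b]])
      have null: "0 \<otimes>\<^bsub>An\<^esub> b = 0" using A.l_null[OF b] by simp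
      show ?thesis
        by (cases "i = l") (simp_all only: simp_thms if_True if_False e[OF one] e[OF galg_zero_closed] k[OF b] null)
    qed
    finally have fin: "t (fgen n i) (e l \<otimes>\<^bsub>An\<^esub> b) = e l \<otimes>\<^bsub>An\<^esub> b + e i \<otimes>\<^bsub>An\<^esub>
        (((if i = l then gsingle (lam - 1) \<one>\<^bsub>Fn\<^esub> else 0) + gsingle (lam_ge lam i l) \<one>\<^bsub>Fn\<^esub> \<otimes>\<^bsub>An\<^esub> e l) \<otimes>\<^bsub>An\<^esub> b)" .
    have c2: "(if i = l then gsingle (lam - 1) \<one>\<^bsub>Fn\<^esub> else 0) + gsingle (lam_ge lam i l) \<one>\<^bsub>Fn\<^esub> \<otimes>\<^bsub>An\<^esub> e l \<in> carrier An"
      using l by (simp add: e_A A.m_closed)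
    show ?thesis
      unfolding fin T_def A_distr(1)[OF e_A[OF l] A.m_closed[OF e_A[OF i] c2] b] A.m_assoc[OF e_A[OF i] c2 b] ..
  qed
  have t_right: "\<forall>f\<in>I. \<forall>a\<in>carrier An. t x (f \<otimes>\<^bsub>An\<^esub> a) = t x f \<otimes>\<^bsub>An\<^esub> a" if "x \<in> carrier Fn" for x
    using that
  proof (induction rule: free_grp_induct)
    case one
    then show ?case by (simp add: t_one I_mult)
  next
    case (gen i)
    have "\<forall>a\<in>carrier An. t (fgen n i) (f \<otimes>\<^bsub>An\<^esub> a) = t (fgen n i) f \<otimes>\<^bsub>An\<^esub> a" if "f \<in> I" for f
      using that
    proof (induction f rule: aug_induct)
      case zero
      have "t (fgen n i) 0 = 0" using t_add[of "fgen n i" 0 0] gen by simp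
      then have "\<forall>a\<in>carrier An. t (fgen n i) (0 \<otimes>\<^bsub>An\<^esub> a) = t (fgen n i) 0 \<otimes>\<^bsub>An\<^esub> a"
        using A.l_null by simp
      then show ?case .
    next
      case (gen l c y)
      then show ?case using \<open>i \<in> {1..n}\<close>
        by (simp add: A.m_assoc e_A t_gen T_A A.m_closed)
    next
      case (add f g)
      have "\<forall>a\<in>carrier An. t (fgen n i) ((f + g) \<otimes>\<^bsub>An\<^esub> a) = t (fgen n i) (f + g) \<otimes>\<^bsub>An\<^esub> a"
        using add gen tI[of "fgen n i"] by (simp add: A_distr I_A t_add I_mult)
      then show ?case .
    qed
    then show ?case by blast
  next
    case (inv x)
    show ?case
    proof (intro ballI)
      fix f a assume f: "f \<in> I" and a: "a \<in> carrier An"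
      have g: "t (inv\<^bsub>Fn\<^esub> x) f \<in> I" using inv f tI by simp
      have "t x (t (inv\<^bsub>Fn\<^esub> x) f) = f" using inv f by (simp add: t_mult[symmetric] t_one)
      then have "t x (t (inv\<^bsub>Fn\<^esub> x) f \<otimes>\<^bsub>An\<^esub> a) = f \<otimes>\<^bsub>An\<^esub> a" using inv(2) g a by simp
      then have "t (inv\<^bsub>Fn\<^esub> x) (f \<otimes>\<^bsub>An\<^esub> a) = t (inv\<^bsub>Fn\<^esub> x) (t x (t (inv\<^bsub>Fn\<^esub> x) f \<otimes>\<^bsub>An\<^esub> a))" by simp
      also have "\<dots> = t (inv\<^bsub>Fn\<^esub> x) f \<otimes>\<^bsub>An\<^esub> a"
        using inv(1) I_mult[OF g a] by (simp add: t_mult[symmetric] t_one)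
      finally show "t (inv\<^bsub>Fn\<^esub> x) (f \<otimes>\<^bsub>An\<^esub> a) = t (inv\<^bsub>Fn\<^esub> x) f \<otimes>\<^bsub>An\<^esub> a" .
    qed
  next
    case (mult x y)
    then show ?case by (simp add: t_mult I_mult tI)
  qed
  have spec: "t (fgen n i) (e l) = gsingle (lam_ge lam i l) (fgen n i) \<otimes>\<^bsub>An\<^esub> e l -
      gsingle (lam_ge lam (i - 1) l - 1) \<one>\<^bsub>Fn\<^esub> \<otimes>\<^bsub>An\<^esub> e l" if i: "i \<in> {1..n}" and l: "l \<in> {1..n}" for i l
  proof -
    have "t (fgen n i) (e l) = T i l"
      using t_gen[OF i l A.one_closed] T_A[OF i l] e_A[OF l] by simp
    also have "\<dots> = e l + gdiff n (ltrans Fn) i ((if i = l then gsingle (lam - 1) \<one>\<^bsub>Fn\<^esub> else 0) + kscale (lam_ge lam i l) (e l))"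
      using i l st.Z_scale[OF e_A[OF l]] by (auto simp: T_def e_mult mult_single e_A reg.rep_one)
    also have "\<dots> = kscale (lam_ge lam i l) (ltrans Fn (fgen n i) (e l)) - kscale (lam_ge lam (i - 1) l - 1) (e l)"
    proof -
      consider "l < i" | "l = i" | "l > i" by linarith
      then show ?thesis
      proof cases
        case 1
        then have "l \<le> i - 1" "l \<le> i" by linarith+
        then show ?thesis using i 1
          by (simp add: lam_ge_def gdiff_def reg.rep_scale reg.scale_left_diff_distrib)
      next
        case 2
        have s: "gsingle (lam - 1) x = kscale (lam - 1) (gsingle 1 x)" for x by (auto simp: gsingle_def fscale_apply)
        have lg: "lam_ge lam (i - 1) i = 1" "lam_ge lam i i = lam" using i by (auto simp: lam_ge_def atLeastAtMost_iff)
        have "gdiff n (ltrans Fn) i (gsingle 1 \<one>\<^bsub>Fn\<^esub>) = e i"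
          using i by (simp add: gdiff_def ltrans_single[OF group_free_grp] e_eq)
        then have "gdiff n (ltrans Fn) i (gsingle (lam - 1) \<one>\<^bsub>Fn\<^esub>) = kscale (lam - 1) (e i)"
          using i by (simp only: s reg.gdiff_scale)
        moreover have "gdiff n (ltrans Fn) i (kscale lam (e i)) = kscale lam (ltrans Fn (fgen n i) (e i)) - kscale lam (e i)"
          using i by (simp add: gdiff_def reg.rep_scale)
        ultimately show ?thesis
          using i 2 by (simp add: lg lg(1)[simplified] reg.gdiff_add reg.scale_left_diff_distrib)
      next
        case 3
        then have "\<not> l \<le> i - 1" "\<not> l \<le> i" by linarith+
        then show ?thesis using i by (simp add: lam_ge_def gdiff_def)
      qed
    qed
    finally show ?thesis using i l by (simp add: mult_single e_A reg.rep_one)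
  qed
  have "is_twisted_action n lam t"
    unfolding is_twisted_action_def Let_def
    using hom t_add t_right spec e_A by (simp add: galg_minus[OF group_free_grp] A.m_closed)
  then show ?thesis by (intro exI[of _ t])
qed

lemma twisted_action: "lam \<noteq> 0 \<Longrightarrow> is_twisted_action n (lam :: 'k) (twisted_action n lam)"
  unfolding twisted_action_def by (rule someI_ex[OF twisted_action_exists])

end

section \<open>The Long-Moody module in coordinates\<close>

locale artin_presentation = artin_module n G \<alpha> sc \<rho> + presentation sc "semidirect (free_grp n) G \<alpha>" \<rho> q V
  for n and G :: "('g, 'z) monoid_scheme" and \<alpha> and sc :: "'k::field \<Rightarrow> 'e::ab_group_add \<Rightarrow> 'e" and \<rho>
    and q :: "'e \<Rightarrow> 'u" and V
begin

abbreviation "Z \<equiv> {u. q u = \<zero>\<^bsub>V\<^esub>}"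
abbreviation "RR \<equiv> group_algebra (free_grp n) :: (fgrp \<Rightarrow> 'k) ring"
abbreviation "II \<equiv> aug_ideal n :: (fgrp \<Rightarrow> 'k) set"
abbreviation "VF \<equiv> res_free G V"
abbreviation "null \<equiv> tensor_null RR II VF"
abbreviation "cls \<equiv> tensor_class RR II VF"
abbreviation "pairs \<equiv> II \<times> carrier V"
abbreviation "FA \<equiv> free_Abelian_group (II \<times> carrier VF)"

lemma q_scale0: "q u = \<zero>\<^bsub>V\<^esub> \<Longrightarrow> q (sc c u) = \<zero>\<^bsub>V\<^esub>"
  using q_scale[of c u] q_scale[of c 0] q_zero by simp

lemma q_rep0: "h \<in> carrier H \<Longrightarrow> q u = \<zero>\<^bsub>V\<^esub> \<Longrightarrow> q (\<rho> h u) = \<zero>\<^bsub>V\<^esub>"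
  using q_rep[of h u] q_rep[of h 0] q_zero by (simp add: rep_zero)

sublocale Q: artin_quotient n G \<alpha> sc \<rho> Z
  by (intro artin_quotient.intro artin_module_axioms artin_quotient_axioms.intro)
    (auto simp: q_zero q_add q_scale0 q_rep0)

sublocale af: aug_rep sc n \<rho>F
  by (intro aug_rep.intro f.free_rep_axioms)

lemma vf: "presentation sc (free_grp n) \<rho>F q VF"
  unfolding res_free_def by (rule presentation_restrict[OF presentation_axioms group_free_grp embed_hom])

sublocale vf: presentation sc "free_grp n" \<rho>F q VF
  by (rule vf)

lemma VF_sel [simp]: "carrier VF = carrier V" "\<zero>\<^bsub>VF\<^esub> = \<zero>\<^bsub>V\<^esub>" "x \<oplus>\<^bsub>VF\<^esub> y = x \<oplus>\<^bsub>V\<^esub> y"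
  by (simp_all add: res_free_def)

lemma null_subgroup: "subgroup null FA"
proof -
  have D: "Poly_Mapping.keys (c - d) \<subseteq> pairs" if "Poly_Mapping.keys c \<subseteq> pairs" "Poly_Mapping.keys d \<subseteq> pairs"
    for c d :: "(fgrp \<Rightarrow> 'k) \<times> 'u \<Rightarrow>\<^sub>0 int"
    using keys_diff[of c d] that by blast
  have O: "Poly_Mapping.keys (frag_of (f, v)) \<subseteq> pairs" if "f \<in> II" "v \<in> carrier V" for f v
    using that by simp
  have "c \<in> carrier FA" if "c \<in> tensor_rels RR II VF" for c
  proof -
    from that have "Poly_Mapping.keys c \<subseteq> pairs"
      unfolding tensor_rels_def
    proof (elim UnE CollectE exE conjE, goal_cases)
      case (1 f f' v)
      then show ?case using af.I_add[of f f'] by (simp only: VF_sel galg_add D O)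
    next
      case (2 f v v')
      then show ?case using M.a_closed[of v v'] by (simp only: VF_sel D O)
    next
      case (3 f a v)
      then show ?case using af.I_mult[of f a] vf.M.smult_closed[of a v] by (simp only: VF_sel D O)
    qed
    then show ?thesis by simp
  qed
  then have "tensor_rels RR II VF \<subseteq> carrier FA" by blast
  then show ?thesis
    unfolding tensor_null_def by (rule group.generate_is_subgroup[OF group_free_Abelian_group])
qed

lemma null_keys: "c \<in> null \<Longrightarrow> Poly_Mapping.keys c \<subseteq> pairs"
proof -
  assume "c \<in> null"
  then have "c \<in> carrier FA" by (rule subgroup.mem_carrier[OF null_subgroup])
  then show ?thesis by simp
qed

lemma null_zero [simp]: "0 \<in> null"
  using subgroup.one_closed[OF null_subgroup] by simp

lemma null_add: "c \<in> null \<Longrightarrow> d \<in> null \<Longrightarrow> c + d \<in> null"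
  using subgroup.m_closed[OF null_subgroup] by simp

lemma null_uminus: "c \<in> null \<Longrightarrow> - c \<in> null"
proof -
  assume c: "c \<in> null"
  then have "inv\<^bsub>FA\<^esub> c = - c" using null_keys by simp
  then show ?thesis using subgroup.m_inv_closed[OF null_subgroup c] by simp
qed

lemma null_diff: "c \<in> null \<Longrightarrow> d \<in> null \<Longrightarrow> c - d \<in> null"
  using null_add[of c "- d"] null_uminus[of d] by simp

lemma null_rel: "c \<in> tensor_rels RR II VF \<Longrightarrow> c \<in> null"
  unfolding tensor_null_def by (rule generate.incl)

lemma cls_eq: "cls c = (\<lambda>d. d + c) ` null"
  unfolding tensor_class_def by (auto simp: r_coset_def)

lemma cls_eq_iff: "cls c = cls d \<longleftrightarrow> c - d \<in> null"
proof
  assume "cls c = cls d"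
  moreover have "c \<in> cls c" unfolding cls_eq by (rule image_eqI[of _ _ 0]) simp_all
  ultimately obtain m where "m \<in> null" "c = m + d" by (auto simp: cls_eq)
  then show "c - d \<in> null" by simp
next
  assume cd: "c - d \<in> null"
  have "m + c \<in> (\<lambda>m. m + d) ` null" if "m \<in> null" for m
    using null_add[OF that cd] by (intro image_eqI[of _ _ "m + (c - d)"]) simp_all
  moreover have "m + d \<in> (\<lambda>m. m + c) ` null" if "m \<in> null" for m
    using null_diff[OF that cd] by (intro image_eqI[of _ _ "m - (c - d)"]) simp_all
  ultimately show "cls c = cls d" unfolding cls_eq by blast
qed

lemma cls_memD: "d \<in> cls c \<Longrightarrow> d - c \<in> null"
  by (auto simp: cls_eq)

text \<open>A lift of \<open>\<Sum>\<^sub>j (x\<^sub>j - 1) \<otimes> v\<^sub>j\<close> to the free abelian group.\<close>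

definition basis_sum :: "(nat \<Rightarrow> 'e) \<Rightarrow> (fgrp \<Rightarrow> 'k) \<times> 'u \<Rightarrow>\<^sub>0 int" where
  "basis_sum v = (\<Sum>j\<in>{1..n}. frag_of (aug_gen n j, q (v j)))"

lemma basis_sum_keys: "Poly_Mapping.keys (basis_sum v) \<subseteq> pairs"
  unfolding basis_sum_def
  by (rule order_trans[OF keys_sum]) (use af.e_I in fastforce)

lemma null_sum: "(\<And>i. i \<in> X \<Longrightarrow> f i \<in> null) \<Longrightarrow> (\<Sum>i\<in>X. f i) \<in> null"
  by (induction X rule: infinite_finite_induct) (auto intro: null_add)

lemma rel_add_left: "f \<in> II \<Longrightarrow> g \<in> II \<Longrightarrow> v \<in> carrier V \<Longrightarrow> frag_of (f + g, v) - frag_of (f, v) - frag_of (g, v) \<in> null"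
  by (rule null_rel) (fastforce simp: tensor_rels_def)

lemma rel_add_right: "f \<in> II \<Longrightarrow> frag_of (f, q (u + v)) - frag_of (f, q u) - frag_of (f, q v) \<in> null"
  by (rule null_rel) (fastforce simp: tensor_rels_def q_add)

lemma rel_mult: "f \<in> II \<Longrightarrow> a \<in> carrier RR \<Longrightarrow> frag_of (f \<otimes>\<^bsub>RR\<^esub> a, q u) - frag_of (f, q (galg_act sc \<rho>F a u)) \<in> null"
proof -
  assume f: "f \<in> II" and a: "a \<in> carrier RR"
  have "frag_of (f \<otimes>\<^bsub>RR\<^esub> a, q u) - frag_of (f, a \<odot>\<^bsub>VF\<^esub> q u) \<in> tensor_rels RR II VF"
    unfolding tensor_rels_def using f a
    by (intro UnI2 CollectI exI[of _ f] exI[of _ a] exI[of _ "q u"] conjI HOL.refl) simp_all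
  then show ?thesis using null_rel by (simp add: vf.q_act a)
qed

lemma rel_zero: "f \<in> II \<Longrightarrow> frag_of (f, \<zero>\<^bsub>V\<^esub>) \<in> null"
  using null_uminus[OF rel_add_right[of f 0 0]] by (simp add: q_zero)

lemma basis_sum_add: "basis_sum (u + v) - basis_sum u - basis_sum v \<in> null"
proof -
  have "(\<Sum>j\<in>{1..n}. frag_of (aug_gen n j, q (u j + v j)) - frag_of (aug_gen n j, q (u j)) -
      frag_of (aug_gen n j, q (v j))) \<in> null"
    using af.e_I by (intro null_sum rel_add_right) auto
  then show ?thesis by (simp add: basis_sum_def sum_subtractf plus_fun_apply)
qed

lemma basis_sum_null: "(\<And>j. j \<in> {1..n} \<Longrightarrow> q (v j) = \<zero>\<^bsub>V\<^esub>) \<Longrightarrow> basis_sum v \<in> null"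
  unfolding basis_sum_def using af.e_I by (intro null_sum) (auto intro: rel_zero)

lemma basis_sum_cong: "(\<And>j. j \<in> {1..n} \<Longrightarrow> q (u j) = q (v j)) \<Longrightarrow> basis_sum u = basis_sum v"
  unfolding basis_sum_def by (intro sum.cong) auto

lemma basis_sum_delta: "j \<in> {1..n} \<Longrightarrow> basis_sum (delta j u) - frag_of (aug_gen n j, q u) \<in> null"
proof -
  assume j: "j \<in> {1..n}"
  have "basis_sum (delta j u) = frag_of (aug_gen n j, q u) + (\<Sum>i\<in>{1..n} - {j}. frag_of (aug_gen n i, \<zero>\<^bsub>V\<^esub>))"
    unfolding basis_sum_def using j by (subst sum.remove[of _ j]) (auto simp: delta_def q_zero intro!: sum.cong)
  moreover have "(\<Sum>i\<in>{1..n} - {j}. frag_of (aug_gen n i, \<zero>\<^bsub>V\<^esub>)) \<in> null"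
    using af.e_I by (intro null_sum rel_zero) auto
  ultimately show ?thesis by simp
qed

text \<open>For \<open>f = (x\<^sub>l - 1) a\<close> the element \<open>a\<close> moves across the tensor sign, and these \<open>f\<close> span the ideal.\<close>

lemma tensor_coord: "f \<in> II \<Longrightarrow> frag_of (f, q u) - basis_sum (coord sc n \<rho>F u f) \<in> null"
proof (induction f arbitrary: u rule: af.aug_induct)
  case zero
  have "frag_of (0 :: fgrp \<Rightarrow> 'k, q u) \<in> null"
    using null_uminus[OF rel_add_left[of 0 0 "q u"]] by simp
  moreover have "basis_sum 0 \<in> null" by (rule basis_sum_null) (simp add: q_zero zero_fun_apply)
  ultimately have "frag_of (0, q u) - basis_sum (coord sc n \<rho>F u 0) \<in> null"
    by (simp only: af.coord_zero null_diff)
  then show ?case .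
next
  case (gen l c y)
  let ?a = "gsingle c y :: fgrp \<Rightarrow> 'k"
  have "frag_of (aug_gen n l \<otimes>\<^bsub>RR\<^esub> ?a, q u) - frag_of (aug_gen n l, q (galg_act sc \<rho>F ?a u)) \<in> null"
    using gen by (intro rel_mult af.e_I) auto
  from null_diff[OF this basis_sum_delta[OF gen(1), of "galg_act sc \<rho>F ?a u"]]
  have "frag_of (aug_gen n l \<otimes>\<^bsub>RR\<^esub> ?a, q u) - basis_sum (delta l (galg_act sc \<rho>F ?a u)) \<in> null"
    by simp
  moreover have "coord sc n \<rho>F u (aug_gen n l \<otimes>\<^bsub>RR\<^esub> ?a) = delta l (galg_act sc \<rho>F ?a u)"
    using gen by (subst af.coord_I_mult) (simp_all add: af.e_I af.coord_e)
  ultimately show ?case by simp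
next
  case (add f g)
  have "frag_of (f + g, q u) - frag_of (f, q u) - frag_of (g, q u) \<in> null"
    using add by (intro rel_add_left) auto
  from null_add[OF this null_add[OF add(3,4)[of u]]]
  have "frag_of (f + g, q u) - basis_sum (coord sc n \<rho>F u f) - basis_sum (coord sc n \<rho>F u g) \<in> null"
    by (simp add: algebra_simps)
  from null_diff[OF this basis_sum_add[of "coord sc n \<rho>F u f" "coord sc n \<rho>F u g"]]
  have "frag_of (f + g, q u) - basis_sum (coord sc n \<rho>F u (f + g)) \<in> null"
    using add by (simp add: af.coord_add af.I_A algebra_simps)
  then show ?case .
qed

definition lift :: "'u \<Rightarrow> 'e" where
  "lift v = (SOME u. q u = v)"

lemma q_lift: "v \<in> carrier V \<Longrightarrow> q (lift v) = v"
  unfolding lift_def by (rule someI_ex) (metis q_surj)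

text \<open>The coordinates of simple tensors, extended additively to formal sums.  They vanish on the relations of the tensor product
  modulo \<open>Z\<close> only, because \<open>lift\<close> is not additive.\<close>

definition formal_coord :: "((fgrp \<Rightarrow> 'k) \<times> 'u \<Rightarrow>\<^sub>0 int) \<Rightarrow> nat \<Rightarrow> 'e" where
  "formal_coord c = (\<Sum>p\<in>Poly_Mapping.keys c. fscale sc (of_int (Poly_Mapping.lookup c p)) (coord sc n \<rho>F (lift (snd p)) (fst p)))"

lemma formal_coord_superset:
  assumes "finite X" "Poly_Mapping.keys c \<subseteq> X"
  shows "formal_coord c = (\<Sum>p\<in>X. fscale sc (of_int (Poly_Mapping.lookup c p)) (coord sc n \<rho>F (lift (snd p)) (fst p)))"
  unfolding formal_coord_def using assms
  by (intro sum.mono_neutral_left) (auto simp: in_keys_iff)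

lemma formal_coord_of [simp]: "formal_coord (frag_of (f, v)) = coord sc n \<rho>F (lift v) f"
  by (simp add: formal_coord_def)

lemma formal_coord_zero [simp]: "formal_coord 0 = 0"
  by (simp add: formal_coord_def)

lemma formal_coord_diff: "formal_coord (c - d) = formal_coord c - formal_coord d"
proof -
  let ?X = "Poly_Mapping.keys c \<union> Poly_Mapping.keys d"
  have "formal_coord (c - d) = (\<Sum>p\<in>?X. fscale sc (of_int (Poly_Mapping.lookup (c - d) p)) (coord sc n \<rho>F (lift (snd p)) (fst p)))"
    using keys_diff[of c d] by (intro formal_coord_superset) auto
  moreover have "formal_coord c = (\<Sum>p\<in>?X. fscale sc (of_int (Poly_Mapping.lookup c p)) (coord sc n \<rho>F (lift (snd p)) (fst p)))"
    "formal_coord d = (\<Sum>p\<in>?X. fscale sc (of_int (Poly_Mapping.lookup d p)) (coord sc n \<rho>F (lift (snd p)) (fst p)))"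
    by (rule formal_coord_superset; simp)+
  ultimately show ?thesis by (simp add: lookup_minus af.nn.scale_left_diff_distrib sum_subtractf)
qed

lemma formal_coord_add: "formal_coord (c + d) = formal_coord c + formal_coord d"
  using formal_coord_diff[of "c + d" d] by simp

lemma formal_coord_sum: "formal_coord (\<Sum>i\<in>X. f i) = (\<Sum>i\<in>X. formal_coord (f i))"
  by (induction X rule: infinite_finite_induct) (auto simp: formal_coord_add)

text \<open>The kernel of the presentation of \<open>I \<otimes> V\<close> by tuples.\<close>

definition nullv :: "(nat \<Rightarrow> 'e) \<Rightarrow> bool" where
  "nullv v \<longleftrightarrow> (\<forall>j\<in>{1..n}. v j \<in> Z)"

lemma nullv_zero [simp]: "nullv 0"
  by (simp add: nullv_def zero_fun_apply q_zero)

lemma nullv_add: "nullv u \<Longrightarrow> nullv v \<Longrightarrow> nullv (u + v)"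
  using Q.add by (simp add: nullv_def plus_fun_apply)

lemma nullv_uminus: "nullv u \<Longrightarrow> nullv (- u)"
  using Q.s.Z_uminus by (simp add: nullv_def uminus_apply)

lemma nullv_diff: "nullv u \<Longrightarrow> nullv v \<Longrightarrow> nullv (u - v)"
  using nullv_add[of u "- v"] nullv_uminus[of v] by simp

lemma nullv_scale: "nullv u \<Longrightarrow> nullv (fscale sc c u)"
  using Q.scale by (simp add: nullv_def fscale_apply)

lemma nullv_sum: "(\<And>i. i \<in> X \<Longrightarrow> nullv (f i)) \<Longrightarrow> nullv (\<Sum>i\<in>X. f i)"
  by (induction X rule: infinite_finite_induct) (auto intro: nullv_add)

lemma nullv_coord: "f \<in> carrier RR \<Longrightarrow> u \<in> Z \<Longrightarrow> nullv (coord sc n \<rho>F u f)"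
  unfolding nullv_def
  using af.coord_stable[of Z f u] Q.zero Q.add Q.scale Q.s.Z_rep by blast

lemma coord_cong: "f \<in> carrier RR \<Longrightarrow> q u = q v \<Longrightarrow> nullv (coord sc n \<rho>F u f - coord sc n \<rho>F v f)"
proof -
  assume f: "f \<in> carrier RR" and "q u = q v"
  then have "u - v \<in> Z" using q_eq_iff by simp
  from nullv_coord[OF f this] show ?thesis using af.coord_linear(1)[OF f, of "u - v" v] by simp
qed

lemma formal_coord_rel:
  assumes "c \<in> tensor_rels RR II VF"
  shows "nullv (formal_coord c)"
  using assms unfolding tensor_rels_def
proof (elim UnE CollectE exE conjE, goal_cases)
  case (1 f f' v)
  then show ?case by (simp add: formal_coord_diff af.coord_add af.I_A)
next
  case (2 f v v')
  have "q (lift (v \<oplus>\<^bsub>V\<^esub> v')) = q (lift v + lift v')" using 2 by (simp add: q_lift q_add)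
  from coord_cong[OF af.I_A[OF 2(2)] this] show ?case
    unfolding 2(1) formal_coord_diff formal_coord_of VF_sel
    unfolding af.coord_linear(1)[OF af.I_A[OF 2(2)]] diff_diff_eq .
next
  case (3 f a v)
  have v: "v \<in> carrier V" using 3(4) by simp
  have "a \<odot>\<^bsub>VF\<^esub> v \<in> carrier V" using vf.M.smult_closed[OF 3(3), of v] v by simp
  moreover have "q (galg_act sc \<rho>F a (lift v)) = a \<odot>\<^bsub>VF\<^esub> v"
    using vf.q_act[OF 3(3), of "lift v"] by (simp add: q_lift v)
  ultimately have "q (galg_act sc \<rho>F a (lift v)) = q (lift (a \<odot>\<^bsub>VF\<^esub> v))" by (simp add: q_lift)
  from coord_cong[OF af.I_A[OF 3(2)] this] show ?case
    unfolding 3(1) formal_coord_diff formal_coord_of af.coord_I_mult[OF 3(2,3)] .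
qed

lemma formal_coord_null:
  assumes "c \<in> null"
  shows "nullv (formal_coord c)"
  using assms unfolding tensor_null_def
proof (induction rule: generate.induct)
  case (inv c)
  have "c \<in> null" by (rule null_rel[OF inv])
  then have "inv\<^bsub>FA\<^esub> c = - c" using null_keys by simp
  then show ?case using formal_coord_diff[of 0 c] formal_coord_rel[OF inv] by (simp add: nullv_uminus)
qed (simp_all add: formal_coord_rel formal_coord_add nullv_add)

lemma formal_coord_basis_sum: "nullv (formal_coord (basis_sum v) - v)"
proof -
  have "formal_coord (basis_sum v) m = lift (q (v m))" if m: "m \<in> {1..n}" for m
  proof -
    have "formal_coord (basis_sum v) m = (\<Sum>j\<in>{1..n}. if j = m then lift (q (v m)) else 0)"
      unfolding basis_sum_def formal_coord_sum sum_fun_apply by (intro sum.cong) (auto simp: af.coord_e delta_def)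
    then show ?thesis using m by simp
  qed
  then show ?thesis using q_lift by (auto simp: nullv_def minus_apply q_eq_iff[symmetric])
qed

text \<open>The coordinate map is a left inverse of the map that sends a tuple to its tensor, so the tensor product is no smaller than \<open>V\<^sup>n\<close>.\<close>

lemma basis_sum_null_iff: "basis_sum v \<in> null \<longleftrightarrow> nullv v"
proof
  assume "basis_sum v \<in> null"
  from nullv_diff[OF formal_coord_null[OF this] formal_coord_basis_sum[of v]] show "nullv v" by simp
qed (auto simp: nullv_def intro: basis_sum_null)

lemma basis_sum_diff: "basis_sum (u - v) - (basis_sum u - basis_sum v) \<in> null"
  using null_uminus[OF basis_sum_add[of "u - v" v]] by (simp add: algebra_simps)

lemma cls_basis_sum_iff: "cls (basis_sum u) = cls (basis_sum v) \<longleftrightarrow> nullv (u - v)"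
proof -
  have "basis_sum u - basis_sum v \<in> null \<longleftrightarrow> basis_sum (u - v) \<in> null"
    using null_diff[OF _ basis_sum_diff[of u v], of "basis_sum (u - v)"]
      null_add[OF basis_sum_diff[of u v], of "basis_sum u - basis_sum v"] by auto
  then show ?thesis by (simp add: cls_eq_iff basis_sum_null_iff)
qed

lemma cls_formal_coord:
  assumes "Poly_Mapping.keys c \<subseteq> pairs"
  shows "cls c = cls (basis_sum (formal_coord c))"
  unfolding cls_eq_iff using assms
proof (induction rule: free_Abelian_group_induct[consumes 1, case_names 2 3 4])
  case 2
  have "basis_sum 0 \<in> null" by (simp add: basis_sum_null_iff)
  then show ?case using null_uminus by simp
next
  case (3 c d)
  from null_diff[OF null_diff[OF 3(3,4)] basis_sum_diff[of "formal_coord c" "formal_coord d"]]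
  show ?case by (simp add: formal_coord_diff algebra_simps)
next
  case (4 p)
  then obtain f v where p: "p = (f, v)" "f \<in> II" "v \<in> carrier V" by auto
  show ?case using tensor_coord[OF p(2), of "lift v"] p by (simp add: q_lift)
qed

end

locale twisted_presentation = artin_presentation n G \<alpha> sc \<rho> q V
  for n and G :: "('g, 'z) monoid_scheme" and \<alpha> and sc :: "'k::field \<Rightarrow> 'e::ab_group_add \<Rightarrow> 'e" and \<rho>
    and q :: "'e \<Rightarrow> 'u" and V +
  fixes lam :: 'k
  assumes lam: "lam \<noteq> 0"
begin

abbreviation "tw \<equiv> twisted_action n lam"
abbreviation "LM \<equiv> lm_obj n G \<alpha> lam V"
abbreviation "la \<equiv> lm_act sc n G \<alpha> \<rho> lam"

sublocale L: artin_module n G \<alpha> "fscale sc" la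
  by (rule lm_rep[OF lam])

lemma tw: "is_twisted_action n lam tw"
  by (rule af.twisted_action[OF lam])

text \<open>By the chain rule, applying \<open>\<alpha>(g)\<close> to the ideal is applying its Jacobian to the coordinates.\<close>

lemma coord_alpha:
  assumes g: "g \<in> carrier G" and f: "f \<in> carrier RR"
  shows "coord sc n \<rho>F (\<rho>G g u) (galg_map (\<alpha> g) f) = lm_G g (coord sc n \<rho>F u f)"
  using f
proof (induction f rule: galg_induct)
  case zero
  have "(\<lambda>j. \<rho>G g ((0 :: nat \<Rightarrow> 'e) j)) = 0" using g by (auto simp: zero_fun_apply rep_zero H_sel)
  then have "coord sc n \<rho>F (\<rho>G g u) (galg_map (\<alpha> g) 0) = lm_G g (coord sc n \<rho>F u 0)"
    by (simp only: galg_map_zero af.coord_zero f.fox_change_zero[OF alpha_gens[OF g]])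
  then show ?case .
next
  case (single c x)
  interpret g: free_rep_map sc sc n \<rho>F "\<lambda>x. \<rho>F (\<alpha> g x)" "\<rho>G g" by (rule rhoG_map[OF g])
  have "fox n \<rho>F (\<alpha> g x) (\<rho>G g u) = lm_G g (fox n \<rho>F x u)"
    unfolding f.fox_chain[OF alpha_endo[OF g] single] g.L_fox[OF single] ..
  then show ?case using g by (simp only: galg_map_single af.coord_single lm_G_scale)
next
  case (add f f')
  have "coord sc n \<rho>F (\<rho>G g u) (galg_map (\<alpha> g) (f + f')) = lm_G g (coord sc n \<rho>F u (f + f'))"
    using add g galg_map_closed[OF add(1), of "\<alpha> g" "free_grp n"] galg_map_closed[OF add(2), of "\<alpha> g" "free_grp n"]
    by (simp only: galg_map_add[OF add(1,2)] af.coord_add lm_G_add alpha_closed)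
  then show ?case .
qed

lemma alpha_I: "g \<in> carrier G \<Longrightarrow> f \<in> II \<Longrightarrow> galg_map (\<alpha> g) f \<in> II"
proof -
  assume g: "g \<in> carrier G" and f: "f \<in> II"
  have "augm (galg_map (\<alpha> g) f) = augm f" if "f \<in> carrier RR" for f :: "fgrp \<Rightarrow> 'k"
    using that
  proof (induction f rule: galg_induct)
    case zero
    have "augm (galg_map (\<alpha> g) 0) = augm (0 :: fgrp \<Rightarrow> 'k)" by (simp only: galg_map_zero)
    then show ?case .
  next
    case (add f f')
    have "augm (galg_map (\<alpha> g) (f + f')) = augm (f + f')"
      using add g galg_map_closed[OF add(1), of "\<alpha> g" "free_grp n"] galg_map_closed[OF add(2), of "\<alpha> g" "free_grp n"]
      by (simp add: galg_map_add[OF add(1,2)] augm_add[where F = "free_grp n"])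
    then show ?case .
  qed (simp add: galg_map_single)
  then show ?thesis
    using f g galg_map_closed[of f "free_grp n" "\<alpha> g" "free_grp n"] by (simp add: aug_ideal_iff)
qed

text \<open>The action of an element of the group algebra on simple tensors, as it occurs in the definition of the Long-Moody module.\<close>

definition sm :: "(fgrp \<times> 'g \<Rightarrow> 'k) \<Rightarrow> (fgrp \<Rightarrow> 'k) \<times> 'u \<Rightarrow> ((fgrp \<Rightarrow> 'k) \<times> 'u \<Rightarrow>\<^sub>0 int)" where
  "sm a = (\<lambda>(f, v). \<Sum>(x, g)\<in>{p. a p \<noteq> 0}.
     frag_of (gsingle (a (x, g)) \<one>\<^bsub>free_grp n\<^esub> \<otimes>\<^bsub>RR\<^esub> tw x (galg_map (\<alpha> g) f),
              gsingle 1 (\<one>\<^bsub>free_grp n\<^esub>, g) \<odot>\<^bsub>V\<^esub> v))"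

lemma sm_keys:
  assumes "a \<in> carrier (group_algebra H)" "f \<in> II" "v \<in> carrier V"
  shows "Poly_Mapping.keys (sm a (f, v)) \<subseteq> pairs"
proof -
  have "(gsingle c \<one>\<^bsub>free_grp n\<^esub> \<otimes>\<^bsub>RR\<^esub> tw x (galg_map (\<alpha> g) f), gsingle 1 (\<one>\<^bsub>free_grp n\<^esub>, g) \<odot>\<^bsub>V\<^esub> v) \<in> pairs"
    if "x \<in> carrier F" "g \<in> carrier G" for x g c
    using that assms af.coord_twisted(1)[OF lam tw that(1) alpha_I[OF that(2)]]
    by (auto simp: H_sel intro!: af.I_mult_left M.smult_closed)
  moreover have "p \<in> carrier F \<times> carrier G" if "a p \<noteq> 0" for p
    using that assms(1) by (auto simp: galg_carrier H_sel)
  ultimately show ?thesis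
    unfolding sm_def prod.case by (intro order_trans[OF keys_sum] UN_least) fastforce
qed

lemma nullv_la: "h \<in> carrier H \<Longrightarrow> nullv v \<Longrightarrow> nullv (la h v)"
proof -
  assume "h \<in> carrier H" and v: "nullv v"
  then obtain x g where h: "h = (x, g)" "x \<in> carrier F" "g \<in> carrier G" by (auto simp: H_sel)
  have "\<forall>j\<in>{1..n}. lm_G g v j \<in> Z"
    using v by (intro ballI Q.lm_G_Z[OF h(3)]) (auto simp: nullv_def)
  then show ?thesis
    unfolding nullv_def h(1) lm_act_eq Q.s.conv_stable_Z[OF lam h(2)] .
qed

lemma nullv_act: "a \<in> carrier (group_algebra H) \<Longrightarrow> nullv v \<Longrightarrow> nullv (galg_act (fscale sc) la a v)"
  unfolding galg_act_def by (intro nullv_sum nullv_scale nullv_la) (auto simp: galg_carrier)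

lemma formal_coord_sm:
  assumes a: "a \<in> carrier (group_algebra H)" and f: "f \<in> II" and v: "v \<in> carrier V"
  shows "nullv (formal_coord (sm a (f, v)) - galg_act (fscale sc) la a (coord sc n \<rho>F (lift v) f))"
proof -
  let ?d = "\<lambda>(x, g). formal_coord (frag_of (gsingle (a (x, g)) \<one>\<^bsub>free_grp n\<^esub> \<otimes>\<^bsub>RR\<^esub> tw x (galg_map (\<alpha> g) f),
      gsingle 1 (\<one>\<^bsub>free_grp n\<^esub>, g) \<odot>\<^bsub>V\<^esub> v)) - fscale sc (a (x, g)) (la (x, g) (coord sc n \<rho>F (lift v) f))"
  have "formal_coord (sm a (f, v)) - galg_act (fscale sc) la a (coord sc n \<rho>F (lift v) f) = (\<Sum>p\<in>{p. a p \<noteq> 0}. ?d p)"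
    by (simp add: sm_def galg_act_def formal_coord_sum sum_subtractf[symmetric] split_def)
  moreover have "nullv (?d p)" if p0: "p \<in> {p. a p \<noteq> 0}" for p
  proof -
    have "p \<in> carrier F \<times> carrier G" using p0 a by (auto simp: galg_carrier H_sel)
    then obtain x g where p: "p = (x, g)" "x \<in> carrier F" "g \<in> carrier G" by blast
    have af: "galg_map (\<alpha> g) f \<in> II" by (rule alpha_I[OF p(3) f])
    have tI: "tw x (galg_map (\<alpha> g) f) \<in> II" by (rule af.coord_twisted(1)[OF lam tw p(2) af])
    have s: "gsingle c \<one>\<^bsub>free_grp n\<^esub> \<otimes>\<^bsub>RR\<^esub> t \<in> carrier RR" if "t \<in> II" for c t
      using af.I_mult_left[OF that] af.I_A by simp
    have "q (lift (gsingle 1 (\<one>\<^bsub>free_grp n\<^esub>, g) \<odot>\<^bsub>V\<^esub> v)) = q (\<rho>G g (lift v))"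
      using p v M.smult_closed[of "gsingle 1 (\<one>\<^bsub>free_grp n\<^esub>, g)" v] q_rep[of "(\<one>\<^bsub>F\<^esub>, g)" "lift v"]
      by (simp add: q_lift H_sel)
    from coord_cong[OF s[OF tI] this, of "a p"]
    have "nullv (coord sc n \<rho>F (lift (gsingle 1 (\<one>\<^bsub>free_grp n\<^esub>, g) \<odot>\<^bsub>V\<^esub> v)) (gsingle (a p) \<one>\<^bsub>free_grp n\<^esub> \<otimes>\<^bsub>RR\<^esub> tw x (galg_map (\<alpha> g) f)) -
        coord sc n \<rho>F (\<rho>G g (lift v)) (gsingle (a p) \<one>\<^bsub>free_grp n\<^esub> \<otimes>\<^bsub>RR\<^esub> tw x (galg_map (\<alpha> g) f)))" .
    moreover have "coord sc n \<rho>F w (gsingle c \<one>\<^bsub>free_grp n\<^esub> \<otimes>\<^bsub>RR\<^esub> t) = fscale sc c (coord sc n \<rho>F w t)"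
      if "t \<in> II" for c w t
      using af.coord_mult[of "gsingle c \<one>\<^bsub>free_grp n\<^esub>" t w] af.I_A[OF that]
      by (simp add: f.fox_one)
    moreover have "coord sc n \<rho>F (\<rho>G g (lift v)) (tw x (galg_map (\<alpha> g) f)) = la (x, g) (coord sc n \<rho>F (lift v) f)"
      unfolding af.coord_twisted(2)[OF lam tw p(2) af] coord_alpha[OF p(3) af.I_A[OF f]] lm_act_eq ..
    ultimately show ?thesis using p tI by simp
  qed
  ultimately show ?thesis by (simp only: nullv_sum)
qed

lemma sm_extend:
  assumes a: "a \<in> carrier (group_algebra H)" and c: "Poly_Mapping.keys c \<subseteq> pairs"
  shows "Poly_Mapping.keys (frag_extend (sm a) c) \<subseteq> pairs"
    and "nullv (formal_coord (frag_extend (sm a) c) - galg_act (fscale sc) la a (formal_coord c))"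
proof -
  show "Poly_Mapping.keys (frag_extend (sm a) c) \<subseteq> pairs"
    using c sm_keys[OF a] by (intro order_trans[OF keys_frag_extend] UN_least) auto
  have diff: "galg_act (fscale sc) la a (u - v) = galg_act (fscale sc) la a u - galg_act (fscale sc) la a v" for u v
    using L.galg_act_add_right[OF a, of "u - v" v] by simp
  show "nullv (formal_coord (frag_extend (sm a) c) - galg_act (fscale sc) la a (formal_coord c))"
    using c
  proof (induction rule: free_Abelian_group_induct[consumes 1, case_names 2 3 4])
    case 2
    then show ?case using L.galg_act_zero_right[OF a] by simp
  next
    case (3 c d)
    from nullv_diff[OF 3(3,4)] show ?case
      by (simp add: frag_extend_diff formal_coord_diff diff algebra_simps)
  next
    case (4 p)
    then show ?case using formal_coord_sm[OF a] by auto
  qed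
qed

lemma LM_smult:
  assumes a: "a \<in> carrier (group_algebra H)"
  shows "a \<odot>\<^bsub>LM\<^esub> cls (basis_sum v) = cls (basis_sum (galg_act (fscale sc) la a v))"
proof -
  have "cls (frag_extend (sm a) c) = cls (basis_sum (galg_act (fscale sc) la a v))" if c: "c \<in> cls (basis_sum v)" for c
  proof -
    have n: "c - basis_sum v \<in> null" by (rule cls_memD[OF c])
    have "Poly_Mapping.keys ((c - basis_sum v) + basis_sum v) \<subseteq> pairs"
      using null_keys[OF n] basis_sum_keys[of v] by (intro order_trans[OF Poly_Mapping.keys_add]) auto
    then have k: "Poly_Mapping.keys c \<subseteq> pairs" by simp
    have "nullv (formal_coord c - formal_coord (basis_sum v))" using formal_coord_null[OF n] by (simp add: formal_coord_diff)
    from nullv_add[OF this formal_coord_basis_sum[of v]] have "nullv (formal_coord c - v)" by simp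
    from nullv_act[OF a this] have "nullv (galg_act (fscale sc) la a (formal_coord c) - galg_act (fscale sc) la a v)"
      using L.galg_act_add_right[OF a, of "formal_coord c - v" v] by simp
    from nullv_add[OF sm_extend(2)[OF a k] this]
    have "nullv (formal_coord (frag_extend (sm a) c) - galg_act (fscale sc) la a v)" by simp
    then show ?thesis by (simp add: cls_formal_coord[OF sm_extend(1)[OF a k]] cls_basis_sum_iff)
  qed
  moreover have "basis_sum v \<in> cls (basis_sum v)"
    unfolding cls_eq by (rule image_eqI[of _ _ 0]) simp_all
  ultimately have "(\<Union>c\<in>cls (basis_sum v). cls (frag_extend (sm a) c)) = cls (basis_sum (galg_act (fscale sc) la a v))"
    by blast
  then show ?thesis by (simp add: lm_obj_def Let_def sm_def)
qed

text \<open>Surjectivity is \<open>tensor_coord\<close>; the action agrees because in coordinates the twisted action is the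
  convolution action and \<open>\<alpha>(g)\<close> is the Jacobian.\<close>

lemma LM_presentation: "presentation (fscale sc) H la (\<lambda>v. cls (basis_sum v)) LM"
proof unfold_locales
  interpret N: normal null FA
    using null_subgroup abelian_free_Abelian_group
    by (intro group.normalI comm_group.subgroup_imp_normal) (auto simp: comm_group_def)
  have car: "carrier LM = {cls c | c. Poly_Mapping.keys c \<subseteq> pairs}"
    by (auto simp: lm_obj_def Let_def tensor_prod_def FactGroup_def RCOSETS_def tensor_class_def)
  show "range (\<lambda>v. cls (basis_sum v)) = carrier LM"
    unfolding car using cls_formal_coord basis_sum_keys by blast
  show "cls (basis_sum 0) = \<zero>\<^bsub>LM\<^esub>"
  proof -
    have "cls (basis_sum 0) = cls 0" by (simp add: cls_eq_iff basis_sum_null_iff)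
    then show ?thesis by (simp add: lm_obj_def Let_def tensor_prod_def FactGroup_def cls_eq)
  qed
  show "cls (basis_sum (u + v)) = cls (basis_sum u) \<oplus>\<^bsub>LM\<^esub> cls (basis_sum v)" for u v
  proof -
    have "cls (basis_sum u) \<oplus>\<^bsub>LM\<^esub> cls (basis_sum v) = cls (basis_sum u + basis_sum v)"
      using N.rcos_sum[of "basis_sum u" "basis_sum v"] basis_sum_keys
      by (simp add: lm_obj_def Let_def tensor_prod_def FactGroup_def tensor_class_def)
    also have "\<dots> = cls (basis_sum (u + v))"
      using null_uminus[OF basis_sum_add[of u v]] by (simp add: cls_eq_iff algebra_simps)
    finally show ?thesis by simp
  qed
qed (rule LM_smult)

lemma LM_zero_iff: "cls (basis_sum v) = \<zero>\<^bsub>LM\<^esub> \<longleftrightarrow> nullv v"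
proof -
  have "\<zero>\<^bsub>LM\<^esub> = cls (basis_sum 0)"
    by (rule presentation.q_zero[OF LM_presentation, symmetric])
  then show ?thesis by (simp add: cls_basis_sum_iff)
qed

end

section \<open>Almost trivial modules\<close>

text \<open>The generators and the scalars generate the group algebra of the free group, so they determine a module
  structure.\<close>

lemma act_from_gens:
  fixes sc :: "'k::field \<Rightarrow> 'e::ab_group_add \<Rightarrow> 'e"
  assumes rep: "group_rep sc (free_grp n) \<rho>" and M: "left_module (group_algebra (free_grp n)) M"
    and closed: "\<And>u. q u \<in> carrier M"
    and add: "\<And>u v. q (u + v) = q u \<oplus>\<^bsub>M\<^esub> q v"
    and scale: "\<And>c u. gsingle c \<one>\<^bsub>free_grp n\<^esub> \<odot>\<^bsub>M\<^esub> q u = q (sc c u)"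
    and gen: "\<And>i u. i \<in> {1..n} \<Longrightarrow> gsingle 1 (fgen n i) \<odot>\<^bsub>M\<^esub> q u = q (\<rho> (fgen n i) u)"
  shows "q 0 = \<zero>\<^bsub>M\<^esub>"
    and "a \<in> carrier (group_algebra (free_grp n)) \<Longrightarrow> a \<odot>\<^bsub>M\<^esub> q u = q (galg_act sc \<rho> a u)"
proof -
  interpret free_rep sc n \<rho> by (rule free_rep.intro[OF rep])
  interpret M: left_module "group_algebra (free_grp n)" M by fact
  show zero: "q 0 = \<zero>\<^bsub>M\<^esub>" using add[of 0 0] closed[of 0] by simp
  have single: "gsingle c h \<otimes>\<^bsub>A\<^esub> gsingle d g = gsingle (c * d) (h \<otimes>\<^bsub>F\<^esub> g)"
    if "h \<in> carrier F" "g \<in> carrier F" for c d h g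
    using that by (rule galg_mult_single)
  have elt: "\<forall>u. gsingle 1 x \<odot>\<^bsub>M\<^esub> q u = q (\<rho> x u)" if "x \<in> carrier F" for x
    using that
  proof (induction rule: free_grp_induct)
    case one
    then show ?case using M.smult_one[OF closed] by (simp add: galg_one rep_one)
  next
    case (gen i)
    then show ?case using assms(6) by simp
  next
    case (inv x)
    show ?case
    proof
      fix u
      have "gsingle 1 (inv\<^bsub>F\<^esub> x) \<odot>\<^bsub>M\<^esub> q u = gsingle 1 (inv\<^bsub>F\<^esub> x) \<odot>\<^bsub>M\<^esub> (gsingle 1 x \<odot>\<^bsub>M\<^esub> q (\<rho> (inv\<^bsub>F\<^esub> x) u))"
        using inv by (simp add: rep_inv)
      also have "\<dots> = (gsingle 1 (inv\<^bsub>F\<^esub> x) \<otimes>\<^bsub>A\<^esub> gsingle 1 x) \<odot>\<^bsub>M\<^esub> q (\<rho> (inv\<^bsub>F\<^esub> x) u)"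
        using inv closed by (simp add: M.smult_assoc1)
      also have "\<dots> = q (\<rho> (inv\<^bsub>F\<^esub> x) u)"
        using inv closed M.smult_one by (simp add: single galg_one)
      finally show "gsingle 1 (inv\<^bsub>F\<^esub> x) \<odot>\<^bsub>M\<^esub> q u = q (\<rho> (inv\<^bsub>F\<^esub> x) u)" .
    qed
  next
    case (mult x y)
    show ?case
    proof
      fix u
      have "gsingle 1 (x \<otimes>\<^bsub>F\<^esub> y) \<odot>\<^bsub>M\<^esub> q u = gsingle 1 x \<odot>\<^bsub>M\<^esub> (gsingle 1 y \<odot>\<^bsub>M\<^esub> q u)"
        using mult closed M.smult_assoc1[of "gsingle 1 x" "gsingle 1 y" "q u"] by (simp add: single)
      then show "gsingle 1 (x \<otimes>\<^bsub>F\<^esub> y) \<odot>\<^bsub>M\<^esub> q u = q (\<rho> (x \<otimes>\<^bsub>F\<^esub> y) u)"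
        using mult by (simp add: rep_mult)
    qed
  qed
  show "a \<odot>\<^bsub>M\<^esub> q u = q (galg_act sc \<rho> a u)" if "a \<in> carrier A"
    using that
  proof (induction a rule: galg_induct)
    case zero
    show ?case using lmod_smult_zero[OF M closed[of u]] \<open>q 0 = \<zero>\<^bsub>M\<^esub>\<close> by simp
  next
    case (single c h)
    have "gsingle c h = gsingle c \<one>\<^bsub>F\<^esub> \<otimes>\<^bsub>A\<^esub> gsingle 1 h"
      using single by (simp add: galg_mult_single)
    then have "gsingle c h \<odot>\<^bsub>M\<^esub> q u = gsingle c \<one>\<^bsub>F\<^esub> \<odot>\<^bsub>M\<^esub> (gsingle 1 h \<odot>\<^bsub>M\<^esub> q u)"
      using single closed by (simp add: M.smult_assoc1)
    then show ?case using single by (simp add: elt scale)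
  next
    case (add a b)
    have "(a + b) \<odot>\<^bsub>M\<^esub> q u = q (galg_act sc \<rho> (a + b) u)"
      using add M.smult_l_distr[of a b "q u"] closed by (simp add: galg_act_add assms(4))
    then show ?case .
  qed
qed

text \<open>The one-dimensional module on which \<open>x\<^sub>i\<close> acts by \<open>c\<close> and the other generators trivially.  Every almost trivial
  module is of this form, by \<open>almost_trivial_elim\<close>.\<close>

definition char_act :: "nat \<Rightarrow> nat \<Rightarrow> 'k::field \<Rightarrow> fgrp \<Rightarrow> 'k \<Rightarrow> 'k" where
  "char_act n i c = free_action n (\<lambda>j z. if j = i then c * z else z)"

definition char_mod :: "nat \<Rightarrow> nat \<Rightarrow> 'k::field \<Rightarrow> (fgrp \<Rightarrow> 'k, 'k) module" where
  "char_mod n i c = \<lparr>carrier = UNIV, monoid.mult = undefined, one = undefined, ring.zero = 0,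
     ring.add = (+), smult = galg_act (*) (char_act n i c)\<rparr>"

context
  fixes n i :: nat and c :: "'k::field"
  assumes c: "c \<noteq> 0" and i: "i \<in> {1..n}"
begin

lemma char_bij: "\<forall>j\<in>{1..n}. bij (\<lambda>z. if j = i then c * z else z)"
proof
  fix j show "bij (\<lambda>z. if j = i then c * z else z)"
    by (rule o_bij[of "\<lambda>z. if j = i then inverse c * z else z"]) (use c in \<open>auto simp: fun_eq_iff\<close>)
qed

lemma char_rep: "group_rep (*) (free_grp n) (char_act n i c)"
  unfolding char_act_def
  by (intro free_action_linear vector_space_mult char_bij) (auto simp: algebra_simps)

lemma char_gen: "j \<in> {1..n} \<Longrightarrow> char_act n i c (fgen n j) z = (if j = i then c * z else z)"
  by (simp add: char_act_def free_action_gen[OF char_bij])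

lemma char_presentation: "presentation (*) (free_grp n) (char_act n i c) (\<lambda>z. z) (char_mod n i c)"
  by (intro presentation.intro char_rep presentation_axioms.intro) (simp_all add: char_mod_def)

lemma char_almost_trivial: "almost_trivial n (char_mod n i c)"
proof -
  interpret presentation "(*)" "free_grp n" "char_act n i c" "\<lambda>z. z" "char_mod n i c"
    by (rule char_presentation)
  show ?thesis
    unfolding almost_trivial_def
  proof (intro conjI left_module)
    have "w = gsingle w \<one>\<^bsub>free_grp n\<^esub> \<odot>\<^bsub>char_mod n i c\<^esub> 1" for w
      using q_scale[of w 1] by simp
    then have "\<forall>w\<in>carrier (char_mod n i c). \<exists>d. w = gsingle d \<one>\<^bsub>free_grp n\<^esub> \<odot>\<^bsub>char_mod n i c\<^esub> 1" by blast
    moreover have "1 \<in> carrier (char_mod n i c)" "1 \<noteq> \<zero>\<^bsub>char_mod n i c\<^esub>" by (simp_all add: char_mod_def)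
    ultimately show "\<exists>t\<in>carrier (char_mod n i c). t \<noteq> \<zero>\<^bsub>char_mod n i c\<^esub> \<and>
        (\<forall>w\<in>carrier (char_mod n i c). \<exists>d. w = gsingle d \<one>\<^bsub>free_grp n\<^esub> \<odot>\<^bsub>char_mod n i c\<^esub> t)"
      by blast
    have "gsingle 1 (fgen n j) \<odot>\<^bsub>char_mod n i c\<^esub> t = t" if "j \<in> {1..n} - {i}" for j t
      using q_rep[of "fgen n j" t] that char_gen[of j t] by simp
    then show "\<exists>m\<in>{1..n}. \<forall>j\<in>{1..n} - {m}. \<forall>t\<in>carrier (char_mod n i c). gsingle 1 (fgen n j) \<odot>\<^bsub>char_mod n i c\<^esub> t = t"
      using i by blast
  qed
qed

end

locale free_presentation = presentation sc "free_grp n" \<rho> q M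
  for sc :: "'k::field \<Rightarrow> 'e::ab_group_add \<Rightarrow> 'e" and n and \<rho> and q :: "'e \<Rightarrow> 'm" and M
begin

abbreviation "Z \<equiv> {u. q u = \<zero>\<^bsub>M\<^esub>}"

lemma q_scale0: "q u = \<zero>\<^bsub>M\<^esub> \<Longrightarrow> q (sc c u) = \<zero>\<^bsub>M\<^esub>"
  using q_scale[of c u] q_scale[of c 0] q_zero by simp

sublocale st: stable_subspace sc n \<rho> Z
proof (intro stable_subspace.intro free_rep.intro group_rep_axioms stable_subspace_axioms.intro)
  fix x u assume "x \<in> carrier (free_grp n)" "u \<in> Z"
  then show "\<rho> x u \<in> Z" using q_rep[of x u] q_rep[of x 0] q_zero by (simp add: rep_zero)
qed (auto simp: q_zero q_add q_scale0)

lemma almost_trivial_elim: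
  fixes T :: "(fgrp \<Rightarrow> 'k, 'k) module"
  assumes "almost_trivial n T"
  obtains t i c where "left_module (group_algebra (free_grp n)) T" "t \<in> carrier T" "i \<in> {1..n}" "c \<noteq> 0"
    "\<forall>w\<in>carrier T. \<exists>d. w = gsingle d \<one>\<^bsub>free_grp n\<^esub> \<odot>\<^bsub>T\<^esub> t"
    "\<forall>w\<in>carrier T. gsingle 1 (fgen n i) \<odot>\<^bsub>T\<^esub> w = gsingle c \<one>\<^bsub>free_grp n\<^esub> \<odot>\<^bsub>T\<^esub> w"
    "\<forall>j\<in>{1..n} - {i}. \<forall>w\<in>carrier T. gsingle 1 (fgen n j) \<odot>\<^bsub>T\<^esub> w = w"
proof -
  obtain t i where T: "left_module (group_algebra (free_grp n)) T" and t: "t \<in> carrier T" "t \<noteq> \<zero>\<^bsub>T\<^esub>"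
    and i: "i \<in> {1..n}" and d: "\<forall>w\<in>carrier T. \<exists>d. w = gsingle d \<one>\<^bsub>free_grp n\<^esub> \<odot>\<^bsub>T\<^esub> t"
    and j: "\<forall>j\<in>{1..n} - {i}. \<forall>w\<in>carrier T. gsingle 1 (fgen n j) \<odot>\<^bsub>T\<^esub> w = w"
    using assms unfolding almost_trivial_def by blast
  interpret T: left_module "group_algebra (free_grp n)" T by fact
  have assoc: "gsingle a x \<odot>\<^bsub>T\<^esub> (gsingle b y \<odot>\<^bsub>T\<^esub> w) = gsingle (a * b) (x \<otimes>\<^bsub>free_grp n\<^esub> y) \<odot>\<^bsub>T\<^esub> w"
    if "x \<in> carrier (free_grp n)" "y \<in> carrier (free_grp n)" "w \<in> carrier T" for x y a b w
  proof -
    have "gsingle a x \<otimes>\<^bsub>group_algebra (free_grp n)\<^esub> gsingle b y = gsingle (a * b) (x \<otimes>\<^bsub>free_grp n\<^esub> y)"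
      using that(1,2) by (rule galg_mult_single)
    then show ?thesis using T.smult_assoc1[of "gsingle a x" "gsingle b y" w] that by simp
  qed
  have x: "fgen n i \<in> carrier (free_grp n)" using i by simp
  obtain c where c: "gsingle 1 (fgen n i) \<odot>\<^bsub>T\<^esub> t = gsingle c \<one>\<^bsub>free_grp n\<^esub> \<odot>\<^bsub>T\<^esub> t"
    using d T.smult_closed[of "gsingle 1 (fgen n i)" t] x t by auto
  have "c \<noteq> 0"
  proof
    assume "c = 0"
    then have "gsingle 1 (fgen n i) \<odot>\<^bsub>T\<^esub> t = \<zero>\<^bsub>T\<^esub>" using c lmod_smult_zero[OF T t(1)] by simp
    then have "gsingle 1 (inv\<^bsub>free_grp n\<^esub> (fgen n i)) \<odot>\<^bsub>T\<^esub> (gsingle 1 (fgen n i) \<odot>\<^bsub>T\<^esub> t) = \<zero>\<^bsub>T\<^esub>"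
      using lmod_zero_right[OF T, of "gsingle 1 (inv\<^bsub>free_grp n\<^esub> (fgen n i))"] x by simp
    then show False using t x T.smult_one[of t] by (simp add: assoc galg_one)
  qed
  moreover have "gsingle 1 (fgen n i) \<odot>\<^bsub>T\<^esub> w = gsingle c \<one>\<^bsub>free_grp n\<^esub> \<odot>\<^bsub>T\<^esub> w" if w: "w \<in> carrier T" for w
  proof -
    obtain a where a: "w = gsingle a \<one>\<^bsub>free_grp n\<^esub> \<odot>\<^bsub>T\<^esub> t" using d w by auto
    have "gsingle 1 (fgen n i) \<odot>\<^bsub>T\<^esub> w = gsingle a \<one>\<^bsub>free_grp n\<^esub> \<odot>\<^bsub>T\<^esub> (gsingle 1 (fgen n i) \<odot>\<^bsub>T\<^esub> t)"
      using x t by (simp add: a assoc)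
    also have "\<dots> = gsingle c \<one>\<^bsub>free_grp n\<^esub> \<odot>\<^bsub>T\<^esub> w"
      using t by (simp add: c a assoc mult.commute)
    finally show ?thesis .
  qed
  ultimately show ?thesis using that T t i d j by blast
qed

lemma hom_zero:
  fixes T :: "(fgrp \<Rightarrow> 'k, 'a) module" and N :: "(fgrp \<Rightarrow> 'k, 'b) module"
  assumes "left_module (group_algebra (free_grp n)) T" "left_module (group_algebra (free_grp n)) N"
  shows "(\<lambda>t\<in>carrier T. \<zero>\<^bsub>N\<^esub>) \<in> lmod_hom (group_algebra (free_grp n)) T N"
proof -
  interpret T: left_module "group_algebra (free_grp n)" T by fact
  interpret N: left_module "group_algebra (free_grp n)" N by fact
  show ?thesis
    using lmod_zero_right[OF assms(2)] by (auto simp: lmod_hom_def T.smult_closed)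
qed

text \<open>A homomorphism from an almost trivial module is a choice of an eigenvector.\<close>

lemma P1_iff: "P1 n M \<longleftrightarrow> no_sub sc n \<rho> Z"
proof
  assume P: "P1 n M"
  show "no_sub sc n \<rho> Z" unfolding no_sub_def
  proof (intro ballI allI impI)
    fix i c e assume i: "i \<in> {1..n}" and c: "c \<noteq> 0"
      and j: "\<forall>j\<in>{1..n} - {i}. gdiff n \<rho> j e \<in> Z" and ev: "\<rho> (fgen n i) e - sc c e \<in> Z"
    interpret T: presentation "(*)" "free_grp n" "char_act n i c" "\<lambda>z. z" "char_mod n i c"
      by (rule char_presentation[OF c i])
    let ?f = "\<lambda>z. q (sc z e)"
    have gen: "gsingle 1 (fgen n m) \<odot>\<^bsub>M\<^esub> ?f z = ?f (char_act n i c (fgen n m) z)" if m: "m \<in> {1..n}" for m z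
    proof -
      have "q (\<rho> (fgen n m) e) = q (if m = i then sc c e else e)"
        using j ev m by (auto simp: q_eq_iff gdiff_def)
      then have "q (sc z (\<rho> (fgen n m) e)) = q (sc z (if m = i then sc c e else e))"
        by (metis q_scale)
      then show ?thesis using m by (auto simp: q_rep rep_scale char_gen[OF c i] mult.commute)
    qed
    have act: "a \<odot>\<^bsub>M\<^esub> ?f z = ?f (galg_act (*) (char_act n i c) a z)"
      if "a \<in> carrier (group_algebra (free_grp n))" for a z
      by (rule act_from_gens(2)[OF char_rep[OF c i] M.left_module_axioms _ _ _ gen that])
        (simp_all add: q_add[symmetric] scale_left_distrib q_scale)
    have "?f \<in> lmod_hom (group_algebra (free_grp n)) (char_mod n i c) M"
      using act by (auto simp: lmod_hom_def char_mod_def q_add[symmetric] scale_left_distrib)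
    then have "?f = (\<lambda>t\<in>carrier (char_mod n i c). \<zero>\<^bsub>M\<^esub>)"
      using P char_almost_trivial[OF c i] by (auto simp: P1_def)
    from fun_cong[OF this, of 1] show "e \<in> Z" by (simp add: char_mod_def)
  qed
next
  assume P: "no_sub sc n \<rho> Z"
  show "P1 n M" unfolding P1_def
  proof (intro allI impI)
    fix T :: "(fgrp \<Rightarrow> 'k, 'k) module" assume aT: "almost_trivial n T"
    then obtain t i c where T: "left_module (group_algebra (free_grp n)) T" "t \<in> carrier T" "i \<in> {1..n}" "c \<noteq> 0"
      and d: "\<forall>w\<in>carrier T. \<exists>d. w = gsingle d \<one>\<^bsub>free_grp n\<^esub> \<odot>\<^bsub>T\<^esub> t"
      and x: "\<forall>w\<in>carrier T. gsingle 1 (fgen n i) \<odot>\<^bsub>T\<^esub> w = gsingle c \<one>\<^bsub>free_grp n\<^esub> \<odot>\<^bsub>T\<^esub> w"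
      and j: "\<forall>j\<in>{1..n} - {i}. \<forall>w\<in>carrier T. gsingle 1 (fgen n j) \<odot>\<^bsub>T\<^esub> w = w"
      by (rule almost_trivial_elim)
    have "\<phi> = (\<lambda>t\<in>carrier T. \<zero>\<^bsub>M\<^esub>)" if \<phi>: "\<phi> \<in> lmod_hom (group_algebra (free_grp n)) T M" for \<phi>
    proof -
      have hom: "\<phi> (a \<odot>\<^bsub>T\<^esub> w) = a \<odot>\<^bsub>M\<^esub> \<phi> w" if "a \<in> carrier (group_algebra (free_grp n))" "w \<in> carrier T" for a w
        using \<phi> that by (simp add: lmod_hom_def)
      have "\<phi> t \<in> carrier M" using \<phi> T(2) by (auto simp: lmod_hom_def)
      then obtain e where e: "\<phi> t = q e" using q_surj by blast
      have "q (\<rho> (fgen n m) e) = q e" if "m \<in> {1..n} - {i}" for m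
        using hom[of "gsingle 1 (fgen n m)" t] j T(2) that by (simp add: e q_rep)
      moreover have "q (\<rho> (fgen n i) e) = q (sc c e)"
        using hom[of "gsingle 1 (fgen n i)" t] hom[of "gsingle c \<one>\<^bsub>free_grp n\<^esub>" t] x T by (simp add: e q_rep q_scale)
      ultimately have "e \<in> Z"
        using P[unfolded no_sub_def, rule_format, OF T(3,4), of e] by (auto simp: gdiff_def q_eq_iff)
      then have "\<phi> w = \<zero>\<^bsub>M\<^esub>" if w: "w \<in> carrier T" for w
      proof -
        obtain a where "w = gsingle a \<one>\<^bsub>free_grp n\<^esub> \<odot>\<^bsub>T\<^esub> t" using d w by blast
        then show ?thesis using hom[of "gsingle a \<one>\<^bsub>free_grp n\<^esub>" t] T(2) \<open>e \<in> Z\<close> by (simp add: e q_scale q_scale0)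
      qed
      then show ?thesis using \<phi> by (auto simp: lmod_hom_def PiE_def extensional_def fun_eq_iff)
    qed
    then show "lmod_hom (group_algebra (free_grp n)) T M = {\<lambda>t\<in>carrier T. \<zero>\<^bsub>M\<^esub>}"
      using hom_zero[OF T(1) M.left_module_axioms] by blast
  qed
qed

text \<open>Extend a basis of the subspace by the given vector.\<close>

lemma separating_functional:
  assumes S: "subspace S" and e: "e \<notin> S"
  shows "\<exists>f. (\<forall>u v. f (u + v) = f u + f v) \<and> (\<forall>c u. f (sc c u) = c * f u) \<and> (\<forall>u\<in>S. f u = 0) \<and> f e = (1 :: 'k)"
proof -
  interpret k: vector_space "(*) :: 'k \<Rightarrow> 'k \<Rightarrow> 'k" by (rule vector_space_mult)
  interpret p: vector_space_pair sc "(*) :: 'k \<Rightarrow> 'k \<Rightarrow> 'k" by unfold_locales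
  obtain B where B: "B \<subseteq> S" "independent B" "span B = S"
    using basis_exists[of S] span_subspace[OF _ _ S] by metis
  have "independent (insert e B)" using B e by (intro independent_insertI) auto
  then obtain f where f: "Vector_Spaces.linear sc (*) f" "\<forall>x\<in>insert e B. f x = (if x = e then 1 else 0)"
    using p.linear_independent_extend[of "insert e B" "\<lambda>x. if x = e then 1 else 0"] by blast
  interpret f: Vector_Spaces.linear sc "(*)" f by (rule f(1))
  have "f u = 0" if "u \<in> S" for u
    using that unfolding B(3)[symmetric]
  proof (induction rule: span_induct_alt)
    case (step c x y)
    then have "f x = 0" using f(2) B e by auto
    then show ?case using step by (simp add: f.add f.scale)
  qed (simp add: f.zero)
  then show ?thesis using f(2) f.add f.scale by (intro exI[of _ f]) auto
qed

text \<open>If the images of the \<open>x\<^sub>j - 1\<close> and of \<open>x\<^sub>i - c\<close> do not span, a linear form that vanishes on them is a homomorphism to an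
  almost trivial module.\<close>

lemma P2_iff: "P2 n M \<longleftrightarrow> no_quot sc n \<rho> Z"
proof
  assume P: "P2 n M"
  show "no_quot sc n \<rho> Z" unfolding no_quot_def
  proof (intro ballI allI impI)
    fix i c e assume i: "i \<in> {1..n}" and c: "(c :: 'k) \<noteq> 0"
    let ?g = "\<lambda>w. (\<Sum>j\<in>{1..n} - {i}. gdiff n \<rho> j (w j)) + (\<rho> (fgen n i) (w i) - sc c (w i))"
    (* if this span were proper, a linear form vanishing on it would give an almost trivial quotient *)
    define S where "S = {u. \<exists>w. u - ?g w \<in> Z}"
    have g_add: "?g (v + w) = ?g v + ?g w" for v w
      using i by (simp add: plus_fun_apply st.gdiff_add sum.distrib rep_add scale_right_distrib)
    have g_scale: "?g (fscale sc a w) = sc a (?g w)" for a w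
      using i by (simp add: fscale_apply st.gdiff_scale rep_scale scale_sum_right scale_right_distrib
          scale_right_diff_distrib scale_left_commute)
    have S: "subspace S" unfolding subspace_def
    proof (intro conjI ballI allI)
      have "?g 0 = 0" using g_add[of 0 0] by simp
      then show "0 \<in> S" unfolding S_def by (intro CollectI exI[of _ 0]) (simp add: q_zero)
    next
      fix u v assume "u \<in> S" "v \<in> S"
      then obtain w w' where "u - ?g w \<in> Z" "v - ?g w' \<in> Z" unfolding S_def by blast
      then have "(u - ?g w) + (v - ?g w') \<in> Z" by (rule st.Z_add)
      then have "(u + v) - ?g (w + w') \<in> Z" unfolding g_add by (simp add: algebra_simps)
      then show "u + v \<in> S" unfolding S_def by blast
    next
      fix a u assume "u \<in> S"
      then obtain w where "u - ?g w \<in> Z" unfolding S_def by blast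
      then have "sc a (u - ?g w) \<in> Z" by (rule st.Z_scale)
      then have "sc a u - ?g (fscale sc a w) \<in> Z" unfolding g_scale by (simp only: scale_right_diff_distrib)
      then show "sc a u \<in> S" unfolding S_def by blast
    qed
    have gS: "?g w \<in> S" for w unfolding S_def by (intro CollectI exI[of _ w]) (simp add: q_zero)
    have ZS: "u \<in> S" if "u \<in> Z" for u
    proof -
      have "?g 0 = 0" using g_add[of 0 0] by simp
      then show ?thesis unfolding S_def using that by (intro CollectI exI[of _ 0]) simp
    qed
    have "e \<in> S"
    proof (rule ccontr)
      assume "e \<notin> S"
      then obtain f where f: "\<And>u v. f (u + v) = f u + f v" "\<And>a u. f (sc a u) = a * f u"
        "\<And>u. u \<in> S \<Longrightarrow> f u = 0" "f e = (1 :: 'k)"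
        using separating_functional[OF S] by blast
      have f_diff: "f (u - v) = f u - f v" for u v using f(1)[of "u - v" v] by simp
      have D: "gdiff n \<rho> m u \<in> S" if "m \<in> {1..n} - {i}" for m u
      proof -
        have "?g (delta m u) = gdiff n \<rho> m u"
        proof -
          have "(\<Sum>j\<in>{1..n} - {i}. gdiff n \<rho> j (delta m u j)) = (\<Sum>j\<in>{1..n} - {i}. if j = m then gdiff n \<rho> m u else 0)"
            by (intro sum.cong) (auto simp: delta_def)
          then show ?thesis using that i by (simp add: delta_apply rep_zero)
        qed
        then show ?thesis using gS by metis
      qed
      have X: "\<rho> (fgen n i) u - sc c u \<in> S" for u
      proof -
        have "(\<Sum>j\<in>{1..n} - {i}. gdiff n \<rho> j (delta i u j)) = 0"
          by (intro sum.neutral) (auto simp: delta_def)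
        then have "?g (delta i u) = \<rho> (fgen n i) u - sc c u" by simp
        then show ?thesis using gS by metis
      qed
      interpret T: presentation "(*)" "free_grp n" "char_act n i c" "\<lambda>z. z" "char_mod n i c"
        by (rule char_presentation[OF c i])
      have gen: "gsingle 1 (fgen n m) \<odot>\<^bsub>char_mod n i c\<^esub> f u = f (\<rho> (fgen n m) u)" if m: "m \<in> {1..n}" for m u
        using T.q_rep[of "fgen n m" "f u"] m f(3)[OF X[of u]] f(3)[OF D[of m u]]
        by (auto simp: char_gen[OF c i] f_diff f(2) gdiff_def split: if_splits)
      have act: "a \<odot>\<^bsub>char_mod n i c\<^esub> f u = f (galg_act sc \<rho> a u)"
        if "a \<in> carrier (group_algebra (free_grp n))" for a u
        by (rule act_from_gens(2)[OF group_rep_axioms T.left_module _ _ _ gen that])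
          (use T.q_scale in \<open>simp_all add: char_mod_def f\<close>)
      let ?\<phi> = "induced_map q f (carrier M)"
      have \<phi>: "?\<phi> (q u) = f u" for u
      proof (rule induced_map_apply)
        show "f u = f v" if "q u = q v" for u v
          using f(3)[OF ZS[of "u - v"]] that by (simp add: q_eq_iff f_diff)
      qed simp
      have "?\<phi> \<in> lmod_hom (group_algebra (free_grp n)) M (char_mod n i c)"
      proof -
        have "?\<phi> (x \<oplus>\<^bsub>M\<^esub> y) = ?\<phi> x + ?\<phi> y" if "x \<in> carrier M" "y \<in> carrier M" for x y
          using q_surj[OF that(1)] q_surj[OF that(2)] \<phi> f(1) by (auto simp: q_add[symmetric])
        moreover have "?\<phi> (a \<odot>\<^bsub>M\<^esub> x) = a \<odot>\<^bsub>char_mod n i c\<^esub> ?\<phi> x"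
          if "a \<in> carrier (group_algebra (free_grp n))" "x \<in> carrier M" for a x
          using q_surj[OF that(2)] that(1) \<phi> act by (auto simp: q_act)
        ultimately show ?thesis
          by (auto simp: lmod_hom_def char_mod_def induced_map_def)
      qed
      then have "?\<phi> = (\<lambda>v\<in>carrier M. \<zero>\<^bsub>char_mod n i c\<^esub>)"
        using P char_almost_trivial[OF c i] by (auto simp: P2_def)
      then have "?\<phi> (q e) = 0" by (simp add: char_mod_def)
      then show False using \<phi> f(4) by simp
    qed
    then show "\<exists>w. e - ?g w \<in> Z" unfolding S_def by blast
  qed
next
  assume P: "no_quot sc n \<rho> Z"
  show "P2 n M" unfolding P2_def
  proof (intro allI impI)
    fix T :: "(fgrp \<Rightarrow> 'k, 'k) module" assume aT: "almost_trivial n T"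
    then obtain t i c where T: "left_module (group_algebra (free_grp n)) T" "t \<in> carrier T" "i \<in> {1..n}" "c \<noteq> 0"
      and x: "\<forall>w\<in>carrier T. gsingle 1 (fgen n i) \<odot>\<^bsub>T\<^esub> w = gsingle c \<one>\<^bsub>free_grp n\<^esub> \<odot>\<^bsub>T\<^esub> w"
      and j: "\<forall>j\<in>{1..n} - {i}. \<forall>w\<in>carrier T. gsingle 1 (fgen n j) \<odot>\<^bsub>T\<^esub> w = w"
      by (rule almost_trivial_elim)
    interpret T: left_module "group_algebra (free_grp n)" T by (rule T(1))
    have "\<phi> = (\<lambda>v\<in>carrier M. \<zero>\<^bsub>T\<^esub>)" if \<phi>: "\<phi> \<in> lmod_hom (group_algebra (free_grp n)) M T" for \<phi>
    proof -
      have closed: "\<phi> (q u) \<in> carrier T" for u using \<phi> by (auto simp: lmod_hom_def)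
      have hom: "a \<odot>\<^bsub>T\<^esub> \<phi> (q u) = \<phi> (q (galg_act sc \<rho> a u))" if "a \<in> carrier (group_algebra (free_grp n))" for a u
        using \<phi> that by (simp add: lmod_hom_def q_act[symmetric])
      have add: "\<phi> (q (u + v)) = \<phi> (q u) \<oplus>\<^bsub>T\<^esub> \<phi> (q v)" for u v
        using \<phi> by (simp add: lmod_hom_def q_add)
      have zero: "\<phi> (q 0) = \<zero>\<^bsub>T\<^esub>" using add[of 0 0] closed[of 0] by simp
      have diff: "\<phi> (q (u - v)) = \<zero>\<^bsub>T\<^esub>" if "\<phi> (q u) = \<phi> (q v)" for u v
      proof -
        have "\<phi> (q (u - v)) \<oplus>\<^bsub>T\<^esub> \<phi> (q v) = \<phi> (q v)" using add[of "u - v" v] that by simp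
        then show ?thesis using closed by simp
      qed
      have D: "\<phi> (q (gdiff n \<rho> m u)) = \<zero>\<^bsub>T\<^esub>" if "m \<in> {1..n} - {i}" for m u
        unfolding gdiff_def using hom[of "gsingle 1 (fgen n m)" u] j closed[of u] that by (intro diff) simp
      have X: "\<phi> (q (\<rho> (fgen n i) u - sc c u)) = \<zero>\<^bsub>T\<^esub>" for u
        using hom[of "gsingle 1 (fgen n i)" u] hom[of "gsingle c \<one>\<^bsub>free_grp n\<^esub>" u] x closed[of u] T(3)
        by (intro diff) (simp add: rep_one)
      have sum: "\<phi> (q (\<Sum>m\<in>J. f m)) = \<zero>\<^bsub>T\<^esub>" if "finite J" "\<And>m. m \<in> J \<Longrightarrow> \<phi> (q (f m)) = \<zero>\<^bsub>T\<^esub>" for J f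
        using that by (induction J rule: finite_induct) (simp_all add: zero add)
      have "\<phi> (q e) = \<zero>\<^bsub>T\<^esub>" for e
      proof -
        obtain w where w: "e - ((\<Sum>j\<in>{1..n} - {i}. gdiff n \<rho> j (w j)) + (\<rho> (fgen n i) (w i) - sc c (w i))) \<in> Z"
          using P[unfolded no_quot_def, rule_format, OF T(3,4), of e] by blast
        let ?g = "(\<Sum>j\<in>{1..n} - {i}. gdiff n \<rho> j (w j)) + (\<rho> (fgen n i) (w i) - sc c (w i))"
        have "q e = q ?g" using w by (simp add: q_eq_iff)
        moreover have "\<phi> (q ?g) = \<zero>\<^bsub>T\<^esub>"
          unfolding add X by (subst sum) (auto intro: D)
        ultimately show ?thesis by simp
      qed
      then have "\<phi> v = \<zero>\<^bsub>T\<^esub>" if "v \<in> carrier M" for v using q_surj[OF that] by auto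
      then show ?thesis using \<phi> by (auto simp: lmod_hom_def PiE_def extensional_def fun_eq_iff)
    qed
    then show "lmod_hom (group_algebra (free_grp n)) M T = {\<lambda>v\<in>carrier M. \<zero>\<^bsub>T\<^esub>}"
      using hom_zero[OF M.left_module_axioms T(1)] by blast
  qed
qed

end

section \<open>Quotients transported into the universe\<close>

text \<open>Iterate an injection of the square of an infinite type into the type.\<close>

lemma tuple_code:
  assumes "infinite (UNIV :: 'u set)"
  shows "\<exists>J :: (nat \<Rightarrow> 'u) \<Rightarrow> 'u. \<forall>u v. J u = J v \<longrightarrow> (\<forall>i\<in>{1..m}. u i = v i)"
proof (induction m)
  case 0
  show ?case by (intro exI[of _ "\<lambda>_. undefined"]) simp
next
  case (Suc m)
  then obtain J :: "(nat \<Rightarrow> 'u) \<Rightarrow> 'u" where J: "\<forall>u v. J u = J v \<longrightarrow> (\<forall>i\<in>{1..m}. u i = v i)" by blast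
  obtain f where "bij_betw f (UNIV \<times> UNIV :: ('u \<times> 'u) set) (UNIV :: 'u set)"
    using card_of_Times_same_infinite[OF assms] unfolding card_of_ordIso[symmetric] by blast
  then have f: "inj f" by (simp add: bij_betw_def)
  show ?case
  proof (intro exI[of _ "\<lambda>u. f (J u, u (Suc m))"] allI impI)
    fix u v :: "nat \<Rightarrow> 'u" assume "f (J u, u (Suc m)) = f (J v, v (Suc m))"
    then have "J u = J v" "u (Suc m) = v (Suc m)" using f by (auto dest: injD)
    then show "\<forall>i\<in>{1..Suc m}. u i = v i" using J by (auto simp: atLeastAtMostSuc_conv)
  qed
qed

text \<open>A quotient of the \<open>n\<close>-fold power of a subset of the universe injects into the universe, by coding chosen
  representatives.\<close>

lemma code_exists:
  fixes q :: "'e \<Rightarrow> 'u" and p :: "(nat \<Rightarrow> 'e) \<Rightarrow> 'm"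
  assumes inf: "infinite (UNIV :: 'u set)"
    and p: "\<And>u v. \<forall>i\<in>{1..n}. q (u i) = q (v i) \<Longrightarrow> p u = p v" and C: "C \<subseteq> range p"
  shows "\<exists>e :: 'm \<Rightarrow> 'u. inj_on e C"
proof -
  obtain J :: "(nat \<Rightarrow> 'u) \<Rightarrow> 'u" where J: "\<forall>u v. J u = J v \<longrightarrow> (\<forall>i\<in>{1..n}. u i = v i)"
    using tuple_code[OF inf] by blast
  define s where "s x = (SOME u. p u = x)" for x
  have s: "p (s x) = x" if "x \<in> C" for x
    unfolding s_def using someI_ex[of "\<lambda>u. p u = x"] that C by blast
  have "inj_on (\<lambda>x. J (\<lambda>i. q (s x i))) C"
  proof (rule inj_onI)
    fix x y assume xy: "x \<in> C" "y \<in> C" "J (\<lambda>i. q (s x i)) = J (\<lambda>i. q (s y i))"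
    then have "\<forall>i\<in>{1..n}. q (s x i) = q (s y i)" using J by blast
    then have "p (s x) = p (s y)" by (rule p)
    then show "x = y" using s xy by simp
  qed
  then show ?thesis by blast
qed

text \<open>The presentation of the quotient by \<open>S\<close>, after transport into the universe.\<close>

definition quot_vec :: "('r, 'm) module \<Rightarrow> 'm set \<Rightarrow> ('e \<Rightarrow> 'm) \<Rightarrow> 'e \<Rightarrow> 'u" where
  "quot_vec M S q u = small_enc (quot_module M S) (S +>\<^bsub>M\<^esub> q u)"

text \<open>A presented module with the submodule that is to be divided out, and a bound on the size of the quotient.  The type
  argument names the universe.\<close>

locale vec_quotient = presentation sc H \<rho> q M
  for sc :: "'k::field \<Rightarrow> 'e::ab_group_add \<Rightarrow> 'e" and H :: "('h, 'z) monoid_scheme" and \<rho>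
    and q :: "'e \<Rightarrow> 'm" and M +
  fixes S :: "'m set" and K :: "'e set" and universe :: "'u itself"
  assumes S: "S = q ` K" and K_zero: "0 \<in> K" and K_add: "u \<in> K \<Longrightarrow> v \<in> K \<Longrightarrow> u + v \<in> K"
    and K_scale: "u \<in> K \<Longrightarrow> sc c u \<in> K" and K_rep: "h \<in> carrier H \<Longrightarrow> u \<in> K \<Longrightarrow> \<rho> h u \<in> K"
    and K_ker: "q u = \<zero>\<^bsub>M\<^esub> \<Longrightarrow> u \<in> K"
    and code: "\<exists>e :: 'm set \<Rightarrow> 'u. inj_on e (carrier (quot_module M S))"
begin

lemma quot: "presentation sc H \<rho> (\<lambda>u. S +>\<^bsub>M\<^esub> q u) (quot_module M S)"
  by (rule presentation_quot(1)[OF presentation_axioms S K_zero K_add K_scale K_rep])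

lemma q_mem: "q u \<in> S \<longleftrightarrow> u \<in> K"
proof
  assume "q u \<in> S"
  then obtain z where z: "z \<in> K" "q u = q z" using S by blast
  then have "u - z \<in> K" by (intro K_ker) (simp add: q_eq_iff)
  from K_add[OF this z(1)] show "u \<in> K" by simp
qed (use S in blast)

lemma quot_zero_iff: "S +>\<^bsub>M\<^esub> q u = \<zero>\<^bsub>quot_module M S\<^esub> \<longleftrightarrow> u \<in> K"
  using presentation_quot(2)[OF presentation_axioms S K_zero K_add K_scale K_rep] q_mem by simp

lemma coset_eq_iff: "S +>\<^bsub>M\<^esub> q u = S +>\<^bsub>M\<^esub> q v \<longleftrightarrow> u - v \<in> K"
  using presentation.q_eq_iff[OF quot, of u v] by (simp add: quot_zero_iff)

lemma vec_presentation: "presentation sc H \<rho> (quot_vec M S q :: 'e \<Rightarrow> 'u) (small_copy (quot_module M S))"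
  and vec_zero_iff: "(quot_vec M S q u :: 'u) = \<zero>\<^bsub>small_copy (quot_module M S)\<^esub> \<longleftrightarrow> u \<in> K"
  and dec_vec: "small_dec (quot_module M S) (quot_vec M S q u :: 'u) = S +>\<^bsub>M\<^esub> q u"
proof -
  obtain e :: "'m set \<Rightarrow> 'u" where e: "inj_on e (carrier (quot_module M S))" using code by blast
  show "presentation sc H \<rho> (quot_vec M S q :: 'e \<Rightarrow> 'u) (small_copy (quot_module M S))"
    "(quot_vec M S q u :: 'u) = \<zero>\<^bsub>small_copy (quot_module M S)\<^esub> \<longleftrightarrow> u \<in> K"
    "small_dec (quot_module M S) (quot_vec M S q u :: 'u) = S +>\<^bsub>M\<^esub> q u"
    using presentation_small[OF quot e] by (simp_all add: quot_vec_def[abs_def] quot_zero_iff)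
qed

end

text \<open>Any lift of \<open>f\<close> that respects the subspaces also lifts the transported map of quotients.\<close>

lemma vec_map:
  fixes q :: "'e::ab_group_add \<Rightarrow> 'm" and q' :: "'f::ab_group_add \<Rightarrow> 'p"
  assumes V: "vec_quotient TYPE('u) sc H \<rho> q M S K" and W: "vec_quotient TYPE('u) sc' H' \<rho>' q' N S' K'"
    and L: "\<And>u v. L (u + v) = L u + L v" "\<And>u. u \<in> K \<Longrightarrow> L u \<in> K'"
    and f: "\<And>u. f (q u) = q' (L u)"
  shows "small_map (quot_module M S) (quot_module N S') (quot_map M S N S' f) (quot_vec M S q u :: 'u) =
    (quot_vec N S' q' (L u) :: 'u)"
proof -
  interpret V: vec_quotient sc H \<rho> q M S K "TYPE('u)" by (rule V)
  interpret W: vec_quotient sc' H' \<rho>' q' N S' K' "TYPE('u)" by (rule W)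
  have "S' +>\<^bsub>N\<^esub> f x = S' +>\<^bsub>N\<^esub> q' (L u)" if x: "x \<in> S +>\<^bsub>M\<^esub> q u" for x
  proof -
    obtain z where z: "z \<in> K" "x = q (z + u)" using x V.S by (auto simp: a_r_coset_def' V.q_add)
    then show ?thesis using L by (simp add: f W.coset_eq_iff)
  qed
  moreover have "q u \<in> S +>\<^bsub>M\<^esub> q u"
    using V.S V.K_zero V.q_add[of 0 u] by (auto simp: a_r_coset_def')
  ultimately have "(\<Union>x\<in>S +>\<^bsub>M\<^esub> q u. S' +>\<^bsub>N\<^esub> f x) = S' +>\<^bsub>N\<^esub> q' (L u)" by blast
  moreover have "S +>\<^bsub>M\<^esub> q u \<in> carrier (quot_module M S)" by (rule presentation.q_closed[OF V.quot])
  moreover have "(quot_vec M S q u :: 'u) \<in> small_enc (quot_module M S) ` carrier (quot_module M S)"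
    using presentation.q_closed[OF V.vec_presentation, of u] by (simp add: small_copy_def)
  ultimately show ?thesis
    by (simp add: small_map_def V.dec_vec quot_map_def quot_vec_def[of N])
qed

section \<open>Linear lifts of module maps\<close>

text \<open>An equivariant linear map of the presenting spaces that induces \<open>\<phi>\<close>.\<close>

definition lifts ::
  "('k \<Rightarrow> 'e \<Rightarrow> 'e) \<Rightarrow> ('h, 'z) monoid_scheme \<Rightarrow> ('h \<Rightarrow> 'e \<Rightarrow> 'e) \<Rightarrow> ('e \<Rightarrow> 'm) \<Rightarrow>
   ('k \<Rightarrow> 'f \<Rightarrow> 'f) \<Rightarrow> ('h \<Rightarrow> 'f \<Rightarrow> 'f) \<Rightarrow> ('f \<Rightarrow> 'p) \<Rightarrow>
   ('m \<Rightarrow> 'p) \<Rightarrow> ('e::ab_group_add \<Rightarrow> 'f::ab_group_add) \<Rightarrow> bool" where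
  "lifts sc H \<rho> q sc' \<rho>' q' \<phi> L \<longleftrightarrow>
    (\<forall>u v. L (u + v) = L u + L v) \<and> (\<forall>c u. L (sc c u) = sc' c (L u)) \<and>
    (\<forall>h\<in>carrier H. \<forall>u. L (\<rho> h u) = \<rho>' h (L u)) \<and> (\<forall>u. \<phi> (q u) = q' (L u))"

lemma lifts_hom:
  fixes H :: "('h, 'z) monoid_scheme"
  assumes "presentation sc H \<rho> q M" "presentation sc' H \<rho>' q' N" "lifts sc H \<rho> q sc' \<rho>' q' \<phi> L"
    and ext: "\<phi> \<in> extensional (carrier M)"
  shows "\<phi> \<in> lmod_hom (group_algebra H) M N"
proof -
  interpret M: presentation sc H \<rho> q M by fact
  interpret N: presentation sc' H \<rho>' q' N by fact
  have L: "L (u + v) = L u + L v" "L (sc c u) = sc' c (L u)" "h \<in> carrier H \<Longrightarrow> L (\<rho> h u) = \<rho>' h (L u)"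
    and \<phi>: "\<phi> (q u) = q' (L u)" for u v c h
    using assms(3) by (auto simp: lifts_def)
  have L0: "L 0 = 0" using L(1)[of 0 0] by simp
  have L_sum: "L (\<Sum>i\<in>I. f i) = (\<Sum>i\<in>I. L (f i))" for I :: "'h set" and f
    by (induction I rule: infinite_finite_induct) (auto simp: L0 L)
  have act: "L (galg_act sc \<rho> a u) = galg_act sc' \<rho>' a (L u)" if "a \<in> carrier (group_algebra H)" for a u
    using that unfolding galg_act_def L_sum by (intro sum.cong) (auto simp: L galg_carrier)
  have "\<phi> x \<in> carrier N" if "x \<in> carrier M" for x using M.q_surj[OF that] \<phi> by auto
  moreover have "\<phi> (x \<oplus>\<^bsub>M\<^esub> y) = \<phi> x \<oplus>\<^bsub>N\<^esub> \<phi> y" if "x \<in> carrier M" "y \<in> carrier M" for x y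
    using M.q_surj[OF that(1)] M.q_surj[OF that(2)] by (auto simp: M.q_add[symmetric] N.q_add[symmetric] \<phi> L)
  moreover have "\<phi> (a \<odot>\<^bsub>M\<^esub> x) = a \<odot>\<^bsub>N\<^esub> \<phi> x" if "a \<in> carrier (group_algebra H)" "x \<in> carrier M" for a x
    using M.q_surj[OF that(2)] that(1) by (auto simp: M.q_act N.q_act \<phi> act)
  ultimately show ?thesis using ext by (auto simp: lmod_hom_def PiE_def)
qed

lemma lifts_id: "presentation sc H \<rho> q M \<Longrightarrow> lifts sc H \<rho> q sc \<rho> q (\<lambda>x\<in>carrier M. x) (\<lambda>u. u)"
  by (simp add: lifts_def presentation.q_closed)

lemma lifts_compose:
  assumes "presentation sc H \<rho> q M" "lifts sc H \<rho> q sc' \<rho>' q' \<phi> L" "lifts sc' H \<rho>' q' sc'' \<rho>'' q'' \<psi> L'"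
  shows "lifts sc H \<rho> q sc'' \<rho>'' q'' (compose (carrier M) \<psi> \<phi>) (\<lambda>u. L' (L u))"
  using assms by (simp add: lifts_def presentation.q_closed compose_def)

text \<open>For the presentations by permutation representations, a map of modules lifts to the linear map that it
  induces on the bases; basis elements outside the module go to zero.\<close>

lemma lifts_exists:
  fixes V :: "('h \<Rightarrow> 'k::field, 'u) module" and W :: "('h \<Rightarrow> 'k, 'w) module"
  assumes H: "group H" and V: "left_module (group_algebra H) V" and W: "left_module (group_algebra H) W"
    and \<phi>: "\<phi> \<in> lmod_hom (group_algebra H) V W"
  shows "\<exists>L. lifts pscale H (perm_act H V) (evaluation H V) pscale (perm_act H W) (evaluation H W) \<phi> L"
proof -
  interpret V: presentation pscale H "perm_act H V" "evaluation H V" V by (rule evaluation_presentation[OF H V])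
  interpret W: presentation pscale H "perm_act H W" "evaluation H W" W by (rule evaluation_presentation[OF H W])
  have hom: "v \<in> carrier V \<Longrightarrow> \<phi> v \<in> carrier W"
    "v \<in> carrier V \<Longrightarrow> w \<in> carrier V \<Longrightarrow> \<phi> (v \<oplus>\<^bsub>V\<^esub> w) = \<phi> v \<oplus>\<^bsub>W\<^esub> \<phi> w"
    "a \<in> carrier (group_algebra H) \<Longrightarrow> v \<in> carrier V \<Longrightarrow> \<phi> (a \<odot>\<^bsub>V\<^esub> v) = a \<odot>\<^bsub>W\<^esub> \<phi> v" for v w a
    using \<phi> by (auto simp: lmod_hom_def)
  have hom0: "\<phi> \<zero>\<^bsub>V\<^esub> = \<zero>\<^bsub>W\<^esub>"
    using hom(2)[of "\<zero>\<^bsub>V\<^esub>" "\<zero>\<^bsub>V\<^esub>"] hom(1)[of "\<zero>\<^bsub>V\<^esub>"] by simp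
  (* the images of the multiples of basis elements *)
  define g where "g v c = (if v \<in> carrier V then Poly_Mapping.single (\<phi> v) c else 0)" for v and c :: 'k
  have g: "g v 0 = 0" "g v (c + d) = g v c + g v d" for v c d
    by (simp_all add: g_def single_add)
  define L where "L p = (\<Sum>v\<in>Poly_Mapping.keys p. g v (Poly_Mapping.lookup p v))" for p
  have superset: "L p = (\<Sum>v\<in>A. g v (Poly_Mapping.lookup p v))" if "finite A" "Poly_Mapping.keys p \<subseteq> A" for p A
    unfolding L_def using that by (intro sum.mono_neutral_left) (auto simp: in_keys_iff g)
  have L_add: "L (p + r) = L p + L r" for p r
  proof -
    let ?A = "Poly_Mapping.keys p \<union> Poly_Mapping.keys r"
    have "L (p + r) = (\<Sum>v\<in>?A. g v (Poly_Mapping.lookup (p + r) v))"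
      using Poly_Mapping.keys_add[of p r] by (intro superset) auto
    moreover have "L p = (\<Sum>v\<in>?A. g v (Poly_Mapping.lookup p v))" "L r = (\<Sum>v\<in>?A. g v (Poly_Mapping.lookup r v))"
      by (rule superset; simp)+
    ultimately show ?thesis by (simp add: lookup_add g sum.distrib)
  qed
  have L_single: "L (Poly_Mapping.single v c) = g v c" for v c
    using superset[of "{v}" "Poly_Mapping.single v c"] by simp
  have L_scale: "L (pscale c p) = pscale c (L p)" for c p
  proof (induction p rule: poly_mapping_additive_induct)
    case (single v d)
    show ?case unfolding pscale_single L_single by (simp add: g_def)
  next
    case (add p r)
    then show ?case by (simp add: L_add V.scale_right_distrib W.scale_right_distrib)
  qed
  have L_rep: "L (perm_act H V h p) = perm_act H W h (L p)" if h: "h \<in> carrier H" for h p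
  proof (induction p rule: poly_mapping_additive_induct)
    case (single v d)
    show ?case unfolding perm_act_single[OF H V h] L_single
      using V.M.smult_closed[of "gsingle 1 h" v] h
      by (auto simp: g_def elt_perm_def perm_act_single[OF H W h] hom W.rep_zero)
  next
    case (add p r)
    then show ?case using h by (simp add: L_add V.rep_add W.rep_add)
  qed
  have L_eval: "\<phi> (evaluation H V p) = evaluation H W (L p)" for p
  proof (induction p rule: poly_mapping_additive_induct)
    case (single v d)
    have "\<one>\<^bsub>H\<^esub> \<in> carrier H" using H by (simp add: group.is_monoid)
    then show ?case unfolding L_single
      using W.q_zero by (simp add: g_def evaluation_single[OF H V] evaluation_single[OF H W] hom hom0)
  next
    case (add p r)
    then show ?case by (simp add: L_add V.q_add W.q_add hom)
  qed
  show ?thesis using L_add L_scale L_rep L_eval unfolding lifts_def by blast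
qed

text \<open>Functoriality is inherited from the lifts: the functor acts on them componentwise, and this respects
  identities and composition.\<close>

lemma functor_of_lifts:
  fixes F :: "(('h \<Rightarrow> 'k::field, 'u) module, 'u \<Rightarrow> 'u, ('h \<Rightarrow> 'k, 'u) module, 'u \<Rightarrow> 'u) funct"
    and sc' :: "'k \<Rightarrow> (nat \<Rightarrow> 'u \<Rightarrow>\<^sub>0 'k) \<Rightarrow> (nat \<Rightarrow> 'u \<Rightarrow>\<^sub>0 'k)"
  assumes H: "group H" and C: "C = full_subcat (left_mod_cat (group_algebra H)) P"
    and obj: "\<And>V. V \<in> Obj C \<Longrightarrow> presentation sc' H (\<rho>' V) (p V) (fobj F V)"
    and P: "\<And>V. V \<in> Obj C \<Longrightarrow> P (fobj F V)"
    and ext: "\<And>V W \<phi>. fmap F V W \<phi> \<in> extensional (carrier (fobj F V))"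
    and map: "\<And>V W \<phi> L. V \<in> Obj C \<Longrightarrow> W \<in> Obj C \<Longrightarrow> \<phi> \<in> lmod_hom (group_algebra H) V W \<Longrightarrow>
      lifts pscale H (perm_act H V) (evaluation H V) pscale (perm_act H W) (evaluation H W) \<phi> L \<Longrightarrow>
      lifts sc' H (\<rho>' V) (p V) sc' (\<rho>' W) (p W) (fmap F V W \<phi>) (\<lambda>v j. L (v j))"
  shows "is_functor C C F"
proof -
  have mod: "left_module (group_algebra H) V" if "V \<in> Obj C" for V using that by (simp add: C)
  have pres: "presentation pscale H (perm_act H V) (evaluation H V) V" if "V \<in> Obj C" for V
    by (rule evaluation_presentation[OF H mod[OF that]])
  have ex: "\<exists>L. lifts pscale H (perm_act H V) (evaluation H V) pscale (perm_act H W) (evaluation H W) \<phi> L"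
    if "V \<in> Obj C" "W \<in> Obj C" "\<phi> \<in> lmod_hom (group_algebra H) V W" for V W \<phi>
    using lifts_exists[OF H mod[OF that(1)] mod[OF that(2)] that(3)] .
  have hom: "fmap F V W \<phi> \<in> lmod_hom (group_algebra H) (fobj F V) (fobj F W)"
    if VW: "V \<in> Obj C" "W \<in> Obj C" "\<phi> \<in> lmod_hom (group_algebra H) V W" for V W \<phi>
  proof -
    obtain L where "lifts pscale H (perm_act H V) (evaluation H V) pscale (perm_act H W) (evaluation H W) \<phi> L"
      using ex[OF VW] by blast
    from lifts_hom[OF obj[OF VW(1)] obj[OF VW(2)] map[OF VW this] ext] show ?thesis .
  qed
  have ident: "fmap F V V (\<lambda>x\<in>carrier V. x) = (\<lambda>x\<in>carrier (fobj F V). x)" if V: "V \<in> Obj C" for V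
  proof (rule extensionalityI[OF ext])
    interpret P: presentation sc' H "\<rho>' V" "p V" "fobj F V" by (rule obj[OF V])
    have "(\<lambda>x\<in>carrier V. x) \<in> lmod_hom (group_algebra H) V V"
      by (rule lifts_hom[OF pres[OF V] pres[OF V] lifts_id[OF pres[OF V]]]) simp
    from map[OF V V this lifts_id[OF pres[OF V]]]
    have "fmap F V V (\<lambda>x\<in>carrier V. x) (p V v) = p V v" for v by (simp add: lifts_def)
    then show "fmap F V V (\<lambda>x\<in>carrier V. x) x = (\<lambda>x\<in>carrier (fobj F V). x) x" if "x \<in> carrier (fobj F V)" for x
      using P.q_surj[OF that] by auto
  qed simp
  have comp: "fmap F A B (compose (carrier A) \<psi> \<phi>) = compose (carrier (fobj F A)) (fmap F D B \<psi>) (fmap F A D \<phi>)"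
    if o: "A \<in> Obj C" "D \<in> Obj C" "B \<in> Obj C"
      and h: "\<phi> \<in> lmod_hom (group_algebra H) A D" "\<psi> \<in> lmod_hom (group_algebra H) D B" for A B D \<phi> \<psi>
  proof (rule extensionalityI[OF ext compose_extensional])
    interpret P: presentation sc' H "\<rho>' A" "p A" "fobj F A" by (rule obj[OF o(1)])
    obtain L where L: "lifts pscale H (perm_act H A) (evaluation H A) pscale (perm_act H D) (evaluation H D) \<phi> L"
      using ex[OF o(1,2) h(1)] by blast
    obtain L' where L': "lifts pscale H (perm_act H D) (evaluation H D) pscale (perm_act H B) (evaluation H B) \<psi> L'"
      using ex[OF o(2,3) h(2)] by blast
    note LL = lifts_compose[OF pres[OF o(1)] L L']
    have "compose (carrier A) \<psi> \<phi> \<in> lmod_hom (group_algebra H) A B"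
      by (rule lifts_hom[OF pres[OF o(1)] pres[OF o(3)] LL compose_extensional])
    from map[OF o(1,3) this LL] map[OF o(1,2) h(1) L] map[OF o(2,3) h(2) L']
    have "fmap F A B (compose (carrier A) \<psi> \<phi>) (p A v) = fmap F D B \<psi> (fmap F A D \<phi> (p A v))" for v
      by (simp add: lifts_def)
    then show "fmap F A B (compose (carrier A) \<psi> \<phi>) x = compose (carrier (fobj F A)) (fmap F D B \<psi>) (fmap F A D \<phi>) x"
      if "x \<in> carrier (fobj F A)" for x
      using P.q_surj[OF that] that by (auto simp: compose_def)
  qed
  have "fobj F V \<in> Obj C" if "V \<in> Obj C" for V
    using presentation.left_module[OF obj[OF that]] P[OF that] by (simp add: C)
  then show ?thesis
    unfolding is_functor_def using hom ident comp by (auto simp: C)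
qed

lemma is_functor_comp:
  "is_functor C D F \<Longrightarrow> is_functor D E G \<Longrightarrow> is_functor C E (G \<circ>\<^sub>F F)"
  by (simp add: is_functor_def comp_functor_def)

lemma is_functor_id: "is_functor C C id_functor"
  by (simp add: is_functor_def id_functor_def)

section \<open>The Katz-Long-Moody functor in coordinates\<close>

context twisted_presentation
begin

lemma LM_F: "x \<in> carrier F \<Longrightarrow>
  gsingle 1 (x, \<one>\<^bsub>G\<^esub>) \<odot>\<^bsub>LM\<^esub> cls (basis_sum v) = cls (basis_sum (conv_act sc n \<rho>F lam x v))"
  using presentation.q_rep[OF LM_presentation, of "(x, \<one>\<^bsub>G\<^esub>)" v] by (simp add: H_sel lm_act_F)

lemma LM_gen_iff:
  assumes i: "i \<in> {1..n}"
  shows "gsingle 1 (fgen n i, \<one>\<^bsub>G\<^esub>) \<odot>\<^bsub>LM\<^esub> cls (basis_sum v) = cls (basis_sum v) \<longleftrightarrow> row sc n \<rho>F lam i v \<in> Z"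
proof -
  have "(v(i := v i + row sc n \<rho>F lam i v) - v) j = (if j = i then row sc n \<rho>F lam i v else 0)" for j
    by (simp add: minus_apply)
  then have "nullv (v(i := v i + row sc n \<rho>F lam i v) - v) \<longleftrightarrow> row sc n \<rho>F lam i v \<in> Z"
    unfolding nullv_def using i Q.zero by auto
  then show ?thesis
    using i by (simp only: LM_F fgen_carrier f.conv_act_gen[OF lam i] cls_basis_sum_iff)
qed

lemma invariants_eq:
  "free_invariants n G LM = (\<lambda>v. cls (basis_sum v)) ` {l. \<forall>i\<in>{1..n}. row sc n \<rho>F lam i l \<in> Z}"
proof (intro subset_antisym subsetI)
  fix w assume w: "w \<in> free_invariants n G LM"
  then obtain l where l: "w = cls (basis_sum l)"
    using presentation.q_surj[OF LM_presentation, of w] by (auto simp: free_invariants_def)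
  have "row sc n \<rho>F lam i l \<in> Z" if i: "i \<in> {1..n}" for i
  proof -
    have "gsingle 1 (fgen n i, \<one>\<^bsub>G\<^esub>) \<odot>\<^bsub>LM\<^esub> w = w"
      using w fgen_carrier[OF i] unfolding free_invariants_def by blast
    then show ?thesis unfolding l LM_gen_iff[OF i] .
  qed
  then show "w \<in> (\<lambda>v. cls (basis_sum v)) ` {l. \<forall>i\<in>{1..n}. row sc n \<rho>F lam i l \<in> Z}"
    unfolding l by blast
next
  fix w assume "w \<in> (\<lambda>v. cls (basis_sum v)) ` {l. \<forall>i\<in>{1..n}. row sc n \<rho>F lam i l \<in> Z}"
  then obtain l where l: "w = cls (basis_sum l)" "\<forall>i\<in>{1..n}. row sc n \<rho>F lam i l \<in> Z" by blast
  have "gsingle 1 (x, \<one>\<^bsub>G\<^esub>) \<odot>\<^bsub>LM\<^esub> w = w" if x: "x \<in> carrier F" for x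
    using Q.s.conv_L[OF lam x l(2)] unfolding l(1) LM_F[OF x] cls_basis_sum_iff nullv_def .
  then show "w \<in> free_invariants n G LM"
    unfolding free_invariants_def l(1) using presentation.q_closed[OF LM_presentation] by blast
qed

lemma eigen_iff:
  assumes i: "i \<in> {1..n}"
  shows "cls (basis_sum v) \<in> eigen_part n G lam LM i \<longleftrightarrow>
    (\<forall>m\<in>{1..n}. (v(i := v i + row sc n \<rho>F lam i v)) m - sc lam (v m) \<in> Z) \<and>
    (\<forall>j\<in>{1..n} - {i}. row sc n \<rho>F lam j v \<in> Z)"
proof -
  have "gsingle lam (\<one>\<^bsub>F\<^esub>, \<one>\<^bsub>G\<^esub>) \<odot>\<^bsub>LM\<^esub> cls (basis_sum v) = cls (basis_sum (fscale sc lam v))"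
    using presentation.q_scale[OF LM_presentation, of lam v] by (simp only: H_sel)
  then have "gsingle 1 (fgen n i, \<one>\<^bsub>G\<^esub>) \<odot>\<^bsub>LM\<^esub> cls (basis_sum v) = gsingle lam (\<one>\<^bsub>F\<^esub>, \<one>\<^bsub>G\<^esub>) \<odot>\<^bsub>LM\<^esub> cls (basis_sum v) \<longleftrightarrow>
      (\<forall>m\<in>{1..n}. (v(i := v i + row sc n \<rho>F lam i v)) m - sc lam (v m) \<in> Z)"
    using i by (simp only: LM_F fgen_carrier f.conv_act_gen[OF lam i] cls_basis_sum_iff nullv_def minus_apply fscale_apply)
  moreover have "(\<forall>j\<in>{1..n} - {i}. gsingle 1 (fgen n j, \<one>\<^bsub>G\<^esub>) \<odot>\<^bsub>LM\<^esub> cls (basis_sum v) = cls (basis_sum v)) \<longleftrightarrow>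
      (\<forall>j\<in>{1..n} - {i}. row sc n \<rho>F lam j v \<in> Z)"
    using LM_gen_iff by blast
  ultimately show ?thesis
    using presentation.q_closed[OF LM_presentation, of v] unfolding eigen_part_def by blast
qed

text \<open>For \<open>\<lambda> = 1\<close> the eigenspaces consist of invariants; otherwise all components of an eigenvector but
  the \<open>i\<close>-th vanish, and the eigenvalue equation says that \<open>x\<^sub>i\<close> fixes the \<open>i\<close>-th component.\<close>

lemma eigen_KL:
  assumes i: "i \<in> {1..n}" and v: "cls (basis_sum v) \<in> eigen_part n G lam LM i"
  shows "v \<in> Q.s.KL lam"
proof -
  have ev: "(v(i := v i + row sc n \<rho>F lam i v)) m - sc lam (v m) \<in> Z" if "m \<in> {1..n}" for m
    using v that unfolding eigen_iff[OF i] by blast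
  have rows: "row sc n \<rho>F lam j v \<in> Z" if "j \<in> {1..n} - {i}" for j
    using v that unfolding eigen_iff[OF i] by blast
  have evi: "(v i + row sc n \<rho>F lam i v) - sc lam (v i) \<in> Z" using ev[OF i] by simp
  show ?thesis
  proof (cases "lam = 1")
    case True
    have "row sc n \<rho>F lam i v \<in> Z" using evi by (simp add: True)
    then have "\<forall>j\<in>{1..n}. row sc n \<rho>F lam j v \<in> Z" using rows by blast
    moreover have "\<forall>j\<in>{1..n}. gdiff n \<rho>F j ((0 :: nat \<Rightarrow> 'e) j) \<in> Z"
      using Q.zero by (simp add: zero_fun_apply f.gdiff_zero)
    ultimately have "0 + v \<in> Q.s.KL lam" by (intro Q.s.KL_I)
    then show ?thesis by simp
  next
    case False
    have vm: "v m \<in> Z" if m: "m \<in> {1..n} - {i}" for m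
    proof -
      have "v m - sc lam (v m) \<in> Z" using ev[of m] m by simp
      then have "sc (1 - lam) (v m) \<in> Z" by (simp add: scale_left_diff_distrib)
      then show ?thesis using False Q.s.Z_scale_iff[of "1 - lam" "v m"] by simp
    qed
    have D: "gdiff n \<rho>F m (v m) \<in> Z" if "m \<in> {1..n} - {i}" for m
      using vm[OF that] that by (intro Q.s.Z_gdiff) auto
    have "(v i + row sc n \<rho>F lam i v) - sc lam (v i) =
        (\<Sum>j\<in>{1..n}. sc (lam_ge lam i j) (gdiff n \<rho>F j (v j)))"
      by (simp add: row_def scale_left_diff_distrib)
    also have "\<dots> = sc lam (gdiff n \<rho>F i (v i)) + (\<Sum>j\<in>{1..n} - {i}. sc (lam_ge lam i j) (gdiff n \<rho>F j (v j)))"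
      using i by (subst sum.remove[of _ i]) (auto simp: lam_ge_def)
    finally have "sc lam (gdiff n \<rho>F i (v i)) + (\<Sum>j\<in>{1..n} - {i}. sc (lam_ge lam i j) (gdiff n \<rho>F j (v j))) \<in> Z"
      using evi by simp
    moreover have "(\<Sum>j\<in>{1..n} - {i}. sc (lam_ge lam i j) (gdiff n \<rho>F j (v j))) \<in> Z"
      by (intro Q.s.Z_sum Q.s.Z_scale D)
    ultimately have "sc lam (gdiff n \<rho>F i (v i)) \<in> Z" using Q.s.Z_add_cancel(1) by blast
    then have "gdiff n \<rho>F i (v i) \<in> Z" using Q.s.Z_scale_iff[OF lam] by blast
    then have "\<forall>m\<in>{1..n}. gdiff n \<rho>F m (v m) \<in> Z" using D by blast
    moreover have "\<forall>m\<in>{1..n}. row sc n \<rho>F lam m 0 \<in> Z"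
      using Q.zero by (simp add: row_def zero_fun_apply f.gdiff_zero)
    ultimately have "v + 0 \<in> Q.s.KL lam" by (intro Q.s.KL_I)
    then show ?thesis by simp
  qed
qed

text \<open>The converse: an element of \<open>K\<close> that is concentrated in one place is an eigenvector.\<close>

lemma delta_eigen:
  assumes i: "i \<in> {1..n}" and u: "gdiff n \<rho>F i u \<in> Z"
  shows "cls (basis_sum (delta i u)) \<in> eigen_part n G lam LM i"
proof -
  have row: "row sc n \<rho>F lam m (delta i u) = (if m = i then sc (lam - 1) u else 0) + sc (lam_ge lam m i) (gdiff n \<rho>F i u)"
    if "m \<in> {1..n}" for m
    by (rule f.row_delta[OF i])
  have z: "sc c (gdiff n \<rho>F i u) \<in> Z" for c by (rule Q.s.Z_scale[OF u])
  have "(u + row sc n \<rho>F lam i (delta i u)) - sc lam u = sc (lam_ge lam i i) (gdiff n \<rho>F i u)"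
    unfolding row[OF i] by (simp add: scale_left_diff_distrib)
  then have "((delta i u)(i := delta i u i + row sc n \<rho>F lam i (delta i u))) m - sc lam (delta i u m) \<in> Z" for m
    using z Q.zero by (simp add: delta_apply)
  moreover have "row sc n \<rho>F lam j (delta i u) \<in> Z" if "j \<in> {1..n} - {i}" for j
    using that z row[of j] by auto
  ultimately show ?thesis unfolding eigen_iff[OF i] by blast
qed

lemma KL_sum: "(\<And>i. i \<in> X \<Longrightarrow> f i \<in> Q.s.KL lam) \<Longrightarrow> (\<Sum>i\<in>X. f i) \<in> Q.s.KL lam"
  by (induction X rule: infinite_finite_induct) (auto intro: Q.s.KL_add Q.s.KL_zero)

text \<open>\<open>L\<close> consists of the invariants, and \<open>K\<close> is spanned by its elements that are concentrated in one place.\<close>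

lemma klm_sub_eq: "klm_sub n G lam LM = (\<lambda>v. cls (basis_sum v)) ` Q.s.KL lam"
proof -
  interpret P: presentation "fscale sc" H la "\<lambda>v. cls (basis_sum v)" LM by (rule LM_presentation)
  show ?thesis
  proof (intro subset_antisym subsetI)
    fix w assume "w \<in> klm_sub n G lam LM"
    then obtain t s where w: "w = finsum LM t {1..n} \<oplus>\<^bsub>LM\<^esub> s"
      and t: "\<forall>i\<in>{1..n}. t i \<in> eigen_part n G lam LM i" and s: "s \<in> free_invariants n G LM"
      unfolding klm_sub_def set_add_def' by blast
    have "\<exists>v. t i = cls (basis_sum v) \<and> v \<in> Q.s.KL lam" if i: "i \<in> {1..n}" for i
    proof -
      have "t i \<in> carrier LM" using t i by (auto simp: eigen_part_def)
      then obtain v where v: "t i = cls (basis_sum v)" using P.q_surj by blast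
      have "v \<in> Q.s.KL lam"
        by (rule eigen_KL[OF i]) (use t[rule_format, OF i] in \<open>simp only: v\<close>)
      then show ?thesis using v by blast
    qed
    then have "\<exists>v. \<forall>i\<in>{1..n}. t i = cls (basis_sum (v i)) \<and> v i \<in> Q.s.KL lam" by (intro bchoice ballI)
    then obtain v where v: "\<And>i. i \<in> {1..n} \<Longrightarrow> t i = cls (basis_sum (v i))" "\<And>i. i \<in> {1..n} \<Longrightarrow> v i \<in> Q.s.KL lam"
      by blast
    obtain l where l: "s = cls (basis_sum l)" "\<forall>i\<in>{1..n}. row sc n \<rho>F lam i l \<in> Z"
      using s unfolding invariants_eq by blast
    have "\<forall>j\<in>{1..n}. gdiff n \<rho>F j ((0 :: nat \<Rightarrow> 'e) j) \<in> Z"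
      using Q.zero by (simp add: zero_fun_apply f.gdiff_zero)
    from Q.s.KL_I[OF this l(2)] have lK: "l \<in> Q.s.KL lam" by simp
    have "finsum LM t {1..n} = finsum LM (\<lambda>i. cls (basis_sum (v i))) {1..n}"
      by (rule P.M.add.finprod_cong') (use v(1) in \<open>auto simp del: cls_basis_sum_iff\<close>)
    then have "w = cls (basis_sum ((\<Sum>i\<in>{1..n}. v i) + l))"
      unfolding w l(1) by (simp only: P.q_sum[OF finite_atLeastAtMost] P.q_add)
    moreover have "(\<Sum>i\<in>{1..n}. v i) + l \<in> Q.s.KL lam"
      by (intro Q.s.KL_add lK KL_sum v(2))
    ultimately show "w \<in> (\<lambda>v. cls (basis_sum v)) ` Q.s.KL lam" by blast
  next
    fix w assume "w \<in> (\<lambda>v. cls (basis_sum v)) ` Q.s.KL lam"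
    then obtain k l where w: "w = cls (basis_sum (k + l))" and k: "\<forall>i\<in>{1..n}. gdiff n \<rho>F i (k i) \<in> Z"
      and l: "\<forall>i\<in>{1..n}. row sc n \<rho>F lam i l \<in> Z" unfolding Q.s.KL_def by blast
    have "(k - (\<Sum>i\<in>{1..n}. delta i (k i))) j = 0" if j: "j \<in> {1..n}" for j
    proof -
      have "(\<Sum>i\<in>{1..n}. delta i (k i) j) = (\<Sum>i\<in>{1..n}. if i = j then k j else 0)"
        by (intro sum.cong) (auto simp: delta_def)
      then show ?thesis using j by (simp add: minus_apply sum_fun_apply)
    qed
    then have "nullv (k - (\<Sum>i\<in>{1..n}. delta i (k i)))" unfolding nullv_def using Q.zero by simp
    then have "cls (basis_sum k) = cls (basis_sum (\<Sum>i\<in>{1..n}. delta i (k i)))"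
      by (simp only: cls_basis_sum_iff)
    then have "w = finsum LM (\<lambda>i. cls (basis_sum (delta i (k i)))) {1..n} \<oplus>\<^bsub>LM\<^esub> cls (basis_sum l)"
      unfolding w P.q_add by (simp only: P.q_sum[OF finite_atLeastAtMost])
    moreover have "finsum LM (\<lambda>i. cls (basis_sum (delta i (k i)))) {1..n} \<in>
        {finsum LM t {1..n} | t. \<forall>i\<in>{1..n}. t i \<in> eigen_part n G lam LM i}"
      by (intro CollectI exI[of _ "\<lambda>i. cls (basis_sum (delta i (k i)))"] conjI HOL.refl ballI delta_eigen k[rule_format])
    moreover have "cls (basis_sum l) \<in> free_invariants n G LM" unfolding invariants_eq using l by blast
    ultimately show "w \<in> klm_sub n G lam LM" unfolding klm_sub_def set_add_def' by blast
  qed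
qed

end

definition basis_vec ::
  "nat \<Rightarrow> ('g, 'z) monoid_scheme \<Rightarrow> (fgrp \<times> 'g \<Rightarrow> 'k::field, 'u) module \<Rightarrow> ('e \<Rightarrow> 'u) \<Rightarrow> (nat \<Rightarrow> 'e) \<Rightarrow> ('k, 'u) lm_elem" where
  "basis_vec n G V q v = tensor_class (group_algebra (free_grp n)) (aug_ideal n) (res_free G V)
     (\<Sum>j\<in>{1..n}. frag_of (aug_gen n j, q (v j)))"

text \<open>The presentation of the Katz-Long-Moody module by tuples.\<close>

definition klm_vec ::
  "nat \<Rightarrow> ('g, 'z) monoid_scheme \<Rightarrow> ('g \<Rightarrow> fgrp \<Rightarrow> fgrp) \<Rightarrow> 'k::field \<Rightarrow> (fgrp \<times> 'g \<Rightarrow> 'k, 'u) module \<Rightarrow>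
   ('e \<Rightarrow> 'u) \<Rightarrow> (nat \<Rightarrow> 'e) \<Rightarrow> 'u" where
  "klm_vec n G \<alpha> lam V q =
    quot_vec (lm_obj n G \<alpha> lam V) (klm_sub n G lam (lm_obj n G \<alpha> lam V)) (basis_vec n G V q)"

lemma twisted_presentationI:
  "artin n G \<alpha> \<Longrightarrow> presentation sc (semidirect (free_grp n) G \<alpha>) \<rho> q V \<Longrightarrow> lam \<noteq> 0 \<Longrightarrow>
    twisted_presentation n G \<alpha> sc \<rho> q V lam"
  by (intro twisted_presentation.intro artin_presentation.intro artin_module.intro
      twisted_presentation_axioms.intro presentation.axioms(1))

context twisted_presentation
begin

lemma basis_vec_eq: "basis_vec n G V q = (\<lambda>v. cls (basis_sum v))"
  by (simp add: basis_vec_def[abs_def] basis_sum_def)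

context
  assumes universe: "infinite (UNIV :: 'u set)"
begin

lemma klm_quotient:
  "vec_quotient TYPE('u) (fscale sc) H la (basis_vec n G V q) LM (klm_sub n G lam LM) (Q.s.KL lam)"
  unfolding basis_vec_eq
proof (intro vec_quotient.intro LM_presentation vec_quotient_axioms.intro klm_sub_eq)
  show "0 \<in> Q.s.KL lam" by (rule Q.s.KL_zero)
  show "u + v \<in> Q.s.KL lam" if "u \<in> Q.s.KL lam" "v \<in> Q.s.KL lam" for u v
    using that by (rule Q.s.KL_add)
  show "fscale sc c u \<in> Q.s.KL lam" if "u \<in> Q.s.KL lam" for c u
    using that by (rule Q.s.KL_scale)
  show "la h u \<in> Q.s.KL lam" if "h \<in> carrier H" "u \<in> Q.s.KL lam" for h u
    by (rule Q.KL_rep[OF lam that])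
  show "u \<in> Q.s.KL lam" if "cls (basis_sum u) = \<zero>\<^bsub>LM\<^esub>" for u
    using that unfolding LM_zero_iff nullv_def by (intro Q.s.KL_Z) blast
  show "\<exists>e :: ('k, 'u) lm_elem set \<Rightarrow> 'u. inj_on e (carrier (quot_module LM (klm_sub n G lam LM)))"
  proof (rule code_exists[OF universe, of n q "\<lambda>u. klm_sub n G lam LM +>\<^bsub>LM\<^esub> cls (basis_sum u)"])
    fix u v :: "nat \<Rightarrow> 'e" assume "\<forall>i\<in>{1..n}. q (u i) = q (v i)"
    then have "basis_sum u = basis_sum v" by (intro basis_sum_cong) blast
    then show "klm_sub n G lam LM +>\<^bsub>LM\<^esub> cls (basis_sum u) = klm_sub n G lam LM +>\<^bsub>LM\<^esub> cls (basis_sum v)"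
      by simp
  next
    show "carrier (quot_module LM (klm_sub n G lam LM)) \<subseteq>
        range (\<lambda>u. klm_sub n G lam LM +>\<^bsub>LM\<^esub> cls (basis_sum u))"
      using presentation.q_surj[OF LM_presentation] by (fastforce simp: quot_module_def A_RCOSETS_def')
  qed
qed

lemma klm_presentation: "presentation (fscale sc) H la (klm_vec n G \<alpha> lam V q) (fobj (KLM n G \<alpha> lam) V)"
  unfolding klm_vec_def KLM_def klm_quot_def funct.select_convs
  by (rule vec_quotient.vec_presentation[OF klm_quotient])

lemma klm_zero_iff: "klm_vec n G \<alpha> lam V q v = \<zero>\<^bsub>fobj (KLM n G \<alpha> lam) V\<^esub> \<longleftrightarrow> v \<in> Q.s.KL lam"
  unfolding klm_vec_def KLM_def klm_quot_def funct.select_convs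
  by (rule vec_quotient.vec_zero_iff[OF klm_quotient])

lemma klm_twisted: "mu \<noteq> 0 \<Longrightarrow>
  twisted_presentation n G \<alpha> (fscale sc) la (klm_vec n G \<alpha> lam V q) (fobj (KLM n G \<alpha> lam) V) mu"
  by (intro twisted_presentationI artin_axioms klm_presentation)

lemma klm_res_presentation:
  "presentation (fscale sc) F (conv_act sc n \<rho>F lam) (klm_vec n G \<alpha> lam V q) (res_free G (fobj (KLM n G \<alpha> lam) V))"
  using presentation_restrict[OF klm_presentation group_free_grp embed_hom]
  by (simp only: res_free_def lm_act_F)

context
  assumes n: "n \<ge> 1" and P: "P1 n VF" "P2 n VF"
begin

lemma no_sub: "no_sub sc n \<rho>F Z" and no_quot: "no_quot sc n \<rho>F Z"
  using P free_presentation.P1_iff[OF free_presentation.intro[OF vf]]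
    free_presentation.P2_iff[OF free_presentation.intro[OF vf]] by simp_all

lemma KL_klm_ker: "Q.s.KL lam = klm_ker sc n \<rho>F lam Z"
  by (rule Q.s.KL_eq[OF n no_sub])

lemma klm_ker_iff: "klm_vec n G \<alpha> lam V q v = \<zero>\<^bsub>fobj (KLM n G \<alpha> lam) V\<^esub> \<longleftrightarrow> v \<in> klm_ker sc n \<rho>F lam Z"
  by (simp only: klm_zero_iff KL_klm_ker)

text \<open>Under (P1) the kernel of the presentation is \<open>klm_ker\<close>, for which the two properties were shown to be
  inherited.\<close>

lemma klm_NT: "P1 n (res_free G (fobj (KLM n G \<alpha> lam) V))" "P2 n (res_free G (fobj (KLM n G \<alpha> lam) V))"
proof -
  interpret p: free_presentation "fscale sc" n "conv_act sc n \<rho>F lam" "klm_vec n G \<alpha> lam V q"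
    "res_free G (fobj (KLM n G \<alpha> lam) V)"
    by (rule free_presentation.intro[OF klm_res_presentation])
  have "p.Z = klm_ker sc n \<rho>F lam Z" by (simp add: res_free_def klm_ker_iff)
  then show "P1 n (res_free G (fobj (KLM n G \<alpha> lam) V))" "P2 n (res_free G (fobj (KLM n G \<alpha> lam) V))"
    using Q.s.no_sub_conv[OF lam no_sub] Q.s.no_quot_conv[OF lam no_quot] p.P1_iff p.P2_iff by simp_all
qed

end

end

end

lemma tensor_relsI:
  "f \<in> I \<Longrightarrow> f' \<in> I \<Longrightarrow> v \<in> carrier V \<Longrightarrow> frag_of (f \<oplus>\<^bsub>R\<^esub> f', v) - frag_of (f, v) - frag_of (f', v) \<in> tensor_rels R I V"
  "f \<in> I \<Longrightarrow> v \<in> carrier V \<Longrightarrow> v' \<in> carrier V \<Longrightarrow> frag_of (f, v \<oplus>\<^bsub>V\<^esub> v') - frag_of (f, v) - frag_of (f, v') \<in> tensor_rels R I V"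
  "f \<in> I \<Longrightarrow> a \<in> carrier R \<Longrightarrow> v \<in> carrier V \<Longrightarrow> frag_of (f \<otimes>\<^bsub>R\<^esub> a, v) - frag_of (f, a \<odot>\<^bsub>V\<^esub> v) \<in> tensor_rels R I V"
  unfolding tensor_rels_def by blast+

text \<open>The map on the tensor product applies \<open>\<phi>\<close> to the second factors, hence acts on coordinates componentwise.\<close>

lemma lm_map_basis_vec:
  fixes sc :: "'k::field \<Rightarrow> 'e::ab_group_add \<Rightarrow> 'e" and sc' :: "'k \<Rightarrow> 'f::ab_group_add \<Rightarrow> 'f"
  assumes V: "twisted_presentation n G \<alpha> sc \<rho> q V lam" and W: "twisted_presentation n G \<alpha> sc' \<rho>' q' W lam"
    and \<phi>: "\<phi> \<in> lmod_hom (group_algebra (semidirect (free_grp n) G \<alpha>)) V W" and L: "\<And>u. \<phi> (q u) = q' (L u)"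
  shows "lm_map n G V W \<phi> (basis_vec n G V q v) = basis_vec n G W q' (\<lambda>j. L (v j))"
proof -
  interpret V: twisted_presentation n G \<alpha> sc \<rho> q V lam by (rule V)
  interpret W: twisted_presentation n G \<alpha> sc' \<rho>' q' W lam by (rule W)
  let ?m = "frag_extend (\<lambda>(f, v). frag_of (f, \<phi> v)) :: _ \<Rightarrow> (fgrp \<Rightarrow> 'k) \<times> _ \<Rightarrow>\<^sub>0 int"
  have closed: "\<phi> x \<in> carrier W" if "x \<in> carrier V" for x using \<phi> that by (auto simp: lmod_hom_def)
  have add: "\<phi> (x \<oplus>\<^bsub>V\<^esub> y) = \<phi> x \<oplus>\<^bsub>W\<^esub> \<phi> y" if "x \<in> carrier V" "y \<in> carrier V" for x y
    using \<phi> that by (simp add: lmod_hom_def)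
  have act: "\<phi> (a \<odot>\<^bsub>V.VF\<^esub> x) = a \<odot>\<^bsub>W.VF\<^esub> \<phi> x" if "a \<in> carrier V.RR" "x \<in> carrier V" for a x
  proof -
    have "galg_map (\<lambda>x. (x, \<one>\<^bsub>G\<^esub>)) a \<in> carrier (group_algebra (semidirect (free_grp n) G \<alpha>))"
      by (rule galg_map_closed[OF that(1)]) (simp add: V.H_sel)
    then show ?thesis using \<phi> that by (simp add: lmod_hom_def res_free_def)
  qed
  have rel: "?m c \<in> W.null" if "c \<in> tensor_rels V.RR V.II V.VF" for c
    using that unfolding tensor_rels_def
  proof (elim UnE CollectE exE conjE, goal_cases)
    case (1 f f' v)
    have "frag_of (f \<oplus>\<^bsub>V.RR\<^esub> f', \<phi> v) - frag_of (f, \<phi> v) - frag_of (f', \<phi> v) \<in> W.null"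
      by (rule W.null_rel, rule tensor_relsI(1)) (use 1 closed in simp_all)
    then show ?case unfolding 1(1) by (simp only: frag_extend_diff frag_extend_of prod.case)
  next
    case (2 f v v')
    have "frag_of (f, \<phi> v \<oplus>\<^bsub>W.VF\<^esub> \<phi> v') - frag_of (f, \<phi> v) - frag_of (f, \<phi> v') \<in> W.null"
      by (rule W.null_rel, rule tensor_relsI(2)) (use 2 closed in simp_all)
    moreover have "\<phi> (v \<oplus>\<^bsub>V.VF\<^esub> v') = \<phi> v \<oplus>\<^bsub>W.VF\<^esub> \<phi> v'" using 2 add by simp
    ultimately show ?case unfolding 2(1) by (simp only: frag_extend_diff frag_extend_of prod.case)
  next
    case (3 f a v)
    have "frag_of (f \<otimes>\<^bsub>V.RR\<^esub> a, \<phi> v) - frag_of (f, a \<odot>\<^bsub>W.VF\<^esub> \<phi> v) \<in> W.null"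
      by (rule W.null_rel, rule tensor_relsI(3)) (use 3 closed in simp_all)
    moreover have "\<phi> (a \<odot>\<^bsub>V.VF\<^esub> v) = a \<odot>\<^bsub>W.VF\<^esub> \<phi> v" using 3 act by simp
    ultimately show ?case unfolding 3(1) by (simp only: frag_extend_diff frag_extend_of prod.case)
  qed
  have null: "?m c \<in> W.null" if "c \<in> V.null" for c
    using that unfolding tensor_null_def[of V.RR V.II V.VF]
  proof (induction rule: generate.induct)
    case one
    then show ?case by simp
  next
    case (incl h)
    then show ?case by (rule rel)
  next
    case (inv c)
    have "inv\<^bsub>V.FA\<^esub> c = - c" using V.null_keys[OF V.null_rel[OF inv]] by simp
    then show ?case using W.null_uminus[OF rel[OF inv]] by (simp add: frag_extend_minus)
  next
    case (eng c d)
    then show ?case using W.null_add by (simp add: frag_extend_add)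
  qed
  have basis: "?m (V.basis_sum v) = W.basis_sum (\<lambda>j. L (v j))"
    by (simp add: V.basis_sum_def W.basis_sum_def frag_extend_sum L)
  have "W.cls (?m c) = W.cls (W.basis_sum (\<lambda>j. L (v j)))" if "c \<in> V.cls (V.basis_sum v)" for c
    using null[OF V.cls_memD[OF that]] unfolding frag_extend_diff basis W.cls_eq_iff .
  moreover have "V.basis_sum v \<in> V.cls (V.basis_sum v)"
    unfolding V.cls_eq by (rule image_eqI[of _ _ 0]) simp_all
  ultimately have "(\<Union>c\<in>V.cls (V.basis_sum v). W.cls (?m c)) = W.cls (W.basis_sum (\<lambda>j. L (v j)))"
    by blast
  moreover have "V.cls (V.basis_sum v) \<in> carrier (tensor_prod V.RR V.II V.VF)"
    using presentation.q_closed[OF V.LM_presentation, of v] by (simp add: lm_obj_def Let_def)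
  ultimately show ?thesis
    unfolding V.basis_vec_eq W.basis_vec_eq by (simp add: lm_map_def Let_def)
qed

text \<open>Rows and differences are natural in the representation.\<close>

lemma (in free_rep_map) L_KL:
  assumes "stable_subspace sc n \<rho> Z" "stable_subspace sc' n \<rho>' Z'" "\<And>u. u \<in> Z \<Longrightarrow> L u \<in> Z'"
    and u: "u \<in> stable_subspace.KL sc n \<rho> Z lam"
  shows "(\<lambda>j. L (u j)) \<in> stable_subspace.KL sc' n \<rho>' Z' lam"
proof -
  obtain k l where u: "u = k + l" "\<forall>i\<in>{1..n}. gdiff n \<rho> i (k i) \<in> Z" "\<forall>i\<in>{1..n}. row sc n \<rho> lam i l \<in> Z"
    using u unfolding stable_subspace.KL_def[OF assms(1)] by blast
  have "(\<lambda>j. L (k j)) + (\<lambda>j. L (l j)) \<in> stable_subspace.KL sc' n \<rho>' Z' lam"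
    by (rule stable_subspace.KL_I[OF assms(2)])
      (use u assms(3) in \<open>auto simp: L_gdiff[symmetric] L_row[symmetric]\<close>)
  moreover have "(\<lambda>j. L (u j)) = (\<lambda>j. L (k j)) + (\<lambda>j. L (l j))"
    by (simp add: u(1) fun_eq_iff plus_fun_apply L_add)
  ultimately show ?thesis by simp
qed

text \<open>Stated for arbitrary presentations, so that it can be applied to the presentation that it yields itself.\<close>

lemma klm_lifts:
  fixes V W :: "(fgrp \<times> 'g \<Rightarrow> 'k::field, 'u) module" and G :: "('g, 'z) monoid_scheme"
    and sc :: "'k \<Rightarrow> 'e::ab_group_add \<Rightarrow> 'e" and sc' :: "'k \<Rightarrow> 'f::ab_group_add \<Rightarrow> 'f"
  assumes universe: "infinite (UNIV :: 'u set)"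
    and V: "twisted_presentation n G \<alpha> sc \<rho> q V lam" and W: "twisted_presentation n G \<alpha> sc' \<rho>' q' W lam"
    and \<phi>: "\<phi> \<in> lmod_hom (group_algebra (semidirect (free_grp n) G \<alpha>)) V W"
    and L: "lifts sc (semidirect (free_grp n) G \<alpha>) \<rho> q sc' \<rho>' q' \<phi> L"
  shows "lifts (fscale sc) (semidirect (free_grp n) G \<alpha>) (lm_act sc n G \<alpha> \<rho> lam) (klm_vec n G \<alpha> lam V q)
    (fscale sc') (lm_act sc' n G \<alpha> \<rho>' lam) (klm_vec n G \<alpha> lam W q') (fmap (KLM n G \<alpha> lam) V W \<phi>) (\<lambda>v j. L (v j))"
proof -
  interpret V: twisted_presentation n G \<alpha> sc \<rho> q V lam by (rule V)
  interpret W: twisted_presentation n G \<alpha> sc' \<rho>' q' W lam by (rule W)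
  have L_add: "L (u + v) = L u + L v" and L_scale: "L (sc c u) = sc' c (L u)"
    and L_rep: "h \<in> carrier V.H \<Longrightarrow> L (\<rho> h u) = \<rho>' h (L u)" and L_q: "\<phi> (q u) = q' (L u)" for u v c h
    using L by (auto simp: lifts_def)
  interpret m: free_rep_map sc sc' n V.\<rho>F W.\<rho>F L
    by (intro free_rep_map.intro free_rep_map_axioms.intro V.f.free_rep_axioms W.f.free_rep_axioms)
      (simp_all add: L_add L_scale L_rep V.H_sel)
  have Z: "L u \<in> W.Z" if "u \<in> V.Z" for u
  proof -
    have "q u = q 0" using that V.q_zero by simp
    then have "q' (L u) = q' (L 0)" by (simp only: L_q[symmetric])
    then show ?thesis by (simp add: m.L_zero W.q_zero)
  qed
  have KL: "(\<lambda>j. L (u j)) \<in> W.Q.s.KL lam" if "u \<in> V.Q.s.KL lam" for u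
    by (rule m.L_KL[OF V.Q.s.stable_subspace_axioms W.Q.s.stable_subspace_axioms Z that])
  have add: "(\<lambda>j. L ((u + v) j)) = (\<lambda>j. L (u j)) + (\<lambda>j. L (v j))" for u v
    by (simp add: fun_eq_iff plus_fun_apply L_add)
  have scale: "(\<lambda>j. L (fscale sc c v j)) = fscale sc' c (\<lambda>j. L (v j))" for c v
    by (simp add: fun_eq_iff fscale_apply L_scale)
  have rep: "(\<lambda>j. L (lm_act sc n G \<alpha> \<rho> lam h v j)) = lm_act sc' n G \<alpha> \<rho>' lam h (\<lambda>j. L (v j))"
    if hH: "h \<in> carrier V.H" for h v
  proof -
    obtain x g where h: "h = (x, g)" "x \<in> carrier (free_grp n)" "g \<in> carrier G" using hH by (auto simp: V.H_sel)
    have "(\<lambda>j. L (V.\<rho>G g (v j))) = (\<lambda>j. W.\<rho>G g (L (v j)))" using h by (simp add: L_rep V.H_sel)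
    then show ?thesis
      unfolding h(1) V.lm_act_eq W.lm_act_eq m.L_conv[OF V.lam h(2)] m.L_fox_change[OF V.alpha_gens[OF h(3)]]
      by simp
  qed
  have "small_map (quot_module V.LM (klm_sub n G lam V.LM)) (quot_module W.LM (klm_sub n G lam W.LM))
      (quot_map V.LM (klm_sub n G lam V.LM) W.LM (klm_sub n G lam W.LM) (lm_map n G V W \<phi>))
      (quot_vec V.LM (klm_sub n G lam V.LM) (basis_vec n G V q) v) =
      (quot_vec W.LM (klm_sub n G lam W.LM) (basis_vec n G W q') (\<lambda>j. L (v j)) :: 'u)" for v
    by (rule vec_map[OF V.klm_quotient[OF universe] W.klm_quotient[OF universe], where L = "\<lambda>v j. L (v j)"],
        rule add, erule KL, rule lm_map_basis_vec[OF V W \<phi> L_q])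
  then have "fmap (KLM n G \<alpha> lam) V W \<phi> (klm_vec n G \<alpha> lam V q v) = klm_vec n G \<alpha> lam W q' (\<lambda>j. L (v j))" for v
    by (simp add: KLM_def klm_vec_def klm_quot_def)
  then show ?thesis unfolding lifts_def using add scale rep by blast
qed

lemma small_map_extensional: "small_map M N f \<in> extensional (carrier (small_copy M))"
  by (simp add: small_map_def small_copy_def)

section \<open>The middle convolution in coordinates\<close>

definition dr_vec :: "nat \<Rightarrow> ('e \<Rightarrow> 'u) \<Rightarrow> (nat \<Rightarrow> 'e) \<Rightarrow> nat \<Rightarrow> 'u" where
  "dr_vec n q v = (\<lambda>i\<in>{1..n}. q (v i))"

definition mc_vec ::
  "nat \<Rightarrow> 'k::field \<Rightarrow> (fgrp \<Rightarrow> 'k, 'u) module \<Rightarrow> ('e \<Rightarrow> 'u) \<Rightarrow> (nat \<Rightarrow> 'e) \<Rightarrow> 'u" where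
  "mc_vec n lam V q = quot_vec (dr_conv n lam V) (dr_sub n lam V) (dr_vec n q)"

context free_presentation
begin

lemma dr_vec_eq_iff: "dr_vec n q u = dr_vec n q v \<longleftrightarrow> (\<forall>j\<in>{1..n}. (u - v) j \<in> Z)"
proof
  assume eq: "dr_vec n q u = dr_vec n q v"
  show "\<forall>j\<in>{1..n}. (u - v) j \<in> Z"
  proof
    fix j assume "j \<in> {1..n}"
    then have "q (u j) = q (v j)" using fun_cong[OF eq, of j] by (simp add: dr_vec_def)
    then show "(u - v) j \<in> Z" by (simp only: q_eq_iff minus_apply mem_Collect_eq)
  qed
next
  assume z: "\<forall>j\<in>{1..n}. (u - v) j \<in> Z"
  show "dr_vec n q u = dr_vec n q v" unfolding dr_vec_def
  proof (rule restrict_ext)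
    fix j assume "j \<in> {1..n}"
    then have "(u - v) j \<in> Z" using z by blast
    then show "q (u j) = q (v j)" by (simp only: q_eq_iff minus_apply mem_Collect_eq)
  qed
qed

lemma dr_vec_range: "range (dr_vec n q) = {1..n} \<rightarrow>\<^sub>E carrier M"
proof (intro subset_antisym subsetI)
  fix w assume w: "w \<in> {1..n} \<rightarrow>\<^sub>E carrier M"
  have "dr_vec n q (\<lambda>i. inv_into UNIV q (w i)) = w"
  proof
    fix i show "dr_vec n q (\<lambda>i. inv_into UNIV q (w i)) i = w i"
      using w f_inv_into_f[of "w i" q UNIV] PiE_mem[OF w, of i] PiE_arb[OF w, of i]
      by (auto simp: dr_vec_def q_range restrict_def)
  qed
  then show "w \<in> range (dr_vec n q)" by (metis rangeI)
qed (auto simp: dr_vec_def)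

text \<open>On the diagonal, \<open>\<lambda> x\<^sub>i = \<lambda> (x\<^sub>i - 1) + \<lambda>\<close>; this matches the entries of the block row with the summands of \<open>row\<close>.\<close>

lemma dr_entry_act:
  assumes i: "i \<in> {1..n}" and j: "j \<in> {1..n}"
  shows "dr_entry n lam i j \<odot>\<^bsub>M\<^esub> q u =
    q (sc (lam_ge lam i j) (gdiff n \<rho> j u) + (if j = i then sc lam u else 0))"
proof -
  have one: "\<one>\<^bsub>free_grp n\<^esub> \<in> carrier (free_grp n)" by simp
  have "(gsingle c (fgen n j) \<ominus>\<^bsub>group_algebra (free_grp n)\<^esub> gsingle c \<one>\<^bsub>free_grp n\<^esub>) \<odot>\<^bsub>M\<^esub> q u = q (sc c (gdiff n \<rho> j u))" for c
  proof -
    have c: "gsingle c (fgen n j) \<in> carrier (group_algebra (free_grp n))"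
      "gsingle c \<one>\<^bsub>free_grp n\<^esub> \<in> carrier (group_algebra (free_grp n))"
      "gsingle (- c) \<one>\<^bsub>free_grp n\<^esub> \<in> carrier (group_algebra (free_grp n))"
      using j one by simp_all
    have "gsingle c (fgen n j) \<ominus>\<^bsub>group_algebra (free_grp n)\<^esub> gsingle c \<one>\<^bsub>free_grp n\<^esub> =
        gsingle c (fgen n j) + gsingle (- c) \<one>\<^bsub>free_grp n\<^esub>"
      unfolding galg_minus[OF group_free_grp c(1,2)] by (auto simp: gsingle_def fun_simps)
    moreover have "gsingle c (fgen n j) + gsingle (- c) \<one>\<^bsub>free_grp n\<^esub> \<in> carrier (group_algebra (free_grp n))"
      using M.R.a_closed[OF c(1,3)] by simp
    ultimately show ?thesis
      using galg_act_add[OF c(1,3), of u]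
      by (simp add: q_act rep_one gdiff_def scale_right_diff_distrib)
  qed
  moreover have "gsingle lam (fgen n i) \<odot>\<^bsub>M\<^esub> q u = q (sc lam (gdiff n \<rho> i u) + sc lam u)"
    using i by (simp add: q_single gdiff_def scale_right_diff_distrib)
  ultimately show ?thesis by (auto simp: dr_entry_def Let_def lam_ge_def galg_one)
qed

lemma dr_op_vec:
  assumes i: "i \<in> {1..n}"
  shows "dr_op n lam M i (dr_vec n q v) = dr_vec n q (v(i := v i + row sc n \<rho> lam i v))"
proof -
  have "finsum M (\<lambda>j. dr_entry n lam i j \<odot>\<^bsub>M\<^esub> dr_vec n q v j) {1..n} =
      finsum M (\<lambda>j. q (sc (lam_ge lam i j) (gdiff n \<rho> j (v j)) + (if j = i then sc lam (v j) else 0))) {1..n}"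
    by (rule M.add.finprod_cong') (auto simp: dr_vec_def dr_entry_act[OF i])
  also have "\<dots> = q (\<Sum>j\<in>{1..n}. sc (lam_ge lam i j) (gdiff n \<rho> j (v j)) + (if j = i then sc lam (v j) else 0))"
    by (rule q_sum[symmetric]) simp
  also have "(\<Sum>j\<in>{1..n}. sc (lam_ge lam i j) (gdiff n \<rho> j (v j)) + (if j = i then sc lam (v j) else 0)) =
      v i + row sc n \<rho> lam i v"
    using i by (simp add: sum.distrib row_def scale_left_diff_distrib)
  finally show ?thesis using i by (auto simp: dr_op_def dr_vec_def fun_eq_iff)
qed

text \<open>The convolution action on tuples yields a module structure with the required values on generators, so the choice in
  \<open>dr_conv\<close> is not void; whatever is chosen then agrees with it by \<open>act_from_gens\<close>.\<close>

lemma dr_presentation: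
  assumes lam: "lam \<noteq> 0"
  shows "presentation (fscale sc) (free_grp n) (conv_act sc n \<rho> lam) (dr_vec n q) (dr_conv n lam M)"
proof -
  let ?A = "group_algebra (free_grp n) :: (fgrp \<Rightarrow> 'k) ring" and ?c = "conv_act sc n \<rho> lam"
  let ?act = "galg_act (fscale sc) ?c"
  interpret N: free_rep "fscale sc" n ?c by (rule st.conv_rep[OF lam])
  have act_Z: "\<forall>j\<in>{1..n}. ?act a v j \<in> Z" if a: "a \<in> carrier ?A" and v: "\<forall>j\<in>{1..n}. v j \<in> Z" for a v
  proof
    fix j assume j: "j \<in> {1..n}"
    have "?c h v j \<in> Z" if "a h \<noteq> 0" for h
      using that a j v st.conv_stable_Z[OF lam, of h v] by (auto simp: galg_carrier)
    then show "?act a v j \<in> Z"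
      unfolding galg_act_def sum_fun_apply fscale_apply by (intro st.Z_sum st.Z_scale) blast
  qed
  have add: "dr_vec n q (u + v) = (\<lambda>i\<in>{1..n}. dr_vec n q u i \<oplus>\<^bsub>M\<^esub> dr_vec n q v i)" for u v
    by (auto simp: dr_vec_def plus_fun_apply q_add)
  define s where "s a w = dr_vec n q (?act a (\<lambda>i. inv_into UNIV q (w i)))" for a w
  interpret S: presentation "fscale sc" "free_grp n" ?c "dr_vec n q" "(power_module n M)\<lparr>smult := s\<rparr>"
  proof (intro presentation.intro N.group_rep_axioms presentation_axioms.intro)
    fix a :: "fgrp \<Rightarrow> 'k" and u assume a: "a \<in> carrier ?A"
    have "inv_into UNIV q (dr_vec n q u i) - u i \<in> Z" if "i \<in> {1..n}" for i
      using that f_inv_into_f[of "q (u i)" q UNIV] by (simp add: dr_vec_def q_eq_iff[symmetric])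
    then have "\<forall>j\<in>{1..n}. ((\<lambda>i. inv_into UNIV q (dr_vec n q u i)) - u) j \<in> Z" by (simp add: minus_apply)
    from act_Z[OF a this]
    have "\<forall>j\<in>{1..n}. (?act a (\<lambda>i. inv_into UNIV q (dr_vec n q u i)) - ?act a u) j \<in> Z"
      using N.galg_act_add_right[OF a, of "(\<lambda>i. inv_into UNIV q (dr_vec n q u i)) - u" u] by simp
    then show "a \<odot>\<^bsub>(power_module n M)\<lparr>smult := s\<rparr>\<^esub> dr_vec n q u = dr_vec n q (?act a u)"
      unfolding dr_vec_eq_iff[symmetric] by (simp add: s_def)
  qed (auto simp: power_module_def dr_vec_range add, simp add: dr_vec_def q_zero zero_fun_apply)
  have surj: "\<exists>u. w = dr_vec n q u" if "w \<in> carrier (power_module n M)" for w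
    using that dr_vec_range by (auto simp: power_module_def)
  have scale: "gsingle c \<one>\<^bsub>free_grp n\<^esub> \<odot>\<^bsub>power_module n M\<^esub> dr_vec n q u = dr_vec n q (fscale sc c u)" for c u
    by (auto simp: power_module_def dr_vec_def q_scale fscale_apply)
  have "is_dr_smult n lam M s"
    unfolding is_dr_smult_def
  proof (intro conjI allI ballI S.left_module)
    fix c v assume "v \<in> carrier (power_module n M)"
    then obtain u where u: "v = dr_vec n q u" using surj by blast
    show "s (gsingle c \<one>\<^bsub>free_grp n\<^esub>) v = gsingle c \<one>\<^bsub>free_grp n\<^esub> \<odot>\<^bsub>power_module n M\<^esub> v"
      using S.q_scale[of c u] by (simp add: u scale)
  next
    fix i v assume i: "i \<in> {1..n}" and "v \<in> carrier (power_module n M)"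
    then obtain u where u: "v = dr_vec n q u" using surj by blast
    show "s (gsingle 1 (fgen n i)) v = dr_op n lam M i v"
      using S.q_rep[OF fgen_carrier[OF i], of u] by (simp add: u dr_op_vec[OF i] st.conv_act_gen[OF lam i])
  qed
  then have d: "is_dr_smult n lam M (SOME s. is_dr_smult n lam M s)" by (rule someI[of "is_dr_smult n lam M" s])
  define t where "t = (SOME s. is_dr_smult n lam M s)"
  have conv: "dr_conv n lam M = (power_module n M)\<lparr>smult := t\<rparr>" by (simp add: dr_conv_def t_def)
  have d: "is_dr_smult n lam M t" using d unfolding t_def .
  have pc: "dr_vec n q u \<in> carrier (power_module n M)" for u
    using dr_vec_range by (auto simp: power_module_def)
  have t: "left_module ?A (dr_conv n lam M)"
    using d unfolding conv is_dr_smult_def by blast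
  have t_scale: "gsingle c \<one>\<^bsub>free_grp n\<^esub> \<odot>\<^bsub>dr_conv n lam M\<^esub> dr_vec n q u = dr_vec n q (fscale sc c u)" for c u
  proof -
    have "t (gsingle c \<one>\<^bsub>free_grp n\<^esub>) (dr_vec n q u) = gsingle c \<one>\<^bsub>free_grp n\<^esub> \<odot>\<^bsub>power_module n M\<^esub> dr_vec n q u"
      using d pc unfolding is_dr_smult_def by blast
    then show ?thesis unfolding scale by (simp add: conv)
  qed
  have t_gen: "gsingle 1 (fgen n i) \<odot>\<^bsub>dr_conv n lam M\<^esub> dr_vec n q u = dr_vec n q (?c (fgen n i) u)"
    if i: "i \<in> {1..n}" for i u
  proof -
    have "t (gsingle 1 (fgen n i)) (dr_vec n q u) = dr_op n lam M i (dr_vec n q u)"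
      using d pc i unfolding is_dr_smult_def by blast
    then show ?thesis unfolding dr_op_vec[OF i] st.conv_act_gen[OF lam i] by (simp add: conv)
  qed
  have range: "range (dr_vec n q) = carrier (dr_conv n lam M)"
    by (simp add: dr_vec_range dr_conv_def power_module_def)
  have add': "dr_vec n q (u + v) = dr_vec n q u \<oplus>\<^bsub>dr_conv n lam M\<^esub> dr_vec n q v" for u v
    unfolding add by (simp add: dr_conv_def power_module_def)
  have closed: "dr_vec n q u \<in> carrier (dr_conv n lam M)" for u unfolding range[symmetric] by simp
  show ?thesis
  proof (intro presentation.intro N.group_rep_axioms presentation_axioms.intro)
    show "range (dr_vec n q) = carrier (dr_conv n lam M)" by (rule range)
    show "dr_vec n q (u + v) = dr_vec n q u \<oplus>\<^bsub>dr_conv n lam M\<^esub> dr_vec n q v" for u v by (rule add')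
    show "dr_vec n q 0 = \<zero>\<^bsub>dr_conv n lam M\<^esub>"
      by (rule act_from_gens(1)[where q = "dr_vec n q" and sc = "fscale sc" and \<rho> = ?c, OF N.group_rep_axioms t closed add' t_scale t_gen])
    show "a \<odot>\<^bsub>dr_conv n lam M\<^esub> dr_vec n q u = dr_vec n q (?act a u)" if "a \<in> carrier ?A" for a u
      by (rule act_from_gens(2)[where q = "dr_vec n q" and sc = "fscale sc" and \<rho> = ?c, OF N.group_rep_axioms t closed add' t_scale t_gen that])
  qed
qed

lemma dr_sub_eq:
  assumes lam: "lam \<noteq> 0"
  shows "dr_sub n lam M = dr_vec n q ` st.KL lam"
proof -
  interpret P: presentation "fscale sc" "free_grp n" "conv_act sc n \<rho> lam" "dr_vec n q" "dr_conv n lam M"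
    by (rule dr_presentation[OF lam])
  have K: "dr_vec n q k \<in> dr_K n M \<longleftrightarrow> (\<forall>i\<in>{1..n}. gdiff n \<rho> i (k i) \<in> Z)" for k
    by (auto simp: dr_K_def dr_vec_def q_rep q_eq_iff gdiff_def)
  have L: "dr_vec n q l \<in> dr_L n lam M \<longleftrightarrow> (\<forall>i\<in>{1..n}. row sc n \<rho> lam i l \<in> Z)" for l
  proof -
    have "dr_vec n q (l(i := l i + row sc n \<rho> lam i l)) = dr_vec n q l \<longleftrightarrow> row sc n \<rho> lam i l \<in> Z"
      if i: "i \<in> {1..n}" for i
    proof -
      have "(l(i := l i + row sc n \<rho> lam i l) - l) j = (if j = i then row sc n \<rho> lam i l else 0)" for j
        by (simp add: minus_apply)
      then show ?thesis unfolding dr_vec_eq_iff using i by (auto simp: q_zero)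
    qed
    moreover have "dr_vec n q l \<in> {1..n} \<rightarrow>\<^sub>E carrier M" using dr_vec_range by blast
    ultimately show ?thesis by (auto simp: dr_L_def dr_op_vec)
  qed
  have K': "dr_K n M = dr_vec n q ` {k. \<forall>i\<in>{1..n}. gdiff n \<rho> i (k i) \<in> Z}"
  proof -
    have "dr_K n M \<subseteq> range (dr_vec n q)" unfolding dr_vec_range by (auto simp: dr_K_def)
    then show ?thesis using K by blast
  qed
  have L': "dr_L n lam M = dr_vec n q ` {l. \<forall>i\<in>{1..n}. row sc n \<rho> lam i l \<in> Z}"
  proof -
    have "dr_L n lam M \<subseteq> range (dr_vec n q)" unfolding dr_vec_range by (auto simp: dr_L_def)
    then show ?thesis using L by blast
  qed
  show ?thesis
    unfolding dr_sub_def set_add_def' K' L' st.KL_def by (auto simp: P.q_add[symmetric])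
qed

context
  fixes lam :: 'k
  assumes universe: "infinite (UNIV :: 'm set)" and lam: "lam \<noteq> 0"
begin

lemma mc_quotient:
  "vec_quotient TYPE('m) (fscale sc) (free_grp n) (conv_act sc n \<rho> lam) (dr_vec n q) (dr_conv n lam M)
    (dr_sub n lam M) (st.KL lam)"
proof (intro vec_quotient.intro dr_presentation[OF lam] vec_quotient_axioms.intro dr_sub_eq[OF lam])
  show "0 \<in> st.KL lam" by (rule st.KL_zero)
  show "u + v \<in> st.KL lam" if "u \<in> st.KL lam" "v \<in> st.KL lam" for u v
    using that by (rule st.KL_add)
  show "fscale sc c u \<in> st.KL lam" if "u \<in> st.KL lam" for c u
    using that by (rule st.KL_scale)
  show "conv_act sc n \<rho> lam x u \<in> st.KL lam" if "x \<in> carrier (free_grp n)" "u \<in> st.KL lam" for x u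
    by (rule st.KL_conv[OF lam that])
  show "u \<in> st.KL lam" if "dr_vec n q u = \<zero>\<^bsub>dr_conv n lam M\<^esub>" for u
  proof (rule st.KL_Z)
    fix j assume j: "j \<in> {1..n}"
    have "dr_vec n q u = dr_vec n q 0" using that presentation.q_zero[OF dr_presentation[OF lam]] by simp
    then show "u j \<in> Z" using j unfolding dr_vec_eq_iff by simp
  qed
  show "\<exists>e :: (nat \<Rightarrow> 'm) set \<Rightarrow> 'm. inj_on e (carrier (quot_module (dr_conv n lam M) (dr_sub n lam M)))"
  proof (rule code_exists[OF universe, of n q "\<lambda>u. dr_sub n lam M +>\<^bsub>dr_conv n lam M\<^esub> dr_vec n q u"])
    fix u v :: "nat \<Rightarrow> 'e" assume "\<forall>i\<in>{1..n}. q (u i) = q (v i)"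
    then have "dr_vec n q u = dr_vec n q v" by (auto simp: dr_vec_def)
    then show "dr_sub n lam M +>\<^bsub>dr_conv n lam M\<^esub> dr_vec n q u = dr_sub n lam M +>\<^bsub>dr_conv n lam M\<^esub> dr_vec n q v"
      by simp
  next
    show "carrier (quot_module (dr_conv n lam M) (dr_sub n lam M)) \<subseteq>
        range (\<lambda>u. dr_sub n lam M +>\<^bsub>dr_conv n lam M\<^esub> dr_vec n q u)"
      using presentation.q_surj[OF dr_presentation[OF lam]] by (fastforce simp: quot_module_def A_RCOSETS_def')
  qed
qed

lemma mc_presentation: "presentation (fscale sc) (free_grp n) (conv_act sc n \<rho> lam) (mc_vec n lam M q) (fobj (MC n lam) M)"
  unfolding mc_vec_def MC_def funct.select_convs
  by (rule vec_quotient.vec_presentation[OF mc_quotient])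

lemma mc_zero_iff: "mc_vec n lam M q v = \<zero>\<^bsub>fobj (MC n lam) M\<^esub> \<longleftrightarrow> v \<in> st.KL lam"
  unfolding mc_vec_def MC_def funct.select_convs
  by (rule vec_quotient.vec_zero_iff[OF mc_quotient])

lemma mc_NT:
  assumes n: "n \<ge> 1" and P: "P1 n M" "P2 n M"
  shows "P1 n (fobj (MC n lam) M)" "P2 n (fobj (MC n lam) M)"
proof -
  interpret p: free_presentation "fscale sc" n "conv_act sc n \<rho> lam" "mc_vec n lam M q" "fobj (MC n lam) M"
    by (rule free_presentation.intro[OF mc_presentation])
  have no: "no_sub sc n \<rho> Z" "no_quot sc n \<rho> Z" using P P1_iff P2_iff by simp_all
  have "p.Z = klm_ker sc n \<rho> lam Z" by (simp add: mc_zero_iff st.KL_eq[OF n no(1)])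
  then show "P1 n (fobj (MC n lam) M)" "P2 n (fobj (MC n lam) M)"
    using st.no_sub_conv[OF lam no(1)] st.no_quot_conv[OF lam no(2)] p.P1_iff p.P2_iff by simp_all
qed

end

end

lemma mc_lifts:
  fixes V W :: "(fgrp \<Rightarrow> 'k::field, 'u) module"
    and sc :: "'k \<Rightarrow> 'e::ab_group_add \<Rightarrow> 'e" and sc' :: "'k \<Rightarrow> 'f::ab_group_add \<Rightarrow> 'f"
  assumes universe: "infinite (UNIV :: 'u set)" and lam: "lam \<noteq> 0"
    and V: "presentation sc (free_grp n) \<rho> q V" and W: "presentation sc' (free_grp n) \<rho>' q' W"
    and L: "lifts sc (free_grp n) \<rho> q sc' \<rho>' q' \<phi> L"
  shows "lifts (fscale sc) (free_grp n) (conv_act sc n \<rho> lam) (mc_vec n lam V q)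
    (fscale sc') (conv_act sc' n \<rho>' lam) (mc_vec n lam W q') (fmap (MC n lam) V W \<phi>) (\<lambda>v j. L (v j))"
proof -
  interpret V: free_presentation sc n \<rho> q V by (rule free_presentation.intro[OF V])
  interpret W: free_presentation sc' n \<rho>' q' W by (rule free_presentation.intro[OF W])
  have L_add: "L (u + v) = L u + L v" and L_scale: "L (sc c u) = sc' c (L u)"
    and L_rep: "x \<in> carrier (free_grp n) \<Longrightarrow> L (\<rho> x u) = \<rho>' x (L u)" and L_q: "\<phi> (q u) = q' (L u)" for u v c x
    using L by (auto simp: lifts_def)
  interpret m: free_rep_map sc sc' n \<rho> \<rho>' L
    by (intro free_rep_map.intro free_rep_map_axioms.intro V.st.free_rep_axioms W.st.free_rep_axioms)
      (simp_all add: L_add L_scale L_rep)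
  have Z: "L u \<in> W.Z" if "u \<in> V.Z" for u
  proof -
    have "q u = q 0" using that V.q_zero by simp
    then have "q' (L u) = q' (L 0)" by (simp only: L_q[symmetric])
    then show ?thesis by (simp add: m.L_zero W.q_zero)
  qed
  have KL: "(\<lambda>j. L (u j)) \<in> W.st.KL lam" if "u \<in> V.st.KL lam" for u
    by (rule m.L_KL[OF V.st.stable_subspace_axioms W.st.stable_subspace_axioms Z that])
  have add: "(\<lambda>j. L ((u + v) j)) = (\<lambda>j. L (u j)) + (\<lambda>j. L (v j))" for u v
    by (simp add: fun_eq_iff plus_fun_apply L_add)
  have scale: "(\<lambda>j. L (fscale sc c v j)) = fscale sc' c (\<lambda>j. L (v j))" for c v
    by (simp add: fun_eq_iff fscale_apply L_scale)
  have f: "(\<lambda>v\<in>carrier (dr_conv n lam V). \<lambda>i\<in>{1..n}. \<phi> (v i)) (dr_vec n q v) = dr_vec n q' (\<lambda>j. L (v j))" for v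
    using presentation.q_closed[OF V.dr_presentation[OF lam], of v] by (auto simp: dr_vec_def L_q)
  have "small_map (quot_module (dr_conv n lam V) (dr_sub n lam V)) (quot_module (dr_conv n lam W) (dr_sub n lam W))
      (quot_map (dr_conv n lam V) (dr_sub n lam V) (dr_conv n lam W) (dr_sub n lam W)
        (\<lambda>v\<in>carrier (dr_conv n lam V). \<lambda>i\<in>{1..n}. \<phi> (v i)))
      (quot_vec (dr_conv n lam V) (dr_sub n lam V) (dr_vec n q) v) =
      (quot_vec (dr_conv n lam W) (dr_sub n lam W) (dr_vec n q') (\<lambda>j. L (v j)) :: 'u)" for v
    by (rule vec_map[OF V.mc_quotient[OF universe lam] W.mc_quotient[OF universe lam], where L = "\<lambda>v j. L (v j)"],
        rule add, erule KL, rule f)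
  then have "fmap (MC n lam) V W \<phi> (mc_vec n lam V q v) = mc_vec n lam W q' (\<lambda>j. L (v j))" for v
    by (simp add: MC_def mc_vec_def)
  then show ?thesis unfolding lifts_def using add scale m.L_conv[OF lam] by blast
qed

section \<open>The category of modules without almost trivial sub- and quotient modules\<close>

text \<open>A presentation remains one after composition with an equivariant linear map that is surjective modulo the kernel.\<close>

lemma presentation_pullback:
  fixes sc' :: "'k::field \<Rightarrow> 'f::ab_group_add \<Rightarrow> 'f"
  assumes "presentation sc H \<rho> q M" and rep: "group_rep sc' H \<rho>'"
    and add: "\<And>u v. A (u + v) = A u + A v" and scale: "\<And>c u. A (sc' c u) = sc c (A u)"
    and equiv: "\<And>h u. h \<in> carrier H \<Longrightarrow> A (\<rho>' h u) = \<rho> h (A u)"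
    and surj: "\<And>u. \<exists>w. q u = q (A w)"
  shows "presentation sc' H \<rho>' (\<lambda>w. q (A w)) M"
proof -
  interpret presentation sc H \<rho> q M by fact
  show ?thesis
  proof (rule presentationI[OF rep left_module])
    show "range (\<lambda>w. q (A w)) = carrier M"
    proof (intro subset_antisym subsetI)
      fix x assume "x \<in> carrier M"
      then obtain u where "x = q u" using q_surj by blast
      then show "x \<in> range (\<lambda>w. q (A w))" using surj[of u] by auto
    qed auto
  qed (simp_all add: add scale equiv q_add q_scale q_rep)
qed

context artin
begin

context
  assumes n: "n \<ge> 1" and universe: "infinite (UNIV :: 'u set)"
begin

lemma Mod_NT_D:
  fixes V :: "(fgrp \<times> 'g \<Rightarrow> 'k::field, 'u) module"
  assumes "V \<in> Obj (Mod_NT TYPE('k) TYPE('u) n G \<alpha>)"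
  shows "left_module (group_algebra H) V" "P1 n (res_free G V)" "P2 n (res_free G V)"
  using assms by (simp_all add: Mod_NT_def)

lemma Mod_NT_twisted:
  fixes V :: "(fgrp \<times> 'g \<Rightarrow> 'k::field, 'u) module"
  assumes "V \<in> Obj (Mod_NT TYPE('k) TYPE('u) n G \<alpha>)" "lam \<noteq> 0"
  shows "twisted_presentation n G \<alpha> pscale (perm_act H V) (evaluation H V) V lam"
  by (intro twisted_presentationI artin_axioms evaluation_presentation group_H Mod_NT_D(1)[OF assms(1)] assms(2))

lemma KLM_functor:
  fixes lam :: "'k::field"
  assumes lam: "lam \<noteq> 0"
  shows "is_functor (Mod_NT TYPE('k) TYPE('u) n G \<alpha>) (Mod_NT TYPE('k) TYPE('u) n G \<alpha>) (KLM n G \<alpha> lam)"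
proof (rule functor_of_lifts[OF group_H Mod_NT_def,
      where sc' = "fscale pscale" and \<rho>' = "\<lambda>V. lm_act pscale n G \<alpha> (perm_act H V) lam"
        and p = "\<lambda>V. klm_vec n G \<alpha> lam V (evaluation H V)"])
  fix V :: "(fgrp \<times> 'g \<Rightarrow> 'k, 'u) module" assume V: "V \<in> Obj (Mod_NT TYPE('k) TYPE('u) n G \<alpha>)"
  interpret V: twisted_presentation n G \<alpha> pscale "perm_act H V" "evaluation H V" V lam
    by (rule Mod_NT_twisted[OF V lam])
  show "presentation (fscale pscale) H (lm_act pscale n G \<alpha> (perm_act H V) lam)
      (klm_vec n G \<alpha> lam V (evaluation H V)) (fobj (KLM n G \<alpha> lam) V)"
    by (rule V.klm_presentation[OF universe])
  show "P1 n (res_free G (fobj (KLM n G \<alpha> lam) V)) \<and> P2 n (res_free G (fobj (KLM n G \<alpha> lam) V))"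
    using V.klm_NT[OF universe n Mod_NT_D(2,3)[OF V]] by blast
next
  show "fmap (KLM n G \<alpha> lam) V W \<phi> \<in> extensional (carrier (fobj (KLM n G \<alpha> lam) V))"
    for V W :: "(fgrp \<times> 'g \<Rightarrow> 'k, 'u) module" and \<phi>
    by (simp add: KLM_def small_map_extensional)
qed (rule klm_lifts[OF universe Mod_NT_twisted[OF _ lam] Mod_NT_twisted[OF _ lam]])

lemma MC_functor:
  fixes lam :: "'k::field"
  assumes lam: "lam \<noteq> 0"
  shows "is_functor (Mod_NT_free TYPE('k) TYPE('u) n) (Mod_NT_free TYPE('k) TYPE('u) n) (MC n lam)"
proof -
  have pres: "presentation pscale (free_grp n) (perm_act (free_grp n) V) (evaluation (free_grp n) V) V"
    and P: "P1 n V" "P2 n V"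
    if "V \<in> Obj (Mod_NT_free TYPE('k) TYPE('u) n)" for V :: "(fgrp \<Rightarrow> 'k, 'u) module"
    using that evaluation_presentation[OF group_free_grp] by (auto simp: Mod_NT_free_def)
  show ?thesis
  proof (rule functor_of_lifts[OF group_free_grp Mod_NT_free_def,
        where sc' = "fscale pscale" and \<rho>' = "\<lambda>V. conv_act pscale n (perm_act (free_grp n) V) lam"
          and p = "\<lambda>V. mc_vec n lam V (evaluation (free_grp n) V)"])
    fix V :: "(fgrp \<Rightarrow> 'k, 'u) module" assume V: "V \<in> Obj (Mod_NT_free TYPE('k) TYPE('u) n)"
    interpret V: free_presentation pscale n "perm_act (free_grp n) V" "evaluation (free_grp n) V" V
      by (rule free_presentation.intro[OF pres[OF V]])
    show "presentation (fscale pscale) (free_grp n) (conv_act pscale n (perm_act (free_grp n) V) lam)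
        (mc_vec n lam V (evaluation (free_grp n) V)) (fobj (MC n lam) V)"
      by (rule V.mc_presentation[OF universe lam])
    show "P1 n (fobj (MC n lam) V) \<and> P2 n (fobj (MC n lam) V)"
      using V.mc_NT[OF universe lam n P[OF V]] by blast
  next
    show "fmap (MC n lam) V W \<phi> \<in> extensional (carrier (fobj (MC n lam) V))"
      for V W :: "(fgrp \<Rightarrow> 'k, 'u) module" and \<phi>
      by (simp add: MC_def small_map_extensional)
  qed (rule mc_lifts[OF universe lam pres pres])
qed

lemma res_functor_functor:
  "is_functor (Mod_NT TYPE('k::field) TYPE('u) n G \<alpha>) (Mod_NT_free TYPE('k) TYPE('u) n) (res_functor G)"
proof -
  have mod: "left_module (group_algebra F) (res_free G V)"
    if V: "V \<in> Obj (Mod_NT TYPE('k) TYPE('u) n G \<alpha>)" for V :: "(fgrp \<times> 'g \<Rightarrow> 'k, 'u) module"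
  proof -
    interpret V: twisted_presentation n G \<alpha> pscale "perm_act H V" "evaluation H V" V 1
      by (rule Mod_NT_twisted[OF V one_neq_zero])
    show ?thesis by (rule V.vf.left_module)
  qed
  have "\<phi> \<in> lmod_hom (group_algebra F) (res_free G V) (res_free G W)"
    if "\<phi> \<in> lmod_hom (group_algebra H) V W" for V W :: "(fgrp \<times> 'g \<Rightarrow> 'k, 'u) module" and \<phi>
  proof -
    have "galg_map (\<lambda>x. (x, \<one>\<^bsub>G\<^esub>)) a \<in> carrier (group_algebra H)" if "a \<in> carrier (group_algebra F)" for a :: "fgrp \<Rightarrow> 'k"
      by (rule galg_map_closed[OF that]) (simp add: H_sel)
    then show ?thesis using that by (simp add: lmod_hom_def res_free_def)
  qed
  then show ?thesis
    using mod Mod_NT_D(2,3)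
    by (simp add: is_functor_def res_functor_def Mod_NT_def Mod_NT_free_def) (simp add: res_free_def)
qed

text \<open>Both functors are presented by tuples with the convolution action and the kernel \<open>K + L\<close>.\<close>

lemma KLM_iso_MC:
  fixes lam :: "'k::field"
  assumes lam: "lam \<noteq> 0"
  shows "naturally_isomorphic (Mod_NT TYPE('k) TYPE('u) n G \<alpha>) (Mod_NT_free TYPE('k) TYPE('u) n)
    (res_functor G \<circ>\<^sub>F KLM n G \<alpha> lam) (MC n lam \<circ>\<^sub>F res_functor G)"
proof (rule naturally_isomorphic_if_same_presentation[OF Mod_NT_free_def,
      where sc = "fscale pscale" and \<rho> = "\<lambda>V. conv_act pscale n (\<lambda>x. perm_act H V (x, \<one>\<^bsub>G\<^esub>)) lam"
        and q = "\<lambda>V. klm_vec n G \<alpha> lam V (evaluation H V)" and q' = "\<lambda>V. mc_vec n lam (res_free G V) (evaluation H V)"])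
  show "is_functor (Mod_NT TYPE('k) TYPE('u) n G \<alpha>) (Mod_NT_free TYPE('k) TYPE('u) n) (res_functor G \<circ>\<^sub>F KLM n G \<alpha> lam)"
    by (rule is_functor_comp[OF KLM_functor[OF lam] res_functor_functor])
  show "is_functor (Mod_NT TYPE('k) TYPE('u) n G \<alpha>) (Mod_NT_free TYPE('k) TYPE('u) n) (MC n lam \<circ>\<^sub>F res_functor G)"
    by (rule is_functor_comp[OF res_functor_functor MC_functor[OF lam]])
next
  fix V :: "(fgrp \<times> 'g \<Rightarrow> 'k, 'u) module" assume V: "V \<in> Obj (Mod_NT TYPE('k) TYPE('u) n G \<alpha>)"
  interpret V: twisted_presentation n G \<alpha> pscale "perm_act H V" "evaluation H V" V lam
    by (rule Mod_NT_twisted[OF V lam])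
  interpret p: free_presentation pscale n V.\<rho>F "evaluation H V" V.VF
    by (rule free_presentation.intro[OF V.vf])
  show "presentation (fscale pscale) (free_grp n) (conv_act pscale n V.\<rho>F lam) (klm_vec n G \<alpha> lam V (evaluation H V))
      (fobj (res_functor G \<circ>\<^sub>F KLM n G \<alpha> lam) V)"
    using V.klm_res_presentation[OF universe] by (simp add: comp_functor_def res_functor_def)
  show "presentation (fscale pscale) (free_grp n) (conv_act pscale n V.\<rho>F lam) (mc_vec n lam (res_free G V) (evaluation H V))
      (fobj (MC n lam \<circ>\<^sub>F res_functor G) V)"
    using p.mc_presentation[OF universe lam] by (simp add: comp_functor_def res_functor_def)
  fix u
  have "klm_vec n G \<alpha> lam V (evaluation H V) u = \<zero>\<^bsub>fobj (KLM n G \<alpha> lam) V\<^esub> \<longleftrightarrow>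
      mc_vec n lam V.VF (evaluation H V) u = \<zero>\<^bsub>fobj (MC n lam) V.VF\<^esub>"
    unfolding V.klm_zero_iff[OF universe] p.mc_zero_iff[OF universe lam] V.VF_sel ..
  then show "klm_vec n G \<alpha> lam V (evaluation H V) u = \<zero>\<^bsub>fobj (res_functor G \<circ>\<^sub>F KLM n G \<alpha> lam) V\<^esub> \<longleftrightarrow>
      mc_vec n lam (res_free G V) (evaluation H V) u = \<zero>\<^bsub>fobj (MC n lam \<circ>\<^sub>F res_functor G) V\<^esub>"
    by (simp add: comp_functor_def res_functor_def res_free_def)
next
  fix V W :: "(fgrp \<times> 'g \<Rightarrow> 'k, 'u) module" and \<phi> u
  assume V: "V \<in> Obj (Mod_NT TYPE('k) TYPE('u) n G \<alpha>)" and W: "W \<in> Obj (Mod_NT TYPE('k) TYPE('u) n G \<alpha>)"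
    and "\<phi> \<in> Hom (Mod_NT TYPE('k) TYPE('u) n G \<alpha>) V W"
  then have \<phi>: "\<phi> \<in> lmod_hom (group_algebra H) V W" by (simp add: Mod_NT_def)
  interpret V: twisted_presentation n G \<alpha> pscale "perm_act H V" "evaluation H V" V lam
    by (rule Mod_NT_twisted[OF V lam])
  interpret W: twisted_presentation n G \<alpha> pscale "perm_act H W" "evaluation H W" W lam
    by (rule Mod_NT_twisted[OF W lam])
  obtain L where L: "lifts pscale H (perm_act H V) (evaluation H V) pscale (perm_act H W) (evaluation H W) \<phi> L"
    using lifts_exists[OF group_H Mod_NT_D(1)[OF V] Mod_NT_D(1)[OF W] \<phi>] by blast
  then have LF: "lifts pscale F V.\<rho>F (evaluation H V) pscale W.\<rho>F (evaluation H W) \<phi> L"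
    by (simp add: lifts_def H_sel)
  have "fmap (KLM n G \<alpha> lam) V W \<phi> (klm_vec n G \<alpha> lam V (evaluation H V) u) =
      klm_vec n G \<alpha> lam W (evaluation H W) (\<lambda>j. L (u j))"
    using klm_lifts[OF universe V.twisted_presentation_axioms W.twisted_presentation_axioms \<phi> L]
    by (simp only: lifts_def)
  moreover have "fmap (MC n lam) V.VF W.VF \<phi> (mc_vec n lam V.VF (evaluation H V) u) =
      mc_vec n lam W.VF (evaluation H W) (\<lambda>j. L (u j))"
    using mc_lifts[OF universe lam V.vf W.vf LF] by (simp only: lifts_def)
  ultimately show "\<exists>u'. fmap (res_functor G \<circ>\<^sub>F KLM n G \<alpha> lam) V W \<phi> (klm_vec n G \<alpha> lam V (evaluation H V) u) =
        klm_vec n G \<alpha> lam W (evaluation H W) u' \<and>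
      fmap (MC n lam \<circ>\<^sub>F res_functor G) V W \<phi> (mc_vec n lam (res_free G V) (evaluation H V) u) =
        mc_vec n lam (res_free G W) (evaluation H W) u'"
    by (intro exI[of _ "\<lambda>j. L (u j)"]) (simp add: comp_functor_def res_functor_def)
qed

text \<open>A functor that is presented by \<open>n\<close> copies of the modules, with the action for \<open>\<lambda>\<tau>\<close> and the kernel
  of the Katz-Long-Moody module for \<open>\<lambda>\<tau>\<close>, is the composite for \<open>\<lambda>\<close> and \<open>\<tau>\<close>: both are quotients of
  \<open>n\<^sup>2\<close> copies by the same kernel, through the multiplication \<open>I \<otimes> I \<otimes> V \<rightarrow> I \<otimes> V\<close>.\<close>

lemma KLM_comp_iso:
  fixes lam \<tau> :: "'k::field" and F' :: "((fgrp \<times> 'g \<Rightarrow> 'k, 'u) module, 'u \<Rightarrow> 'u, (fgrp \<times> 'g \<Rightarrow> 'k, 'u) module, 'u \<Rightarrow> 'u) funct"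
  assumes lam: "lam \<noteq> 0" "\<tau> \<noteq> 0"
    and F': "is_functor (Mod_NT TYPE('k) TYPE('u) n G \<alpha>) (Mod_NT TYPE('k) TYPE('u) n G \<alpha>) F'"
    and b: "\<And>V. V \<in> Obj (Mod_NT TYPE('k) TYPE('u) n G \<alpha>) \<Longrightarrow>
      presentation (fscale pscale) H (lm_act pscale n G \<alpha> (perm_act H V) (lam * \<tau>)) (b V) (fobj F' V)"
    and ker: "\<And>V v. V \<in> Obj (Mod_NT TYPE('k) TYPE('u) n G \<alpha>) \<Longrightarrow>
      b V v = \<zero>\<^bsub>fobj F' V\<^esub> \<longleftrightarrow>
        v \<in> klm_ker pscale n (\<lambda>x. perm_act H V (x, \<one>\<^bsub>G\<^esub>)) (lam * \<tau>) {u. evaluation H V u = \<zero>\<^bsub>V\<^esub>}"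
    and nat: "\<And>V W \<phi> L v. V \<in> Obj (Mod_NT TYPE('k) TYPE('u) n G \<alpha>) \<Longrightarrow> W \<in> Obj (Mod_NT TYPE('k) TYPE('u) n G \<alpha>) \<Longrightarrow>
      \<phi> \<in> lmod_hom (group_algebra H) V W \<Longrightarrow>
      lifts pscale H (perm_act H V) (evaluation H V) pscale (perm_act H W) (evaluation H W) \<phi> L \<Longrightarrow>
      fmap F' V W \<phi> (b V v) = b W (\<lambda>j. L (v j))"
  shows "naturally_isomorphic (Mod_NT TYPE('k) TYPE('u) n G \<alpha>) (Mod_NT TYPE('k) TYPE('u) n G \<alpha>)
    (KLM n G \<alpha> lam \<circ>\<^sub>F KLM n G \<alpha> \<tau>) F'"
proof (rule naturally_isomorphic_if_same_presentation[OF Mod_NT_def,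
      where sc = "fscale (fscale pscale)"
        and \<rho> = "\<lambda>V. lm_act (fscale pscale) n G \<alpha> (lm_act pscale n G \<alpha> (perm_act H V) \<tau>) lam"
        and q = "\<lambda>V. klm_vec n G \<alpha> lam (fobj (KLM n G \<alpha> \<tau>) V) (klm_vec n G \<alpha> \<tau> V (evaluation H V))"
        and q' = "\<lambda>V w. b V (aug_sum n (conv_act pscale n (\<lambda>x. perm_act H V (x, \<one>\<^bsub>G\<^esub>)) \<tau>) w)"])
  show "is_functor (Mod_NT TYPE('k) TYPE('u) n G \<alpha>) (Mod_NT TYPE('k) TYPE('u) n G \<alpha>) (KLM n G \<alpha> lam \<circ>\<^sub>F KLM n G \<alpha> \<tau>)"
    by (rule is_functor_comp[OF KLM_functor[OF lam(2)] KLM_functor[OF lam(1)]])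
  show "is_functor (Mod_NT TYPE('k) TYPE('u) n G \<alpha>) (Mod_NT TYPE('k) TYPE('u) n G \<alpha>) F'" by (rule F')
next
  fix V :: "(fgrp \<times> 'g \<Rightarrow> 'k, 'u) module" assume V: "V \<in> Obj (Mod_NT TYPE('k) TYPE('u) n G \<alpha>)"
  interpret V: twisted_presentation n G \<alpha> pscale "perm_act H V" "evaluation H V" V \<tau>
    by (rule Mod_NT_twisted[OF V lam(2)])
  let ?K = "fobj (KLM n G \<alpha> \<tau>) V" and ?A = "aug_sum n (conv_act pscale n V.\<rho>F \<tau>)"
  interpret K: twisted_presentation n G \<alpha> "fscale pscale" "lm_act pscale n G \<alpha> (perm_act H V) \<tau>"
    "klm_vec n G \<alpha> \<tau> V (evaluation H V)" ?K lam
    by (rule V.klm_twisted[OF universe lam(1)])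
  interpret N: free_rep "fscale pscale" n "conv_act pscale n V.\<rho>F \<tau>" by (rule V.f.conv_rep[OF lam(2)])
  note NT = Mod_NT_D(2,3)[OF V]
  show "presentation (fscale (fscale pscale)) H (lm_act (fscale pscale) n G \<alpha> (lm_act pscale n G \<alpha> (perm_act H V) \<tau>) lam)
      (klm_vec n G \<alpha> lam ?K (klm_vec n G \<alpha> \<tau> V (evaluation H V))) (fobj (KLM n G \<alpha> lam \<circ>\<^sub>F KLM n G \<alpha> \<tau>) V)"
    using K.klm_presentation[OF universe] by (simp add: comp_functor_def)
  show "presentation (fscale (fscale pscale)) H (lm_act (fscale pscale) n G \<alpha> (lm_act pscale n G \<alpha> (perm_act H V) \<tau>) lam)
      (\<lambda>w. b V (?A w)) (fobj F' V)"
  proof (rule presentation_pullback[OF b[OF V] K.L.group_rep_axioms])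
    fix u
    obtain w where w: "\<forall>j\<in>{1..n}. (u - ?A w) j \<in> V.Z"
      using V.Q.s.aug_sum_conv_surj[OF lam(2) V.no_quot[OF universe n NT]] by blast
    have "b V (u - ?A w) = \<zero>\<^bsub>fobj F' V\<^esub>"
      unfolding ker[OF V] by (rule V.Q.s.klm_ker_Z) (use w in blast)
    then have "b V u = b V (?A w)" using presentation.q_eq_iff[OF b[OF V]] by blast
    then show "\<exists>w. b V u = b V (?A w)" by blast
  qed (use N.aug_sum_add N.aug_sum_scale V.aug_sum_lm_mult[OF lam] in simp_all)
  fix w
  have Z: "K.Z = klm_ker pscale n V.\<rho>F \<tau> V.Z" using V.klm_ker_iff[OF universe n NT] by simp
  have "klm_vec n G \<alpha> lam ?K (klm_vec n G \<alpha> \<tau> V (evaluation H V)) w = \<zero>\<^bsub>fobj (KLM n G \<alpha> lam) ?K\<^esub> \<longleftrightarrow>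
      w \<in> klm_ker (fscale pscale) n (\<lambda>x. lm_act pscale n G \<alpha> (perm_act H V) \<tau> (x, \<one>\<^bsub>G\<^esub>)) lam K.Z"
    by (rule K.klm_ker_iff[OF universe n V.klm_NT[OF universe n NT]])
  also have "\<dots> \<longleftrightarrow> ?A w \<in> klm_ker pscale n V.\<rho>F (lam * \<tau>) V.Z"
    unfolding Z V.lm_act_F by (rule V.Q.s.klm_ker_klm_ker[OF lam V.no_sub[OF universe n NT]])
  also have "\<dots> \<longleftrightarrow> b V (?A w) = \<zero>\<^bsub>fobj F' V\<^esub>" by (rule ker[OF V, symmetric])
  finally show "klm_vec n G \<alpha> lam ?K (klm_vec n G \<alpha> \<tau> V (evaluation H V)) w = \<zero>\<^bsub>fobj (KLM n G \<alpha> lam \<circ>\<^sub>F KLM n G \<alpha> \<tau>) V\<^esub> \<longleftrightarrow>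
      b V (?A w) = \<zero>\<^bsub>fobj F' V\<^esub>"
    by (simp add: comp_functor_def)
next
  fix V W :: "(fgrp \<times> 'g \<Rightarrow> 'k, 'u) module" and \<phi> and w :: "nat \<Rightarrow> nat \<Rightarrow> 'u \<Rightarrow>\<^sub>0 'k"
  assume V: "V \<in> Obj (Mod_NT TYPE('k) TYPE('u) n G \<alpha>)" and W: "W \<in> Obj (Mod_NT TYPE('k) TYPE('u) n G \<alpha>)"
    and "\<phi> \<in> Hom (Mod_NT TYPE('k) TYPE('u) n G \<alpha>) V W"
  then have \<phi>: "\<phi> \<in> lmod_hom (group_algebra H) V W" by (simp add: Mod_NT_def)
  interpret V: twisted_presentation n G \<alpha> pscale "perm_act H V" "evaluation H V" V \<tau>
    by (rule Mod_NT_twisted[OF V lam(2)])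
  interpret W: twisted_presentation n G \<alpha> pscale "perm_act H W" "evaluation H W" W \<tau>
    by (rule Mod_NT_twisted[OF W lam(2)])
  obtain L where L: "lifts pscale H (perm_act H V) (evaluation H V) pscale (perm_act H W) (evaluation H W) \<phi> L"
    using lifts_exists[OF group_H Mod_NT_D(1)[OF V] Mod_NT_D(1)[OF W] \<phi>] by blast
  note L1 = klm_lifts[OF universe V.twisted_presentation_axioms W.twisted_presentation_axioms \<phi> L]
  have \<phi>1: "fmap (KLM n G \<alpha> \<tau>) V W \<phi> \<in> lmod_hom (group_algebra H) (fobj (KLM n G \<alpha> \<tau>) V) (fobj (KLM n G \<alpha> \<tau>) W)"
    by (rule lifts_hom[OF V.klm_presentation[OF universe] W.klm_presentation[OF universe] L1])
      (simp add: KLM_def small_map_extensional)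
  interpret m: free_rep_map "fscale pscale" "fscale pscale" n "conv_act pscale n V.\<rho>F \<tau>" "conv_act pscale n W.\<rho>F \<tau>"
    "\<lambda>v j. L (v j)"
  proof (intro free_rep_map.intro free_rep_map_axioms.intro V.f.conv_rep W.f.conv_rep lam(2))
    fix x v assume "x \<in> carrier F"
    then have "(x, \<one>\<^bsub>G\<^esub>) \<in> carrier H" by (simp add: H_sel)
    then show "(\<lambda>j. L (conv_act pscale n V.\<rho>F \<tau> x v j)) = conv_act pscale n W.\<rho>F \<tau> x (\<lambda>j. L (v j))"
      using L1 unfolding lifts_def V.lm_act_F[symmetric] W.lm_act_F[symmetric] by blast
  qed (use L1 in \<open>simp_all only: lifts_def\<close>)
  let ?w = "\<lambda>i j. L (w i j)"
  have "fmap (KLM n G \<alpha> lam) (fobj (KLM n G \<alpha> \<tau>) V) (fobj (KLM n G \<alpha> \<tau>) W) (fmap (KLM n G \<alpha> \<tau>) V W \<phi>)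
      (klm_vec n G \<alpha> lam (fobj (KLM n G \<alpha> \<tau>) V) (klm_vec n G \<alpha> \<tau> V (evaluation H V)) w) =
      klm_vec n G \<alpha> lam (fobj (KLM n G \<alpha> \<tau>) W) (klm_vec n G \<alpha> \<tau> W (evaluation H W)) ?w"
    using klm_lifts[OF universe V.klm_twisted[OF universe lam(1)] W.klm_twisted[OF universe lam(1)] \<phi>1 L1]
    by (simp only: lifts_def)
  moreover have "fmap F' V W \<phi> (b V (aug_sum n (conv_act pscale n V.\<rho>F \<tau>) w)) =
      b W (aug_sum n (conv_act pscale n W.\<rho>F \<tau>) ?w)"
    unfolding nat[OF V W \<phi> L] m.L_aug_sum ..
  ultimately show "\<exists>u'. fmap (KLM n G \<alpha> lam \<circ>\<^sub>F KLM n G \<alpha> \<tau>) V W \<phi>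
        (klm_vec n G \<alpha> lam (fobj (KLM n G \<alpha> \<tau>) V) (klm_vec n G \<alpha> \<tau> V (evaluation H V)) w) =
        klm_vec n G \<alpha> lam (fobj (KLM n G \<alpha> \<tau>) W) (klm_vec n G \<alpha> \<tau> W (evaluation H W)) u' \<and>
      fmap F' V W \<phi> (b V (aug_sum n (conv_act pscale n V.\<rho>F \<tau>) w)) =
        b W (aug_sum n (conv_act pscale n W.\<rho>F \<tau>) u')"
    by (intro exI[of _ ?w]) (simp add: comp_functor_def)
qed

lemma KLM_mult:
  fixes lam \<tau> :: "'k::field"
  assumes lam: "lam \<noteq> 0" "\<tau> \<noteq> 0"
  shows "naturally_isomorphic (Mod_NT TYPE('k) TYPE('u) n G \<alpha>) (Mod_NT TYPE('k) TYPE('u) n G \<alpha>)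
    (KLM n G \<alpha> lam \<circ>\<^sub>F KLM n G \<alpha> \<tau>) (KLM n G \<alpha> (lam * \<tau>))"
proof (rule KLM_comp_iso[OF lam, where b = "\<lambda>V. klm_vec n G \<alpha> (lam * \<tau>) V (evaluation H V)"])
  have l: "lam * \<tau> \<noteq> 0" using lam by simp
  then show "is_functor (Mod_NT TYPE('k) TYPE('u) n G \<alpha>) (Mod_NT TYPE('k) TYPE('u) n G \<alpha>) (KLM n G \<alpha> (lam * \<tau>))"
    by (rule KLM_functor)
  fix V :: "(fgrp \<times> 'g \<Rightarrow> 'k, 'u) module" assume V: "V \<in> Obj (Mod_NT TYPE('k) TYPE('u) n G \<alpha>)"
  note tV = Mod_NT_twisted[OF V l]
  show "presentation (fscale pscale) H (lm_act pscale n G \<alpha> (perm_act H V) (lam * \<tau>))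
      (klm_vec n G \<alpha> (lam * \<tau>) V (evaluation H V)) (fobj (KLM n G \<alpha> (lam * \<tau>)) V)"
    by (rule twisted_presentation.klm_presentation[OF tV universe])
  show "klm_vec n G \<alpha> (lam * \<tau>) V (evaluation H V) v = \<zero>\<^bsub>fobj (KLM n G \<alpha> (lam * \<tau>)) V\<^esub> \<longleftrightarrow>
      v \<in> klm_ker pscale n (\<lambda>x. perm_act H V (x, \<one>\<^bsub>G\<^esub>)) (lam * \<tau>) {u. evaluation H V u = \<zero>\<^bsub>V\<^esub>}" for v
    by (rule twisted_presentation.klm_ker_iff[OF tV universe n Mod_NT_D(2,3)[OF V]])
  fix W :: "(fgrp \<times> 'g \<Rightarrow> 'k, 'u) module" and \<phi> L v
  assume W: "W \<in> Obj (Mod_NT TYPE('k) TYPE('u) n G \<alpha>)" and \<phi>: "\<phi> \<in> lmod_hom (group_algebra H) V W"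
    and L: "lifts pscale H (perm_act H V) (evaluation H V) pscale (perm_act H W) (evaluation H W) \<phi> L"
  show "fmap (KLM n G \<alpha> (lam * \<tau>)) V W \<phi> (klm_vec n G \<alpha> (lam * \<tau>) V (evaluation H V) v) =
      klm_vec n G \<alpha> (lam * \<tau>) W (evaluation H W) (\<lambda>j. L (v j))"
    using klm_lifts[OF universe tV Mod_NT_twisted[OF W l] \<phi> L] by (simp only: lifts_def)
qed

text \<open>For \<open>\<lambda>\<tau> = 1\<close> the multiplication \<open>I \<otimes> V \<rightarrow> V\<close> takes the place of the Katz-Long-Moody module.\<close>

lemma KLM_inverse:
  fixes lam \<tau> :: "'k::field"
  assumes l: "lam * \<tau> = 1"
  shows "naturally_isomorphic (Mod_NT TYPE('k) TYPE('u) n G \<alpha>) (Mod_NT TYPE('k) TYPE('u) n G \<alpha>)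
    (KLM n G \<alpha> lam \<circ>\<^sub>F KLM n G \<alpha> \<tau>) id_functor"
proof (rule KLM_comp_iso[where b = "\<lambda>V v. evaluation H V (aug_sum n (\<lambda>x. perm_act H V (x, \<one>\<^bsub>G\<^esub>)) v)"])
  show "lam \<noteq> 0" "\<tau> \<noteq> 0" using l by auto
  show "is_functor (Mod_NT TYPE('k) TYPE('u) n G \<alpha>) (Mod_NT TYPE('k) TYPE('u) n G \<alpha>) id_functor"
    by (rule is_functor_id)
  fix V :: "(fgrp \<times> 'g \<Rightarrow> 'k, 'u) module" assume V: "V \<in> Obj (Mod_NT TYPE('k) TYPE('u) n G \<alpha>)"
  interpret V: twisted_presentation n G \<alpha> pscale "perm_act H V" "evaluation H V" V 1
    by (rule Mod_NT_twisted[OF V one_neq_zero])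
  note NT = Mod_NT_D(2,3)[OF V]
  show "presentation (fscale pscale) H (lm_act pscale n G \<alpha> (perm_act H V) (lam * \<tau>))
      (\<lambda>v. evaluation H V (aug_sum n V.\<rho>F v)) (fobj id_functor V)"
    unfolding l id_functor_def funct.select_convs
  proof (rule presentation_pullback[OF V.presentation_axioms V.L.group_rep_axioms])
    fix u
    obtain v where "u - aug_sum n V.\<rho>F v \<in> V.Z" using V.Q.s.aug_sum_surj[OF n V.no_quot[OF universe n NT]] by blast
    then have "evaluation H V u = evaluation H V (aug_sum n V.\<rho>F v)" by (simp add: V.q_eq_iff)
    then show "\<exists>w. evaluation H V u = evaluation H V (aug_sum n V.\<rho>F w)" by blast
  qed (use V.f.aug_sum_add V.f.aug_sum_scale V.aug_sum_lm_one in simp_all)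
  show "evaluation H V (aug_sum n V.\<rho>F v) = \<zero>\<^bsub>fobj id_functor V\<^esub> \<longleftrightarrow> v \<in> klm_ker pscale n V.\<rho>F (lam * \<tau>) V.Z" for v
    unfolding l V.Q.s.klm_ker_one[OF n V.no_sub[OF universe n NT]] by (simp add: id_functor_def)
  fix W :: "(fgrp \<times> 'g \<Rightarrow> 'k, 'u) module" and \<phi> L v
  assume W: "W \<in> Obj (Mod_NT TYPE('k) TYPE('u) n G \<alpha>)" and \<phi>: "\<phi> \<in> lmod_hom (group_algebra H) V W"
    and L: "lifts pscale H (perm_act H V) (evaluation H V) pscale (perm_act H W) (evaluation H W) \<phi> L"
  interpret W: twisted_presentation n G \<alpha> pscale "perm_act H W" "evaluation H W" W 1
    by (rule Mod_NT_twisted[OF W one_neq_zero])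
  interpret m: free_rep_map pscale pscale n V.\<rho>F W.\<rho>F L
    by (intro free_rep_map.intro free_rep_map_axioms.intro V.f.free_rep_axioms W.f.free_rep_axioms)
      (use L in \<open>simp_all add: lifts_def H_sel\<close>)
  show "fmap id_functor V W \<phi> (evaluation H V (aug_sum n V.\<rho>F v)) = evaluation H W (aug_sum n W.\<rho>F (\<lambda>j. L (v j)))"
    using L by (simp add: id_functor_def lifts_def m.L_aug_sum[symmetric])
qed

end

end

theorem theorem0p2:
  fixes n :: nat and G :: "('g, 'z) monoid_scheme" and \<alpha> :: "'g \<Rightarrow> fgrp \<Rightarrow> fgrp"
  assumes n: "n \<ge> 2"
    and artin: "artin_rep n G \<alpha>"
    and universe: "infinite (UNIV :: 'u set)"
  shows
    "(\<forall>lam::'k::field. lam \<noteq> 0 \<longrightarrow>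
        is_functor (Mod_NT TYPE('k) TYPE('u) n G \<alpha>) (Mod_NT TYPE('k) TYPE('u) n G \<alpha>) (KLM n G \<alpha> lam)) \<and>
     (carrier G = {\<one>\<^bsub>G\<^esub>} \<longrightarrow>
        (\<forall>lam::'k. lam \<noteq> 0 \<longrightarrow>
           is_functor (Mod_NT_free TYPE('k) TYPE('u) n) (Mod_NT_free TYPE('k) TYPE('u) n) (MC n lam) \<and>
           naturally_isomorphic (Mod_NT TYPE('k) TYPE('u) n G \<alpha>) (Mod_NT_free TYPE('k) TYPE('u) n)
             (res_functor G \<circ>\<^sub>F KLM n G \<alpha> lam) (MC n lam \<circ>\<^sub>F res_functor G))) \<and>
     (\<forall>(lam::'k) \<tau>. lam \<noteq> 0 \<longrightarrow> \<tau> \<noteq> 0 \<longrightarrow>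
        naturally_isomorphic (Mod_NT TYPE('k) TYPE('u) n G \<alpha>) (Mod_NT TYPE('k) TYPE('u) n G \<alpha>)
          (KLM n G \<alpha> lam \<circ>\<^sub>F KLM n G \<alpha> \<tau>) (KLM n G \<alpha> (lam * \<tau>))) \<and>
     (\<forall>lam::'k. lam \<noteq> 0 \<longrightarrow>
        equivalence_with_inverse (Mod_NT TYPE('k) TYPE('u) n G \<alpha>) (Mod_NT TYPE('k) TYPE('u) n G \<alpha>)
          (KLM n G \<alpha> lam) (KLM n G \<alpha> (inverse lam)))"
proof -
  interpret artin n G \<alpha> by (rule artin.intro[OF artin])
  have n1: "n \<ge> 1" using n by simp
  show ?thesis
    unfolding equivalence_with_inverse_def
    by (intro conjI allI impI KLM_functor[OF n1 universe] MC_functor[OF n1 universe] KLM_iso_MC[OF n1 universe]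
        KLM_mult[OF n1 universe] KLM_inverse[OF n1 universe]) simp_all
qed

end
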